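(* Let $\mathbb{X}=(X_t,\,t\in\mathbb{Z})$ be a strictly stationary stochastic process of random elements of $L^2=L^2([0,1])$ with $\mathbb{E}X_t=0$, which is $L^2$-$m$-approximable and satisfies $\lim_{m\to\infty} m\sqrt{\mathbb{E}\|X_t-X_{t,m}\|^2}=0$. Let $X_1^*,X_2^*,\ldots,X_n^*$ be pseudo-observations generated from $\mathbf{X}_n=\{X_1,\ldots,X_n\}$ by the moving block bootstrap (MBB) with block size $b=b(n)$, where $b^{-1}+bn^{-1/2}=o(1)$ as $n\to\infty$. Put $\overline{X}_n=n^{-1}\sum_{t=1}^nX_t$ and $\overline{X}_n^*=n^{-1}\sum_{t=1}^nX_t^*$. Then, as $n\to\infty$: (i) $d\big(\mathcal{L}(\sqrt{n}(\overline{X}_n^*-\mathbb{E}^*(\overline{X}_n^* ))\mid \mathbf{X}_n),\ \mathcal{L}(\sqrt{n}\,\overline{X}_n)\big)\to 0$ in probability, where $d$ is any metric metrizing weak convergence on $L^2$; (ii) $\big\|n\,\mathbb{E}^*\big[(\overline{X}_n^*-\mathbb{E}^*(\overline{X}_n^* ))\otimes(\overline{X}_n^*-\mathbb{E}^*(\overline{X}_n^* ))\big]-n\,\mathbb{E}\big[\overline{X}_n\otimes\overline{X}_n\big]\big\|_{HS}=o_P(1)$.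
   Context: $L^2=L^2([0,1])$ is the separable Hilbert space of square-integrable real-valued functions on $[0,1]$, with $\langle f,g\rangle=\int_0^1 f(\tau)g(\tau)\,d\tau$, $\|f\|^2=\langle f,f\rangle$, and tensor product $f\otimes g(\cdot)=\langle f,\cdot\rangle g$. $\|\cdot\|_{HS}$ is the Hilbert-Schmidt norm, $\|\Psi\|_{HS}^2=\sum_{i}\|\Psi(e_i)\|^2$ for an orthonormal basis $(e_i)$ of $L^2$. $\mathcal{L}(Z)$ denotes the law of the random element $Z$; $\mathcal{L}(\cdot\mid\mathbf{X}_n)$ and $\mathbb{E}^*$ denote law and expectation conditional on $\mathbf{X}_n$. $L^2$-$m$-approximability: a process $\{X_t,t\in\mathbb{Z}\}$ of $L^2$-valued random elements is $L^2$-$m$-approximable if (1) $X_t=f(\delta_t,\delta_{t-1},\delta_{t-2},\ldots)$ for a measurable function $f:(L^2)^\infty\to L^2$ and a sequence $\{\delta_t,t\in\mathbb{Z}\}$ of i.i.d. random elements of $L^2$; and (2) $\mathbb{E}\|X_0\|^2<\infty$ and $\sum_{m\ge1}\sqrt{\mathbb{E}\|X_t-X_{t,m}\|^2}<\infty$, where $X_{t,m}=f(\delta_t,\delta_{t-1},\ldots,\delta_{t-m+1},\delta^{(m)}_{t,t-m},\delta^{(m)}_{t,t-m-1},\ldots)$ and the $\delta^{(m)}_{t,k}$ are independent copies of $\delta_0$, independent of each other and of $\{\delta_s\}$. (By stationarity $\mathbb{E}\|X_t-X_{t,m}\|^2$ does not depend on $t$.) MBB: for simplicity $n=kb$ with $k$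 a positive integer, $1\le b<n$; $N=n-b+1$. For $t=1,\ldots,N$ let $B_t=\{X_t,X_{t+1},\ldots,X_{t+b-1}\}$. Let $I_1,\ldots,I_k$ be i.i.d. uniform on $\{1,\ldots,N\}$ (independent of the data). Let $B_i^*=B_{I_i}$ and denote its elements, in order, by $X^*_{(i-1)b+1},\ldots,X^*_{ib}$, $i=1,\ldots,k$; joining the blocks in the order $B_1^*,\ldots,B_k^*$ gives $X_1^*,\ldots,X_n^*$. *)

theory Defs
  imports "HOL-Probability.Probability"
begin

section \<open>The Hilbert space \<open>L\<^sup>2([0,1])\<close>\<close>

definition unit_lborel :: "real measure" where
  "unit_lborel = restrict_space lborel {0..1}"

definition square_integrable :: "(real \<Rightarrow> real) \<Rightarrow> bool" where
  "square_integrable f \<longleftrightarrow>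
     f \<in> borel_measurable unit_lborel \<and> integrable unit_lborel (\<lambda>x. (f x)\<^sup>2)"

lemma prob_space_unit_lborel: "prob_space unit_lborel"
  by (rule prob_spaceI) (simp add: unit_lborel_def space_restrict_space emeasure_restrict_space)

lemma square_integrable_mult:
  assumes "square_integrable f" "square_integrable g"
  shows "integrable unit_lborel (\<lambda>x. f x * g x)"
proof (rule Bochner_Integration.integrable_bound)
  show "integrable unit_lborel (\<lambda>x. (f x)\<^sup>2 + (g x)\<^sup>2)"
    using assms by (auto simp: square_integrable_def)
  show "(\<lambda>x. f x * g x) \<in> borel_measurable unit_lborel"
    using assms by (auto simp: square_integrable_def)
  have "\<bar>f x * g x\<bar> \<le> (f x)\<^sup>2 + (g x)\<^sup>2" for x
    using sum_squares_bound[of "\<bar>f x\<bar>" "\<bar>g x\<bar>"] zero_le_power2[of "f x"] zero_le_power2[of "g x"]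
    unfolding abs_mult power2_abs by linarith
  then show "AE x in unit_lborel. norm (f x * g x) \<le> norm ((f x)\<^sup>2 + (g x)\<^sup>2)"
    by auto
qed

lemma square_integrable_zero: "square_integrable (\<lambda>x. 0)"
  by (simp add: square_integrable_def)

lemma square_integrable_add:
  assumes "square_integrable f" "square_integrable g"
  shows "square_integrable (\<lambda>x. f x + g x)"
  using assms square_integrable_mult[OF assms]
  by (auto simp: square_integrable_def power2_sum mult.assoc)

lemma square_integrable_scale:
  assumes "square_integrable f"
  shows "square_integrable (\<lambda>x. c * f x)"
  using assms by (auto simp: square_integrable_def power_mult_distrib)

lemma square_integrable_uminus:
  "square_integrable f \<Longrightarrow> square_integrable (\<lambda>x. - f x)"
  by (auto simp: square_integrable_def)

lemma square_integrable_diff: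
  assumes "square_integrable f" "square_integrable g"
  shows "square_integrable (\<lambda>x. f x - g x)"
  using square_integrable_add[OF assms(1) square_integrable_uminus[OF assms(2)]] by simp

lemma square_integrable_dominated:
  assumes "square_integrable w" "h \<in> borel_measurable unit_lborel"
    and "AE x in unit_lborel. \<bar>h x\<bar> \<le> w x"
  shows "square_integrable h"
proof -
  have "integrable unit_lborel (\<lambda>x. (h x)\<^sup>2)"
  proof (rule Bochner_Integration.integrable_bound)
    show "integrable unit_lborel (\<lambda>x. (w x)\<^sup>2)"
      using assms by (auto simp: square_integrable_def)
    show "(\<lambda>x. (h x)\<^sup>2) \<in> borel_measurable unit_lborel"
      using assms by auto
    show "AE x in unit_lborel. norm ((h x)\<^sup>2) \<le> norm ((w x)\<^sup>2)"
      using assms(3) by eventually_elim (auto simp flip: abs_le_square_iff)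
  qed
  with assms show ?thesis by (simp add: square_integrable_def)
qed

lemma square_integrable_const: "square_integrable (\<lambda>x. c)"
  using prob_space.finite_measure[OF prob_space_unit_lborel]
  by (simp add: square_integrable_def finite_measure.integrable_const)

text \<open>Functions on \<open>[0,1]\<close> are represented by total functions; values outside \<open>[0,1]\<close> are
  irrelevant for the almost-everywhere classes, as \<^const>\<open>unit_lborel\<close> has \<open>space\<close> \<open>{0..1}\<close>.\<close>

definition L2_eq :: "(real \<Rightarrow> real) \<Rightarrow> (real \<Rightarrow> real) \<Rightarrow> bool" where
  "L2_eq f g \<longleftrightarrow> square_integrable f \<and> square_integrable g \<and> (AE x in unit_lborel. f x = g x)"

lemma part_equivp_L2_eq: "part_equivp L2_eq"
proof (rule part_equivpI)
  show "\<exists>x. L2_eq x x"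
    by (auto simp: L2_eq_def intro: square_integrable_zero)
  show "symp L2_eq" by (auto simp: symp_def L2_eq_def)
  show "transp L2_eq"
    unfolding transp_def L2_eq_def by (auto elim: eventually_elim2)
qed

quotient_type L2 = "real \<Rightarrow> real" / partial: L2_eq
  by (rule part_equivp_L2_eq)

lemma L2_eq_refl: "square_integrable f \<Longrightarrow> L2_eq f f"
  by (simp add: L2_eq_def)

instantiation L2 :: real_inner
begin

lift_definition zero_L2 :: L2 is "\<lambda>x. 0"
  by (simp add: L2_eq_def square_integrable_zero)

lift_definition plus_L2 :: "L2 \<Rightarrow> L2 \<Rightarrow> L2" is "\<lambda>f g x. f x + g x"
  by (auto simp: L2_eq_def square_integrable_add elim: eventually_elim2)

lift_definition uminus_L2 :: "L2 \<Rightarrow> L2" is "\<lambda>f x. - f x"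
  by (auto simp: L2_eq_def square_integrable_uminus)

lift_definition minus_L2 :: "L2 \<Rightarrow> L2 \<Rightarrow> L2" is "\<lambda>f g x. f x - g x"
  by (auto simp: L2_eq_def square_integrable_diff elim: eventually_elim2)

lift_definition scaleR_L2 :: "real \<Rightarrow> L2 \<Rightarrow> L2" is "\<lambda>c f x. c * f x"
  by (auto simp: L2_eq_def square_integrable_scale elim: eventually_mono)

lift_definition inner_L2 :: "L2 \<Rightarrow> L2 \<Rightarrow> real" is "\<lambda>f g. \<integral>x. f x * g x \<partial>unit_lborel"
  unfolding L2_eq_def square_integrable_def
  by (rule integral_cong_AE) (auto elim: eventually_elim2)

definition norm_L2 :: "L2 \<Rightarrow> real" where "norm_L2 f = sqrt (inner f f)"
definition dist_L2 :: "L2 \<Rightarrow> L2 \<Rightarrow> real" where "dist_L2 f g = norm (f - g)"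
definition sgn_L2 :: "L2 \<Rightarrow> L2" where "sgn_L2 f = inverse (norm f) *\<^sub>R f"
definition uniformity_L2 :: "(L2 \<times> L2) filter" where
  "uniformity_L2 = (INF e\<in>{0 <..}. principal {(x, y). dist x y < e})"
definition open_L2 :: "L2 set \<Rightarrow> bool" where
  "open_L2 S \<longleftrightarrow> (\<forall>x\<in>S. \<forall>\<^sub>F (x', y) in uniformity. x' = x \<longrightarrow> y \<in> S)"

instance
proof
  fix x y z :: L2 and a b :: real
  show "x + y + z = x + (y + z)"
    by transfer (auto simp: L2_eq_def add.assoc intro!: square_integrable_add)
  show "x + y = y + x"
    by transfer (auto simp: L2_eq_def add.commute intro!: square_integrable_add)
  show "0 + x = x"
    by transfer (auto simp: L2_eq_def)
  show "- x + x = 0"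
    by transfer (auto simp: L2_eq_def square_integrable_zero)
  show "x - y = x + - y"
    by transfer (auto simp: L2_eq_def intro: square_integrable_diff)
  show "a *\<^sub>R (x + y) = a *\<^sub>R x + a *\<^sub>R y"
    by transfer (auto simp: L2_eq_def distrib_left
        intro!: square_integrable_add square_integrable_scale)
  show "(a + b) *\<^sub>R x = a *\<^sub>R x + b *\<^sub>R x"
    by transfer (auto simp: L2_eq_def distrib_right
        intro!: square_integrable_add square_integrable_scale)
  show "a *\<^sub>R b *\<^sub>R x = (a * b) *\<^sub>R x"
    by transfer (auto simp: L2_eq_def mult.assoc intro!: square_integrable_scale)
  show "1 *\<^sub>R x = x"
    by transfer (auto simp: L2_eq_def)
  show "dist x y = norm (x - y)" by (simp add: dist_L2_def)
  show "sgn x = inverse (norm x) *\<^sub>R x" by (simp add: sgn_L2_def)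
  show "uniformity = (INF e\<in>{0 <..}. principal {(x, y :: L2). dist x y < e})"
    by (simp add: uniformity_L2_def)
  show "open U \<longleftrightarrow> (\<forall>x\<in>U. \<forall>\<^sub>F (x', y) in uniformity. x' = x \<longrightarrow> y \<in> U)" for U :: "L2 set"
    by (simp add: open_L2_def)
  show "x \<bullet> y = y \<bullet> x"
    by transfer (simp add: mult.commute)
  show "(x + y) \<bullet> z = x \<bullet> z + y \<bullet> z"
    by transfer (simp add: L2_eq_def distrib_right square_integrable_mult)
  show "(a *\<^sub>R x) \<bullet> y = a * (x \<bullet> y)"
    by transfer (simp add: mult.assoc)
  show "0 \<le> x \<bullet> x"
    by transfer simp
  show "x \<bullet> x = 0 \<longleftrightarrow> x = 0"
  proof transfer
    fix f assume "L2_eq f f"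
    then show "(\<integral>x. f x * f x \<partial>unit_lborel) = 0 \<longleftrightarrow> L2_eq f (\<lambda>x. 0)"
      using integral_nonneg_eq_0_iff_AE[of unit_lborel "\<lambda>x. f x * f x"]
      by (auto simp: L2_eq_def square_integrable_mult square_integrable_zero)
  qed
  show "norm x = sqrt (x \<bullet> x)" by (simp add: norm_L2_def)
qed

end


lemma square_integrable_rep_L2: "square_integrable (rep_L2 f)"
  using Quotient3_rep_reflp[OF Quotient3_L2, of f] by (simp add: L2_eq_def)

lemma abs_rep_L2: "abs_L2 (rep_L2 f) = f"
  by (rule Quotient3_abs_rep[OF Quotient3_L2])

lemma abs_L2_diff:
  "square_integrable f \<Longrightarrow> square_integrable g \<Longrightarrow>
    abs_L2 f - abs_L2 g = abs_L2 (\<lambda>x. f x - g x)"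
  by (rule minus_L2.abs_eq) (auto intro: L2_eq_refl)

lemma abs_L2_add:
  "square_integrable f \<Longrightarrow> square_integrable g \<Longrightarrow>
    abs_L2 f + abs_L2 g = abs_L2 (\<lambda>x. f x + g x)"
  by (rule plus_L2.abs_eq) (auto intro: L2_eq_refl)

lemma abs_L2_scaleR:
  "square_integrable f \<Longrightarrow> c *\<^sub>R abs_L2 f = abs_L2 (\<lambda>x. c * f x)"
  by (rule scaleR_L2.abs_eq) (auto intro: L2_eq_refl)

lemma inner_abs_L2:
  "square_integrable f \<Longrightarrow> square_integrable g \<Longrightarrow>
    abs_L2 f \<bullet> abs_L2 g = (\<integral>x. f x * g x \<partial>unit_lborel)"
  by (rule inner_L2.abs_eq) (auto intro: L2_eq_refl)

lemma norm_abs_L2: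
  "square_integrable f \<Longrightarrow> (norm (abs_L2 f))\<^sup>2 = (\<integral>x. (f x)\<^sup>2 \<partial>unit_lborel)"
  by (simp add: power2_norm_eq_inner inner_abs_L2) (simp add: power2_eq_square)

lemma nn_integral_abs_L2:
  assumes "square_integrable f"
  shows "(\<integral>\<^sup>+x. ennreal ((f x)\<^sup>2) \<partial>unit_lborel) = ennreal ((norm (abs_L2 f))\<^sup>2)"
  using assms
  by (subst nn_integral_eq_integral) (auto simp: norm_abs_L2 square_integrable_def)

lemma integral_abs_le_norm_L2:
  assumes "square_integrable f"
  shows "integrable unit_lborel (\<lambda>x. \<bar>f x\<bar>)" (is ?A)
    and "(\<integral>x. \<bar>f x\<bar> \<partial>unit_lborel) \<le> norm (abs_L2 f)" (is ?B)
proof -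
  interpret prob_space unit_lborel by (rule prob_space_unit_lborel)
  have sa: "square_integrable (\<lambda>x. \<bar>f x\<bar>)" and s1: "square_integrable (\<lambda>x. 1)"
    using assms square_integrable_const by (auto simp: square_integrable_def)
  show ?A using square_integrable_mult[OF sa s1] by simp
  have "(\<integral>x. \<bar>f x\<bar> \<partial>unit_lborel) = abs_L2 (\<lambda>x. \<bar>f x\<bar>) \<bullet> abs_L2 (\<lambda>x. 1)"
    by (simp add: inner_abs_L2[OF sa s1])
  also have "\<dots> \<le> norm (abs_L2 (\<lambda>x. \<bar>f x\<bar>)) * norm (abs_L2 (\<lambda>x. 1))"
    by (rule norm_cauchy_schwarz)
  also have "norm (abs_L2 (\<lambda>x. 1)) = 1"
  proof (rule power2_eq_imp_eq)
    show "(norm (abs_L2 (\<lambda>x. 1)))\<^sup>2 = 1\<^sup>2"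
      using norm_abs_L2[OF s1] by (simp add: prob_space)
  qed simp_all
  also have "norm (abs_L2 (\<lambda>x. \<bar>f x\<bar>)) = norm (abs_L2 f)"
  proof (rule power2_eq_imp_eq)
    show "(norm (abs_L2 (\<lambda>x. \<bar>f x\<bar>)))\<^sup>2 = (norm (abs_L2 f))\<^sup>2"
      unfolding norm_abs_L2[OF sa] norm_abs_L2[OF assms] by simp
  qed simp_all
  finally show ?B by simp
qed

lemma Cauchy_L2_subseq_AE:
  fixes g :: "nat \<Rightarrow> real \<Rightarrow> real"
  assumes g: "\<And>k. square_integrable (g k)"
    and step: "\<And>k. norm (abs_L2 (g (Suc k)) - abs_L2 (g k)) \<le> (1/2) ^ k"
  shows "AE x in unit_lborel. convergent (\<lambda>k. g k x)"
proof -
  let ?h = "\<lambda>k x. g (Suc k) x - g k x"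
  have h: "square_integrable (?h k)" for k
    by (intro square_integrable_diff g)
  have [measurable]: "g k \<in> borel_measurable unit_lborel" for k
    using g by (auto simp: square_integrable_def)
  have le: "(\<integral>\<^sup>+x. ennreal \<bar>?h k x\<bar> \<partial>unit_lborel) \<le> ennreal ((1/2) ^ k)" for k
    using integral_abs_le_norm_L2[OF h, of k] step[of k] g
    by (subst nn_integral_eq_integral) (auto simp: abs_L2_diff intro!: ennreal_leI)
  have "(\<integral>\<^sup>+x. (\<Sum>k. ennreal \<bar>?h k x\<bar>) \<partial>unit_lborel)
      = (\<Sum>k. \<integral>\<^sup>+x. ennreal \<bar>?h k x\<bar> \<partial>unit_lborel)"
    by (rule nn_integral_suminf) auto
  also have "\<dots> \<le> (\<Sum>k. ennreal ((1/2) ^ k))"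
    by (intro suminf_le le) auto
  also have "\<dots> = ennreal (\<Sum>k. (1/2) ^ k)"
    by (rule suminf_ennreal2) (auto intro: summable_geometric)
  also have "\<dots> < \<infinity>" by simp
  finally have "AE x in unit_lborel. (\<Sum>k. ennreal \<bar>?h k x\<bar>) \<noteq> \<infinity>"
    by (intro nn_integral_noteq_infinite) auto
  then show ?thesis
  proof eventually_elim
    case (elim x)
    then have "summable (\<lambda>k. \<bar>?h k x\<bar>)"
      by (intro summable_suminf_not_top) auto
    then have "summable (\<lambda>k. ?h k x)" by (rule summable_rabs_cancel)
    then have "convergent (\<lambda>n. \<Sum>k<n. ?h k x)" by (simp add: summable_iff_convergent)
    then obtain l where "(\<lambda>n. \<Sum>k<n. ?h k x) \<longlonglongrightarrow> l"
      unfolding convergent_def by blast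
    then have "(\<lambda>n. g n x - g 0 x) \<longlonglongrightarrow> l"
      unfolding sum_lessThan_telescope[of "\<lambda>k. g k x"] .
    from tendsto_add[OF this tendsto_const[of "g 0 x"]]
    have "(\<lambda>n. g n x) \<longlonglongrightarrow> l + g 0 x" by simp
    then show ?case by (rule convergentI)
  qed
qed

instance L2 :: complete_space
proof
  fix u :: "nat \<Rightarrow> L2"
  assume C: "Cauchy u"
  have "\<exists>N. \<forall>m\<ge>N. \<forall>n\<ge>N. norm (u m - u n) < (1/2) ^ k" for k
    using C by (metis CauchyD half_gt_zero_iff zero_less_one zero_less_power)
  then obtain N where N: "\<And>k m n. m \<ge> N k \<Longrightarrow> n \<ge> N k \<Longrightarrow> norm (u m - u n) < (1/2) ^ k"
    by metis
  define r where "r k = (\<Sum>i\<le>k. N i) + k" for k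
  have rN: "r k \<ge> N k" for k
    unfolding r_def using member_le_sum[of k "{..k}" N] by simp
  have r: "strict_mono r"
    by (rule strict_monoI_Suc) (simp add: r_def)
  define g where "g k = rep_L2 (u (r k))" for k
  have sg: "square_integrable (g k)" for k
    by (simp add: g_def square_integrable_rep_L2)
  have ag: "abs_L2 (g k) = u (r k)" for k
    by (simp add: g_def abs_rep_L2)
  have mg[measurable]: "g k \<in> borel_measurable unit_lborel" for k
    using sg by (auto simp: square_integrable_def)
  have conv: "AE x in unit_lborel. convergent (\<lambda>k. g k x)"
  proof (rule Cauchy_L2_subseq_AE[OF sg])
    fix k
    have "r (Suc k) \<ge> N k"
      using rN[of k] strict_mono_mono[OF r] by (meson le_SucI monoD order_refl order_trans)
    then show "norm (abs_L2 (g (Suc k)) - abs_L2 (g k)) \<le> (1/2) ^ k"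
      using N[of k "r (Suc k)" "r k"] rN[of k] by (simp add: ag)
  qed
  define h where "h x = lim (\<lambda>k. g k x)" for x
  have mh[measurable]: "h \<in> borel_measurable unit_lborel"
    unfolding h_def by (rule borel_measurable_lim_metric) simp
  have lim: "AE x in unit_lborel. (\<lambda>k. g k x) \<longlonglongrightarrow> h x"
    using conv by eventually_elim (simp add: h_def convergent_LIMSEQ_iff)
  have bound: "square_integrable (\<lambda>x. h x - g m x) \<and>
      norm (abs_L2 (\<lambda>x. h x - g m x)) \<le> (1/2) ^ m" for m
  proof -
    have "(\<integral>\<^sup>+x. ennreal ((h x - g m x)\<^sup>2) \<partial>unit_lborel)
        = (\<integral>\<^sup>+x. liminf (\<lambda>k. ennreal ((g k x - g m x)\<^sup>2)) \<partial>unit_lborel)"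
    proof (rule nn_integral_cong_AE, use lim in eventually_elim)
      case (elim x)
      then have "(\<lambda>k. ennreal ((g k x - g m x)\<^sup>2)) \<longlonglongrightarrow> ennreal ((h x - g m x)\<^sup>2)"
        by (intro tendsto_ennrealI tendsto_intros)
      then show ?case by (rule lim_imp_Liminf[OF trivial_limit_sequentially, symmetric])
    qed
    also have "\<dots> \<le> liminf (\<lambda>k. \<integral>\<^sup>+x. ennreal ((g k x - g m x)\<^sup>2) \<partial>unit_lborel)"
      by (rule nn_integral_liminf) simp
    also have "\<dots> \<le> ennreal (((1/2) ^ m)\<^sup>2)"
    proof (rule order_trans[OF Liminf_mono Liminf_const[THEN eq_refl]])
      show "\<forall>\<^sub>F k in sequentially.
          (\<integral>\<^sup>+x. ennreal ((g k x - g m x)\<^sup>2) \<partial>unit_lborel) \<le> ennreal (((1/2) ^ m)\<^sup>2)"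
        using eventually_ge_at_top[of m]
      proof eventually_elim
        case (elim k)
        then have "r k \<ge> N m"
          using rN[of m] strict_mono_mono[OF r] by (meson monoD order_trans)
        then have "norm (abs_L2 (g k) - abs_L2 (g m)) \<le> (1/2) ^ m"
          using N[of m "r k" "r m"] rN[of m] by (simp add: ag)
        then show ?case
          using sg by (simp add: nn_integral_abs_L2 square_integrable_diff abs_L2_diff
              power_mono)
      qed
    qed simp
    finally have le: "(\<integral>\<^sup>+x. ennreal ((h x - g m x)\<^sup>2) \<partial>unit_lborel) \<le> ennreal (((1/2) ^ m)\<^sup>2)" .
    have s: "square_integrable (\<lambda>x. h x - g m x)"
      unfolding square_integrable_def
      using le by (auto intro!: integrableI_nonneg simp: le_less_trans[OF _ ennreal_less_top])
    moreover have "norm (abs_L2 (\<lambda>x. h x - g m x)) \<le> (1/2) ^ m"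
    proof (rule power2_le_imp_le)
      show "(norm (abs_L2 (\<lambda>x. h x - g m x)))\<^sup>2 \<le> ((1/2) ^ m)\<^sup>2"
        using le unfolding nn_integral_abs_L2[OF s] by (subst (asm) ennreal_le_iff) simp_all
    qed simp
    ultimately show ?thesis by simp
  qed
  have sh: "square_integrable h"
    using square_integrable_add[OF conjunct1[OF bound[of 0]] sg[of 0]] by simp
  have "(\<lambda>m. u (r m)) \<longlonglongrightarrow> abs_L2 h"
  proof (rule LIMSEQ_I)
    fix e :: real assume "e > 0"
    then obtain M where M: "(1/2) ^ M < e"
      using real_arch_pow_inv[of e "1/2"] by auto
    have "norm (u (r m) - abs_L2 h) < e" if "m \<ge> M" for m
    proof -
      have "norm (u (r m) - abs_L2 h) = norm (abs_L2 h - abs_L2 (g m))"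
        by (simp add: ag norm_minus_commute)
      also have "\<dots> \<le> (1/2) ^ m"
        using bound[of m] by (simp add: abs_L2_diff sh sg)
      also have "\<dots> \<le> (1/2) ^ M"
        using that by (simp add: power_decreasing)
      finally show ?thesis using M by simp
    qed
    then show "\<exists>no. \<forall>n\<ge>no. norm (u (r n) - abs_L2 h) < e" by blast
  qed
  with C r show "convergent u"
    using Cauchy_converges_subseq[of u r] unfolding convergent_def by (auto simp: o_def)
qed


lemma abs_L2_tendsto_dominated:
  assumes w: "square_integrable w"
    and h: "h \<in> borel_measurable unit_lborel"
    and s: "\<And>n. s n \<in> borel_measurable unit_lborel"
    and lim: "\<And>x. x \<in> space unit_lborel \<Longrightarrow> (\<lambda>n. s n x) \<longlonglongrightarrow> h x"
    and bound: "\<And>n x. x \<in> space unit_lborel \<Longrightarrow> \<bar>s n x\<bar> \<le> w x"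
  shows "(\<lambda>n. abs_L2 (s n)) \<longlonglongrightarrow> abs_L2 h"
proof -
  have bh: "\<bar>h x\<bar> \<le> w x" if "x \<in> space unit_lborel" for x
    using tendsto_rabs[OF lim[OF that]] bound[OF that]
    by (auto intro: LIMSEQ_le_const2)
  have sh: "square_integrable h" and ss: "\<And>n. square_integrable (s n)"
    using h s bh bound by (auto intro!: square_integrable_dominated[OF w])
  have "(\<lambda>n. \<integral>x. (s n x - h x)\<^sup>2 \<partial>unit_lborel) \<longlonglongrightarrow> (\<integral>x. 0 \<partial>unit_lborel)"
  proof (rule integral_dominated_convergence)
    show "(\<lambda>x. 0) \<in> borel_measurable unit_lborel" by simp
    show "\<And>n. (\<lambda>x. (s n x - h x)\<^sup>2) \<in> borel_measurable unit_lborel" using h s by simp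
    show "integrable unit_lborel (\<lambda>x. (2 * w x)\<^sup>2)"
      using square_integrable_scale[OF w, of 2] by (simp add: square_integrable_def)
    show "AE x in unit_lborel. (\<lambda>n. (s n x - h x)\<^sup>2) \<longlonglongrightarrow> 0"
    proof (rule AE_I2)
      fix x assume "x \<in> space unit_lborel"
      from tendsto_power[OF tendsto_diff[OF lim[OF this] tendsto_const], of "h x" 2]
      show "(\<lambda>n. (s n x - h x)\<^sup>2) \<longlonglongrightarrow> 0" by simp
    qed
    show "AE x in unit_lborel. norm ((s n x - h x)\<^sup>2) \<le> (2 * w x)\<^sup>2" for n
    proof (rule AE_I2)
      fix x assume x: "x \<in> space unit_lborel"
      have "\<bar>s n x - h x\<bar> \<le> \<bar>2 * w x\<bar>"
        using bh[OF x] bound[OF x, of n] by linarith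
      then show "norm ((s n x - h x)\<^sup>2) \<le> (2 * w x)\<^sup>2"
        by (simp add: abs_le_square_iff del: power_mult_distrib abs_mult)
    qed
  qed
  then have "(\<lambda>n. (norm (abs_L2 (s n) - abs_L2 h))\<^sup>2) \<longlonglongrightarrow> 0"
    using ss sh by (simp add: abs_L2_diff norm_abs_L2 square_integrable_diff)
  from tendsto_real_sqrt[OF this] have "(\<lambda>n. norm (abs_L2 (s n) - abs_L2 h)) \<longlonglongrightarrow> 0"
    by simp
  then show ?thesis by (simp add: LIM_zero_iff tendsto_norm_zero_iff)
qed

definition rat_step_L2 :: "(rat \<times> rat) list \<Rightarrow> L2" where
  "rat_step_L2 l =
     (\<Sum>(q, a) \<leftarrow> l. of_rat q *\<^sub>R abs_L2 (indicator {..of_rat a}))"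

lemma square_integrable_indicator:
  "A \<in> sets borel \<Longrightarrow> square_integrable (indicator A)"
  by (rule square_integrable_dominated[OF square_integrable_const[of 1]])
    (auto simp: unit_lborel_def indicator_def intro!: measurable_restrict_space1)

lemma closure_rat_step_L2: "closure (range rat_step_L2) = UNIV"
proof -
  let ?S = "closure (range rat_step_L2)"
  have seq: "h \<in> ?S" if "\<And>n. s n \<in> ?S" "s \<longlonglongrightarrow> h" for s h
    using that closed_sequentially[OF closed_closure[of "range rat_step_L2"]] by blast
  have add: "f + g \<in> ?S" if f: "f \<in> ?S" and g: "g \<in> ?S" for f g
  proof -
    from f g obtain u v where u: "\<And>n. u n \<in> range rat_step_L2" "u \<longlonglongrightarrow> f"
      and v: "\<And>n. v n \<in> range rat_step_L2" "v \<longlonglongrightarrow> g"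
      unfolding closure_sequential by blast
    have "u n + v n \<in> range rat_step_L2" for n
    proof -
      obtain l l' where "u n = rat_step_L2 l" "v n = rat_step_L2 l'"
        using u(1)[of n] v(1)[of n] by auto
      then have "u n + v n = rat_step_L2 (l @ l')" by (simp add: rat_step_L2_def)
      then show ?thesis by simp
    qed
    with tendsto_add[OF u(2) v(2)] show ?thesis
      unfolding closure_sequential by (intro exI[of _ "\<lambda>n. u n + v n"]) simp
  qed
  have scale_rat: "of_rat q *\<^sub>R f \<in> ?S" if f: "f \<in> ?S" for f q
  proof -
    from f obtain u where u: "\<And>n. u n \<in> range rat_step_L2" "u \<longlonglongrightarrow> f"
      unfolding closure_sequential by blast
    have "of_rat q *\<^sub>R u n \<in> range rat_step_L2" for n
    proof -
      obtain l where l: "u n = rat_step_L2 l" using u(1)[of n] by auto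
      have "of_rat q *\<^sub>R rat_step_L2 l = rat_step_L2 (map (\<lambda>(p, a). (q * p, a)) l)"
        unfolding rat_step_L2_def
        by (induction l) (auto simp: scaleR_add_right of_rat_mult)
      then show ?thesis using l by simp
    qed
    with tendsto_scaleR[OF tendsto_const u(2)] show ?thesis
      unfolding closure_sequential by (intro exI[of _ "\<lambda>n. of_rat q *\<^sub>R u n"]) simp
  qed
  have rat_approx: "\<exists>q :: nat \<Rightarrow> rat. (\<lambda>n. of_rat (q n)) \<longlonglongrightarrow> c \<and> (\<forall>n. c < of_rat (q n))" for c :: real
  proof -
    have "\<exists>q. c < of_rat q \<and> of_rat q < c + 1 / real (Suc n)" for n
      by (rule of_rat_dense) simp
    then obtain q where q: "\<And>n. c < of_rat (q n)" "\<And>n. of_rat (q n) < c + 1 / real (Suc n)"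
      by metis
    have "(\<lambda>n. of_rat (q n)) \<longlonglongrightarrow> c"
    proof (rule tendsto_sandwich)
      show "(\<lambda>n. c) \<longlonglongrightarrow> c" by simp
      show "(\<lambda>n. c + 1 / real (Suc n)) \<longlonglongrightarrow> c"
        using tendsto_add[OF tendsto_const LIMSEQ_inverse_real_of_nat, of c]
        by (simp add: inverse_eq_divide)
    qed (use q in \<open>auto intro!: always_eventually less_imp_le\<close>)
    with q show ?thesis by blast
  qed
  have scale: "c *\<^sub>R f \<in> ?S" if f: "f \<in> ?S" for f c
  proof -
    obtain q :: "nat \<Rightarrow> rat" where q: "(\<lambda>n. of_rat (q n)) \<longlonglongrightarrow> c"
      using rat_approx[of c] by blast
    show ?thesis
      by (rule seq[OF scale_rat[OF f]]) (rule tendsto_scaleR[OF q tendsto_const])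
  qed
  have diff: "f - g \<in> ?S" if "f \<in> ?S" "g \<in> ?S" for f g
    using add[OF that(1) scale[OF that(2), of "-1"]] by simp
  have empty_ind: "(indicator {} :: real \<Rightarrow> real) = (\<lambda>x. 0)" by (simp add: fun_eq_iff)
  have zero: "0 \<in> ?S"
  proof (rule subsetD[OF closure_subset])
    have "0 = rat_step_L2 []" by (simp add: rat_step_L2_def)
    then show "0 \<in> range rat_step_L2" by (rule range_eqI)
  qed
  have ind_empty: "abs_L2 (indicator {}) \<in> ?S"
    using zero unfolding empty_ind zero_L2_def .
  note s1 = square_integrable_const[of 1]
  have meas: "(indicator A :: real \<Rightarrow> real) \<in> borel_measurable unit_lborel" if "A \<in> sets borel" for A :: "real set"
    using square_integrable_indicator[OF that] by (simp add: square_integrable_def)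
  have basic: "abs_L2 (indicator {..a}) \<in> ?S" for a
  proof -
    obtain q :: "nat \<Rightarrow> rat" where q: "(\<lambda>n. of_rat (q n)) \<longlonglongrightarrow> a" "\<And>n. a < of_rat (q n)"
      using rat_approx[of a] by blast
    show ?thesis
    proof (rule seq)
      show "abs_L2 (indicator {..of_rat (q n)}) \<in> ?S" for n
      proof (rule subsetD[OF closure_subset])
        have "abs_L2 (indicator {..of_rat (q n)}) = rat_step_L2 [(1, q n)]"
          by (simp add: rat_step_L2_def)
        then show "abs_L2 (indicator {..of_rat (q n)}) \<in> range rat_step_L2" by simp
      qed
      show "(\<lambda>n. abs_L2 (indicator {..of_rat (q n)})) \<longlonglongrightarrow> abs_L2 (indicator {..a})"
      proof (rule abs_L2_tendsto_dominated[OF s1 meas meas])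
        fix x :: real
        show "(\<lambda>n. indicator {..of_rat (q n)} x :: real) \<longlonglongrightarrow> indicator {..a} x"
        proof (cases "x \<le> a")
          case True
          then have "x \<le> of_rat (q n)" for n using q(2)[of n] by simp
          with True show ?thesis by simp
        next
          case False
          then have "\<forall>\<^sub>F n in sequentially. of_rat (q n) < x"
            using order_tendstoD(2)[OF q(1), of x] by simp
          then have "\<forall>\<^sub>F n in sequentially. (indicator {..of_rat (q n)} x :: real) = indicator {..a} x"
            by eventually_elim (use False in simp)
          then show ?thesis by (rule tendsto_eventually)
        qed
      qed (auto simp: indicator_def)
    qed
  qed
  have ind: "abs_L2 (indicator A) \<in> ?S" if A: "A \<in> sets borel" for A
  proof -
    have "Int_stable (range (\<lambda>a::real. {..a}))"
      by (auto simp: Int_stable_def)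
    moreover have "range (\<lambda>a::real. {..a}) \<subseteq> Pow UNIV" by simp
    moreover have "A \<in> sigma_sets UNIV (range (\<lambda>a::real. {..a}))"
      using A unfolding borel_eq_atMost by simp
    ultimately show ?thesis
    proof (induction rule: sigma_sets_induct_disjoint)
      case (basic A)
      then show ?case using \<open>\<And>a. abs_L2 (indicator {..a}) \<in> ?S\<close> by auto
    next
      case empty
      show ?case by (rule ind_empty)
    next
      case (compl A)
      then have A: "A \<in> sets borel" unfolding borel_eq_atMost by simp
      have "abs_L2 (indicator UNIV) \<in> ?S"
      proof (rule seq[OF basic])
        show "(\<lambda>n::nat. abs_L2 (indicator {..1::real})) \<longlonglongrightarrow> abs_L2 (indicator UNIV)"
          by (rule abs_L2_tendsto_dominated[OF s1 meas meas])
            (auto simp: indicator_def unit_lborel_def space_restrict_space)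
      qed
      then have "abs_L2 (indicator UNIV) - abs_L2 (indicator A) \<in> ?S"
        using compl by (intro diff)
      also have "abs_L2 (indicator UNIV) - abs_L2 (indicator A)
          = abs_L2 (\<lambda>x. indicator UNIV x - indicator A x)"
        using A by (intro abs_L2_diff square_integrable_indicator) simp_all
      also have "(\<lambda>x. indicator UNIV x - indicator A x) = (indicator (UNIV - A) :: real \<Rightarrow> real)"
        by (auto simp: indicator_def fun_eq_iff)
      finally show ?case .
    next
      case (union A)
      then have A: "A i \<in> sets borel" for i unfolding borel_eq_atMost by auto
      have sum: "abs_L2 (indicator (\<Union>i<n. A i)) \<in> ?S" for n :: nat
      proof (induction n)
        case 0
        show ?case using ind_empty unfolding empty_ind by simp
      next
        case (Suc n)
        have "(indicator (\<Union>i<Suc n. A i) :: real \<Rightarrow> real)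
            = (\<lambda>x. indicator (\<Union>i<n. A i) x + indicator (A n) x)"
        proof
          fix x
          have "x \<notin> A i" if "x \<in> A n" "i < n" for i
            using that disjoint_family_onD[OF union(1), of n i] by auto
          then show "(indicator (\<Union>i<Suc n. A i) x :: real)
              = indicator (\<Union>i<n. A i) x + indicator (A n) x"
            by (auto simp: indicator_def less_Suc_eq)
        qed
        then show ?case
          using add[OF Suc union(3)[of n]] A
          by (simp add: abs_L2_add square_integrable_indicator)
      qed
      show ?case
      proof (rule seq[OF sum])
        show "(\<lambda>n. abs_L2 (indicator (\<Union>i<n. A i))) \<longlonglongrightarrow> abs_L2 (indicator (\<Union>i. A i))"
          using A by (intro abs_L2_tendsto_dominated[OF s1 meas meas] LIMSEQ_indicator_UN)
            (auto simp: indicator_def)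
      qed
    qed
  qed
  have nonneg: "square_integrable f \<longrightarrow> abs_L2 f \<in> ?S"
    if "f \<in> borel_measurable unit_lborel" "\<And>x. 0 \<le> f x" for f
    using that
  proof (induction rule: borel_measurable_induct_real)
    case (set A)
    then have "A \<in> sets borel"
      by (auto simp: unit_lborel_def sets_restrict_space)
    then show ?case using ind by blast
  next
    case (mult u c)
    show ?case
    proof (cases "c = 0")
      case True
      then show ?thesis using zero by (simp add: zero_L2_def)
    next
      case False
      then have "square_integrable u" if "square_integrable (\<lambda>x. c * u x)"
        using square_integrable_scale[OF that, of "1 / c"] by simp
      then show ?thesis
        using mult scale by (metis abs_L2_scaleR)
    qed
  next
    case (add u v)
    show ?case
    proof
      assume s: "square_integrable (\<lambda>x. v x + u x)"
      have "square_integrable u" "square_integrable v"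
        using add by (auto intro!: square_integrable_dominated[OF s])
      then show "abs_L2 (\<lambda>x. v x + u x) \<in> ?S"
        using add \<open>\<And>f g. f \<in> ?S \<Longrightarrow> g \<in> ?S \<Longrightarrow> f + g \<in> ?S\<close> by (metis abs_L2_add)
    qed
  next
    case (seq U)
    show ?case
    proof
      assume s: "square_integrable f"
      have le: "\<bar>U i x\<bar> \<le> f x" if "x \<in> space unit_lborel" for i x
        using incseq_le[OF _ seq.hyps(4)[OF that], of i] seq.hyps(2)[of i x] seq.hyps(3)
        by (auto simp: incseq_def le_fun_def)
      have "square_integrable (U i)" for i
        using le seq.hyps(1) by (auto intro!: square_integrable_dominated[OF s])
      then have U: "abs_L2 (U i) \<in> ?S" for i using seq.IH by blast
      have "(\<lambda>i. abs_L2 (U i)) \<longlonglongrightarrow> abs_L2 f"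
        by (rule abs_L2_tendsto_dominated[OF s that(1) seq.hyps(1) seq.hyps(4) le])
      then show "abs_L2 f \<in> ?S"
        by (rule closed_sequentially[OF closed_closure U])
    qed
  qed
  have "f \<in> ?S" for f
  proof -
    let ?f = "rep_L2 f"
    note s = square_integrable_rep_L2[of f]
    have m: "?f \<in> borel_measurable unit_lborel" using s by (simp add: square_integrable_def)
    have sa: "square_integrable (\<lambda>x. \<bar>?f x\<bar>)"
      using s by (auto simp: square_integrable_def)
    have p: "square_integrable (\<lambda>x. max 0 (?f x))" and n: "square_integrable (\<lambda>x. max 0 (- ?f x))"
      using m by (auto intro!: square_integrable_dominated[OF sa])
    then have "abs_L2 (\<lambda>x. max 0 (?f x)) - abs_L2 (\<lambda>x. max 0 (- ?f x)) \<in> ?S"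
      using m by (intro diff nonneg[rule_format]) auto
    also have "abs_L2 (\<lambda>x. max 0 (?f x)) - abs_L2 (\<lambda>x. max 0 (- ?f x))
        = abs_L2 (\<lambda>x. max 0 (?f x) - max 0 (- ?f x))"
      by (rule abs_L2_diff[OF p n])
    also have "(\<lambda>x. max 0 (?f x) - max 0 (- ?f x)) = ?f"
      by (auto simp: fun_eq_iff max_def)
    finally show ?thesis by (simp add: abs_rep_L2)
  qed
  then show ?thesis by blast
qed

instance L2 :: second_countable_topology
proof
  define D where "D = range rat_step_L2"
  have D: "countable D" "closure D = UNIV"
    by (simp_all add: D_def closure_rat_step_L2)
  define B where "B = (\<lambda>(x, q). ball x (of_rat q)) ` (D \<times> (UNIV :: rat set))"
  have "topological_basis B"
  proof (rule topological_basisI)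
    show "\<And>b. b \<in> B \<Longrightarrow> open b" by (auto simp: B_def)
    fix U :: "L2 set" and x
    assume "open U" "x \<in> U"
    then obtain e where e: "e > 0" "ball x e \<subseteq> U" by (meson open_contains_ball)
    obtain q where q: "0 < real_of_rat q" "real_of_rat q < e / 2"
      using of_rat_dense[of 0 "e / 2"] e(1) by auto
    have "x \<in> closure D" using D by simp
    then obtain y where y: "y \<in> D" "dist y x < of_rat q"
      using q(1) unfolding closure_approachable by blast
    have "ball y (of_rat q) \<subseteq> U"
    proof
      fix z assume "z \<in> ball y (of_rat q)"
      then have "dist x z < e"
        using dist_triangle[of x z y] y(2) q(2) by (simp add: dist_commute)
      then show "z \<in> U" using e(2) by auto
    qed
    moreover have "x \<in> ball y (of_rat q)" "ball y (of_rat q) \<in> B"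
      using y by (auto simp: B_def)
    ultimately show "\<exists>b\<in>B. x \<in> b \<and> b \<subseteq> U" by blast
  qed
  moreover have "countable B" using D by (simp add: B_def)
  ultimately show "\<exists>B::L2 set set. countable B \<and> open = generate_topology B"
    by (metis topological_basis_imp_subbasis)
qed

instance L2 :: polish_space ..

instance L2 :: banach ..


section \<open>Operators on \<open>L\<^sup>2\<close>\<close>

definition tensor :: "L2 \<Rightarrow> L2 \<Rightarrow> L2 \<Rightarrow> L2" where
  "tensor f g = (\<lambda>h. (f \<bullet> h) *\<^sub>R g)"

definition orthonormal_basis :: "(nat \<Rightarrow> L2) \<Rightarrow> bool" where
  "orthonormal_basis e \<longleftrightarrow>
     (\<forall>i j. e i \<bullet> e j = (if i = j then 1 else 0)) \<and> closure (span (range e)) = UNIV"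

text \<open>Extended-valued, so that an operator that is not Hilbert-Schmidt has infinite norm
  instead of an unspecified one.\<close>

definition hs_norm :: "(nat \<Rightarrow> L2) \<Rightarrow> (L2 \<Rightarrow> L2) \<Rightarrow> ennreal" where
  "hs_norm e \<Psi> =
     (if summable (\<lambda>i. (norm (\<Psi> (e i)))\<^sup>2)
      then ennreal (sqrt (\<Sum>i. (norm (\<Psi> (e i)))\<^sup>2)) else \<infinity>)"

text \<open>The expectation of a random operator is taken pointwise; for \<open>T = tensor Z Z\<close> this is the
  usual \<open>h \<mapsto> E[\<langle>Z, h\<rangle> Z]\<close>.\<close>

definition op_expectation :: "'w measure \<Rightarrow> ('w \<Rightarrow> L2 \<Rightarrow> L2) \<Rightarrow> L2 \<Rightarrow> L2" where
  "op_expectation M T = (\<lambda>h. \<integral>\<omega>. T \<omega> h \<partial>M)"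


section \<open>Conditional expectations and conditional laws\<close>

text \<open>\<open>E\<close> is a version of the conditional expectation of \<open>Y\<close> given the sub-\<open>\<sigma>\<close>-algebra \<open>G\<close>
  of \<open>M\<close>. (The library's \<^const>\<open>real_cond_exp\<close> only covers real random variables.)\<close>

definition has_cond_exp ::
  "'w measure \<Rightarrow> 'w measure \<Rightarrow> ('w \<Rightarrow> 'b) \<Rightarrow> ('w \<Rightarrow> 'b::{banach, second_countable_topology}) \<Rightarrow> bool"
where
  "has_cond_exp M G Y E \<longleftrightarrow>
     integrable M Y \<and> integrable M E \<and> E \<in> borel_measurable G \<and>
     (\<forall>A\<in>sets G. (LINT \<omega>:A|M. Y \<omega>) = (LINT \<omega>:A|M. E \<omega>))"

definition has_op_cond_exp ::
  "'w measure \<Rightarrow> 'w measure \<Rightarrow> ('w \<Rightarrow> L2 \<Rightarrow> L2) \<Rightarrow> ('w \<Rightarrow> L2 \<Rightarrow> L2) \<Rightarrow> bool"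
where
  "has_op_cond_exp M G T C \<longleftrightarrow>
     (\<forall>\<omega>\<in>space M. bounded_linear (C \<omega>)) \<and>
     (\<forall>h. has_cond_exp M G (\<lambda>\<omega>. T \<omega> h) (\<lambda>\<omega>. C \<omega> h))"

text \<open>\<open>\<kappa>\<close> is a version of the (regular) conditional law of \<open>Z\<close> given \<open>G\<close>.\<close>

definition has_cond_law ::
  "'w measure \<Rightarrow> 'w measure \<Rightarrow> ('w \<Rightarrow> 'b::topological_space) \<Rightarrow> ('w \<Rightarrow> 'b measure) \<Rightarrow> bool"
where
  "has_cond_law M G Z \<kappa> \<longleftrightarrow>
     \<kappa> \<in> G \<rightarrow>\<^sub>M prob_algebra borel \<and>
     (\<forall>A\<in>sets borel. AE \<omega> in M.
        measure (\<kappa> \<omega>) A = real_cond_exp M G (\<lambda>\<omega>'. indicator A (Z \<omega>')) \<omega>)"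


section \<open>Modes of convergence\<close>

definition weakly_converges ::
  "(nat \<Rightarrow> 'b::topological_space measure) \<Rightarrow> 'b measure \<Rightarrow> bool"
where
  "weakly_converges \<mu> \<nu> \<longleftrightarrow>
     (\<forall>g :: 'b \<Rightarrow> real. continuous_on UNIV g \<and> bounded (range g) \<longrightarrow>
        (\<lambda>n. \<integral>x. g x \<partial>\<mu> n) \<longlonglongrightarrow> (\<integral>x. g x \<partial>\<nu>))"

definition metrizes_weak_convergence ::
  "('b::topological_space measure \<Rightarrow> 'b measure \<Rightarrow> real) \<Rightarrow> bool"
where
  "metrizes_weak_convergence d \<longleftrightarrow>
     Metric_space (space (prob_algebra borel)) d \<and>
     (\<forall>\<mu> \<nu>. (\<forall>n. \<mu> n \<in> space (prob_algebra borel)) \<and> \<nu> \<in> space (prob_algebra borel) \<longrightarrow>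
        ((\<lambda>n. d (\<mu> n) \<nu>) \<longlonglongrightarrow> 0 \<longleftrightarrow> weakly_converges \<mu> \<nu>))"

text \<open>Convergence to zero in probability of \<open>[0,\<infinity>]\<close>-valued random variables. Measurability is part
  of the claim: the measure of a non-measurable set is \<open>0\<close> by convention.\<close>

definition tendsto_zero_in_prob ::
  "'w measure \<Rightarrow> ('i \<Rightarrow> 'w \<Rightarrow> ennreal) \<Rightarrow> 'i filter \<Rightarrow> bool"
where
  "tendsto_zero_in_prob M Y F \<longleftrightarrow>
     (\<forall>\<^sub>F n in F. Y n \<in> borel_measurable M) \<and>
     (\<forall>\<epsilon>>0. ((\<lambda>n. measure M {\<omega>\<in>space M. Y n \<omega> > ennreal \<epsilon>}) \<longlongrightarrow> 0) F)"


section \<open>Stationary, \<open>L\<^sup>2\<close>-\<open>m\<close>-approximable processes\<close>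

definition strictly_stationary :: "'w measure \<Rightarrow> (int \<Rightarrow> 'w \<Rightarrow> L2) \<Rightarrow> bool" where
  "strictly_stationary M X \<longleftrightarrow>
     (\<forall>t. X t \<in> borel_measurable M) \<and>
     (\<forall>J s. finite J \<longrightarrow>
        distr M (\<Pi>\<^sub>M t\<in>J. borel) (\<lambda>\<omega>. \<lambda>t\<in>J. X (t + s) \<omega>) =
        distr M (\<Pi>\<^sub>M t\<in>J. borel) (\<lambda>\<omega>. \<lambda>t\<in>J. X t \<omega>))"

text \<open>The coupled variable \<open>X\<^bsub>t,m\<^esub>\<close>: the innovations \<open>\<delta>\<^bsub>t\<^esub>, \<dots>, \<delta>\<^bsub>t-m+1\<^esub>\<close> are kept, the earlier
  ones are replaced by the independent copies \<open>\<delta>' m t k\<close>, \<open>k \<le> t - m\<close>.\<close>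

definition m_coupled ::
  "((nat \<Rightarrow> L2) \<Rightarrow> L2) \<Rightarrow> (int \<Rightarrow> 'w \<Rightarrow> L2) \<Rightarrow> (nat \<Rightarrow> int \<Rightarrow> int \<Rightarrow> 'w \<Rightarrow> L2) \<Rightarrow>
    int \<Rightarrow> nat \<Rightarrow> 'w \<Rightarrow> L2"
where
  "m_coupled f \<delta> \<delta>' t m \<omega> =
     f (\<lambda>j. if j < m then \<delta> (t - int j) \<omega> else \<delta>' m t (t - int j) \<omega>)"

definition approx_error ::
  "'w measure \<Rightarrow> (int \<Rightarrow> 'w \<Rightarrow> L2) \<Rightarrow> ((nat \<Rightarrow> L2) \<Rightarrow> L2) \<Rightarrow> (int \<Rightarrow> 'w \<Rightarrow> L2) \<Rightarrow>
    (nat \<Rightarrow> int \<Rightarrow> int \<Rightarrow> 'w \<Rightarrow> L2) \<Rightarrow> int \<Rightarrow> nat \<Rightarrow> real"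
where
  "approx_error M X f \<delta> \<delta>' t m =
     sqrt (\<integral>\<omega>. (norm (X t \<omega> - m_coupled f \<delta> \<delta>' t m \<omega>))\<^sup>2 \<partial>M)"

text \<open>The representation \<open>(f, \<delta>, \<delta>')\<close> is kept as a parameter because further conditions refer
  to the same \<open>X\<^bsub>t,m\<^esub>\<close>.\<close>

definition L2_m_approximable ::
  "'w measure \<Rightarrow> (int \<Rightarrow> 'w \<Rightarrow> L2) \<Rightarrow> ((nat \<Rightarrow> L2) \<Rightarrow> L2) \<Rightarrow> (int \<Rightarrow> 'w \<Rightarrow> L2) \<Rightarrow>
    (nat \<Rightarrow> int \<Rightarrow> int \<Rightarrow> 'w \<Rightarrow> L2) \<Rightarrow> bool"
where
  "L2_m_approximable M X f \<delta> \<delta>' \<longleftrightarrow>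
     f \<in> borel_measurable (\<Pi>\<^sub>M j\<in>UNIV. borel) \<and>
     prob_space.indep_vars M (\<lambda>_. borel) (case_sum \<delta> (\<lambda>(m, t, k). \<delta>' m t k)) UNIV \<and>
     (\<forall>s. distr M borel (\<delta> s) = distr M borel (\<delta> 0)) \<and>
     (\<forall>m t k. distr M borel (\<delta>' m t k) = distr M borel (\<delta> 0)) \<and>
     (\<forall>t. AE \<omega> in M. X t \<omega> = f (\<lambda>j. \<delta> (t - int j) \<omega>)) \<and>
     integrable M (\<lambda>\<omega>. (norm (X 0 \<omega>))\<^sup>2) \<and>
     (\<forall>t. summable (\<lambda>m. approx_error M X f \<delta> \<delta>' t (Suc m)))"


section \<open>Moving block bootstrap\<close>

text \<open>Blocks are only considered for sample sizes \<open>n = k * b n\<close>. A block length with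
  \<open>b n \<longrightarrow> \<infinity>\<close> and \<open>b n < n\<close> cannot divide every large \<open>n\<close> (take \<open>n\<close> prime), so \<open>n \<longrightarrow> \<infinity>\<close> has to be
  read along an infinite set \<open>S\<close> of admissible sample sizes, i.e. along the filter
  \<open>inf sequentially (principal S)\<close>.\<close>

text \<open>The \<open>\<sigma>\<close>-algebra generated by \<open>X\<^sub>1, \<dots>, X\<^sub>n\<close>.\<close>

definition data_algebra :: "'w measure \<Rightarrow> (int \<Rightarrow> 'w \<Rightarrow> L2) \<Rightarrow> nat \<Rightarrow> 'w measure" where
  "data_algebra M X n =
     vimage_algebra (space M) (\<lambda>\<omega>. \<lambda>t\<in>{1..n}. X (int t) \<omega>) (\<Pi>\<^sub>M t\<in>{1..n}. borel)"

definition mbb_indices ::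
  "'w measure \<Rightarrow> (int \<Rightarrow> 'w \<Rightarrow> L2) \<Rightarrow> nat \<Rightarrow> nat \<Rightarrow> (nat \<Rightarrow> 'w \<Rightarrow> nat) \<Rightarrow> bool"
where
  "mbb_indices M X n b I \<longleftrightarrow>
     (let k = n div b; N = n - b + 1 in
       prob_space.indep_vars M (\<lambda>_. count_space UNIV) I {1..k} \<and>
       (\<forall>i\<in>{1..k}. distr M (count_space UNIV) (I i) = measure_pmf (pmf_of_set {1..N})) \<and>
       prob_space.indep_set M
         (sets (vimage_algebra (space M) (\<lambda>\<omega>. \<lambda>i\<in>{1..k}. I i \<omega>) (\<Pi>\<^sub>M i\<in>{1..k}. count_space UNIV)))
         (sets (data_algebra M X n)))"

text \<open>The pseudo-observation \<open>X\<^sup>*\<^sub>s\<close>, \<open>1 \<le> s \<le> n\<close>, for block size \<open>b\<close>.\<close>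

definition mbb_obs ::
  "(int \<Rightarrow> 'w \<Rightarrow> L2) \<Rightarrow> nat \<Rightarrow> (nat \<Rightarrow> 'w \<Rightarrow> nat) \<Rightarrow> nat \<Rightarrow> 'w \<Rightarrow> L2"
where
  "mbb_obs X b I s \<omega> = X (int (I ((s - 1) div b + 1) \<omega> + (s - 1) mod b)) \<omega>"

lemma mbb_obs_block:
  assumes "1 \<le> i" "1 \<le> j" "j \<le> b"
  shows "mbb_obs X b I ((i - 1) * b + j) \<omega> = X (int (I i \<omega> + (j - 1))) \<omega>"
proof -
  have *: "(i - 1) * b + j - 1 = (j - 1) + (i - 1) * b" and lt: "j - 1 < b"
    using assms by auto
  have "((i - 1) * b + j - 1) div b = i - 1"
    unfolding * using lt by (subst div_mult_self1) auto
  moreover have "((i - 1) * b + j - 1) mod b = j - 1"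
    unfolding * using lt by (subst mod_mult_self1) auto
  moreover have "i - 1 + 1 = i" using assms by simp
  ultimately show ?thesis unfolding mbb_obs_def by (simp only:)
qed

definition sample_mean :: "(int \<Rightarrow> 'w \<Rightarrow> L2) \<Rightarrow> nat \<Rightarrow> 'w \<Rightarrow> L2" where
  "sample_mean X n \<omega> = (1 / real n) *\<^sub>R (\<Sum>t=1..n. X (int t) \<omega>)"

definition mbb_mean ::
  "(int \<Rightarrow> 'w \<Rightarrow> L2) \<Rightarrow> nat \<Rightarrow> nat \<Rightarrow> (nat \<Rightarrow> 'w \<Rightarrow> nat) \<Rightarrow> 'w \<Rightarrow> L2"
where
  "mbb_mean X n b I \<omega> = (1 / real n) *\<^sub>R (\<Sum>s=1..n. mbb_obs X b I s \<omega>)"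

end

theory Submission
  imports Defs
begin

text \<open>Coupling and truncation approximate every scalar process \<open>\<langle>X\<^sub>t, g\<rangle>\<close> by bounded, finitely
  dependent processes, with a small error in the second moment of normalised block sums. For the
  latter, fourth moments yield a law of large numbers for the empirical variance of the overlapping
  blocks, and independence of blocks separated by short gaps yields Gaussian limits of
  characteristic functions. Given the data, the bootstrap statistic is \<open>1 / sqrt k\<close> times a sum of
  \<open>k\<close> independent draws from the centred block sums, so its conditional characteristic function is
  the \<open>k\<close>-th power of an average over blocks, and converges in mean to the same Gaussian limit.

  In place of tightness, approximability bounds \<open>E \<parallel>V - P\<^sub>K V\<parallel>\<^sup>2\<close> for normalised sums \<open>V\<close> by a null
  sequence in \<open>K\<close>, uniformly in the block length. Laws on \<open>L\<^sup>2\<close> are compared through the functions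
  \<open>exp (- (\<Sum>a. \<parallel>x - a\<parallel>\<^sup>2))\<close> for finite lists of points \<open>a\<close> of a countable dense set: these determine
  weak convergence and are Gaussian mixtures of characters. Both laws in (i) are close to the same
  Gaussian measure. For (ii), the matrix entries converge in mean, and the entries outside a finite
  corner are controlled through \<open>c\<^sub>i\<^sub>l\<^sup>2 \<le> c\<^sub>i\<^sub>i c\<^sub>l\<^sub>l\<close> and the same tail bound.\<close>

section \<open>Orthonormal expansions\<close>

text \<open>The process has only second moments, while the law of large numbers for squared blocks
  and the cubic Taylor remainder ask for more. Truncation supplies these moments, and limits become
  double ones: the approximation level is fixed while the sample size grows, so every comparison
  must cost, up to a null sequence, at most the level times a constant that does not depend on the
  approximating process. Truncation errors are multiplied by the range \<open>m\<close> of
  dependence, hence the coupling depth is chosen before the truncation level; the rate condition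
  pays for the lags below \<open>m\<close>, where coupled differences share innovations. Coupled
  variables at different times use separate copies, so independence becomes disjointness of index
  sets. \<open>Estar\<close>, \<open>Lstar\<close> and \<open>Cstar\<close> are arbitrary versions
  and are identified almost everywhere with averages over the \<open>N ^ k\<close> selections of
  blocks. The metric is arbitrary as well: finitely many test integrals control a neighbourhood of
  the limit, and countably many make the distance measurable, which convergence in probability
  includes. The block condition enters as \<open>b\<close> and \<open>n / b\<close> tending to
  infinity.\<close>

locale L2_basis =
  fixes e :: "nat \<Rightarrow> L2"
  assumes onb: "orthonormal_basis e"
begin

definition proj :: "nat \<Rightarrow> L2 \<Rightarrow> L2" where
  "proj K x = (\<Sum>i<K. (x \<bullet> e i) *\<^sub>R e i)"

lemma inner_e: "e i \<bullet> e j = (if i = j then 1 else 0)"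
  using onb by (simp add: orthonormal_basis_def)

lemma inner_lincomb_e: "(\<Sum>i<K. a i *\<^sub>R e i) \<bullet> e j = (if j < K then a j else 0)"
  by (simp add: inner_sum_left inner_e if_distrib[of "\<lambda>x. a _ * x"] sum.delta cong: if_cong)

lemma norm_lincomb_e: "(norm (\<Sum>i<K. a i *\<^sub>R e i))\<^sup>2 = (\<Sum>i<K. (a i)\<^sup>2)"
proof -
  have "(norm (\<Sum>i<K. a i *\<^sub>R e i))\<^sup>2 = (\<Sum>j<K. a j * ((\<Sum>i<K. a i *\<^sub>R e i) \<bullet> e j))"
    unfolding power2_norm_eq_inner inner_sum_right[of _ _ "{..<K}"] inner_scaleR_right ..
  also have "\<dots> = (\<Sum>i<K. (a i)\<^sup>2)"
    by (intro sum.cong refl) (simp add: inner_lincomb_e power2_eq_square)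
  finally show ?thesis .
qed

lemma inner_proj_e: "proj K x \<bullet> e j = (if j < K then x \<bullet> e j else 0)"
  unfolding proj_def by (rule inner_lincomb_e)

lemma norm_proj: "(norm (proj K x))\<^sup>2 = (\<Sum>i<K. (x \<bullet> e i)\<^sup>2)"
  unfolding proj_def by (rule norm_lincomb_e)

lemma proj_scaleR: "proj K (c *\<^sub>R x) = c *\<^sub>R proj K x"
  by (simp add: proj_def scaleR_sum_right)

lemma bounded_linear_proj: "bounded_linear (proj K)"
  unfolding proj_def[abs_def]
  by (intro bounded_linear_sum bounded_linear_scaleR_left[THEN bounded_linear_compose]
      bounded_linear_inner_left)

lemma proj_diff: "proj K (x - y) = proj K x - proj K y"
  by (rule linear_diff[OF bounded_linear.linear[OF bounded_linear_proj]])

lemma measurable_proj [measurable]: "proj K \<in> borel_measurable borel"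
  by (intro borel_measurable_continuous_onI bounded_linear.continuous_on[OF bounded_linear_proj] continuous_on_id)

lemma inner_proj_residual: "(x - proj K x) \<bullet> (\<Sum>i<K. a i *\<^sub>R e i) = 0"
  by (simp add: inner_sum_right inner_diff_left inner_proj_e)

lemma pythagoras_proj: "(norm x)\<^sup>2 = (norm (proj K x))\<^sup>2 + (norm (x - proj K x))\<^sup>2"
proof -
  have "(x - proj K x) \<bullet> proj K x = 0"
    unfolding proj_def[of K x] by (rule inner_proj_residual[unfolded proj_def])
  then have "proj K x \<bullet> (x - proj K x) = 0" by (simp add: inner_commute)
  from norm_add_Pythagorean[of "proj K x" "x - proj K x"] this
  show ?thesis by (simp add: orthogonal_def)
qed

lemma norm_proj_le: "norm (proj K x) \<le> norm x"
  by (rule power2_le_imp_le) (use pythagoras_proj[of x K] in auto)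

lemma norm_residual_le: "norm (x - proj K x) \<le> norm x"
  by (rule power2_le_imp_le) (use pythagoras_proj[of x K] in auto)

lemma norm_residual_antimono:
  assumes "K \<le> K'"
  shows "norm (x - proj K' x) \<le> norm (x - proj K x)"
proof (rule power2_le_imp_le)
  have "(norm (proj K x))\<^sup>2 \<le> (norm (proj K' x))\<^sup>2"
    unfolding norm_proj using assms by (intro sum_mono2) auto
  then show "(norm (x - proj K' x))\<^sup>2 \<le> (norm (x - proj K x))\<^sup>2"
    using pythagoras_proj[of x K] pythagoras_proj[of x K'] by linarith
qed simp

text \<open>The projection and its competitor both lie in the span of the first \<open>K\<close>
  vectors, to which the residual is orthogonal, so Pythagoras only adds a nonnegative term.\<close>

lemma residual_best: "norm (x - proj K x) \<le> norm (x - (\<Sum>i<K. a i *\<^sub>R e i))"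
proof -
  let ?s = "\<Sum>i<K. a i *\<^sub>R e i"
  have "proj K x - ?s = (\<Sum>i<K. (x \<bullet> e i - a i) *\<^sub>R e i)"
    by (simp add: proj_def sum_subtractf scaleR_diff_left)
  then have "orthogonal (x - proj K x) (proj K x - ?s)"
    using inner_proj_residual by (simp add: orthogonal_def)
  from norm_add_Pythagorean[OF this]
  have "(norm (x - ?s))\<^sup>2 = (norm (x - proj K x))\<^sup>2 + (norm (proj K x - ?s))\<^sup>2" by simp
  then have "(norm (x - proj K x))\<^sup>2 \<le> (norm (x - ?s))\<^sup>2" by simp
  then show ?thesis by (rule power2_le_imp_le) simp
qed

text \<open>Initial segments with zero padding replace the arbitrary finite index sets of
  \<open>span\<close>, so that elements of the span compete directly with
  \<open>proj K\<close>.\<close>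

lemma span_eE:
  assumes "s \<in> span (range e)"
  obtains K a where "s = (\<Sum>i<K. a i *\<^sub>R e i)"
proof -
  from assms have "\<exists>K a. s = (\<Sum>i<K. a i *\<^sub>R e i)"
  proof (induction rule: span_induct_alt)
    case base
    show ?case by (rule exI[of _ 0]) simp
  next
    case (step c x y)
    then obtain K a j where y: "y = (\<Sum>i<K. a i *\<^sub>R e i)" and x: "x = e j" by auto
    \<comment> \<open>A length above both \<open>K\<close> and \<open>j\<close>, to which the old
      combination and the new vector are padded.\<close>
    let ?n = "K + Suc j"
    let ?b = "\<lambda>i. (if i < K then a i else 0) + (if i = j then c else 0)"
    have "(\<Sum>i<?n. ?b i *\<^sub>R e i) =
        (\<Sum>i<?n. (if i < K then a i else 0) *\<^sub>R e i) + (\<Sum>i<?n. (if i = j then c else 0) *\<^sub>R e i)"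
      by (simp only: scaleR_add_left sum.distrib)
    also have "(\<Sum>i<?n. (if i < K then a i else 0) *\<^sub>R e i) = (\<Sum>i<K. a i *\<^sub>R e i)"
      by (rule sum.mono_neutral_cong_right) auto
    also have "(\<Sum>i<?n. (if i = j then c else 0) *\<^sub>R e i) = (\<Sum>i\<in>{j}. c *\<^sub>R e i)"
      by (rule sum.mono_neutral_cong_right) auto
    finally have "c *\<^sub>R x + y = (\<Sum>i<?n. ?b i *\<^sub>R e i)" using x y by (simp add: add.commute)
    then show ?case by (intro exI[of _ ?n] exI[of _ ?b])
  qed
  then show ?thesis using that by blast
qed

text \<open>Density of the span gives one good finite combination; optimality of the projection and
  monotonicity of the residual carry it to all later \<open>K\<close>.\<close>

lemma residual_tendsto: "(\<lambda>K. norm (x - proj K x)) \<longlonglongrightarrow> 0"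
proof (rule LIMSEQ_I)
  fix r :: real assume "r > 0"
  have "x \<in> closure (span (range e))" using onb by (simp add: orthonormal_basis_def)
  then obtain s where s: "s \<in> span (range e)" "dist s x < r"
    using \<open>r > 0\<close> unfolding closure_approachable by blast
  obtain K a where K: "s = (\<Sum>i<K. a i *\<^sub>R e i)" using s(1) by (rule span_eE)
  have "norm (x - proj n x) < r" if "n \<ge> K" for n
    using norm_residual_antimono[OF that, of x] residual_best[of x K a] s(2)
    unfolding K by (simp add: dist_norm norm_minus_commute)
  then show "\<exists>no. \<forall>n\<ge>no. norm (norm (x - proj n x) - 0) < r" by auto
qed

lemma proj_tendsto: "(\<lambda>K. proj K x) \<longlonglongrightarrow> x"
  using tendsto_diff[OF tendsto_const[of x] tendsto_norm_zero_cancel[OF residual_tendsto[of x]]] by simp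

lemma parseval: "(\<lambda>i. (x \<bullet> e i)\<^sup>2) sums (norm x)\<^sup>2"
  unfolding sums_def norm_proj[symmetric] by (intro tendsto_intros proj_tendsto)

lemma inner_e_ext: "(\<And>i. x \<bullet> e i = y \<bullet> e i) \<Longrightarrow> x = y"
  using LIMSEQ_unique[OF proj_tendsto[of x]] proj_tendsto[of y] by (simp add: proj_def)

text \<open>The squared distance of two partial sums is a stretch of the series of squares, so
  completeness applies. It later turns almost surely square-summable Gaussian coordinates into an
  element of \<open>L2\<close>.\<close>

lemma riesz_fischer:
  assumes "summable (\<lambda>i. (a i)\<^sup>2)"
  shows "convergent (\<lambda>K. \<Sum>i<K. a i *\<^sub>R e i)" "lim (\<lambda>K. \<Sum>i<K. a i *\<^sub>R e i) \<bullet> e j = a j"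
proof -
  let ?s = "\<lambda>K. \<Sum>i<K. a i *\<^sub>R e i"
  have "Cauchy ?s"
  proof (rule CauchyI)
    fix r :: real assume "r > 0"
    have "Cauchy (\<lambda>K. \<Sum>i<K. (a i)\<^sup>2)"
      using assms unfolding summable_iff_convergent by (rule convergent_Cauchy)
    then obtain N where N: "\<And>m n. m \<ge> N \<Longrightarrow> n \<ge> N \<Longrightarrow> norm ((\<Sum>i<m. (a i)\<^sup>2) - (\<Sum>i<n. (a i)\<^sup>2)) < r\<^sup>2"
      using CauchyD[of _ "r\<^sup>2"] \<open>r > 0\<close> by (metis zero_less_power)
    have main: "norm (?s m - ?s n) < r" if "n \<ge> N" "m \<ge> n" for m n
    proof -
      \<comment> \<open>Stated for any additive group, because it serves both the vectors and their
        squared coefficients.\<close>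
      have split: "(\<Sum>i<m. f i) = (\<Sum>i<n. f i) + (\<Sum>i<m. if i < n then 0 else f i)" for f :: "nat \<Rightarrow> 'b::ab_group_add"
      proof -
        have "(\<Sum>i<m. f i) = (\<Sum>i\<in>{..<n}. f i) + (\<Sum>i\<in>{n..<m}. f i)"
          using that(2) by (simp add: ivl_disj_un(8) lessThan_atLeast0 sum.atLeastLessThan_concat)
        also have "(\<Sum>i\<in>{n..<m}. f i) = (\<Sum>i<m. if i < n then 0 else f i)"
          by (rule sum.mono_neutral_cong_left) auto
        finally show ?thesis .
      qed
      have "?s m - ?s n = (\<Sum>i<m. (if i < n then 0 else a i) *\<^sub>R e i)"
        unfolding split[of "\<lambda>i. a i *\<^sub>R e i"] by (simp add: if_distrib[of "\<lambda>x. x *\<^sub>R _"] cong: if_cong)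
      then have "(norm (?s m - ?s n))\<^sup>2 = (\<Sum>i<m. (if i < n then 0 else a i)\<^sup>2)"
        by (simp add: norm_lincomb_e)
      also have "\<dots> = (\<Sum>i<m. (a i)\<^sup>2) - (\<Sum>i<n. (a i)\<^sup>2)"
        unfolding split[of "\<lambda>i. (a i)\<^sup>2"] by (simp add: if_distrib[of "\<lambda>x. x\<^sup>2"] cong: if_cong)
      also have "\<dots> < r\<^sup>2" using N[of m n] that by simp
      finally show ?thesis by (rule power_less_imp_less_base) (use \<open>r > 0\<close> in simp)
    qed
    have "norm (?s m - ?s n) < r" if "m \<ge> N" "n \<ge> N" for m n
      using main[of n m] main[of m n] that norm_minus_commute[of "?s m" "?s n"]
      by (cases "n \<le> m") (simp_all only: nat_le_linear)
    then show "\<exists>M. \<forall>m\<ge>M. \<forall>n\<ge>M. norm (?s m - ?s n) < r" by blast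
  qed
  then show c: "convergent ?s" by (rule Cauchy_convergent)
  have "(\<lambda>K. ?s K \<bullet> e j) \<longlonglongrightarrow> (lim ?s) \<bullet> e j"
    using c by (intro tendsto_intros) (simp add: convergent_LIMSEQ_iff)
  moreover have "(\<lambda>K. ?s K \<bullet> e j) \<longlonglongrightarrow> a j"
    by (rule tendsto_eventually) (use eventually_gt_at_top[of j] in \<open>eventually_elim, simp add: inner_lincomb_e\<close>)
  ultimately show "lim ?s \<bullet> e j = a j" by (rule LIMSEQ_unique)
qed

end

section \<open>Gaussian measures\<close>

text \<open>Plays two roles: the randomness from which the Gaussian limit is built, and the mixing
  variable that writes a Gaussian function as an average of characters.\<close>

definition std_iid :: "(nat \<Rightarrow> real) measure" where
  "std_iid = PiM UNIV (\<lambda>_. std_normal_distribution)"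

lemma prob_space_std_normal: "prob_space std_normal_distribution"
  by (rule prob_space_normal_density) simp

interpretation std_iid: prob_space std_iid
  unfolding std_iid_def by (rule prob_space_PiM) (rule prob_space_std_normal)

lemma sets_std_iid: "sets std_iid = sets (PiM UNIV (\<lambda>_. borel))"
  unfolding std_iid_def by (rule sets_PiM_cong) auto

lemma measurable_std_iid_component [measurable]: "(\<lambda>w. w i) \<in> borel_measurable std_iid"
  by (subst measurable_cong_sets[OF sets_std_iid refl]) simp

lemma distr_std_iid_component: "distr std_iid borel (\<lambda>w. w i) = std_normal_distribution"
proof -
  have "distr std_iid std_normal_distribution (\<lambda>w. w i) = std_normal_distribution"
    unfolding std_iid_def by (rule distr_PiM_component) (simp_all add: prob_space_std_normal)
  moreover have "distr std_iid borel (\<lambda>w. w i) = distr std_iid std_normal_distribution (\<lambda>w. w i)"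
    by (rule distr_cong) auto
  ultimately show ?thesis by simp
qed

lemma indep_std_iid: "std_iid.indep_vars (\<lambda>_. borel) (\<lambda>i w. w i) UNIV"
proof (subst std_iid.indep_vars_iff_distr_eq_PiM)
  show "distr std_iid (PiM UNIV (\<lambda>_. borel)) (\<lambda>x. \<lambda>i\<in>UNIV. x i) =
    PiM UNIV (\<lambda>i. distr std_iid borel (\<lambda>w. w i))"
    using distr_id2[OF sets_std_iid[symmetric]]
    by (simp add: distr_std_iid_component restrict_UNIV flip: std_iid_def)
qed auto

lemma char_std_iid:
  assumes "finite J"
  shows "(CLINT w|std_iid. iexp (\<Sum>j\<in>J. t j * w j)) = complex_of_real (exp (- (\<Sum>j\<in>J. (t j)\<^sup>2) / 2))"
proof -
  have one: "(CLINT w|std_iid. iexp (t j * w j)) = complex_of_real (exp (- (t j)\<^sup>2 / 2))" for j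
  proof -
    have "(CLINT w|std_iid. iexp (t j * w j)) = char (distr std_iid borel (\<lambda>w. w j)) (t j)"
      unfolding char_def by (subst integral_distr) auto
    then show ?thesis by (simp add: distr_std_iid_component char_std_normal_distribution)
  qed
  have "(CLINT w|std_iid. iexp (\<Sum>j\<in>J. t j * w j)) = (CLINT w|std_iid. (\<Prod>j\<in>J. iexp (t j * w j)))"
    using assms by (simp add: exp_sum sum_distrib_left)
  also have "\<dots> = (\<Prod>j\<in>J. CLINT w|std_iid. iexp (t j * w j))"
  proof (rule std_iid.indep_vars_lebesgue_integral[OF assms])
    show "std_iid.indep_vars (\<lambda>_. borel) (\<lambda>j w. iexp (t j * w j)) J"
      using std_iid.indep_vars_compose2[OF std_iid.indep_vars_subset[OF indep_std_iid], of J "\<lambda>j x. iexp (t j * x)"]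
      by auto
  qed (auto intro!: std_iid.integrable_iexp)
  also have "\<dots> = complex_of_real (exp (\<Sum>j\<in>J. - (t j)\<^sup>2 / 2))"
    unfolding one by (simp add: exp_sum[OF assms])
  finally show ?thesis by (simp add: sum_negf sum_divide_distrib)
qed

lemma std_iid_second_moment:
  assumes "finite J"
  shows "integrable std_iid (\<lambda>w. (\<Sum>j\<in>J. t j * w j)\<^sup>2)"
    and "(\<integral>w. (\<Sum>j\<in>J. t j * w j)\<^sup>2 \<partial>std_iid) = (\<Sum>j\<in>J. (t j)\<^sup>2)"
proof -
  have sq: "integrable std_iid (\<lambda>w. (w i)\<^sup>2)" "(\<integral>w. (w i)\<^sup>2 \<partial>std_iid) = 1" for i
  proof -
    have "integrable (distr std_iid borel (\<lambda>w. w i)) (\<lambda>x. x\<^sup>2)"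
      "(\<integral>x. x\<^sup>2 \<partial>distr std_iid borel (\<lambda>w. w i)) = 1"
      unfolding distr_std_iid_component
      using integrable_std_normal_distribution_moment[of 2] std_normal_distribution_even_moments(1)[of 1]
      by simp_all
    then show "integrable std_iid (\<lambda>w. (w i)\<^sup>2)" "(\<integral>w. (w i)\<^sup>2 \<partial>std_iid) = 1"
      by (simp_all add: integrable_distr_eq integral_distr)
  qed
  have lin: "integrable std_iid (\<lambda>w. w i)" "(\<integral>w. w i \<partial>std_iid) = 0" for i
  proof -
    have "integrable (distr std_iid borel (\<lambda>w. w i)) (\<lambda>x. x)"
      "(\<integral>x. x \<partial>distr std_iid borel (\<lambda>w. w i)) = 0"
      unfolding distr_std_iid_component
      using integrable_std_normal_distribution_moment[of 1] integral_std_normal_distribution_moment_odd[of 1]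
      by simp_all
    then show "integrable std_iid (\<lambda>w. w i)" "(\<integral>w. w i \<partial>std_iid) = 0"
      by (simp_all add: integrable_distr_eq integral_distr)
  qed
  have mix: "integrable std_iid (\<lambda>w. w i * w j)"
     "(\<integral>w. w i * w j \<partial>std_iid) = (if i = j then 1 else 0)" for i j
  proof -
    have "integrable std_iid (\<lambda>w. w i * w j) \<and> (\<integral>w. w i * w j \<partial>std_iid) = (if i = j then 1 else 0)"
    proof (cases "i = j")
      case True then show ?thesis using sq[of j] by (simp add: power2_eq_square)
    next
      case False
      have I: "std_iid.indep_vars (\<lambda>_. borel) (\<lambda>i w. w i) {i, j}"
        by (rule std_iid.indep_vars_subset[OF indep_std_iid]) simp
      show ?thesis
        using std_iid.indep_vars_integrable[OF _ I] std_iid.indep_vars_lebesgue_integral[OF _ I] lin False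
        by simp
    qed
    then show "integrable std_iid (\<lambda>w. w i * w j)"
     "(\<integral>w. w i * w j \<partial>std_iid) = (if i = j then 1 else 0)" by auto
  qed
  have eq: "(\<Sum>j\<in>J. t j * w j)\<^sup>2 = (\<Sum>i\<in>J. \<Sum>j\<in>J. t i * t j * (w i * w j))" for w :: "nat \<Rightarrow> real"
    by (simp add: power2_eq_square sum_product mult_ac)
  show "integrable std_iid (\<lambda>w. (\<Sum>j\<in>J. t j * w j)\<^sup>2)"
    unfolding eq by (intro Bochner_Integration.integrable_sum integrable_mult_right mix)
  show "(\<integral>w. (\<Sum>j\<in>J. t j * w j)\<^sup>2 \<partial>std_iid) = (\<Sum>j\<in>J. (t j)\<^sup>2)"
    unfolding eq using assms
    by (subst Bochner_Integration.integral_sum, simp add: mix,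
        subst Bochner_Integration.integral_sum, simp add: mix)
      (simp add: mix power2_eq_square if_distrib[of "\<lambda>x. _ * x"] cong: if_cong)
qed


section \<open>Positive semidefinite kernels and their Cholesky factors\<close>

definition psd :: "(nat \<Rightarrow> nat \<Rightarrow> real) \<Rightarrow> bool" where
  "psd c \<longleftrightarrow> (\<forall>i j. c i j = c j i) \<and> (\<forall>n x. 0 \<le> (\<Sum>i<n. \<Sum>j<n. x i * x j * c i j))"

text \<open>Along the line through \<open>x\<close> in direction \<open>k\<close> the form is a
  quadratic polynomial in \<open>t\<close>. Its nonnegativity at well chosen \<open>t\<close> is the
  source of the facts on pivots below.\<close>

lemma quadratic_form_shift:
  fixes c :: "nat \<Rightarrow> nat \<Rightarrow> real"
  assumes sym: "\<And>i j. c i j = c j i" and k: "k < n"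
  shows "(\<Sum>i<n. \<Sum>j<n. (x i + (if i = k then t else 0)) * (x j + (if j = k then t else 0)) * c i j) =
    (\<Sum>i<n. \<Sum>j<n. x i * x j * c i j) + 2 * t * (\<Sum>i<n. x i * c i k) + t\<^sup>2 * c k k"
proof -
  let ?d = "\<lambda>i. if i = k then t else 0"
  have d: "(\<Sum>j<n. ?d j * g j) = t * g k" for g :: "nat \<Rightarrow> real"
    using k by (simp add: if_distrib[of "\<lambda>x. x * _"] cong: if_cong)
  have "(\<Sum>i<n. \<Sum>j<n. (x i + ?d i) * (x j + ?d j) * c i j) =
     (\<Sum>i<n. \<Sum>j<n. x i * x j * c i j) + (\<Sum>i<n. x i * (\<Sum>j<n. ?d j * c i j)) +
     (\<Sum>i<n. ?d i * (\<Sum>j<n. x j * c i j)) + (\<Sum>i<n. ?d i * (\<Sum>j<n. ?d j * c i j))"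
    by (simp add: algebra_simps sum.distrib sum_distrib_left)
  also have "(\<Sum>i<n. x i * (\<Sum>j<n. ?d j * c i j)) = t * (\<Sum>i<n. x i * c i k)"
    unfolding d by (simp add: sum_distrib_left mult_ac)
  also have "(\<Sum>i<n. ?d i * (\<Sum>j<n. x j * c i j)) = t * (\<Sum>i<n. x i * c i k)"
    unfolding d using sym[of k] by (simp only:)
  also have "(\<Sum>i<n. ?d i * (\<Sum>j<n. ?d j * c i j)) = t\<^sup>2 * c k k"
    unfolding d by (simp add: power2_eq_square)
  finally show ?thesis by simp
qed

lemma psdD: "psd c \<Longrightarrow> 0 \<le> (\<Sum>i<n. \<Sum>j<n. x i * x j * c i j)"
  by (simp add: psd_def)

lemma psd_sym: "psd c \<Longrightarrow> c i j = c j i"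
  by (simp add: psd_def)

lemma psd_diag_nonneg: "psd c \<Longrightarrow> 0 \<le> c k k"
  using quadratic_form_shift[of c k "Suc k" "\<lambda>_. 0" 1] psd_sym[of c]
    psdD[of c "\<lambda>i. 0 + (if i = k then 1 else 0)" "Suc k"] by simp

text \<open>With a zero diagonal entry the quadratic polynomial becomes affine in \<open>t\<close>,
  and an affine function bounded below has slope zero.\<close>

lemma psd_diag_zero:
  assumes "psd c" "c k k = 0"
  shows "c i k = 0"
proof (rule ccontr)
  assume nz: "c i k \<noteq> 0"
  have sym: "c i j = c j i" for i j using assms by (auto simp: psd_def)
  \<comment> \<open>Chosen so that \<open>c i i + 2 * t * c i k\<close> equals -1.\<close>
  define t where "t = - (c i i + 1) / (2 * c i k)"
  define n where "n = Suc (i + k)"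
  let ?x = "\<lambda>j. 0 + (if j = i then 1 else 0) :: real"
  have "(\<Sum>i<n. \<Sum>j<n. ?x i * ?x j * c i j) = c i i"
    using quadratic_form_shift[of c i n "\<lambda>_. 0" 1] sym by (simp add: n_def)
  moreover have "(\<Sum>i<n. ?x i * c i k) = c i k"
    by (simp add: if_distrib[of "\<lambda>x. x * _"] n_def cong: if_cong)
  moreover have "0 \<le> (\<Sum>i<n. \<Sum>j<n. (?x i + (if i = k then t else 0)) * (?x j + (if j = k then t else 0)) * c i j)"
    by (rule psdD[OF assms(1)])
  moreover have "(\<Sum>i<n. \<Sum>j<n. (?x i + (if i = k then t else 0)) * (?x j + (if j = k then t else 0)) * c i j)
     = (\<Sum>i<n. \<Sum>j<n. ?x i * ?x j * c i j) + 2 * t * (\<Sum>i<n. ?x i * c i k) + t\<^sup>2 * c k k"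
    by (rule quadratic_form_shift[OF sym]) (simp add: n_def)
  ultimately have "0 \<le> c i i + 2 * t * c i k" using assms(2) by simp
  then show False using nz by (simp add: t_def field_simps)
qed

text \<open>The Schur complement: the residual covariance after regression on coordinate
  \<open>k\<close>. If the pivot \<open>c k k\<close> is zero, division by zero returns zero and the
  kernel is left unchanged.\<close>

definition schur :: "nat \<Rightarrow> (nat \<Rightarrow> nat \<Rightarrow> real) \<Rightarrow> nat \<Rightarrow> nat \<Rightarrow> real" where
  "schur k c i j = c i j - c i k * c k j / c k k"

text \<open>Completing the square in coordinate \<open>k\<close>: the form of the complement at
  \<open>y\<close> is the original form at \<open>y\<close> shifted by \<open>- B / c k k\<close> in
  direction \<open>k\<close>, the minimiser along that line.\<close>

lemma psd_schur:
  assumes "psd c"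
  shows "psd (schur k c)"
proof (cases "c k k = 0")
  case True
  then show ?thesis using assms by (simp add: schur_def[abs_def])
next
  case False
  have sym: "c i j = c j i" for i j using assms by (auto simp: psd_def)
  have nn: "0 \<le> (\<Sum>i<n. \<Sum>j<n. x i * x j * schur k c i j)" for n x
  proof -
    \<comment> \<open>The length must exceed \<open>k\<close>, since the shift acts on that
      coordinate even when it lies outside the first \<open>n\<close>.\<close>
    define N where "N = n + Suc k"
    define y where "y i = (if i < n then x i else 0)" for i
    define B where "B = (\<Sum>i<N. y i * c i k)"
    have kN: "k < N" by (simp add: N_def)
    have ext: "(\<Sum>i<n. \<Sum>j<n. x i * x j * g i j) = (\<Sum>i<N. \<Sum>j<N. y i * y j * g i j)" for g :: "nat \<Rightarrow> nat \<Rightarrow> real"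
    proof (rule sum.mono_neutral_cong_left)
      show "(\<Sum>j<n. x i * x j * g i j) = (\<Sum>j<N. y i * y j * g i j)" if "i \<in> {..<n}" for i
        using that by (intro sum.mono_neutral_cong_left) (auto simp: y_def N_def)
    qed (auto simp: y_def N_def)
    have trm: "y i * y j * schur k c i j = y i * y j * c i j - (y i * c i k) * (y j * c j k) / c k k" for i j
      by (simp add: schur_def algebra_simps sym[of k j])
    have "(\<Sum>i<N. \<Sum>j<N. y i * y j * schur k c i j) =
        (\<Sum>i<N. \<Sum>j<N. y i * y j * c i j) - (\<Sum>i<N. \<Sum>j<N. (y i * c i k) * (y j * c j k) / c k k)"
      unfolding sum_subtractf[symmetric] by (simp only: trm)
    also have "(\<Sum>i<N. \<Sum>j<N. (y i * c i k) * (y j * c j k) / c k k) = B\<^sup>2 / c k k"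
      unfolding B_def power2_eq_square sum_product sum_divide_distrib ..
    also have "(\<Sum>i<N. \<Sum>j<N. y i * y j * c i j) - B\<^sup>2 / c k k =
      (\<Sum>i<N. \<Sum>j<N. (y i + (if i = k then - B / c k k else 0)) * (y j + (if j = k then - B / c k k else 0)) * c i j)"
      unfolding quadratic_form_shift[OF sym kN] B_def[symmetric] using False by (simp add: power2_eq_square)
    also have "\<dots> \<ge> 0" by (rule psdD[OF assms])
    finally show ?thesis unfolding ext .
  qed
  show ?thesis unfolding psd_def using nn by (auto simp: schur_def sym mult.commute)
qed

primrec schur_iter :: "(nat \<Rightarrow> nat \<Rightarrow> real) \<Rightarrow> nat \<Rightarrow> nat \<Rightarrow> nat \<Rightarrow> real" where
  "schur_iter c 0 = c"
| "schur_iter c (Suc k) = schur k (schur_iter c k)"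

lemma psd_schur_iter: "psd c \<Longrightarrow> psd (schur_iter c k)"
  by (induction k) (auto intro: psd_schur)

text \<open>Elimination clears row and column \<open>k\<close>, also for a zero pivot, where
  positivity already forces them to vanish; rows and columns cleared earlier stay zero.\<close>

lemma schur_iter_zero:
  assumes "psd c"
  shows "i < k \<or> j < k \<Longrightarrow> schur_iter c k i j = 0"
proof (induction k arbitrary: i j)
  case (Suc k)
  note p = psd_schur_iter[OF assms, of k]
  have sym: "schur_iter c k i j = schur_iter c k j i" for i j using p by (auto simp: psd_def)
  have "schur k (schur_iter c k) i k = 0" "schur k (schur_iter c k) k j = 0" for i j
    using psd_diag_zero[OF p, of k i] psd_diag_zero[OF p, of k j] sym[of k j]
    by (cases "schur_iter c k k k = 0"; simp add: schur_def)+
  with Suc show ?case by (auto simp: schur_def less_Suc_eq)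
qed simp

text \<open>Column \<open>k\<close> of the lower triangular factor. A zero pivot yields a zero
  column through division by zero, so degenerate covariances need no separate treatment.\<close>

definition cholesky :: "(nat \<Rightarrow> nat \<Rightarrow> real) \<Rightarrow> nat \<Rightarrow> nat \<Rightarrow> real" where
  "cholesky c i k = schur_iter c k i k / sqrt (schur_iter c k k k)"

lemma cholesky_lower: "psd c \<Longrightarrow> i < k \<Longrightarrow> cholesky c i k = 0"
  by (simp add: cholesky_def schur_iter_zero)

text \<open>Each elimination removes exactly the rank-one kernel of one column; the remainder
  vanishes once \<open>n\<close> exceeds one of the two indices.\<close>

lemma cholesky_telescope:
  assumes "psd c"
  shows "c i j = schur_iter c n i j + (\<Sum>k<n. cholesky c i k * cholesky c j k)"
proof (induction n)
  case (Suc n)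
  note p = psd_schur_iter[OF assms, of n]
  have "cholesky c i n * cholesky c j n = schur_iter c n i n * schur_iter c n n j / schur_iter c n n n"
    using psd_diag_nonneg[OF p, of n] p by (simp add: cholesky_def psd_def)
  with Suc show ?case by (simp add: schur_def)
qed simp

lemma cholesky_eq:
  assumes "psd c" "i < n \<or> j < n"
  shows "(\<Sum>k<n. cholesky c i k * cholesky c j k) = c i j"
  using cholesky_telescope[OF assms(1), of i j n] schur_iter_zero[OF assms] by simp

section \<open>Gaussian measures with a given covariance kernel\<close>

context L2_basis
begin

definition gauss_coeff :: "(nat \<Rightarrow> nat \<Rightarrow> real) \<Rightarrow> nat \<Rightarrow> (nat \<Rightarrow> real) \<Rightarrow> real" where
  "gauss_coeff c i w = (\<Sum>k<Suc i. cholesky c i k * w k)"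

text \<open>Total and measurable through \<open>lim\<close>; its value where the expansion diverges
  is unspecified, which for a positive semidefinite \<open>c\<close> with summable diagonal concerns
  a null set.\<close>

definition gauss_vec :: "(nat \<Rightarrow> nat \<Rightarrow> real) \<Rightarrow> (nat \<Rightarrow> real) \<Rightarrow> L2" where
  "gauss_vec c w = lim (\<lambda>K. \<Sum>i<K. gauss_coeff c i w *\<^sub>R e i)"

definition gauss_measure :: "(nat \<Rightarrow> nat \<Rightarrow> real) \<Rightarrow> L2 measure" where
  "gauss_measure c = distr std_iid borel (gauss_vec c)"

lemma measurable_gauss_coeff [measurable]: "gauss_coeff c i \<in> borel_measurable std_iid"
  unfolding gauss_coeff_def[abs_def] by measurable

lemma measurable_gauss_vec [measurable]: "gauss_vec c \<in> borel_measurable std_iid"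
  unfolding gauss_vec_def[abs_def] by measurable

lemma gauss_measure_in: "gauss_measure c \<in> space (prob_algebra borel)"
  unfolding gauss_measure_def space_prob_algebra by (auto intro!: std_iid.prob_space_distr)

text \<open>The expected sum of squared coordinates is the trace of \<open>c\<close>, so almost
  surely the coordinates are square-summable and the expansion converges.\<close>

lemma AE_gauss_vec:
  assumes "psd c" "summable (\<lambda>i. c i i)"
  shows "AE w in std_iid. \<forall>i. gauss_vec c w \<bullet> e i = gauss_coeff c i w"
proof -
  have m: "integrable std_iid (\<lambda>w. (gauss_coeff c i w)\<^sup>2)" "(\<integral>w. (gauss_coeff c i w)\<^sup>2 \<partial>std_iid) = c i i" for i
    unfolding gauss_coeff_def using std_iid_second_moment[of "{..<Suc i}"] cholesky_eq[OF assms(1), of i "Suc i" i]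
    by (simp_all add: power2_eq_square)
  have "(\<integral>\<^sup>+w. (\<Sum>i. ennreal ((gauss_coeff c i w)\<^sup>2)) \<partial>std_iid) = (\<Sum>i. ennreal (c i i))"
    by (subst nn_integral_suminf) (auto simp: nn_integral_eq_integral m)
  also have "\<dots> < \<infinity>"
    using assms(2) psd_diag_nonneg[OF assms(1)] by (simp add: suminf_ennreal2)
  finally have "AE w in std_iid. (\<Sum>i. ennreal ((gauss_coeff c i w)\<^sup>2)) \<noteq> \<infinity>"
    by (intro nn_integral_noteq_infinite) auto
  then show ?thesis
  proof eventually_elim
    case (elim w)
    then have "summable (\<lambda>i. (gauss_coeff c i w)\<^sup>2)" by (intro summable_suminf_not_top) auto
    then show ?case unfolding gauss_vec_def by (simp add: riesz_fischer(2))
  qed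
qed

lemma char_gauss_measure:
  assumes "psd c" "summable (\<lambda>i. c i i)"
  shows "(CLINT x|gauss_measure c. iexp (\<Sum>i<K. a i * (x \<bullet> e i))) =
    complex_of_real (exp (- (\<Sum>i<K. \<Sum>j<K. a i * a j * c i j) / 2))"
proof -
  have "(CLINT x|gauss_measure c. iexp (\<Sum>i<K. a i * (x \<bullet> e i))) =
      (CLINT w|std_iid. iexp (\<Sum>i<K. a i * (gauss_vec c w \<bullet> e i)))"
    unfolding gauss_measure_def by (rule integral_distr) measurable
  also have "\<dots> = (CLINT w|std_iid. iexp (\<Sum>k<K. (\<Sum>i<K. a i * cholesky c i k) * w k))"
  proof (rule integral_cong_AE)
    show "AE w in std_iid. iexp (\<Sum>i<K. a i * (gauss_vec c w \<bullet> e i)) =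
        iexp (\<Sum>k<K. (\<Sum>i<K. a i * cholesky c i k) * w k)"
      using AE_gauss_vec[OF assms]
    proof eventually_elim
      case (elim w)
      \<comment> \<open>Lower triangularity lets all coordinates below \<open>K\<close> share the
        same \<open>K\<close> normals.\<close>
      have "gauss_coeff c i w = (\<Sum>k<K. cholesky c i k * w k)" if "i < K" for i
        unfolding gauss_coeff_def using that
        by (intro sum.mono_neutral_left) (auto simp: cholesky_lower[OF assms(1)])
      then have "(\<Sum>i<K. a i * gauss_coeff c i w) = (\<Sum>i<K. \<Sum>k<K. a i * cholesky c i k * w k)"
        by (simp add: sum_distrib_left mult_ac)
      also have "\<dots> = (\<Sum>k<K. (\<Sum>i<K. a i * cholesky c i k) * w k)"
        by (subst sum.swap) (simp add: sum_distrib_right)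
      finally show ?case using elim by simp
    qed
  qed measurable
  also have "\<dots> = complex_of_real (exp (- (\<Sum>k<K. (\<Sum>i<K. a i * cholesky c i k)\<^sup>2) / 2))"
    by (rule char_std_iid) simp
  also have "(\<Sum>k<K. (\<Sum>i<K. a i * cholesky c i k)\<^sup>2) = (\<Sum>k<K. \<Sum>i<K. \<Sum>j<K. a i * a j * (cholesky c i k * cholesky c j k))"
    by (simp add: power2_eq_square sum_product mult_ac)
  also have "\<dots> = (\<Sum>i<K. \<Sum>j<K. \<Sum>k<K. a i * a j * (cholesky c i k * cholesky c j k))"
    by (subst sum.swap, rule sum.cong[OF refl], subst sum.swap) (rule refl)
  also have "\<dots> = (\<Sum>i<K. \<Sum>j<K. a i * a j * c i j)"
    by (simp add: sum_distrib_left[symmetric] cholesky_eq[OF assms(1)])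
  finally show ?thesis .
qed

end

section \<open>A countable family of test functions for weak convergence\<close>

text \<open>Lists allow repeated points, so concatenation corresponds to multiplication and linear
  combinations form an algebra; the empty list supplies the constants. In an inner product space
  each such function is a multiple of a Gaussian function of the distance to one centre.\<close>

definition bump :: "'a::metric_space list \<Rightarrow> 'a \<Rightarrow> real" where
  "bump l x = exp (- (\<Sum>a\<leftarrow>l. (dist x a)\<^sup>2))"

lemma bump_Nil [simp]: "bump [] x = 1"
  by (simp add: bump_def)

lemma bump_append: "bump (l @ l') x = bump l x * bump l' x"
  by (simp add: bump_def exp_add[symmetric])

lemma bump_pos: "0 < bump l x"
  by (simp add: bump_def)

lemma bump_le_1: "bump l x \<le> 1"
  by (auto simp: bump_def intro!: sum_list_nonneg)

lemma abs_bump_le_1: "\<bar>bump l x\<bar> \<le> 1"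
  using bump_pos[of l x] bump_le_1[of l x] by simp

lemma continuous_on_bump: "continuous_on S (bump l)"
proof -
  have "continuous_on S (\<lambda>x. \<Sum>a\<leftarrow>l. (dist x a)\<^sup>2)"
    by (induction l) (auto intro!: continuous_intros)
  then show ?thesis unfolding bump_def[abs_def] by (intro continuous_intros)
qed

lemma measurable_bump [measurable]: "bump l \<in> borel_measurable borel"
  by (intro borel_measurable_continuous_onI continuous_on_bump)

inductive_set bump_alg :: "'a::metric_space set \<Rightarrow> ('a \<Rightarrow> real) set" for D where
  zero: "(\<lambda>x. 0) \<in> bump_alg D"
| step: "f \<in> bump_alg D \<Longrightarrow> set l \<subseteq> D \<Longrightarrow> (\<lambda>x. f x + c * bump l x) \<in> bump_alg D"

lemma bump_alg_add:
  assumes "g \<in> bump_alg D" "f \<in> bump_alg D"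
  shows "(\<lambda>x. f x + g x) \<in> bump_alg D"
  using assms
proof (induction g)
  case (step g l c)
  from bump_alg.step[OF step.IH[OF step.prems] step.hyps(2), of c]
  show ?case by (simp add: add.assoc)
qed simp

lemma bump_alg_mult_bump:
  assumes "f \<in> bump_alg D" "set l \<subseteq> D"
  shows "(\<lambda>x. f x * (c * bump l x)) \<in> bump_alg D"
  using assms
proof (induction f)
  case zero
  show ?case using bump_alg.zero by simp
next
  case (step f l' c')
  from bump_alg.step[OF step.IH[OF step.prems], of "l' @ l" "c' * c"] step.hyps step.prems
  show ?case by (simp add: bump_append algebra_simps)
qed

lemma bump_alg_mult:
  assumes "g \<in> bump_alg D" "f \<in> bump_alg D"
  shows "(\<lambda>x. f x * g x) \<in> bump_alg D"
  using assms
proof (induction g)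
  case zero
  show ?case using bump_alg.zero by simp
next
  case (step g l c)
  from bump_alg_add[OF bump_alg_mult_bump[OF step.prems step.hyps(2), of c] step.IH[OF step.prems]]
  show ?case by (simp add: algebra_simps)
qed

lemma bump_alg_measurable [measurable_dest]: "f \<in> bump_alg D \<Longrightarrow> f \<in> borel_measurable borel"
  by (induction rule: bump_alg.induct) auto

lemma bump_alg_bounded: "f \<in> bump_alg D \<Longrightarrow> \<exists>B. \<forall>x. \<bar>f x\<bar> \<le> B"
proof (induction rule: bump_alg.induct)
  case (step f l c)
  then obtain B where B: "\<bar>f x\<bar> \<le> B" for x by auto
  have "\<bar>f x + c * bump l x\<bar> \<le> B + \<bar>c\<bar>" for x
    using B[of x] mult_left_mono[OF abs_bump_le_1[of l x], of "\<bar>c\<bar>"]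
    by (intro order_trans[OF abs_triangle_ineq]) (auto simp: abs_mult)
  then show ?case by blast
qed auto

text \<open>The uniform closure, to which limits of integrals extend at once. Arbitrary bounded
  continuous functions are reached from it only pointwise and from below.\<close>

definition bump_closure :: "'a::metric_space set \<Rightarrow> ('a \<Rightarrow> real) set" where
  "bump_closure D = {f. \<forall>r>0. \<exists>g\<in>bump_alg D. \<forall>x. \<bar>f x - g x\<bar> < r}"

lemma bump_alg_closure: "f \<in> bump_alg D \<Longrightarrow> f \<in> bump_closure D"
  unfolding bump_closure_def by (auto intro!: bexI[of _ f])

lemma bump_closureE:
  assumes "f \<in> bump_closure D" "r > 0"
  obtains g where "g \<in> bump_alg D" "\<And>x. \<bar>f x - g x\<bar> < r"
  using assms unfolding bump_closure_def by blast

lemma bump_closure_closed: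
  assumes "\<And>r. r > 0 \<Longrightarrow> \<exists>g\<in>bump_closure D. \<forall>x. \<bar>f x - g x\<bar> < r"
  shows "f \<in> bump_closure D"
  unfolding bump_closure_def
proof (intro CollectI allI impI)
  fix r :: real assume "r > 0"
  then obtain g where g: "g \<in> bump_closure D" "\<And>x. \<bar>f x - g x\<bar> < r / 2"
    using assms[of "r / 2"] by auto
  obtain h where h: "h \<in> bump_alg D" "\<And>x. \<bar>g x - h x\<bar> < r / 2"
    using bump_closureE[OF g(1), of "r / 2"] \<open>r > 0\<close> by auto
  have "\<bar>f x - h x\<bar> < r" for x using g(2)[of x] h(2)[of x] by linarith
  then show "\<exists>g\<in>bump_alg D. \<forall>x. \<bar>f x - g x\<bar> < r" using h(1) by blast
qed

lemma bump_closure_bounded: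
  assumes "f \<in> bump_closure D"
  obtains B where "B > 0" "\<And>x. \<bar>f x\<bar> \<le> B"
proof -
  obtain g where g: "g \<in> bump_alg D" "\<And>x. \<bar>f x - g x\<bar> < 1"
    using bump_closureE[OF assms zero_less_one] by blast
  obtain B where B: "\<And>x. \<bar>g x\<bar> \<le> B" using bump_alg_bounded[OF g(1)] by auto
  have "\<bar>f x\<bar> \<le> \<bar>B\<bar> + 1" for x using g(2)[of x] B[of x] by linarith
  then show ?thesis by (intro that[of "\<bar>B\<bar> + 1"]) auto
qed

lemma bump_closure_measurable [measurable_dest]:
  assumes "f \<in> bump_closure D"
  shows "f \<in> borel_measurable borel"
proof -
  have "\<exists>g\<in>bump_alg D. \<forall>x. \<bar>f x - g x\<bar> < 1 / Suc n" for n
    using assms unfolding bump_closure_def by simp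
  then obtain g where g: "\<And>n. g n \<in> bump_alg D" "\<And>n x. \<bar>f x - g n x\<bar> < 1 / Suc n" by metis
  show ?thesis
  proof (rule borel_measurable_LIMSEQ_real)
    show "(\<lambda>n. g n x) \<longlonglongrightarrow> f x" for x
    proof -
      have "(\<lambda>n. g n x - f x) \<longlonglongrightarrow> 0"
      proof (rule tendsto_rabs_zero_cancel, rule tendsto_sandwich[OF _ _ tendsto_const])
        show "(\<lambda>n. 1 / real (Suc n)) \<longlonglongrightarrow> 0"
          using LIMSEQ_inverse_real_of_nat by (simp add: inverse_eq_divide)
        show "\<forall>\<^sub>F n in sequentially. \<bar>g n x - f x\<bar> \<le> 1 / real (Suc n)"
          using g(2)[of x] by (intro always_eventually allI) (smt (verit))
      qed simp
      then show ?thesis by (simp add: LIM_zero_iff)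
    qed
  qed (use g(1) in measurable)
qed

lemma bump_closure_add:
  assumes "f \<in> bump_closure D" "g \<in> bump_closure D"
  shows "(\<lambda>x. f x + g x) \<in> bump_closure D"
  unfolding bump_closure_def
proof (intro CollectI allI impI)
  fix r :: real assume r: "r > 0"
  obtain f' where f: "f' \<in> bump_alg D" "\<And>x. \<bar>f x - f' x\<bar> < r / 2"
    using bump_closureE[OF assms(1), of "r / 2"] r by auto
  obtain g' where g: "g' \<in> bump_alg D" "\<And>x. \<bar>g x - g' x\<bar> < r / 2"
    using bump_closureE[OF assms(2), of "r / 2"] r by auto
  have "\<bar>f x + g x - (f' x + g' x)\<bar> < r" for x using f(2)[of x] g(2)[of x] by linarith
  then show "\<exists>h\<in>bump_alg D. \<forall>x. \<bar>f x + g x - h x\<bar> < r"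
    using bump_alg_add[OF g(1) f(1)] by (intro bexI[of _ "\<lambda>x. f' x + g' x"]) auto
qed

lemma bump_closure_mult:
  assumes "f \<in> bump_closure D" "g \<in> bump_closure D"
  shows "(\<lambda>x. f x * g x) \<in> bump_closure D"
  unfolding bump_closure_def
proof (intro CollectI allI impI)
  fix r :: real assume r: "r > 0"
  obtain A where A: "A > 0" "\<And>x. \<bar>g x\<bar> \<le> A" using bump_closure_bounded[OF assms(2)] by blast
  obtain f' where f: "f' \<in> bump_alg D" "\<And>x. \<bar>f x - f' x\<bar> < r / (2 * A)"
    using bump_closureE[OF assms(1), of "r / (2 * A)"] r A by auto
  obtain B where B: "\<bar>f' x\<bar> \<le> B" for x using bump_alg_bounded[OF f(1)] by auto
  obtain g' where g: "g' \<in> bump_alg D" "\<And>x. \<bar>g x - g' x\<bar> < r / (2 * (\<bar>B\<bar> + 1))"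
    using bump_closureE[OF assms(2), of "r / (2 * (\<bar>B\<bar> + 1))"] r by auto
  have "\<bar>f x * g x - f' x * g' x\<bar> < r" for x
  proof -
    have "f x * g x - f' x * g' x = (f x - f' x) * g x + f' x * (g x - g' x)"
      by (simp add: algebra_simps)
    also have "\<bar>\<dots>\<bar> \<le> \<bar>f x - f' x\<bar> * \<bar>g x\<bar> + \<bar>f' x\<bar> * \<bar>g x - g' x\<bar>"
      by (rule order_trans[OF abs_triangle_ineq]) (simp add: abs_mult)
    also have "\<dots> \<le> \<bar>f x - f' x\<bar> * A + (\<bar>B\<bar> + 1) * \<bar>g x - g' x\<bar>"
      using A B[of x] by (intro add_mono mult_mono) auto
    also have "\<bar>f x - f' x\<bar> * A < r / 2" using f(2)[of x] A by (simp add: field_simps)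
    also have "(\<bar>B\<bar> + 1) * \<bar>g x - g' x\<bar> \<le> r / 2" using g(2)[of x] by (simp add: field_simps)
    finally show ?thesis by simp
  qed
  then show "\<exists>h\<in>bump_alg D. \<forall>x. \<bar>f x * g x - h x\<bar> < r"
    using bump_alg_mult[OF g(1) f(1)] by (intro bexI[of _ "\<lambda>x. f' x * g' x"]) auto
qed

lemma bump_closure_bump: "set l \<subseteq> D \<Longrightarrow> bump l \<in> bump_closure D"
  using bump_alg.step[OF bump_alg.zero, of l D 1] by (intro bump_alg_closure) simp

lemma bump_closure_const: "(\<lambda>x. c) \<in> bump_closure D"
  using bump_alg.step[OF bump_alg.zero, of "[]" D c] by (intro bump_alg_closure) simp

lemma bump_closure_polynomial:
  fixes p :: "real \<Rightarrow> real"
  assumes "real_polynomial_function p" "f \<in> bump_closure D"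
  shows "(\<lambda>x. p (f x)) \<in> bump_closure D"
  using assms
proof (induction p)
  case (linear p)
  have "p y = p 1 * y" for y using linear_scale[OF bounded_linear.linear[OF linear(1)], of y 1] by simp
  then show ?case using bump_closure_mult[OF bump_closure_const linear(2)] by (metis (no_types, lifting) ext)
qed (auto intro: bump_closure_const bump_closure_add bump_closure_mult)

text \<open>The range of \<open>f\<close> is bounded, so Weierstrass on \<open>{-B..B}\<close>
  replaces \<phi> by a polynomial. With the absolute value for \<phi> this provides maxima, with a
  clipping function the plateaus.\<close>

lemma bump_closure_continuous:
  fixes \<phi> :: "real \<Rightarrow> real"
  assumes "continuous_on UNIV \<phi>" "f \<in> bump_closure D"
  shows "(\<lambda>x. \<phi> (f x)) \<in> bump_closure D"
proof (rule bump_closure_closed)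
  fix r :: real assume r: "r > 0"
  obtain B where B: "\<And>x. \<bar>f x\<bar> \<le> B" using bump_closure_bounded[OF assms(2)] by blast
  obtain p where p: "real_polynomial_function p" "\<And>y. y \<in> {-B..B} \<Longrightarrow> \<bar>\<phi> y - p y\<bar> < r"
    using Stone_Weierstrass_real_polynomial_function[of "{-B..B}" \<phi> r] r
      continuous_on_subset[OF assms(1), of "{-B..B}"] by auto
  have "\<bar>\<phi> (f x) - p (f x)\<bar> < r" for x using B[of x] by (intro p(2)) (auto simp: abs_le_iff)
  then show "\<exists>g\<in>bump_closure D. \<forall>x. \<bar>\<phi> (f x) - g x\<bar> < r"
    using bump_closure_polynomial[OF p(1) assms(2)] by (intro bexI[of _ "\<lambda>x. p (f x)"]) auto
qed

lemma bump_closure_max: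
  assumes "f \<in> bump_closure D" "g \<in> bump_closure D"
  shows "(\<lambda>x. max (f x) (g x)) \<in> bump_closure D"
proof -
  have "(\<lambda>x. \<bar>f x + (- 1) * g x\<bar>) \<in> bump_closure D"
    by (intro bump_closure_continuous[where \<phi> = abs] continuous_intros bump_closure_add assms
        bump_closure_mult bump_closure_const)
  then have "(\<lambda>x. (1/2) * ((f x + g x) + \<bar>f x + (- 1) * g x\<bar>)) \<in> bump_closure D"
    by (intro bump_closure_mult bump_closure_const bump_closure_add assms)
  also have "(\<lambda>x. (1/2) * ((f x + g x) + \<bar>f x + (- 1) * g x\<bar>)) = (\<lambda>x. max (f x) (g x))"
    by (auto simp: fun_eq_iff max_def)
  finally show ?thesis .
qed

text \<open>A single bump, rescaled and clipped: the two exponentials are its values at distances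
  \<open>r / 2\<close> and \<open>r\<close> from \<open>a\<close>, so for positive \<open>r\<close>
  it is one inside the smaller ball and zero outside the larger.\<close>

definition plateau :: "'a::metric_space \<Rightarrow> real \<Rightarrow> 'a \<Rightarrow> real" where
  "plateau a r x = min 1 (max 0 ((bump [a] x - exp (- r\<^sup>2)) / (exp (- (r / 2)\<^sup>2) - exp (- r\<^sup>2))))"

lemma plateau_closure: "a \<in> D \<Longrightarrow> plateau a r \<in> bump_closure D"
  unfolding plateau_def[abs_def] divide_inverse
  by (rule bump_closure_continuous[where f = "bump [a]"])
    (auto intro!: continuous_intros bump_closure_bump)

lemma plateau_range: "0 \<le> plateau a r x" "plateau a r x \<le> 1"
  by (auto simp: plateau_def)

lemma plateau_in:
  assumes "r > 0" "dist x a \<le> r / 2"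
  shows "plateau a r x = 1"
proof -
  have "(dist x a)\<^sup>2 \<le> (r / 2)\<^sup>2" using assms by (intro power_mono) auto
  moreover have "(r / 2)\<^sup>2 < r\<^sup>2" using assms by (simp add: power_divide)
  ultimately have "exp (- (r / 2)\<^sup>2) - exp (- r\<^sup>2) > 0" "bump [a] x - exp (- r\<^sup>2) \<ge> exp (- (r / 2)\<^sup>2) - exp (- r\<^sup>2)"
    by (auto simp: bump_def)
  then have "(bump [a] x - exp (- r\<^sup>2)) / (exp (- (r / 2)\<^sup>2) - exp (- r\<^sup>2)) \<ge> 1" by (simp add: le_divide_eq)
  then show ?thesis unfolding plateau_def by linarith
qed

lemma plateau_out:
  assumes "r > 0" "dist x a \<ge> r"
  shows "plateau a r x = 0"
proof -
  have "r\<^sup>2 \<le> (dist x a)\<^sup>2" using assms by (intro power_mono) auto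
  moreover have "(r / 2)\<^sup>2 < r\<^sup>2" using assms by (simp add: power_divide)
  ultimately have "exp (- (r / 2)\<^sup>2) - exp (- r\<^sup>2) > 0" "bump [a] x - exp (- r\<^sup>2) \<le> 0"
    by (auto simp: bump_def)
  then have "(bump [a] x - exp (- r\<^sup>2)) / (exp (- (r / 2)\<^sup>2) - exp (- r\<^sup>2)) \<le> 0" by (simp add: divide_nonpos_pos)
  then show ?thesis unfolding plateau_def by linarith
qed

text \<open>The space need not be compact, so uniform approximation of \<open>g\<close> is out of
  reach. The rational multiples of plateaus lying below \<open>g\<close> are countably many, and
  their finite maxima increase to \<open>g\<close>.\<close>

lemma continuous_approx_from_below:
  fixes g :: "'a::metric_space \<Rightarrow> real"
  assumes D: "countable D" "closure D = UNIV"
    and g: "continuous_on UNIV g" "\<And>x. 0 \<le> g x"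
  shows "\<exists>h. (\<forall>n. h n \<in> bump_closure D) \<and> (\<forall>n x. 0 \<le> h n x \<and> h n x \<le> g x) \<and> (\<forall>x. (\<lambda>n. h n x) \<longlonglongrightarrow> g x)"
proof -
  define T where "T = {(a, q, r). a \<in> D \<and> q \<in> \<rat> \<and> r \<in> \<rat> \<and> 0 < r \<and> 0 \<le> q \<and> (\<forall>x. q * plateau a r x \<le> g x)}"
  have "D \<noteq> {}" using D(2) by auto
  then obtain a0 where "a0 \<in> D" by auto
  \<comment> \<open>Nonnegativity of \<open>g\<close> admits the zero multiple, so \<open>T\<close>
    is nonempty and \<open>from_nat_into\<close> really takes its values in it.\<close>
  then have "(a0, 0, 1) \<in> T" using g(2) by (auto simp: T_def)
  then have T: "T \<noteq> {}" by auto
  have "T \<subseteq> D \<times> \<rat> \<times> \<rat>" by (auto simp: T_def)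
  then have cT: "countable T" using D(1) countable_rat by (meson countable_SIGMA countable_subset)
  define \<psi> where "\<psi> t x = (case t of (a, q, r) \<Rightarrow> q * plateau a r x)" for t :: "'a \<times> real \<times> real" and x
  define s where "s = from_nat_into T"
  have sT: "s i \<in> T" for i unfolding s_def by (rule from_nat_into[OF T])
  have s_surj: "\<exists>i. s i = t" if "t \<in> T" for t unfolding s_def using from_nat_into_surj[OF cT that] .
  have \<psi>cl: "(\<lambda>x. \<psi> t x) \<in> bump_closure D" if "t \<in> T" for t
    using that unfolding T_def \<psi>_def by (auto intro!: bump_closure_mult bump_closure_const plateau_closure)
  have \<psi>le: "0 \<le> \<psi> t x" "\<psi> t x \<le> g x" if "t \<in> T" for t x
    using that unfolding T_def \<psi>_def by (auto intro!: mult_nonneg_nonneg plateau_range)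
  define h where "h = rec_nat (\<lambda>x. \<psi> (s 0) x) (\<lambda>n f x. max (f x) (\<psi> (s (Suc n)) x))"
  have h0: "h 0 = (\<lambda>x. \<psi> (s 0) x)" and hS: "h (Suc n) = (\<lambda>x. max (h n x) (\<psi> (s (Suc n)) x))" for n
    by (simp_all add: h_def)
  have hcl: "h n \<in> bump_closure D" for n
    by (induction n) (auto simp: h0 hS intro!: bump_closure_max \<psi>cl sT)
  have hle: "0 \<le> h n x \<and> h n x \<le> g x" for n x
    by (induction n) (auto simp: h0 hS le_max_iff_disj \<psi>le sT)
  have hmono: "incseq (\<lambda>n. h n x)" for x
    by (rule incseq_SucI) (simp add: hS)
  have hge: "\<psi> (s n) x \<le> h n x" for n x
    by (cases n) (auto simp: h0 hS)
  have "(\<lambda>n. h n x) \<longlonglongrightarrow> g x" for x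
  proof (rule order_tendstoI)
    fix t assume "t < g x"
    show "\<forall>\<^sub>F n in sequentially. t < h n x"
    proof (cases "t < 0")
      case True
      then show ?thesis using hle by (intro always_eventually) (meson less_le_trans)
    next
      case False
      obtain q where q: "q \<in> \<rat>" "t < q" "q < g x" using Rats_dense_in_real[OF \<open>t < g x\<close>] by auto
      have "open {y. q < g y}"
        using open_Collect_less[OF continuous_on_const g(1)] by simp
      then obtain \<rho> where \<rho>: "\<rho> > 0" "ball x \<rho> \<subseteq> {y. q < g y}"
        using q by (metis mem_Collect_eq open_contains_ball)
      \<comment> \<open>A plateau of radius \<open>r\<close> about a point within
        \<open>r / 2\<close> of \<open>x\<close> equals one at \<open>x\<close> and vanishes beyond
        distance \<open>3 * r / 2 < \<rho>\<close> from it; nearer than \<rho> the function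
        \<open>g\<close> exceeds \<open>q\<close>.\<close>
      obtain r where r: "r \<in> \<rat>" "0 < r" "r < \<rho> / 2" using Rats_dense_in_real[of 0 "\<rho> / 2"] \<rho>(1) by auto
      have "x \<in> closure D" using D by simp
      then obtain a where a: "a \<in> D" "dist a x < r / 2"
        using r(2) unfolding closure_approachable by (meson half_gt_zero)
      have "(a, q, r) \<in> T"
        unfolding T_def
      proof (clarsimp simp: a r q, intro conjI allI)
        show "0 \<le> q" using q False by simp
        fix y
        show "q * plateau a r y \<le> g y"
        proof (cases "dist y a \<ge> r")
          case True
          then show ?thesis using plateau_out[OF r(2) True] g(2) by simp
        next
          case far: False
          have "dist x y \<le> dist a x + dist y a" using dist_triangle[of x y a] by (simp add: dist_commute)
          with far have "dist x y < \<rho>" using a r by linarith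
          then have "q < g y" using \<rho>(2) by auto
          moreover have "q * plateau a r y \<le> q" using mult_left_mono[OF plateau_range(2) \<open>0 \<le> q\<close>, of a r y] by simp
          ultimately show ?thesis by simp
        qed
      qed
      then obtain i where i: "s i = (a, q, r)" using s_surj by blast
      have "plateau a r x = 1" using a r(2) by (intro plateau_in) (auto simp: dist_commute)
      then have "\<psi> (s i) x = q" by (simp add: \<psi>_def i)
      then have "t < h n x" if "n \<ge> i" for n
        using hge[of i x] incseqD[OF hmono that, of x] q by linarith
      then show ?thesis using eventually_sequentially by blast
    qed
  next
    fix t assume "g x < t"
    then show "\<forall>\<^sub>F n in sequentially. h n x < t"
      using hle by (intro always_eventually) (meson le_less_trans)
  qed
  then show ?thesis using hcl hle by blast
qed

lemma space_prob_algebra_borel: "\<mu> \<in> space (prob_algebra borel) \<longleftrightarrow> prob_space \<mu> \<and> sets \<mu> = sets borel"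
  by (auto simp: space_prob_algebra)

lemma integrable_bounded_borel:
  fixes g :: "'a::topological_space \<Rightarrow> 'b::{banach, second_countable_topology}"
  assumes "\<mu> \<in> space (prob_algebra borel)" "g \<in> borel_measurable borel" "\<And>x. norm (g x) \<le> B"
  shows "integrable \<mu> g"
proof -
  interpret prob_space \<mu> using assms(1) by (simp add: space_prob_algebra_borel)
  have s: "sets \<mu> = sets borel" using assms(1) by (simp add: space_prob_algebra_borel)
  show ?thesis
    using assms(2,3) by (intro integrable_const_bound[where B = B]) (auto simp: measurable_cong_sets[OF s refl])
qed

lemma integrable_bump: "\<mu> \<in> space (prob_algebra borel) \<Longrightarrow> integrable \<mu> (bump l)"
  by (rule integrable_bounded_borel[where B = 1]) (auto simp: abs_bump_le_1)

lemma bump_closure_integrable: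
  assumes "\<mu> \<in> space (prob_algebra borel)" "f \<in> bump_closure D"
  shows "integrable \<mu> f"
proof -
  obtain B where "\<And>x. \<bar>f x\<bar> \<le> B" using bump_closure_bounded[OF assms(2)] by blast
  then show ?thesis using assms by (intro integrable_bounded_borel[where B = B]) auto
qed

lemma integral_diff_le_sup:
  fixes f g :: "'a::topological_space \<Rightarrow> real"
  assumes "\<mu> \<in> space (prob_algebra borel)" "integrable \<mu> f" "integrable \<mu> g" "\<And>x. \<bar>f x - g x\<bar> \<le> r"
  shows "\<bar>(\<integral>x. f x \<partial>\<mu>) - (\<integral>x. g x \<partial>\<mu>)\<bar> \<le> r"
proof -
  interpret prob_space \<mu> using assms(1) by (simp add: space_prob_algebra_borel)
  have "\<bar>(\<integral>x. f x \<partial>\<mu>) - (\<integral>x. g x \<partial>\<mu>)\<bar> = \<bar>\<integral>x. f x - g x \<partial>\<mu>\<bar>"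
    using assms by simp
  also have "\<dots> \<le> (\<integral>x. \<bar>f x - g x\<bar> \<partial>\<mu>)" by (rule integral_abs_bound)
  also have "\<dots> \<le> (\<integral>x. r \<partial>\<mu>)" using assms by (intro integral_mono) auto
  finally show ?thesis by (simp add: prob_space)
qed

lemma bump_closure_tendsto:
  assumes P: "\<And>n. \<mu> n \<in> space (prob_algebra borel)" "\<nu> \<in> space (prob_algebra borel)"
    and conv: "\<And>l. set l \<subseteq> D \<Longrightarrow> ((\<lambda>n. \<integral>x. bump l x \<partial>\<mu> n) \<longlongrightarrow> (\<integral>x. bump l x \<partial>\<nu>)) F"
    and f: "f \<in> bump_closure D"
  shows "((\<lambda>n. \<integral>x. f x \<partial>\<mu> n) \<longlongrightarrow> (\<integral>x. f x \<partial>\<nu>)) F"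
proof -
  have alg: "((\<lambda>n. \<integral>x. g x \<partial>\<mu> n) \<longlongrightarrow> (\<integral>x. g x \<partial>\<nu>)) F" if "g \<in> bump_alg D" for g
    using that
  proof (induction g)
    case (step g l c)
    have int: "integrable \<rho> g" if "\<rho> \<in> space (prob_algebra borel)" for \<rho>
      by (rule bump_closure_integrable[OF that bump_alg_closure[OF step.hyps(1)]])
    have eq: "(\<integral>x. g x + c * bump l x \<partial>\<rho>) = (\<integral>x. g x \<partial>\<rho>) + c * (\<integral>x. bump l x \<partial>\<rho>)"
      if "\<rho> \<in> space (prob_algebra borel)" for \<rho>
      using int[OF that] integrable_bump[OF that] by simp
    show ?case unfolding eq[OF P(1)] eq[OF P(2)] by (intro tendsto_intros step conv)
  qed simp
  show ?thesis
  proof (rule tendstoI)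
    fix r :: real assume r: "r > 0"
    obtain g where g: "g \<in> bump_alg D" "\<And>x. \<bar>f x - g x\<bar> < r / 3"
      using bump_closureE[OF f, of "r / 3"] r by auto
    have ev: "\<forall>\<^sub>F n in F. dist (\<integral>x. g x \<partial>\<mu> n) (\<integral>x. g x \<partial>\<nu>) < r / 3"
      using alg[OF g(1)] r by (intro tendstoD) auto
    have close: "\<bar>(\<integral>x. f x \<partial>\<rho>) - (\<integral>x. g x \<partial>\<rho>)\<bar> \<le> r / 3" if "\<rho> \<in> space (prob_algebra borel)" for \<rho>
      by (rule integral_diff_le_sup[OF that bump_closure_integrable[OF that f]
          bump_closure_integrable[OF that bump_alg_closure[OF g(1)]]]) (use g(2) less_imp_le in blast)
    show "\<forall>\<^sub>F n in F. dist (\<integral>x. f x \<partial>\<mu> n) (\<integral>x. f x \<partial>\<nu>) < r"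
      using ev
    proof eventually_elim
      case (elim n)
      then show ?case using close[OF P(1)[of n]] close[OF P(2)] unfolding dist_real_def by linarith
    qed
  qed
qed

text \<open>Approximation from below, with dominated convergence under the limit \<nu> alone, bounds
  the lower limit of the integrals of a nonnegative bounded function. Applied to
  \<open>g + B\<close> and to \<open>B - g\<close> it gives both inequalities.\<close>

lemma weakly_converges_bump:
  fixes \<nu> :: "'a::metric_space measure"
  assumes D: "countable D" "closure D = UNIV"
    and P: "\<And>n. \<mu> n \<in> space (prob_algebra borel)" "\<nu> \<in> space (prob_algebra borel)"
    and conv: "\<And>l. set l \<subseteq> D \<Longrightarrow> (\<lambda>n. \<integral>x. bump l x \<partial>\<mu> n) \<longlonglongrightarrow> (\<integral>x. bump l x \<partial>\<nu>)"
  shows "weakly_converges \<mu> \<nu>"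
  unfolding weakly_converges_def
proof (intro allI impI, elim conjE)
  fix g :: "'a \<Rightarrow> real" assume g: "continuous_on UNIV g" "bounded (range g)"
  obtain B where B: "\<And>x. \<bar>g x\<bar> \<le> B" using g(2) by (auto simp: bounded_iff)
  have mb: "f \<in> borel_measurable borel" if "continuous_on UNIV f" for f :: "'a \<Rightarrow> real"
    using that by (rule borel_measurable_continuous_onI)
  have lower: "\<forall>\<^sub>F n in sequentially. (\<integral>x. f x \<partial>\<nu>) - r < (\<integral>x. f x \<partial>\<mu> n)"
    if f: "continuous_on UNIV f" "\<And>x. 0 \<le> f x" "\<And>x. f x \<le> C" and r: "r > 0" for f :: "'a \<Rightarrow> real" and C r :: real
  proof -
    obtain h where h: "\<And>n. h n \<in> bump_closure D" "\<And>n x. 0 \<le> h n x \<and> h n x \<le> f x" "\<And>x. (\<lambda>n. h n x) \<longlonglongrightarrow> f x"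
      using continuous_approx_from_below[OF D f(1,2)] by blast
    interpret \<nu>: prob_space \<nu> using P(2) by (simp add: space_prob_algebra_borel)
    have s: "sets \<nu> = sets borel" using P(2) by (simp add: space_prob_algebra_borel)
    have int: "integrable \<rho> f" if "\<rho> \<in> space (prob_algebra borel)" for \<rho>
      using f by (intro integrable_bounded_borel[OF that, where B = C] mb) auto
    have "(\<lambda>n. \<integral>x. h n x \<partial>\<nu>) \<longlonglongrightarrow> (\<integral>x. f x \<partial>\<nu>)"
    proof (rule integral_dominated_convergence)
      show "integrable \<nu> f" by (rule int[OF P(2)])
      then show "f \<in> borel_measurable \<nu>" by simp
      show "h n \<in> borel_measurable \<nu>" for n
        using bump_closure_integrable[OF P(2) h(1)] by simp
    qed (use h in auto)
    then have "\<forall>\<^sub>F n in sequentially. (\<integral>x. f x \<partial>\<nu>) - r < (\<integral>x. h n x \<partial>\<nu>)"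
      using r by (intro order_tendstoD) auto
    then obtain m where m: "(\<integral>x. f x \<partial>\<nu>) - r < (\<integral>x. h m x \<partial>\<nu>)"
      by (metis eventually_happens' sequentially_bot)
    have "\<forall>\<^sub>F n in sequentially. (\<integral>x. f x \<partial>\<nu>) - r < (\<integral>x. h m x \<partial>\<mu> n)"
      by (rule order_tendstoD(1)[OF bump_closure_tendsto[OF P conv h(1)] m])
    then show ?thesis
    proof eventually_elim
      case (elim n)
      have "(\<integral>x. h m x \<partial>\<mu> n) \<le> (\<integral>x. f x \<partial>\<mu> n)"
        using h(2) by (intro integral_mono int P bump_closure_integrable[OF P(1) h(1)]) auto
      with elim show ?case by simp
    qed
  qed
  have int: "integrable \<rho> g" if "\<rho> \<in> space (prob_algebra borel)" for \<rho>
    using B by (intro integrable_bounded_borel[OF that, where B = B] mb g) auto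
  have shift: "(\<integral>x. g x + B \<partial>\<rho>) = (\<integral>x. g x \<partial>\<rho>) + B" "(\<integral>x. B - g x \<partial>\<rho>) = B - (\<integral>x. g x \<partial>\<rho>)"
    if "\<rho> \<in> space (prob_algebra borel)" for \<rho>
  proof -
    interpret \<rho>: prob_space \<rho> using that by (simp add: space_prob_algebra_borel)
    show "(\<integral>x. g x + B \<partial>\<rho>) = (\<integral>x. g x \<partial>\<rho>) + B" "(\<integral>x. B - g x \<partial>\<rho>) = B - (\<integral>x. g x \<partial>\<rho>)"
      using int[OF that] by (simp_all add: \<rho>.prob_space)
  qed
  show "(\<lambda>n. \<integral>x. g x \<partial>\<mu> n) \<longlonglongrightarrow> (\<integral>x. g x \<partial>\<nu>)"
  proof (rule tendstoI)
    fix r :: real assume r: "r > 0"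
    have "0 \<le> g x + B" "g x + B \<le> 2 * B" "0 \<le> B - g x" "B - g x \<le> 2 * B" for x using B[of x] by auto
    then have "\<forall>\<^sub>F n in sequentially. (\<integral>x. g x + B \<partial>\<nu>) - r < (\<integral>x. g x + B \<partial>\<mu> n)"
      "\<forall>\<^sub>F n in sequentially. (\<integral>x. B - g x \<partial>\<nu>) - r < (\<integral>x. B - g x \<partial>\<mu> n)"
      using r by (intro lower[where C = "2 * B"] continuous_intros g; simp)+
    then show "\<forall>\<^sub>F n in sequentially. dist (\<integral>x. g x \<partial>\<mu> n) (\<integral>x. g x \<partial>\<nu>) < r"
    proof eventually_elim
      case (elim n)
      then show ?case unfolding shift[OF P(1)] shift[OF P(2)] dist_real_def by linarith
    qed
  qed
qed

text \<open>Otherwise for every \<open>n\<close> some measure agrees with \<nu> on the first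
  \<open>n + 1\<close> bump integrals up to \<open>1 / (n + 1)\<close> and still has distance at
  least \<epsilon>. Such a sequence converges weakly to \<nu>, against the metrization. This is what
  makes an unspecified metric tractable.\<close>

lemma metrizes_bump_neighbourhood:
  fixes \<nu> :: "'a::metric_space measure"
  assumes D: "countable D" "closure D = UNIV"
    and d: "metrizes_weak_convergence d" and \<nu>: "\<nu> \<in> space (prob_algebra borel)" and "\<epsilon> > 0"
  shows "\<exists>L \<eta>. finite L \<and> L \<subseteq> lists D \<and> \<eta> > 0 \<and> (\<forall>\<mu>\<in>space (prob_algebra borel).
    (\<forall>l\<in>L. \<bar>(\<integral>x. bump l x \<partial>\<mu>) - (\<integral>x. bump l x \<partial>\<nu>)\<bar> < \<eta>) \<longrightarrow> d \<mu> \<nu> < \<epsilon>)"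
proof (rule ccontr)
  assume contra: "\<not> ?thesis"
  define ls where "ls = from_nat_into (lists D)"
  have ne: "lists D \<noteq> {}" by auto
  have ls: "ls i \<in> lists D" for i unfolding ls_def by (rule from_nat_into[OF ne])
  have "\<exists>\<mu>\<in>space (prob_algebra borel). (\<forall>i\<le>n. \<bar>(\<integral>x. bump (ls i) x \<partial>\<mu>) - (\<integral>x. bump (ls i) x \<partial>\<nu>)\<bar> < 1 / Suc n) \<and> d \<mu> \<nu> \<ge> \<epsilon>" for n
  proof -
    have "\<not> (finite (ls ` {..n}) \<and> ls ` {..n} \<subseteq> lists D \<and> 1 / real (Suc n) > 0 \<and> (\<forall>\<mu>\<in>space (prob_algebra borel).
    (\<forall>l\<in>ls ` {..n}. \<bar>(\<integral>x. bump l x \<partial>\<mu>) - (\<integral>x. bump l x \<partial>\<nu>)\<bar> < 1 / Suc n) \<longrightarrow> d \<mu> \<nu> < \<epsilon>))"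
      using contra by blast
    then show ?thesis using ls by (force simp: not_less)
  qed
  then obtain \<mu> where \<mu>: "\<And>n. \<mu> n \<in> space (prob_algebra borel)"
    "\<And>n i. i \<le> n \<Longrightarrow> \<bar>(\<integral>x. bump (ls i) x \<partial>\<mu> n) - (\<integral>x. bump (ls i) x \<partial>\<nu>)\<bar> < 1 / Suc n" "\<And>n. d (\<mu> n) \<nu> \<ge> \<epsilon>"
    by metis
  have "weakly_converges \<mu> \<nu>"
  proof (rule weakly_converges_bump[OF D \<mu>(1) \<nu>])
    fix l assume "set l \<subseteq> D"
    then have "l \<in> lists D" by auto
    then obtain i where i: "ls i = l"
      unfolding ls_def using from_nat_into_surj[OF countable_lists[OF D(1)], of l] by blast
    have "(\<lambda>n. (\<integral>x. bump l x \<partial>\<mu> n) - (\<integral>x. bump l x \<partial>\<nu>)) \<longlonglongrightarrow> 0"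
    proof (rule tendsto_rabs_zero_cancel, rule tendsto_sandwich[OF _ _ tendsto_const])
      show "(\<lambda>n. 1 / real (Suc n)) \<longlonglongrightarrow> 0"
        using LIMSEQ_inverse_real_of_nat by (simp add: inverse_eq_divide)
      show "\<forall>\<^sub>F n in sequentially. \<bar>(\<integral>x. bump l x \<partial>\<mu> n) - (\<integral>x. bump l x \<partial>\<nu>)\<bar> \<le> 1 / real (Suc n)"
        using eventually_ge_at_top[of i]
        by eventually_elim (use \<mu>(2) i in \<open>auto intro: less_imp_le\<close>)
    qed simp
    then show "(\<lambda>n. \<integral>x. bump l x \<partial>\<mu> n) \<longlonglongrightarrow> (\<integral>x. bump l x \<partial>\<nu>)" by (simp add: LIM_zero_iff)
  qed
  then have "(\<lambda>n. d (\<mu> n) \<nu>) \<longlonglongrightarrow> 0"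
    using d \<mu>(1) \<nu> unfolding metrizes_weak_convergence_def by blast
  then have "\<forall>\<^sub>F n in sequentially. d (\<mu> n) \<nu> < \<epsilon>" using \<open>\<epsilon> > 0\<close> by (rule order_tendstoD)
  then obtain n where "d (\<mu> n) \<nu> < \<epsilon>" using eventually_happens'[OF sequentially_bot] by blast
  with \<mu>(3)[of n] show False by simp
qed

text \<open>The countably many bump integrals map measures into a sequence space, and a sublevel set
  of the distance is the preimage of an open set there: a union, possibly uncountable, of
  neighbourhoods given by finitely many coordinates.\<close>

lemma metrizes_measurable:
  fixes \<nu> :: "'a::{metric_space, second_countable_topology} measure"
  assumes d: "metrizes_weak_convergence d" and \<nu>: "\<nu> \<in> space (prob_algebra borel)"
  shows "(\<lambda>\<mu>. d \<mu> \<nu>) \<in> borel_measurable (prob_algebra borel)"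
proof (subst borel_measurable_iff_less, intro allI)
  fix a
  let ?P = "space (prob_algebra (borel :: 'a measure))"
  interpret Metric_space ?P d using d by (simp add: metrizes_weak_convergence_def)
  obtain D :: "'a set" where D: "countable D" "closure D = UNIV"
  proof -
    obtain D :: "'a set" where D: "countable D" "\<And>X. open X \<Longrightarrow> X \<noteq> {} \<Longrightarrow> \<exists>d\<in>D. d \<in> X"
      using countable_dense_setE by blast
    have "x \<in> closure D" for x
      unfolding closure_iff_nhds_not_empty using D(2) by (metis IntI empty_iff interior_subset open_interior subsetD)
    then show ?thesis using D(1) that by blast
  qed
  define ls where "ls = from_nat_into (lists D)"
  define \<Phi> where "\<Phi> \<mu> i = (\<integral>x. bump (ls i) x \<partial>\<mu>)" for \<mu> :: "'a measure" and i
  have \<Phi>: "\<Phi> \<in> measurable (prob_algebra borel) borel"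
  proof (rule measurable_coordinatewise_then_product)
    show "(\<lambda>\<mu>. \<Phi> \<mu> i) \<in> borel_measurable (prob_algebra borel)" for i
      unfolding \<Phi>_def prob_algebra_def
      by (intro measurable_restrict_space1 integral_measurable_subprob_algebra) simp
  qed
  have "\<exists>U. open U \<and> \<Phi> \<mu> \<in> U \<and> (\<forall>\<mu>'\<in>?P. \<Phi> \<mu>' \<in> U \<longrightarrow> d \<mu>' \<nu> < a)" if \<mu>: "\<mu> \<in> ?P" "d \<mu> \<nu> < a" for \<mu>
  proof -
    obtain L \<eta> where L: "finite L" "L \<subseteq> lists D" "\<eta> > 0"
      "\<And>\<mu>'. \<mu>' \<in> ?P \<Longrightarrow> (\<forall>l\<in>L. \<bar>(\<integral>x. bump l x \<partial>\<mu>') - (\<integral>x. bump l x \<partial>\<mu>)\<bar> < \<eta>) \<Longrightarrow> d \<mu>' \<mu> < a - d \<mu> \<nu>"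
      using metrizes_bump_neighbourhood[OF D d \<mu>(1), of "a - d \<mu> \<nu>"] \<mu>(2) by auto
    have "\<exists>i. ls i = l" if "l \<in> L" for l
      using from_nat_into_surj[OF countable_lists[OF D(1)], of l] that L(2) unfolding ls_def by blast
    then obtain k where k: "\<And>l. l \<in> L \<Longrightarrow> ls (k l) = l" by metis
    define U where "U = (\<Inter>l\<in>L. {y. \<bar>y (k l) - \<Phi> \<mu> (k l)\<bar> < \<eta>})"
    have "open U"
      unfolding U_def
      by (intro open_INT L ballI open_Collect_less continuous_intros continuous_on_product_coordinates)
    moreover have "\<Phi> \<mu> \<in> U" using L(3) by (simp add: U_def)
    moreover have "d \<mu>' \<nu> < a" if "\<mu>' \<in> ?P" "\<Phi> \<mu>' \<in> U" for \<mu>'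
    proof -
      have "d \<mu>' \<mu> < a - d \<mu> \<nu>"
      proof (rule L(4)[OF that(1)], rule ballI)
        fix l assume l: "l \<in> L"
        then show "\<bar>(\<integral>x. bump l x \<partial>\<mu>') - (\<integral>x. bump l x \<partial>\<mu>)\<bar> < \<eta>"
          using that(2) k[OF l] unfolding U_def \<Phi>_def by auto
      qed
      then show ?thesis using triangle[OF that(1) \<mu>(1) \<nu>] by linarith
    qed
    ultimately show ?thesis by blast
  qed
  then obtain U where U: "\<And>\<mu>. \<mu> \<in> ?P \<Longrightarrow> d \<mu> \<nu> < a \<Longrightarrow> open (U \<mu>) \<and> \<Phi> \<mu> \<in> U \<mu> \<and> (\<forall>\<mu>'\<in>?P. \<Phi> \<mu>' \<in> U \<mu> \<longrightarrow> d \<mu>' \<nu> < a)"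
    by metis
  define V where "V = (\<Union>\<mu>\<in>{\<mu>\<in>?P. d \<mu> \<nu> < a}. U \<mu>)"
  have "open V" unfolding V_def using U by auto
  then have "\<Phi> -` V \<inter> ?P \<in> sets (prob_algebra borel)" by (intro measurable_sets[OF \<Phi>]) auto
  also have "\<Phi> -` V \<inter> ?P = {\<mu>\<in>?P. d \<mu> \<nu> < a}" using U unfolding V_def by auto
  finally show "{\<mu>\<in>?P. d \<mu> \<nu> < a} \<in> sets (prob_algebra borel)" .
qed

section \<open>Convergence of random measures\<close>

lemma kernel_integral_measurable:
  fixes f :: "'b \<Rightarrow> 'c::{banach, second_countable_topology}"
  assumes "\<kappa> \<in> M \<rightarrow>\<^sub>M prob_algebra N" "f \<in> borel_measurable N"
  shows "(\<lambda>\<omega>. \<integral>x. f x \<partial>\<kappa> \<omega>) \<in> borel_measurable M"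
  by (rule measurable_compose[OF measurable_prob_algebraD[OF assms(1)] integral_measurable_subprob_algebra[OF assms(2)]])

text \<open>When the integrand depends on the parameter too, the kernel is pushed forward along
  \<open>y \<mapsto> (x, y)\<close>, so that one fixed function on the product is
  integrated.\<close>

lemma kernel_integral_measurable2:
  fixes f :: "'a \<Rightarrow> 'b \<Rightarrow> 'c::{banach, second_countable_topology}"
  assumes f[measurable]: "(\<lambda>(x, y). f x y) \<in> borel_measurable (M \<Otimes>\<^sub>M N)"
    and L: "L \<in> M \<rightarrow>\<^sub>M prob_algebra N"
  shows "(\<lambda>x. \<integral>y. f x y \<partial>L x) \<in> borel_measurable M"
proof -
  note L[THEN measurable_prob_algebraD, measurable]
  note measurable_distr2[measurable] integral_measurable_subprob_algebra[measurable]
  have "(\<lambda>x. \<integral>p. (case p of (x, y) \<Rightarrow> f x y) \<partial>distr (L x) (M \<Otimes>\<^sub>M N) (\<lambda>y. (x, y))) \<in> borel_measurable M"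
    by measurable
  moreover have "(\<integral>p. (case p of (x, y) \<Rightarrow> f x y) \<partial>distr (L x) (M \<Otimes>\<^sub>M N) (\<lambda>y. (x, y))) = (\<integral>y. f x y \<partial>L x)"
    if x: "x \<in> space M" for x
  proof -
    have s: "sets (L x) = sets N"
      using measurable_space[OF L x] by (simp add: space_prob_algebra)
    show ?thesis using x by (subst integral_distr) (auto simp: measurable_cong_sets[OF s refl])
  qed
  ultimately show ?thesis by (simp cong: measurable_cong)
qed

text \<open>The derivative at \<open>z\<close> has absolute value
  \<open>sqrt lam * (2 * s * exp (- s\<^sup>2))\<close> with
  \<open>s = sqrt lam * \<bar>z\<bar>\<close>, and
  \<open>2 * s \<le> 1 + s\<^sup>2 \<le> exp (s\<^sup>2)\<close>.\<close>

lemma exp_neg_square_lipschitz: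
  fixes u v :: real
  assumes "0 \<le> lam"
  shows "\<bar>exp (- lam * u\<^sup>2) - exp (- lam * v\<^sup>2)\<bar> \<le> sqrt lam * \<bar>u - v\<bar>"
proof -
  have main: "\<bar>exp (- lam * v\<^sup>2) - exp (- lam * u\<^sup>2)\<bar> \<le> sqrt lam * (v - u)" if "u < v" for u v :: real
  proof -
    have "\<exists>z>u. z < v \<and> exp (- lam * v\<^sup>2) - exp (- lam * u\<^sup>2) = (v - u) * (exp (- lam * z\<^sup>2) * (- lam * (2 * z)))"
      using that by (intro MVT2) (auto intro!: derivative_eq_intros simp: power2_eq_square)
    then obtain z where z: "exp (- lam * v\<^sup>2) - exp (- lam * u\<^sup>2) = (v - u) * (exp (- lam * z\<^sup>2) * (- lam * (2 * z)))"
      by blast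
    define s where "s = sqrt lam * \<bar>z\<bar>"
    have s2: "s\<^sup>2 = lam * z\<^sup>2" using assms by (simp add: s_def power_mult_distrib)
    have "2 * s \<le> 1 + s\<^sup>2" using sum_power2_ge_zero[of "s - 1" 0] by (simp add: power2_diff)
    also have "\<dots> \<le> exp (s\<^sup>2)" by (rule exp_ge_add_one_self)
    finally have "2 * s * exp (- s\<^sup>2) \<le> 1" by (simp add: exp_minus field_simps)
    then have "sqrt lam * (2 * s * exp (- s\<^sup>2)) \<le> sqrt lam" using assms by (simp add: mult_left_le)
    moreover have "\<bar>exp (- lam * z\<^sup>2) * (- lam * (2 * z))\<bar> = sqrt lam * (2 * s * exp (- s\<^sup>2))"
    proof -
      have "\<bar>exp (- lam * z\<^sup>2) * (- lam * (2 * z))\<bar> = exp (- (lam * z\<^sup>2)) * ((sqrt lam * sqrt lam) * (2 * \<bar>z\<bar>))"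
        using assms by (simp add: abs_mult)
      also have "\<dots> = sqrt lam * (2 * s * exp (- s\<^sup>2))" unfolding s2 by (simp add: s_def)
      finally show ?thesis .
    qed
    ultimately have "\<bar>exp (- lam * z\<^sup>2) * (- lam * (2 * z))\<bar> \<le> sqrt lam" by simp
    then have "(v - u) * \<bar>exp (- lam * z\<^sup>2) * (- lam * (2 * z))\<bar> \<le> (v - u) * sqrt lam"
      using that by (intro mult_left_mono) auto
    then show ?thesis unfolding z abs_mult using that by (simp add: mult.commute)
  qed
  show ?thesis
    using main[of u v] main[of v u] by (cases u v rule: linorder_cases) (auto simp: abs_minus_commute)
qed

lemma bump_complete_square:
  fixes x :: "'a::real_inner"
  shows "(\<Sum>a\<leftarrow>l. (dist x a)\<^sup>2) = real (length l) * (norm x)\<^sup>2 - 2 * (x \<bullet> sum_list l) + (\<Sum>a\<leftarrow>l. (norm a)\<^sup>2)"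
  by (induction l) (auto simp: dist_norm power2_norm_eq_inner inner_diff_left inner_diff_right inner_add_right
      inner_commute algebra_simps)

text \<open>Completing the square: for a nonempty list the centre is the mean of its points and
  \<open>lam\<close> its length.\<close>

lemma bump_eq_gaussian:
  fixes l :: "'a::real_inner list"
  shows "\<exists>c lam m. 0 \<le> lam \<and> (\<forall>x. bump l x = c * exp (- lam * (norm (x - m))\<^sup>2))"
proof (cases "l = []")
  case True
  then show ?thesis by (intro exI[of _ 1] exI[of _ 0]) simp
next
  case False
  define lam where "lam = real (length l)"
  define m where "m = (1 / lam) *\<^sub>R sum_list l"
  define q where "q = (\<Sum>a\<leftarrow>l. (norm a)\<^sup>2) - lam * (norm m)\<^sup>2"
  have lam: "lam > 0" using False by (simp add: lam_def)
  have m: "sum_list l = lam *\<^sub>R m" using lam by (simp add: m_def)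
  have "bump l x = exp (- q) * exp (- lam * (norm (x - m))\<^sup>2)" for x
    unfolding bump_def bump_complete_square exp_add[symmetric] lam_def[symmetric] m
    by (simp add: power2_norm_eq_inner inner_diff_left inner_diff_right q_def algebra_simps inner_commute)
  then show ?thesis using lam less_imp_le by blast
qed

section \<open>From characteristic functionals to Gaussian test functions\<close>

context L2_basis
begin

abbreviation lin :: "nat \<Rightarrow> (nat \<Rightarrow> real) \<Rightarrow> L2 \<Rightarrow> real" where
  "lin K a x \<equiv> \<Sum>i<K. a i * (x \<bullet> e i)"

text \<open>The characteristic function of independent normals, read with point and frequency
  exchanged; the scale \<open>sqrt (2 * lam)\<close> cancels the factor 1/2 in its exponent.\<close>

lemma gaussian_proj_eq:
  assumes "0 \<le> lam"
  shows "complex_of_real (exp (- lam * (norm (proj K x))\<^sup>2)) =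
    (CLINT w|std_iid. iexp (lin K (\<lambda>i. sqrt (2 * lam) * w i) x))"
proof -
  have "(CLINT w|std_iid. iexp (lin K (\<lambda>i. sqrt (2 * lam) * w i) x)) =
      (CLINT w|std_iid. iexp (\<Sum>i<K. (sqrt (2 * lam) * (x \<bullet> e i)) * w i))"
    by (simp add: mult_ac)
  also have "\<dots> = complex_of_real (exp (- (\<Sum>i<K. (sqrt (2 * lam) * (x \<bullet> e i))\<^sup>2) / 2))"
    by (rule char_std_iid) simp
  also have "(\<Sum>i<K. (sqrt (2 * lam) * (x \<bullet> e i))\<^sup>2) = 2 * lam * (norm (proj K x))\<^sup>2"
    using assms by (simp add: power_mult_distrib norm_proj sum_distrib_left)
  finally show ?thesis by simp
qed

definition charf :: "nat \<Rightarrow> (nat \<Rightarrow> real) \<Rightarrow> L2 measure \<Rightarrow> complex" where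
  "charf K a \<mu> = (CLINT x|\<mu>. iexp (lin K a x))"

lemma cmod_charf_le: "\<mu> \<in> space (prob_algebra borel) \<Longrightarrow> cmod (charf K a \<mu>) \<le> 1"
proof -
  assume \<mu>: "\<mu> \<in> space (prob_algebra borel)"
  interpret prob_space \<mu> using \<mu> by (simp add: space_prob_algebra_borel)
  have "cmod (charf K a \<mu>) \<le> (\<integral>x. cmod (iexp (lin K a x)) \<partial>\<mu>)"
    unfolding charf_def by (rule integral_norm_bound)
  then show ?thesis by (simp add: prob_space)
qed

text \<open>Fubini moves the mixture outside, after which the measure enters only through its
  characteristic functional in the first \<open>K\<close> coordinates, and the centre
  \<open>m\<close> only as a phase.\<close>

lemma gaussian_proj_integral:
  assumes \<mu>: "\<mu> \<in> space (prob_algebra borel)" and lam: "0 \<le> lam"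
  shows "complex_of_real (\<integral>x. exp (- lam * (norm (proj K (x - m)))\<^sup>2) \<partial>\<mu>) =
    (CLINT w|std_iid. iexp (- lin K (\<lambda>i. sqrt (2 * lam) * w i) m) * charf K (\<lambda>i. sqrt (2 * lam) * w i) \<mu>)"
proof -
  interpret \<mu>: prob_space \<mu> using \<mu> by (simp add: space_prob_algebra_borel)
  interpret P: pair_prob_space \<mu> std_iid ..
  have s[measurable_cong]: "sets \<mu> = sets borel" using \<mu> by (simp add: space_prob_algebra_borel)
  let ?f = "\<lambda>x w. iexp (lin K (\<lambda>i. sqrt (2 * lam) * w i) (x - m))"
  have [measurable]: "(\<lambda>(x, w). ?f x w) \<in> borel_measurable (\<mu> \<Otimes>\<^sub>M std_iid)" by measurable
  have int: "integrable (\<mu> \<Otimes>\<^sub>M std_iid) (\<lambda>(x, w). ?f x w)"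
    by (rule P.integrable_const_bound[where B = 1]) (auto split: prod.split)
  have "complex_of_real (\<integral>x. exp (- lam * (norm (proj K (x - m)))\<^sup>2) \<partial>\<mu>) =
      (CLINT x|\<mu>. complex_of_real (exp (- lam * (norm (proj K (x - m)))\<^sup>2)))"
    by simp
  also have "\<dots> = (CLINT x|\<mu>. CLINT w|std_iid. ?f x w)"
    unfolding gaussian_proj_eq[OF lam] ..
  also have "\<dots> = (CLINT w|std_iid. CLINT x|\<mu>. ?f x w)"
    by (rule P.Fubini_integral[symmetric]) (rule int)
  also have "\<dots> = (CLINT w|std_iid. iexp (- lin K (\<lambda>i. sqrt (2 * lam) * w i) m) * charf K (\<lambda>i. sqrt (2 * lam) * w i) \<mu>)"
  proof (rule Bochner_Integration.integral_cong[OF refl])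
    fix w
    have "?f x w = iexp (- lin K (\<lambda>i. sqrt (2 * lam) * w i) m) * iexp (lin K (\<lambda>i. sqrt (2 * lam) * w i) x)" for x
      unfolding exp_add[symmetric] by (simp add: inner_diff_left right_diff_distrib sum_subtractf)
    then show "(CLINT x|\<mu>. ?f x w) = iexp (- lin K (\<lambda>i. sqrt (2 * lam) * w i) m) * charf K (\<lambda>i. sqrt (2 * lam) * w i) \<mu>"
      unfolding charf_def by simp
  qed
  finally show ?thesis .
qed

lemma charf_kernel_measurable:
  assumes "\<kappa> \<in> M \<rightarrow>\<^sub>M prob_algebra borel"
  shows "(\<lambda>\<omega>. charf K a (\<kappa> \<omega>)) \<in> borel_measurable M"
  unfolding charf_def by (rule kernel_integral_measurable[OF assms]) measurable

lemma charf_kernel_measurable2: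
  assumes \<kappa>: "\<kappa> \<in> M \<rightarrow>\<^sub>M prob_algebra borel"
  shows "(\<lambda>(\<omega>, w). charf K (\<lambda>i. c * w i) (\<kappa> \<omega>)) \<in> borel_measurable (M \<Otimes>\<^sub>M std_iid)"
proof -
  have "(\<lambda>p. charf K (\<lambda>i. c * snd p i) (\<kappa> (fst p))) \<in> borel_measurable (M \<Otimes>\<^sub>M std_iid)"
    unfolding charf_def
  proof (rule kernel_integral_measurable2[where N = borel])
    show "(\<lambda>p. \<kappa> (fst p)) \<in> M \<Otimes>\<^sub>M std_iid \<rightarrow>\<^sub>M prob_algebra borel"
      by (rule measurable_compose[OF measurable_fst \<kappa>])
    show "(\<lambda>(p, x). iexp (lin K (\<lambda>i. c * snd p i) x)) \<in> borel_measurable ((M \<Otimes>\<^sub>M std_iid) \<Otimes>\<^sub>M borel)"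
      by measurable
  qed
  then show ?thesis by (simp add: case_prod_beta')
qed

text \<open>The Gaussian function is a mixture of characters, which is why convergence of characteristic
  functionals suffices once the mass outside finitely many coordinates is controlled.\<close>

lemma random_gaussian_proj_tendsto:
  fixes m :: L2
  assumes M: "prob_space M" and \<kappa>: "\<And>n. \<kappa> n \<in> M \<rightarrow>\<^sub>M prob_algebra borel" and \<gamma>: "\<gamma> \<in> space (prob_algebra borel)"
    and char: "\<And>a. (\<lambda>n. \<integral>\<omega>. cmod (charf K a (\<kappa> n \<omega>) - charf K a \<gamma>) \<partial>M) \<longlonglongrightarrow> 0"
    and lam: "0 \<le> lam"
  defines "g \<equiv> \<lambda>x. exp (- lam * (norm (proj K (x - m)))\<^sup>2)"
  shows "(\<lambda>n. \<integral>\<omega>. \<bar>(\<integral>x. g x \<partial>\<kappa> n \<omega>) - (\<integral>x. g x \<partial>\<gamma>)\<bar> \<partial>M) \<longlonglongrightarrow> 0"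
proof -
  interpret M: prob_space M by fact
  interpret P: pair_prob_space M std_iid ..
  define c where "c = sqrt (2 * lam)"
  define H where "H n \<omega> w = cmod (charf K (\<lambda>i. c * w i) (\<kappa> n \<omega>) - charf K (\<lambda>i. c * w i) \<gamma>)" for n \<omega> w
  have \<kappa>P: "\<kappa> n \<omega> \<in> space (prob_algebra borel)" if "\<omega> \<in> space M" for n \<omega>
    using measurable_space[OF \<kappa> that] .
  have c2: "(\<lambda>(\<omega>, w). charf K (\<lambda>i. c * w i) (\<kappa> n \<omega>)) \<in> borel_measurable (M \<Otimes>\<^sub>M std_iid)"
    "(\<lambda>(\<omega>, w). charf K (\<lambda>i. c * w i) \<gamma>) \<in> borel_measurable (M \<Otimes>\<^sub>M std_iid)" for n
    using charf_kernel_measurable2[OF \<kappa>] charf_kernel_measurable2[of "\<lambda>_. \<gamma>"] \<gamma> by auto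
  note [measurable] = this[unfolded case_prod_beta']
  have H_meas[measurable]: "(\<lambda>(\<omega>, w). H n \<omega> w) \<in> borel_measurable (M \<Otimes>\<^sub>M std_iid)" for n
    unfolding H_def case_prod_beta' by measurable
  have H_nonneg: "0 \<le> H n \<omega> w" for n \<omega> w by (simp add: H_def)
  have H_le: "H n \<omega> w \<le> 2" if "\<omega> \<in> space M" for n \<omega> w
    using cmod_charf_le[OF \<kappa>P[OF that, of n], of K "\<lambda>i. c * w i"] cmod_charf_le[OF \<gamma>, of K "\<lambda>i. c * w i"]
      norm_triangle_ineq4[of "charf K (\<lambda>i. c * w i) (\<kappa> n \<omega>)" "charf K (\<lambda>i. c * w i) \<gamma>"]
    by (simp add: H_def)
  note H_range = H_nonneg H_le
  have H_int: "integrable (M \<Otimes>\<^sub>M std_iid) (\<lambda>(\<omega>, w). H n \<omega> w)" for n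
    by (rule P.integrable_const_bound[where B = 2])
      (use H_range in \<open>auto simp: space_pair_measure intro!: AE_I2\<close>)
  have H_int_w: "integrable std_iid (H n \<omega>)" if \<omega>: "\<omega> \<in> space M" for n \<omega>
    using H_range \<omega> measurable_compose[OF measurable_Pair1'[OF \<omega>] H_meas[of n]]
    by (intro std_iid.integrable_const_bound[where B = 2]) auto
  have cm: "(\<lambda>w. charf K (\<lambda>i. c * w i) \<mu>) \<in> borel_measurable std_iid" if "\<mu> \<in> space (prob_algebra borel)" for \<mu>
  proof -
    \<comment> \<open>Measurability in \<open>w\<close> alone comes from the joint statement for a
      constant kernel, restricted to the diagonal.\<close>
    have "(\<lambda>p. charf K (\<lambda>i. c * snd p i) \<mu>) \<in> borel_measurable (std_iid \<Otimes>\<^sub>M std_iid)"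
      using charf_kernel_measurable2[of "\<lambda>_. \<mu>" std_iid K c] that by (simp add: case_prod_beta')
    then have "(\<lambda>w. charf K (\<lambda>i. c * snd (w, w) i) \<mu>) \<in> borel_measurable std_iid" by measurable
    then show ?thesis by simp
  qed
  have int_c: "integrable std_iid (\<lambda>w. iexp (- lin K (\<lambda>i. c * w i) m) * charf K (\<lambda>i. c * w i) \<mu>)"
    if \<mu>: "\<mu> \<in> space (prob_algebra borel)" for \<mu>
    using cm[OF \<mu>] cmod_charf_le[OF \<mu>]
    by (intro std_iid.integrable_const_bound[where B = 1]) (auto simp: norm_mult)
  have pt: "\<bar>(\<integral>x. g x \<partial>\<kappa> n \<omega>) - (\<integral>x. g x \<partial>\<gamma>)\<bar> \<le> (\<integral>w. H n \<omega> w \<partial>std_iid)" if \<omega>: "\<omega> \<in> space M" for n \<omega>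
  proof -
    have "complex_of_real ((\<integral>x. g x \<partial>\<kappa> n \<omega>) - (\<integral>x. g x \<partial>\<gamma>)) =
      (CLINT w|std_iid. iexp (- lin K (\<lambda>i. c * w i) m) * charf K (\<lambda>i. c * w i) (\<kappa> n \<omega>)
         - iexp (- lin K (\<lambda>i. c * w i) m) * charf K (\<lambda>i. c * w i) \<gamma>)"
      unfolding of_real_diff g_def gaussian_proj_integral[OF \<kappa>P[OF \<omega>] lam] gaussian_proj_integral[OF \<gamma> lam] c_def[symmetric]
      by (rule Bochner_Integration.integral_diff[symmetric]; intro int_c \<kappa>P \<omega> \<gamma>)
    then have "\<bar>(\<integral>x. g x \<partial>\<kappa> n \<omega>) - (\<integral>x. g x \<partial>\<gamma>)\<bar> = cmod \<dots>" by (metis norm_of_real)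
    also have "\<dots> \<le> (\<integral>w. cmod (iexp (- lin K (\<lambda>i. c * w i) m) * charf K (\<lambda>i. c * w i) (\<kappa> n \<omega>)
         - iexp (- lin K (\<lambda>i. c * w i) m) * charf K (\<lambda>i. c * w i) \<gamma>) \<partial>std_iid)"
      by (rule integral_norm_bound)
    also have "\<dots> = (\<integral>w. H n \<omega> w \<partial>std_iid)"
      unfolding H_def right_diff_distrib[symmetric] norm_mult by simp
    finally show ?thesis .
  qed
  have E: "(\<integral>\<omega>. \<bar>(\<integral>x. g x \<partial>\<kappa> n \<omega>) - (\<integral>x. g x \<partial>\<gamma>)\<bar> \<partial>M) \<le> (\<integral>w. (\<integral>\<omega>. H n \<omega> w \<partial>M) \<partial>std_iid)" for n
  proof -
    have "(\<integral>\<omega>. \<bar>(\<integral>x. g x \<partial>\<kappa> n \<omega>) - (\<integral>x. g x \<partial>\<gamma>)\<bar> \<partial>M) \<le> (\<integral>\<omega>. (\<integral>w. H n \<omega> w \<partial>std_iid) \<partial>M)"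
    proof (rule integral_mono')
      show "integrable M (\<lambda>\<omega>. \<integral>w. H n \<omega> w \<partial>std_iid)"
        using P.integrable_fst[OF H_int[of n]] by simp
      show "0 \<le> (\<integral>w. H n \<omega> w \<partial>std_iid)" for \<omega> by (intro Bochner_Integration.integral_nonneg H_range)
    qed (rule pt)
    also have "\<dots> = (\<integral>w. (\<integral>\<omega>. H n \<omega> w \<partial>M) \<partial>std_iid)"
      by (rule P.Fubini_integral[symmetric]) (rule H_int)
    finally show ?thesis .
  qed
  have H_swap: "(\<lambda>(w, \<omega>). H n \<omega> w) \<in> borel_measurable (std_iid \<Otimes>\<^sub>M M)" for n
    using measurable_pair_swap[OF H_meas[of n]] by (simp add: case_prod_beta')
  \<comment> \<open>For each fixed \<open>w\<close> the frequencies are deterministic, so the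
    hypothesis on characteristic functionals applies; two bounds the difference of two such
    functionals.\<close>
  have "(\<lambda>n. \<integral>w. (\<integral>\<omega>. H n \<omega> w \<partial>M) \<partial>std_iid) \<longlonglongrightarrow> (\<integral>w. 0 \<partial>std_iid)"
  proof (rule integral_dominated_convergence)
    show "(\<lambda>w. \<integral>\<omega>. H n \<omega> w \<partial>M) \<in> borel_measurable std_iid" for n
      by (rule M.borel_measurable_lebesgue_integral) (rule H_swap)
    show "integrable std_iid (\<lambda>w. 2 :: real)" by simp
    show "AE w in std_iid. (\<lambda>n. \<integral>\<omega>. H n \<omega> w \<partial>M) \<longlonglongrightarrow> 0"
      unfolding H_def by (intro AE_I2 char)
    show "AE w in std_iid. norm (\<integral>\<omega>. H n \<omega> w \<partial>M) \<le> 2" for n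
    proof (rule AE_I2)
      fix w assume w: "w \<in> space std_iid"
      have "integrable M (\<lambda>\<omega>. H n \<omega> w)"
        using H_range measurable_compose[OF measurable_Pair2'[OF w] H_meas[of n]]
        by (intro M.integrable_const_bound[where B = 2]) auto
      then have "(\<integral>\<omega>. H n \<omega> w \<partial>M) \<le> (\<integral>\<omega>. 2 \<partial>M)"
        by (intro integral_mono) (auto simp: H_range)
      moreover have "0 \<le> (\<integral>\<omega>. H n \<omega> w \<partial>M)" by (intro Bochner_Integration.integral_nonneg H_range)
      ultimately show "norm (\<integral>\<omega>. H n \<omega> w \<partial>M) \<le> 2" by (simp add: M.prob_space)
    qed
  qed simp_all
  then have lim: "(\<lambda>n. \<integral>w. (\<integral>\<omega>. H n \<omega> w \<partial>M) \<partial>std_iid) \<longlonglongrightarrow> 0" by simp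
  show ?thesis
    by (rule tendsto_sandwich[OF _ _ tendsto_const lim]) (auto intro!: always_eventually E)
qed

text \<open>The test function is replaced by its version on the first \<open>K\<close> coordinates,
  at a cost governed by the residual and bounded in mean by \<open>\<tau> K\<close> uniformly in
  \<open>n\<close>. The cap at one matches the boundedness of the test functions and makes the
  residual integrable under \<gamma> without a moment assumption there.\<close>

lemma random_measures_bump_tendsto:
  assumes M: "prob_space M" and \<kappa>: "\<And>n. \<kappa> n \<in> M \<rightarrow>\<^sub>M prob_algebra borel" and \<gamma>: "\<gamma> \<in> space (prob_algebra borel)"
    and char: "\<And>K a. (\<lambda>n. \<integral>\<omega>. cmod (charf K a (\<kappa> n \<omega>) - charf K a \<gamma>) \<partial>M) \<longlonglongrightarrow> 0"
    and tail: "\<And>K n. (\<integral>\<omega>. (\<integral>x. min 1 (norm (x - proj K x)) \<partial>\<kappa> n \<omega>) \<partial>M) \<le> \<tau> K" "\<tau> \<longlonglongrightarrow> 0"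
  shows "(\<lambda>n. \<integral>\<omega>. \<bar>(\<integral>x. bump l x \<partial>\<kappa> n \<omega>) - (\<integral>x. bump l x \<partial>\<gamma>)\<bar> \<partial>M) \<longlonglongrightarrow> 0"
proof -
  interpret M: prob_space M by fact
  interpret \<gamma>: prob_space \<gamma> using \<gamma> by (simp add: space_prob_algebra_borel)
  have s\<gamma>[measurable_cong]: "sets \<gamma> = sets borel" using \<gamma> by (simp add: space_prob_algebra_borel)
  have \<kappa>P: "\<kappa> n \<omega> \<in> space (prob_algebra borel)" if "\<omega> \<in> space M" for n \<omega>
    using measurable_space[OF \<kappa> that] .
  obtain c lam m where lam: "0 \<le> lam" and bump: "\<And>x. bump l x = c * exp (- lam * (norm (x - m))\<^sup>2)"
    using bump_eq_gaussian[of l] by blast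
  define g where "g x = exp (- lam * (norm (x - m))\<^sup>2)" for x
  define gK where "gK K x = exp (- lam * (norm (proj K (x - m)))\<^sup>2)" for K x
  define t where "t K x = min 1 (norm (x - proj K x))" for K and x :: L2
  \<comment> \<open>One constant for both regimes: the Lipschitz constant \<open>sqrt lam\<close>
    where the residual is at most one, the trivial bound 1 elsewhere.\<close>
  define A where "A = 1 + sqrt lam"
  define q where "q K = norm (m - proj K m)" for K
  have A: "A \<ge> 1" using lam by (simp add: A_def)
  have [measurable]: "g \<in> borel_measurable borel" "gK K \<in> borel_measurable borel" "t K \<in> borel_measurable borel" for K
    unfolding g_def[abs_def] gK_def[abs_def] t_def[abs_def] by measurable
  have range: "0 \<le> g x" "g x \<le> 1" "0 \<le> gK K x" "gK K x \<le> 1" "0 \<le> t K x" "t K x \<le> 1" "0 \<le> q K" for x K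
    using lam by (auto simp: g_def gK_def t_def q_def)
  have int: "integrable \<mu> g" "integrable \<mu> (gK K)" "integrable \<mu> (t K)" if "\<mu> \<in> space (prob_algebra borel)" for \<mu> K
    using range by (auto intro!: integrable_bounded_borel[OF that, where B = 1])
  have close: "\<bar>g x - gK K x\<bar> \<le> A * (t K x + q K)" for x K
  proof -
    have "0 \<le> g x" "g x \<le> 1" "0 \<le> gK K x" "gK K x \<le> 1" by (rule range)+
    then have le1: "\<bar>g x - gK K x\<bar> \<le> 1" by linarith
    have "\<bar>g x - gK K x\<bar> \<le> sqrt lam * \<bar>norm (x - m) - norm (proj K (x - m))\<bar>"
      unfolding g_def gK_def by (rule exp_neg_square_lipschitz[OF lam])
    also have "\<dots> \<le> sqrt lam * norm ((x - proj K x) - (m - proj K m))"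
      using norm_triangle_ineq3[of "x - m" "proj K (x - m)"] lam
      by (intro mult_left_mono) (simp_all add: proj_diff algebra_simps)
    also have "\<dots> \<le> sqrt lam * (norm (x - proj K x) + q K)"
      unfolding q_def using lam by (intro mult_left_mono norm_triangle_ineq4) auto
    finally have le2: "\<bar>g x - gK K x\<bar> \<le> sqrt lam * (norm (x - proj K x) + q K)" .
    show ?thesis
    proof (cases "norm (x - proj K x) \<le> 1")
      case True
      have "sqrt lam * (norm (x - proj K x) + q K) \<le> A * (norm (x - proj K x) + q K)"
        using range(7)[of K] by (intro mult_right_mono) (auto simp: A_def)
      then show ?thesis using le2 True by (simp add: t_def)
    next
      case False
      have "1 * 1 \<le> A * (t K x + q K)" using A range(7)[of K] False by (intro mult_mono) (auto simp: t_def)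
      then show ?thesis using le1 by simp
    qed
  qed
  have intclose: "\<bar>(\<integral>x. g x \<partial>\<mu>) - (\<integral>x. gK K x \<partial>\<mu>)\<bar> \<le> A * ((\<integral>x. t K x \<partial>\<mu>) + q K)"
    if \<mu>: "\<mu> \<in> space (prob_algebra borel)" for \<mu> K
  proof -
    interpret \<mu>: prob_space \<mu> using \<mu> by (simp add: space_prob_algebra_borel)
    have "\<bar>(\<integral>x. g x \<partial>\<mu>) - (\<integral>x. gK K x \<partial>\<mu>)\<bar> = \<bar>\<integral>x. g x - gK K x \<partial>\<mu>\<bar>"
      using int[OF \<mu>] by simp
    also have "\<dots> \<le> (\<integral>x. \<bar>g x - gK K x\<bar> \<partial>\<mu>)" by (rule integral_abs_bound)
    also have "\<dots> \<le> (\<integral>x. A * (t K x + q K) \<partial>\<mu>)"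
      using int[OF \<mu>] close by (intro integral_mono) auto
    also have "\<dots> = A * ((\<integral>x. t K x \<partial>\<mu>) + q K)" using int[OF \<mu>] by (simp add: \<mu>.prob_space)
    finally show ?thesis .
  qed
  have t\<gamma>: "(\<lambda>K. \<integral>x. t K x \<partial>\<gamma>) \<longlonglongrightarrow> 0"
  proof -
    have "(\<lambda>K. \<integral>x. t K x \<partial>\<gamma>) \<longlonglongrightarrow> (\<integral>x. 0 \<partial>\<gamma>)"
    proof (rule integral_dominated_convergence)
      show "integrable \<gamma> (\<lambda>x. 1 :: real)" by simp
      show "AE x in \<gamma>. (\<lambda>K. t K x) \<longlonglongrightarrow> 0"
      proof (rule AE_I2)
        fix x
        have "(\<lambda>K. t K x) \<longlonglongrightarrow> min 1 0"
          unfolding t_def by (intro tendsto_min tendsto_const residual_tendsto)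
        then show "(\<lambda>K. t K x) \<longlonglongrightarrow> 0" by simp
      qed
    qed (use range in auto)
    then show ?thesis by simp
  qed
  define \<rho> where "\<rho> K = A * (\<tau> K + q K) + A * ((\<integral>x. t K x \<partial>\<gamma>) + q K)" for K
  have "\<rho> \<longlonglongrightarrow> A * (0 + 0) + A * (0 + 0)"
    unfolding \<rho>_def q_def by (intro tendsto_intros tail t\<gamma> residual_tendsto)
  then have \<rho>: "\<rho> \<longlonglongrightarrow> 0" by simp
  define D where "D n = (\<integral>\<omega>. \<bar>(\<integral>x. g x \<partial>\<kappa> n \<omega>) - (\<integral>x. g x \<partial>\<gamma>)\<bar> \<partial>M)" for n
  define DK where "DK K n = (\<integral>\<omega>. \<bar>(\<integral>x. gK K x \<partial>\<kappa> n \<omega>) - (\<integral>x. gK K x \<partial>\<gamma>)\<bar> \<partial>M)" for K n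
  have km[measurable]: "(\<lambda>\<omega>. \<integral>x. f x \<partial>\<kappa> n \<omega>) \<in> borel_measurable M" if "f \<in> borel_measurable borel" for n and f :: "L2 \<Rightarrow> real"
    by (rule kernel_integral_measurable[OF \<kappa> that])
  have kb: "\<bar>\<integral>x. f x \<partial>\<mu>\<bar> \<le> 1" if \<mu>: "\<mu> \<in> space (prob_algebra borel)"
    and "\<And>x. 0 \<le> f x" "\<And>x. f x \<le> 1" for f :: "L2 \<Rightarrow> real" and \<mu>
  proof -
    interpret \<mu>: prob_space \<mu> using \<mu> by (simp add: space_prob_algebra_borel)
    have "(\<integral>x. f x \<partial>\<mu>) \<le> (\<integral>x. 1 \<partial>\<mu>)" by (rule integral_mono') (use that in auto)
    moreover have "0 \<le> (\<integral>x. f x \<partial>\<mu>)" by (intro Bochner_Integration.integral_nonneg that)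
    ultimately show ?thesis by (simp add: \<mu>.prob_space)
  qed
  have bound: "D n \<le> DK K n + \<rho> K" for n K
  proof -
    have iD: "integrable M (\<lambda>\<omega>. \<integral>x. f x \<partial>\<kappa> n \<omega>)"
      if "f \<in> borel_measurable borel" "\<And>x. 0 \<le> f x" "\<And>x. f x \<le> 1" for f :: "L2 \<Rightarrow> real"
      using kb[OF \<kappa>P] that by (intro M.integrable_const_bound[where B = 1] km AE_I2) auto
    note iDs = iD[of g] iD[of "gK K"] iD[of "t K"]
    have "D n \<le> (\<integral>\<omega>. A * ((\<integral>x. t K x \<partial>\<kappa> n \<omega>) + q K) + \<bar>(\<integral>x. gK K x \<partial>\<kappa> n \<omega>) - (\<integral>x. gK K x \<partial>\<gamma>)\<bar>
         + A * ((\<integral>x. t K x \<partial>\<gamma>) + q K) \<partial>M)"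
      unfolding D_def
    proof (rule integral_mono)
      fix \<omega> assume \<omega>: "\<omega> \<in> space M"
      show "\<bar>(\<integral>x. g x \<partial>\<kappa> n \<omega>) - (\<integral>x. g x \<partial>\<gamma>)\<bar> \<le> A * ((\<integral>x. t K x \<partial>\<kappa> n \<omega>) + q K)
         + \<bar>(\<integral>x. gK K x \<partial>\<kappa> n \<omega>) - (\<integral>x. gK K x \<partial>\<gamma>)\<bar> + A * ((\<integral>x. t K x \<partial>\<gamma>) + q K)"
        using intclose[OF \<kappa>P[OF \<omega>], of n K] intclose[OF \<gamma>, of K] by linarith
    qed (use iDs range in auto)
    also have "\<dots> = A * ((\<integral>\<omega>. (\<integral>x. t K x \<partial>\<kappa> n \<omega>) \<partial>M) + q K) + DK K n + A * ((\<integral>x. t K x \<partial>\<gamma>) + q K)"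
      using iDs range by (simp add: M.prob_space DK_def)
    also have "\<dots> \<le> DK K n + \<rho> K"
      using mult_left_mono[OF tail(1)[of n K], of A] A unfolding \<rho>_def t_def[symmetric] by (simp add: algebra_simps)
    finally show ?thesis .
  qed
  have "D \<longlonglongrightarrow> 0"
  proof (rule LIMSEQ_I)
    fix r :: real assume r: "r > 0"
    \<comment> \<open>\<open>K\<close> is fixed before \<open>n\<close> grows, which the uniformity
      of \<open>\<rho> K\<close> in \<open>n\<close> permits.\<close>
    obtain K where K: "\<rho> K < r / 2"
      using order_tendstoD(2)[OF \<rho>, of "r / 2"] r by (metis eventually_happens' half_gt_zero sequentially_bot)
    have "DK K \<longlonglongrightarrow> 0"
      using random_gaussian_proj_tendsto[OF M \<kappa> \<gamma> char lam, where m = m and K = K] unfolding DK_def[abs_def] gK_def .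
    then obtain N where N: "\<And>n. n \<ge> N \<Longrightarrow> DK K n < r / 2"
      using order_tendstoD(2)[of "DK K" 0 sequentially "r / 2"] r unfolding eventually_sequentially by auto
    have "0 \<le> D n" for n unfolding D_def by simp
    then have "norm (D n - 0) < r" if "n \<ge> N" for n using N[OF that] bound[of n K] K by simp
    then show "\<exists>no. \<forall>n\<ge>no. norm (D n - 0) < r" by blast
  qed
  then have "(\<lambda>n. \<bar>c\<bar> * D n) \<longlonglongrightarrow> \<bar>c\<bar> * 0" by (intro tendsto_intros)
  moreover have "(\<integral>\<omega>. \<bar>(\<integral>x. bump l x \<partial>\<kappa> n \<omega>) - (\<integral>x. bump l x \<partial>\<gamma>)\<bar> \<partial>M) = \<bar>c\<bar> * D n" for n
    unfolding D_def bump g_def by (simp add: right_diff_distrib[symmetric] abs_mult)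
  ultimately show ?thesis by simp
qed

end

section \<open>Square-integrable random elements\<close>

text \<open>One notion for real and \<open>L2\<close>-valued variables, so that covariance bounds
  are proved once, through the inner product.\<close>

definition sqint :: "'w measure \<Rightarrow> ('w \<Rightarrow> 'b::{real_inner, banach, second_countable_topology}) \<Rightarrow> bool" where
  "sqint M f \<longleftrightarrow> f \<in> borel_measurable M \<and> integrable M (\<lambda>\<omega>. (norm (f \<omega>))\<^sup>2)"

definition nrm2 :: "'w measure \<Rightarrow> ('w \<Rightarrow> 'b::real_normed_vector) \<Rightarrow> real" where
  "nrm2 M f = sqrt (\<integral>\<omega>. (norm (f \<omega>))\<^sup>2 \<partial>M)"

lemma nrm2_nonneg [simp]: "0 \<le> nrm2 M f"
  by (simp add: nrm2_def)

lemma nrm2_square: "(nrm2 M f)\<^sup>2 = (\<integral>\<omega>. (norm (f \<omega>))\<^sup>2 \<partial>M)"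
  by (simp add: nrm2_def)

lemma sqint_measurable [measurable_dest]: "sqint M f \<Longrightarrow> f \<in> borel_measurable M"
  by (simp add: sqint_def)

lemma sqint_mult:
  assumes "sqint M f" "sqint M g"
  shows "integrable M (\<lambda>\<omega>. norm (f \<omega>) * norm (g \<omega>))"
proof (rule Bochner_Integration.integrable_bound)
  show "integrable M (\<lambda>\<omega>. (norm (f \<omega>))\<^sup>2 + (norm (g \<omega>))\<^sup>2)"
    using assms by (auto simp: sqint_def)
  have "norm (f \<omega>) * norm (g \<omega>) \<le> (norm (f \<omega>))\<^sup>2 + (norm (g \<omega>))\<^sup>2" for \<omega>
    using sum_squares_bound[of "norm (f \<omega>)" "norm (g \<omega>)"] zero_le_power2[of "norm (f \<omega>)"] zero_le_power2[of "norm (g \<omega>)"]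
    by linarith
  then show "AE \<omega> in M. norm (norm (f \<omega>) * norm (g \<omega>)) \<le> norm ((norm (f \<omega>))\<^sup>2 + (norm (g \<omega>))\<^sup>2)"
    by (simp add: abs_mult)
qed (use assms in measurable)

lemma sqint_inner_integrable:
  assumes "sqint M f" "sqint M g"
  shows "integrable M (\<lambda>\<omega>. f \<omega> \<bullet> g \<omega>)"
  by (rule Bochner_Integration.integrable_bound[OF sqint_mult[OF assms]])
    (use assms in \<open>auto simp: Cauchy_Schwarz_ineq2 abs_mult\<close>)

lemma nrm2_cauchy_schwarz:
  assumes f: "sqint M f" and g: "sqint M g"
  shows "(\<integral>\<omega>. norm (f \<omega>) * norm (g \<omega>) \<partial>M) \<le> nrm2 M f * nrm2 M g"
proof -
  let ?f = "\<lambda>\<omega>. norm (f \<omega>)" and ?g = "\<lambda>\<omega>. norm (g \<omega>)"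
  note [measurable] = sqint_measurable[OF f] sqint_measurable[OF g]
  have "(\<integral>\<^sup>+\<omega>. ennreal (?f \<omega>) * ennreal (?g \<omega>) \<partial>M)\<^sup>2 \<le> (\<integral>\<^sup>+\<omega>. ennreal (?f \<omega>) ^ 2 \<partial>M) * (\<integral>\<^sup>+\<omega>. ennreal (?g \<omega>) ^ 2 \<partial>M)"
    by (rule Cauchy_Schwarz_nn_integral) auto
  also have "(\<integral>\<^sup>+\<omega>. ennreal (?f \<omega>) ^ 2 \<partial>M) = ennreal ((nrm2 M f)\<^sup>2)"
    using f by (simp add: ennreal_power nn_integral_eq_integral nrm2_square sqint_def)
  also have "(\<integral>\<^sup>+\<omega>. ennreal (?g \<omega>) ^ 2 \<partial>M) = ennreal ((nrm2 M g)\<^sup>2)"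
    using g by (simp add: ennreal_power nn_integral_eq_integral nrm2_square sqint_def)
  also have "(\<integral>\<^sup>+\<omega>. ennreal (?f \<omega>) * ennreal (?g \<omega>) \<partial>M) = ennreal (\<integral>\<omega>. ?f \<omega> * ?g \<omega> \<partial>M)"
    using sqint_mult[OF f g] by (simp add: ennreal_mult[symmetric] nn_integral_eq_integral)
  finally have "(\<integral>\<omega>. ?f \<omega> * ?g \<omega> \<partial>M)\<^sup>2 \<le> (nrm2 M f * nrm2 M g)\<^sup>2"
    by (simp add: ennreal_power ennreal_mult[symmetric] power_mult_distrib)
  then show ?thesis by (rule power2_le_imp_le) simp
qed

lemma abs_expectation_inner_le:
  assumes "sqint M f" "sqint M g"
  shows "\<bar>\<integral>\<omega>. f \<omega> \<bullet> g \<omega> \<partial>M\<bar> \<le> nrm2 M f * nrm2 M g"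
proof -
  have "\<bar>\<integral>\<omega>. f \<omega> \<bullet> g \<omega> \<partial>M\<bar> \<le> (\<integral>\<omega>. \<bar>f \<omega> \<bullet> g \<omega>\<bar> \<partial>M)" by (rule integral_abs_bound)
  also have "\<dots> \<le> (\<integral>\<omega>. norm (f \<omega>) * norm (g \<omega>) \<partial>M)"
    by (intro integral_mono integrable_abs sqint_inner_integrable sqint_mult assms Cauchy_Schwarz_ineq2)
  finally show ?thesis using nrm2_cauchy_schwarz[OF assms] by simp
qed

lemma sqint_add:
  assumes "sqint M f" "sqint M g"
  shows "sqint M (\<lambda>\<omega>. f \<omega> + g \<omega>)"
  using assms sqint_inner_integrable[OF assms] unfolding sqint_def
  by (auto simp: power2_norm_eq_inner inner_add_left inner_add_right inner_commute[of "g _" "f _"])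

lemma sqint_scaleR: "sqint M f \<Longrightarrow> sqint M (\<lambda>\<omega>. c *\<^sub>R f \<omega>)"
  by (auto simp: sqint_def power_mult_distrib)

lemma sqint_diff: "sqint M f \<Longrightarrow> sqint M g \<Longrightarrow> sqint M (\<lambda>\<omega>. f \<omega> - g \<omega>)"
  using sqint_add[of M f "\<lambda>\<omega>. (- 1) *\<^sub>R g \<omega>"] sqint_scaleR[of M g "- 1"] by simp

lemma sqint_zero [simp]: "sqint M (\<lambda>\<omega>. 0)"
  by (simp add: sqint_def)

lemma sqint_sum: "(\<And>i. i \<in> A \<Longrightarrow> sqint M (f i)) \<Longrightarrow> sqint M (\<lambda>\<omega>. \<Sum>i\<in>A. f i \<omega>)"
  by (induction A rule: infinite_finite_induct) (auto intro: sqint_add)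

lemma sqint_cmult: "sqint M f \<Longrightarrow> sqint M (\<lambda>\<omega>. c * f \<omega>)" for f :: "'w \<Rightarrow> real"
  using sqint_scaleR[of M f c] by simp

lemma sqint_divide: "sqint M f \<Longrightarrow> sqint M (\<lambda>\<omega>. f \<omega> / c)" for f :: "'w \<Rightarrow> real"
  using sqint_cmult[of M f "1 / c"] by simp

lemma nrm2_scaleR: "nrm2 M (\<lambda>\<omega>. c *\<^sub>R f \<omega>) = \<bar>c\<bar> * nrm2 M f"
  by (simp add: nrm2_def power_mult_distrib real_sqrt_mult)

lemma nrm2_mono:
  assumes "sqint M g" "f \<in> borel_measurable M" "\<And>\<omega>. \<omega> \<in> space M \<Longrightarrow> norm (f \<omega>) \<le> norm (g \<omega>)"
  shows "nrm2 M f \<le> nrm2 M g"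
  unfolding nrm2_def
  by (intro real_sqrt_le_mono integral_mono') (use assms in \<open>auto simp: sqint_def power_mono\<close>)

lemma sqint_mono:
  assumes "sqint M g" "f \<in> borel_measurable M" "\<And>\<omega>. \<omega> \<in> space M \<Longrightarrow> norm (f \<omega>) \<le> norm (g \<omega>)"
  shows "sqint M f"
  unfolding sqint_def
proof
  show "integrable M (\<lambda>\<omega>. (norm (f \<omega>))\<^sup>2)"
    by (rule Bochner_Integration.integrable_bound[of M "\<lambda>\<omega>. (norm (g \<omega>))\<^sup>2"])
      (use assms in \<open>auto simp: sqint_def intro!: AE_I2 power_mono\<close>)
qed fact

lemma (in prob_space) sqint_const [simp]: "sqint M (\<lambda>\<omega>. c)"
  by (simp add: sqint_def)

lemma (in prob_space) sqint_bounded: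
  assumes "f \<in> borel_measurable M" "\<And>\<omega>. \<omega> \<in> space M \<Longrightarrow> norm (f \<omega>) \<le> L"
  shows "sqint M f"
  unfolding sqint_def using assms
  by (auto intro!: integrable_const_bound[where B = "L\<^sup>2"] AE_I2 power_mono)

lemma (in prob_space) sqint_integrable:
  assumes "sqint M f"
  shows "integrable M f"
proof -
  have "integrable M (\<lambda>\<omega>. norm (f \<omega>) * norm (1::real))"
    by (rule sqint_mult[OF assms sqint_const])
  then show ?thesis using assms by (auto simp: integrable_norm_iff sqint_def)
qed

lemma (in prob_space) expectation_norm_le_nrm2:
  assumes "sqint M f"
  shows "(\<integral>\<omega>. norm (f \<omega>) \<partial>M) \<le> nrm2 M f"
  using nrm2_cauchy_schwarz[OF assms sqint_const[of "1::real"]] by (simp add: nrm2_def prob_space)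

text \<open>Fubini on the product of the two laws: for fixed \<open>a\<close> the inner integral is
  the inner product of \<open>a\<close> with the mean of \<open>B\<close>.\<close>

lemma (in prob_space) expectation_inner_indep:
  fixes A B :: "'a \<Rightarrow> 'b::{real_inner, banach, second_countable_topology}"
  assumes A: "sqint M A" and B: "sqint M B" and ind: "indep_var borel A borel B"
    and zero: "(\<integral>\<omega>. B \<omega> \<partial>M) = 0"
  shows "(\<integral>\<omega>. A \<omega> \<bullet> B \<omega> \<partial>M) = 0"
proof -
  note [measurable] = sqint_measurable[OF A] sqint_measurable[OF B]
  let ?A = "distr M borel A" and ?B = "distr M borel B"
  interpret dA: prob_space ?A by (rule prob_space_distr) measurable
  interpret dB: prob_space ?B by (rule prob_space_distr) measurable
  interpret P: pair_prob_space ?A ?B ..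
  have J: "?A \<Otimes>\<^sub>M ?B = distr M (borel \<Otimes>\<^sub>M borel) (\<lambda>x. (A x, B x))"
    using ind unfolding indep_var_distribution_eq by simp
  have int: "integrable (?A \<Otimes>\<^sub>M ?B) (\<lambda>(a, b). a \<bullet> b)"
    unfolding J by (subst integrable_distr_eq) (auto intro: sqint_inner_integrable A B)
  have intB: "integrable ?B (\<lambda>b. b)"
    using sqint_integrable[OF B] by (simp add: integrable_distr_eq)
  have "(\<integral>\<omega>. A \<omega> \<bullet> B \<omega> \<partial>M) = (\<integral>p. (case p of (a, b) \<Rightarrow> a \<bullet> b) \<partial>(?A \<Otimes>\<^sub>M ?B))"
    unfolding J by (subst integral_distr) auto
  also have "\<dots> = (\<integral>a. (\<integral>b. a \<bullet> b \<partial>?B) \<partial>?A)"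
    using P.integral_fst'[OF int] by simp
  also have "\<dots> = (\<integral>a. a \<bullet> (\<integral>b. b \<partial>?B) \<partial>?A)"
    using intB by simp
  also have "(\<integral>b. b \<partial>?B) = 0" using zero by (simp add: integral_distr)
  finally show ?thesis by simp
qed

text \<open>Each row of the Gram matrix has at most \<open>2 * q\<close> nonzero entries, each at
  most \<open>C\<close> by Cauchy-Schwarz. The range \<open>q\<close> is \<open>m\<close> for single
  terms, \<open>b + m\<close> for overlapping blocks and 1 for the gaps between blocks.\<close>

lemma (in prob_space) second_moment_sum_le:
  fixes W :: "nat \<Rightarrow> 'a \<Rightarrow> 'b::{real_inner, banach, second_countable_topology}"
  assumes W: "\<And>t. sqint M (W t)" and C: "\<And>t. (\<integral>\<omega>. (norm (W t \<omega>))\<^sup>2 \<partial>M) \<le> C"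
    and orth: "\<And>s t. s + q \<le> t \<Longrightarrow> (\<integral>\<omega>. W s \<omega> \<bullet> W t \<omega> \<partial>M) = 0"
  shows "(\<integral>\<omega>. (norm (\<Sum>t<N. W t \<omega>))\<^sup>2 \<partial>M) \<le> 2 * real q * real N * C"
proof -
  have C0: "0 \<le> C" using C[of 0] order_trans[OF Bochner_Integration.integral_nonneg[of M "\<lambda>\<omega>. (norm (W 0 \<omega>))\<^sup>2"]] by auto
  have le: "(\<integral>\<omega>. W s \<omega> \<bullet> W t \<omega> \<partial>M) \<le> C" for s t
  proof -
    have "nrm2 M (W u) \<le> sqrt C" for u using C[of u] by (simp add: nrm2_def)
    then have "nrm2 M (W s) * nrm2 M (W t) \<le> sqrt C * sqrt C" using C0 by (intro mult_mono) auto
    then show ?thesis using abs_expectation_inner_le[OF W W, of s t] C0 by simp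
  qed
  have row: "(\<Sum>t<N. \<integral>\<omega>. W s \<omega> \<bullet> W t \<omega> \<partial>M) \<le> 2 * real q * C" for s
  proof -
    \<comment> \<open>The subtraction is truncated at zero; near the start the window is merely
      shorter.\<close>
    have z: "(\<integral>\<omega>. W s \<omega> \<bullet> W t \<omega> \<partial>M) = 0" if "t \<notin> {s + 1 - q..<s + q}" for t
      using orth[of s t] orth[of t s] that by (auto simp: inner_commute)
    have "(\<Sum>t<N. \<integral>\<omega>. W s \<omega> \<bullet> W t \<omega> \<partial>M) = (\<Sum>t\<in>{..<N} \<inter> {s + 1 - q..<s + q}. \<integral>\<omega>. W s \<omega> \<bullet> W t \<omega> \<partial>M)"
      by (rule sum.mono_neutral_right) (auto intro: z)
    also have "\<dots> \<le> real (card ({..<N} \<inter> {s + 1 - q..<s + q})) * C"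
      by (rule sum_bounded_above) (rule le)
    also have "\<dots> \<le> (2 * real q) * C"
    proof (intro mult_right_mono C0)
      have "card ({..<N} \<inter> {s + 1 - q..<s + q}) \<le> card {s + 1 - q..<s + q}" by (intro card_mono) auto
      also have "\<dots> \<le> 2 * q" by simp
      finally show "real (card ({..<N} \<inter> {s + 1 - q..<s + q})) \<le> 2 * real q" by linarith
    qed
    finally show ?thesis .
  qed
  have "(\<integral>\<omega>. (norm (\<Sum>t<N. W t \<omega>))\<^sup>2 \<partial>M) = (\<integral>\<omega>. (\<Sum>s<N. \<Sum>t<N. W s \<omega> \<bullet> W t \<omega>) \<partial>M)"
    by (simp add: power2_norm_eq_inner inner_sum_left inner_sum_right) (subst sum.swap, rule refl)
  also have "\<dots> = (\<Sum>s<N. \<Sum>t<N. \<integral>\<omega>. W s \<omega> \<bullet> W t \<omega> \<partial>M)"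
    by (subst Bochner_Integration.integral_sum;
        (intro sum.cong refl Bochner_Integration.integral_sum Bochner_Integration.integrable_sum sqint_inner_integrable W)?)
  also have "\<dots> \<le> (\<Sum>s<N. 2 * real q * C)" by (intro sum_mono row)
  finally show ?thesis by (simp add: mult_ac)
qed

section \<open>Functions of independent innovations\<close>

locale innovations = prob_space M for M :: "'w measure" +
  fixes Z :: "'i \<Rightarrow> 'w \<Rightarrow> 'b::{second_countable_topology, banach}"
  assumes indep_Z: "indep_vars (\<lambda>_. borel) Z UNIV"
begin

text \<open>Turns independence into set theory: variables measurable with respect to
  \<open>gen\<close> of disjoint index sets are independent.\<close>

definition gen :: "'i set \<Rightarrow> 'w measure" where
  "gen K = vimage_algebra (space M) (\<lambda>\<omega>. \<lambda>i\<in>K. Z i \<omega>) (PiM K (\<lambda>_. borel))"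

lemma measurable_Z [measurable]: "Z i \<in> borel_measurable M"
  using indep_Z by (simp add: indep_vars_def)

lemma space_gen [simp]: "space (gen K) = space M"
  by (simp add: gen_def)

lemma Z_gen: "i \<in> K \<Longrightarrow> Z i \<in> borel_measurable (gen K)"
proof -
  assume "i \<in> K"
  have "(\<lambda>\<omega>. (\<lambda>i\<in>K. Z i \<omega>) i) \<in> borel_measurable (gen K)"
    unfolding gen_def
    by (rule measurable_compose[OF measurable_vimage_algebra1 measurable_component_singleton])
      (use \<open>i \<in> K\<close> in \<open>auto simp: space_PiM\<close>)
  then show ?thesis using \<open>i \<in> K\<close> by simp
qed

lemma gen_mono:
  assumes "K \<subseteq> K'" "f \<in> gen K \<rightarrow>\<^sub>M N"
  shows "f \<in> gen K' \<rightarrow>\<^sub>M N"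
proof -
  have "(\<lambda>\<omega>. \<omega>) \<in> gen K' \<rightarrow>\<^sub>M gen K"
    unfolding gen_def[of K]
    by (rule measurable_vimage_algebra2) (use assms(1) Z_gen in \<open>auto intro!: measurable_restrict\<close>)
  from measurable_compose[OF this assms(2)] show ?thesis by simp
qed

lemma gen_M:
  assumes "f \<in> gen K \<rightarrow>\<^sub>M N"
  shows "f \<in> M \<rightarrow>\<^sub>M N"
proof -
  have "(\<lambda>\<omega>. \<omega>) \<in> M \<rightarrow>\<^sub>M gen K"
    unfolding gen_def
    by (rule measurable_vimage_algebra2) (auto intro!: measurable_restrict)
  from measurable_compose[OF this assms] show ?thesis by simp
qed

lemma gen_indep_vars:
  assumes disj: "disjoint_family_on K J" and f: "\<And>j. j \<in> J \<Longrightarrow> f j \<in> gen (K j) \<rightarrow>\<^sub>M N j"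
  shows "indep_vars N f J"
proof -
  have "indep_vars (\<lambda>j. PiM (K j) (\<lambda>_. borel)) (\<lambda>j \<omega>. restrict (\<lambda>i. Z i \<omega>) (K j)) J"
    by (rule indep_vars_restrict[OF indep_Z _ disj]) simp
  then have I: "indep_sets (\<lambda>j. {(\<lambda>\<omega>. restrict (\<lambda>i. Z i \<omega>) (K j)) -` A \<inter> space M |A. A \<in> sets (PiM (K j) (\<lambda>_. borel))}) J"
    unfolding indep_vars_def2 by simp
  show ?thesis
    unfolding indep_vars_def2
  proof
    show "\<forall>j\<in>J. random_variable (N j) (f j)" using f gen_M by blast
    show "indep_sets (\<lambda>j. {f j -` A \<inter> space M |A. A \<in> sets (N j)}) J"
    proof (rule indep_sets_mono_sets[OF I])
      fix j assume j: "j \<in> J"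
      have "{f j -` A \<inter> space M |A. A \<in> sets (N j)} \<subseteq> sets (gen (K j))"
        using measurable_sets[OF f[OF j]] by auto
      also have "sets (gen (K j)) = {(\<lambda>\<omega>. restrict (\<lambda>i. Z i \<omega>) (K j)) -` A \<inter> space M |A. A \<in> sets (PiM (K j) (\<lambda>_. borel))}"
        unfolding gen_def by (rule sets_vimage_algebra2) (auto simp: space_PiM)
      finally show "{f j -` A \<inter> space M |A. A \<in> sets (N j)} \<subseteq>
        {(\<lambda>\<omega>. restrict (\<lambda>i. Z i \<omega>) (K j)) -` A \<inter> space M |A. A \<in> sets (PiM (K j) (\<lambda>_. borel))}" .
    qed
  qed
qed

lemma gen_indep_var:
  assumes "K \<inter> K' = {}" "f \<in> gen K \<rightarrow>\<^sub>M N" "g \<in> gen K' \<rightarrow>\<^sub>M N'"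
  shows "indep_var N f N' g"
  unfolding indep_var_def
  by (rule gen_indep_vars[where K = "case_bool K K'"])
    (use assms in \<open>auto simp: disjoint_family_on_def split: bool.split\<close>)

text \<open>Every injective choice of innovations has the same product law. Stationarity, and
  equality in law of a variable and its coupled version, are both instances.\<close>

lemma law_reindex:
  fixes \<pi> :: "'j \<Rightarrow> 'i"
  assumes inj: "inj \<pi>" and ident: "\<And>i. distr M borel (Z i) = \<nu>"
  shows "distr M (PiM UNIV (\<lambda>_. borel)) (\<lambda>\<omega> j. Z (\<pi> j) \<omega>) = PiM UNIV (\<lambda>_. \<nu>)"
proof -
  have "indep_vars (\<lambda>_. borel) (\<lambda>j. Z (\<pi> j)) UNIV"
    by (rule gen_indep_vars[where K = "\<lambda>j. {\<pi> j}"])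
      (use inj in \<open>auto simp: disjoint_family_on_def inj_def intro!: Z_gen\<close>)
  then have "distr M (PiM UNIV (\<lambda>_. borel)) (\<lambda>\<omega>. \<lambda>j\<in>UNIV. Z (\<pi> j) \<omega>) = PiM UNIV (\<lambda>j. distr M borel (Z (\<pi> j)))"
    by (subst (asm) indep_vars_iff_distr_eq_PiM) auto
  then show ?thesis by (simp add: ident restrict_UNIV)
qed

end

section \<open>Bounded finitely dependent processes\<close>

definition bsum :: "(int \<Rightarrow> 'w \<Rightarrow> 'b::comm_monoid_add) \<Rightarrow> int \<Rightarrow> nat \<Rightarrow> 'w \<Rightarrow> 'b" where
  "bsum y t b \<omega> = (\<Sum>j<b. y (t + int j) \<omega>)"

lemma bsum_add: "bsum y t (a + b) \<omega> = bsum y t a \<omega> + bsum y (t + int a) b \<omega>"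
  by (induction b) (simp_all add: bsum_def add.assoc)

lemma bsum_mult: "bsum y t (k * b) \<omega> = (\<Sum>i<k. bsum y (t + int (i * b)) b \<omega>)"
proof (induction k)
  case (Suc k)
  have "bsum y t (Suc k * b) \<omega> = bsum y t (k * b + b) \<omega>" by (simp add: add.commute)
  then show ?case using Suc by (simp add: bsum_add)
qed (simp add: bsum_def)

lemma bsum_diff: "bsum (\<lambda>t \<omega>. x t \<omega> - y t \<omega>) t b \<omega> = bsum x t b \<omega> - bsum y t b \<omega>"
  for x y :: "int \<Rightarrow> 'w \<Rightarrow> 'b::ab_group_add"
  by (simp add: bsum_def sum_subtractf)

lemma sum_power4_le:
  fixes f :: "'a \<Rightarrow> real"
  shows "(\<Sum>i\<in>I. f i) ^ 4 \<le> real (card I) ^ 3 * (\<Sum>i\<in>I. f i ^ 4)"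
proof -
  have "(\<Sum>i\<in>I. f i) ^ 4 = ((\<Sum>i\<in>I. f i)\<^sup>2)\<^sup>2" by simp
  also have "\<dots> \<le> ((\<Sum>i\<in>I. (f i)\<^sup>2) * card I)\<^sup>2"
    by (intro power_mono sum_squared_le_sum_of_squares) simp
  also have "\<dots> = (\<Sum>i\<in>I. (f i)\<^sup>2)\<^sup>2 * (real (card I))\<^sup>2" by (simp add: power_mult_distrib)
  also have "\<dots> \<le> ((\<Sum>i\<in>I. ((f i)\<^sup>2)\<^sup>2) * card I) * (real (card I))\<^sup>2"
    by (intro mult_right_mono sum_squared_le_sum_of_squares) simp
  also have "\<dots> = real (card I) ^ 3 * (\<Sum>i\<in>I. f i ^ 4)" by (simp add: power_numeral_reduce mult_ac)
  finally show ?thesis .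
qed

text \<open>Adding an independent centred term leaves only even products: the fourth moment of
  \<open>Y + S\<close> is that of \<open>Y\<close>, plus six times the product of second moments,
  plus that of \<open>S\<close>. The mixed term is why the second moment is carried along in the
  induction.\<close>

lemma (in prob_space) indep_fourth_moment:
  fixes Y :: "'j \<Rightarrow> 'a \<Rightarrow> real"
  assumes "finite J" "indep_vars (\<lambda>_. borel) Y J" "\<And>j. j \<in> J \<Longrightarrow> expectation (Y j) = 0"
    "\<And>j \<omega>. j \<in> J \<Longrightarrow> \<omega> \<in> space M \<Longrightarrow> \<bar>Y j \<omega>\<bar> \<le> L"
  shows "expectation (\<lambda>\<omega>. (\<Sum>j\<in>J. Y j \<omega>)\<^sup>2) \<le> real (card J) * L\<^sup>2 \<and>
    expectation (\<lambda>\<omega>. (\<Sum>j\<in>J. Y j \<omega>) ^ 4) \<le> 3 * (real (card J))\<^sup>2 * L ^ 4"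
  using assms
proof (induction J rule: finite_induct)
  case (insert x J)
  define S where "S \<omega> = (\<Sum>j\<in>J. Y j \<omega>)" for \<omega>
  have rv: "random_variable borel (Y j)" if "j \<in> insert x J" for j
    using insert.prems(1) that by (auto simp: indep_vars_def)
  have mS: "S \<in> borel_measurable M" unfolding S_def[abs_def] using rv by measurable
  have bS: "\<bar>S \<omega>\<bar> \<le> real (card J) * L" if "\<omega> \<in> space M" for \<omega>
    unfolding S_def by (rule order_trans[OF sum_abs sum_bounded_above]) (use insert.prems that in auto)
  have ind: "indep_var borel (Y x) borel S"
    unfolding S_def[abs_def] by (rule indep_vars_sum) (use insert in auto)
  have bx: "\<bar>Y x \<omega>\<bar> \<le> L" if "\<omega> \<in> space M" for \<omega> using insert.prems(3) that by simp
  have pow: "\<bar>z ^ p\<bar> \<le> B ^ p" if "\<bar>z\<bar> \<le> B" for z B :: real and p :: nat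
    using that by (simp add: power_abs power_mono)
  have iS: "integrable M (\<lambda>\<omega>. S \<omega> ^ p)" for p
    using mS by (intro integrable_const_bound[where B = "(real (card J) * L) ^ p"] AE_I2) (auto intro: pow bS)
  have iY: "integrable M (\<lambda>\<omega>. Y x \<omega> ^ p)" for p
    using rv[of x] by (intro integrable_const_bound[where B = "L ^ p"] AE_I2) (auto intro: pow bx)
  have prod: "integrable M (\<lambda>\<omega>. Y x \<omega> ^ p * S \<omega> ^ q)"
    "expectation (\<lambda>\<omega>. Y x \<omega> ^ p * S \<omega> ^ q) = expectation (\<lambda>\<omega>. Y x \<omega> ^ p) * expectation (\<lambda>\<omega>. S \<omega> ^ q)" for p q
  proof -
    have "indep_var borel ((\<lambda>z. z ^ p) \<circ> Y x) borel ((\<lambda>z. z ^ q) \<circ> S)"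
      by (rule indep_var_compose[OF ind]) auto
    then have I: "indep_var borel (\<lambda>\<omega>. Y x \<omega> ^ p) borel (\<lambda>\<omega>. S \<omega> ^ q)" by (simp add: comp_def)
    show "integrable M (\<lambda>\<omega>. Y x \<omega> ^ p * S \<omega> ^ q)"
      by (rule indep_var_integrable[OF I iY iS])
    show "expectation (\<lambda>\<omega>. Y x \<omega> ^ p * S \<omega> ^ q) = expectation (\<lambda>\<omega>. Y x \<omega> ^ p) * expectation (\<lambda>\<omega>. S \<omega> ^ q)"
      by (rule indep_var_lebesgue_integral[OF I iY iS])
  qed
  have Y0: "expectation (Y x) = 0" using insert.prems(2) by simp
  have "integrable M (Y j)" if "j \<in> J" for j
    using rv[of j] insert.prems(3)[of j] that by (intro integrable_const_bound[where B = L] AE_I2) auto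
  then have S0: "expectation S = 0"
    unfolding S_def using insert.prems(2) by simp
  have Yp: "expectation (\<lambda>\<omega>. Y x \<omega> ^ p) \<le> L ^ p" if "even p" for p
  proof -
    have "expectation (\<lambda>\<omega>. Y x \<omega> ^ p) \<le> expectation (\<lambda>\<omega>. L ^ p)"
      by (rule integral_mono) (use iY pow[OF bx, of _ p] in \<open>auto simp: abs_le_iff\<close>)
    then show ?thesis by (simp add: prob_space)
  qed
  have IH: "expectation (\<lambda>\<omega>. (S \<omega>)\<^sup>2) \<le> real (card J) * L\<^sup>2" "expectation (\<lambda>\<omega>. S \<omega> ^ 4) \<le> 3 * (real (card J))\<^sup>2 * L ^ 4"
    using insert.IH insert.prems indep_vars_subset[OF insert.prems(1), of J] by (auto simp: S_def)
  have sumS: "(\<Sum>j\<in>insert x J. Y j \<omega>) = Y x \<omega> + S \<omega>" for \<omega>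
    using insert by (simp add: S_def)
  note prod' = prod[of 1 1, unfolded power_one_right] prod[of 3 1, unfolded power_one_right]
    prod[of 2 2] prod[of 1 3, unfolded power_one_right]
  have e2: "(Y x \<omega> + S \<omega>)\<^sup>2 = Y x \<omega> ^ 2 + (2 * (Y x \<omega> * S \<omega>) + S \<omega> ^ 2)" for \<omega>
    by (simp add: power2_sum)
  have e4: "(Y x \<omega> + S \<omega>) ^ 4 = Y x \<omega> ^ 4 + (4 * (Y x \<omega> ^ 3 * S \<omega>) + (6 * (Y x \<omega> ^ 2 * S \<omega> ^ 2) + (4 * (Y x \<omega> * S \<omega> ^ 3) + S \<omega> ^ 4)))" for \<omega>
    by (simp add: power_numeral_reduce algebra_simps)
  have E2: "expectation (\<lambda>\<omega>. (Y x \<omega> + S \<omega>)\<^sup>2) = expectation (\<lambda>\<omega>. Y x \<omega> ^ 2) + expectation (\<lambda>\<omega>. S \<omega> ^ 2)"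
    unfolding e2 using iY[of 2] iS[of 2] prod' Y0 by simp
  have E4: "expectation (\<lambda>\<omega>. (Y x \<omega> + S \<omega>) ^ 4) = expectation (\<lambda>\<omega>. Y x \<omega> ^ 4)
      + 6 * (expectation (\<lambda>\<omega>. Y x \<omega> ^ 2) * expectation (\<lambda>\<omega>. S \<omega> ^ 2)) + expectation (\<lambda>\<omega>. S \<omega> ^ 4)"
    unfolding e4 using iY[of 4] iS[of 4] prod' Y0 S0 by simp
  have c: "card (insert x J) = Suc (card J)" using insert by simp
  have "expectation (\<lambda>\<omega>. Y x \<omega> ^ 2) * expectation (\<lambda>\<omega>. S \<omega> ^ 2) \<le> L ^ 2 * (real (card J) * L\<^sup>2)"
    using Yp[of 2] IH(1) by (intro mult_mono) auto
  then have "expectation (\<lambda>\<omega>. (Y x \<omega> + S \<omega>) ^ 4) \<le> L ^ 4 + 6 * (L ^ 2 * (real (card J) * L\<^sup>2)) + 3 * (real (card J))\<^sup>2 * L ^ 4"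
    unfolding E4 using Yp[of 4] IH(2) by simp
  also have "\<dots> = (1 + 6 * real (card J) + 3 * (real (card J))\<^sup>2) * L ^ 4"
    by (simp add: algebra_simps power4_eq_xxxx power2_eq_square)
  \<comment> \<open>With \<open>c\<close> the cardinality,
    \<open>1 + 6 * c + 3 * c\<^sup>2 \<le> 3 * (c + 1)\<^sup>2\<close>.\<close>
  also have "\<dots> \<le> 3 * (real (Suc (card J)))\<^sup>2 * L ^ 4"
    by (intro mult_right_mono) (auto simp: power2_eq_square algebra_simps)
  finally show ?case
    unfolding sumS E2 c using Yp[of 2] IH(1) by (simp add: algebra_simps)
qed simp

text \<open>The target is the \<open>k\<close>-th power of \<open>exp (- s / (2 * k))\<close>, and
  products of numbers in the unit disc differ by at most the sum of the factorwise differences. The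
  three terms are the Taylor remainder, the mismatch of variances and the second-order error of the
  exponential. It serves both the independent long parts and the equal factors of the
  bootstrap.\<close>

lemma prod_char_bound:
  fixes z :: "nat \<Rightarrow> complex"
  assumes z: "\<And>i. i < k \<Longrightarrow> cmod (z i) \<le> 1" and k: "1 \<le> k" and s: "0 \<le> s"
    and R: "\<And>i. i < k \<Longrightarrow> cmod (z i - complex_of_real (1 - q / (2 * real k))) \<le> R"
  shows "cmod ((\<Prod>i<k. z i) - complex_of_real (exp (- s / 2))) \<le> real k * R + \<bar>q - s\<bar> / 2 + s\<^sup>2 / (8 * real k)"
proof -
  define u where "u = s / (2 * real k)"
  have u: "0 \<le> u" using s by (simp add: u_def)
  have "exp (- s / 2) = exp (- u) ^ k"
    using k by (simp add: u_def exp_of_nat_mult[symmetric])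
  then have "complex_of_real (exp (- s / 2)) = (\<Prod>i<k. complex_of_real (exp (- u)))" by simp
  then have "cmod ((\<Prod>i<k. z i) - complex_of_real (exp (- s / 2))) \<le> (\<Sum>i<k. cmod (z i - complex_of_real (exp (- u))))"
    using u by (simp only:) (rule norm_prod_diff, use z u in auto)
  also have "\<dots> \<le> (\<Sum>i<k. R + \<bar>q - s\<bar> / (2 * real k) + u\<^sup>2 / 2)"
  proof (rule sum_mono)
    fix i assume i: "i \<in> {..<k}"
    have "\<bar>exp (- u) - (1 - u)\<bar> \<le> u\<^sup>2 / 2"
    proof -
      have "1 - u \<le> exp (- u)" using exp_ge_add_one_self[of "- u"] by simp
      \<comment> \<open>The third-order Maclaurin remainder at a nonpositive argument is
        nonpositive.\<close>
      moreover have "exp (- u) \<le> 1 - u + u\<^sup>2 / 2"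
      proof -
        have "\<exists>t. \<bar>t\<bar> \<le> \<bar>- u\<bar> \<and> exp (- u) = (\<Sum>m<3. (- u) ^ m / fact m) + exp t / fact 3 * (- u) ^ 3"
          using Maclaurin_exp_le[of "- u" 3] by blast
        then obtain t where "exp (- u) = (\<Sum>m<3. (- u) ^ m / fact m) + exp t / fact 3 * (- u) ^ 3" by blast
        moreover have "exp t / fact 3 * (- u) ^ 3 \<le> 0" using u by (intro mult_nonneg_nonpos) (auto simp: power_numeral_reduce)
        ultimately show ?thesis by (simp add: eval_nat_numeral)
      qed
      ultimately show ?thesis by linarith
    qed
    then have A: "cmod (complex_of_real (1 - u) - complex_of_real (exp (- u))) \<le> u\<^sup>2 / 2"
      unfolding of_real_diff[symmetric] norm_of_real by (simp add: abs_minus_commute)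
    have "(1 - q / (2 * real k)) - (1 - u) = - (q - s) / (2 * real k)"
      using k by (simp add: u_def field_simps)
    then have B: "cmod (complex_of_real (1 - q / (2 * real k)) - complex_of_real (1 - u)) = \<bar>q - s\<bar> / (2 * real k)"
      unfolding of_real_diff[symmetric] norm_of_real by (simp add: abs_divide abs_minus_commute)
    have "z i - complex_of_real (exp (- u)) = (z i - complex_of_real (1 - q / (2 * real k))) +
       (complex_of_real (1 - q / (2 * real k)) - complex_of_real (1 - u)) + (complex_of_real (1 - u) - complex_of_real (exp (- u)))" by simp
    also have "cmod \<dots> \<le> R + \<bar>q - s\<bar> / (2 * real k) + u\<^sup>2 / 2"
      by (intro order_trans[OF norm_triangle_ineq] add_mono R A eq_refl[OF B]) (use i in auto)
    finally show "cmod (z i - complex_of_real (exp (- u))) \<le> R + \<bar>q - s\<bar> / (2 * real k) + u\<^sup>2 / 2" .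
  qed
  also have "\<dots> = real k * R + \<bar>q - s\<bar> / 2 + s\<^sup>2 / (8 * real k)"
    using k by (simp add: u_def field_simps power2_eq_square)
  finally show ?thesis .
qed

lemma iexp_taylor2:
  "cmod (iexp x - (1 + \<i> * complex_of_real x - complex_of_real (x\<^sup>2 / 2))) \<le> min (x\<^sup>2) (\<bar>x\<bar> ^ 3 / 6)"
proof -
  have "(\<Sum>k\<le>2. (\<i> * complex_of_real x) ^ k / fact k) = 1 + \<i> * complex_of_real x - complex_of_real (x\<^sup>2 / 2)"
    by (simp add: eval_nat_numeral mult_ac)
  then show ?thesis using iexp_approx1[of x 2] iexp_approx2[of x 2] by (simp add: fact_numeral)
qed

text \<open>Finite dependence is expressed through the index sets \<open>S\<close> rather than
  through independence itself, so that sums over blocks inherit it. Stationarity appears as shift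
  invariance of covariances, the form in which block variances use it.\<close>

locale mdep = innovations M Z for M :: "'w measure" and Z :: "'i \<Rightarrow> 'w \<Rightarrow> 'b::{second_countable_topology, banach}" +
  fixes y :: "int \<Rightarrow> 'w \<Rightarrow> real" and S :: "int \<Rightarrow> 'i set" and m :: nat and L :: real
  assumes y_gen: "\<And>t. y t \<in> borel_measurable (gen (S t))"
    and S_disj: "\<And>s t. s + int m \<le> t \<Longrightarrow> S s \<inter> S t = {}"
    and m_pos: "1 \<le> m"
    and y_bound: "\<And>t \<omega>. \<omega> \<in> space M \<Longrightarrow> \<bar>y t \<omega>\<bar> \<le> L"
    and y_mean: "\<And>t. expectation (y t) = 0"
    and y_cov: "\<And>s t r. expectation (\<lambda>\<omega>. y (s + r) \<omega> * y (t + r) \<omega>) = expectation (\<lambda>\<omega>. y s \<omega> * y t \<omega>)"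
begin

lemma y_measurable [measurable]: "y t \<in> borel_measurable M"
  by (rule gen_M[OF y_gen])

lemma y_sqint: "sqint M (y t)"
  by (rule sqint_bounded[where L = L]) (auto simp: y_bound)

lemma bsum_measurable [measurable]: "bsum y t b \<in> borel_measurable M"
  unfolding bsum_def[abs_def] by measurable

lemma bsum_gen: "bsum y t b \<in> borel_measurable (gen (\<Union>j<b. S (t + int j)))"
  unfolding bsum_def[abs_def]
  by (intro borel_measurable_sum gen_mono[OF _ y_gen]) auto

text \<open>The last time of the first block is \<open>t + a - 1\<close>, whence the
  \<open>s + 1\<close> on the right.\<close>

lemma blocks_disjoint:
  assumes "t + int a + int m \<le> s + 1"
  shows "(\<Union>j<a. S (t + int j)) \<inter> (\<Union>j<b. S (s + int j)) = {}"
proof -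
  have "S (t + int i) \<inter> S (s + int j) = {}" if "i < a" for i j
    using assms that by (intro S_disj) auto
  then show ?thesis by blast
qed

lemma bsum_indep:
  assumes "t + int a + int m \<le> s + 1"
  shows "indep_var borel (bsum y t a) borel (bsum y s b)"
  by (rule gen_indep_var[OF blocks_disjoint[OF assms] bsum_gen bsum_gen])

lemma bsum_bound: "\<omega> \<in> space M \<Longrightarrow> \<bar>bsum y t b \<omega>\<bar> \<le> real b * L"
  unfolding bsum_def using sum_bounded_above[of "{..<b}" "\<lambda>j. \<bar>y (t + int j) \<omega>\<bar>" L]
  by (intro order_trans[OF sum_abs]) (auto simp: y_bound)

lemma bsum_sqint: "sqint M (bsum y t b)"
  by (rule sqint_bounded[where L = "real b * L"]) (auto simp: bsum_bound)

lemma bsum_mean: "expectation (bsum y t b) = 0"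
  unfolding bsum_def[abs_def] by (simp add: sqint_integrable[OF y_sqint] y_mean)

lemma y_orth: "s + int m \<le> t \<Longrightarrow> expectation (\<lambda>\<omega>. y s \<omega> * y t \<omega>) = 0"
  using expectation_inner_indep[OF y_sqint y_sqint gen_indep_var[OF S_disj y_gen y_gen] y_mean] by simp

lemma bsum_second_moment: "expectation (\<lambda>\<omega>. (bsum y t b \<omega>)\<^sup>2) \<le> 2 * real m * real b * L\<^sup>2"
proof -
  have "expectation (\<lambda>\<omega>. (norm (\<Sum>j<b. y (t + int j) \<omega>))\<^sup>2) \<le> 2 * real m * real b * L\<^sup>2"
  proof (rule second_moment_sum_le[OF y_sqint])
    fix j
    have "expectation (\<lambda>\<omega>. (norm (y (t + int j) \<omega>))\<^sup>2) \<le> expectation (\<lambda>\<omega>. L\<^sup>2)"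
      using y_sqint y_bound by (intro integral_mono) (auto simp: sqint_def abs_le_square_iff[symmetric] intro: power2_mono order_trans[OF _ abs_ge_self])
    then show "expectation (\<lambda>\<omega>. (norm (y (t + int j) \<omega>))\<^sup>2) \<le> L\<^sup>2" by (simp add: prob_space)
  qed (simp add: y_orth)
  then show ?thesis by (simp add: bsum_def)
qed

text \<open>Indices in one residue class modulo \<open>m\<close> are at least \<open>m\<close>
  apart, so their terms are independent. Each of the \<open>m\<close> class sums obeys the bound for
  independent terms, and the power-mean inequality joins them at a cost of
  \<open>m ^ 3\<close>.\<close>

lemma bsum_fourth_moment: "expectation (\<lambda>\<omega>. (bsum y t b \<omega>) ^ 4) \<le> 3 * real m ^ 4 * L ^ 4 * (real b)\<^sup>2"
proof -
  define J where "J r = {j \<in> {..<b}. j mod m = r}" for r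
  define T where "T r \<omega> = (\<Sum>j\<in>J r. y (t + int j) \<omega>)" for r \<omega>
  have split: "bsum y t b \<omega> = (\<Sum>r<m. T r \<omega>)" for \<omega>
    unfolding bsum_def T_def J_def
    by (rule sum.group[symmetric]) (use m_pos in auto)
  have mT[measurable]: "T r \<in> borel_measurable M" for r unfolding T_def[abs_def] by measurable
  have one: "expectation (\<lambda>\<omega>. T r \<omega> ^ 4) \<le> 3 * (real b)\<^sup>2 * L ^ 4" for r
  proof -
    have "indep_vars (\<lambda>_. borel) (\<lambda>j. y (t + int j)) (J r)"
    proof (rule gen_indep_vars[where K = "\<lambda>j. S (t + int j)"])
      show "disjoint_family_on (\<lambda>j. S (t + int j)) (J r)"
        unfolding disjoint_family_on_def
      proof (intro ballI impI)
        have far: "S (t + int i) \<inter> S (t + int j) = {}" if ij: "i \<in> J r" "j \<in> J r" "i < j" for i j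
        proof -
          have "i mod m = j mod m" using ij by (simp add: J_def)
          then have "m dvd j - i" using ij(3) by (metis mod_eq_dvd_iff_nat less_imp_le)
          then have "m \<le> j - i" using ij(3) by (auto intro: dvd_imp_le)
          then show ?thesis using ij(3) by (intro S_disj) linarith
        qed
        fix i j assume "i \<in> J r" "j \<in> J r" "i \<noteq> j"
        then show "S (t + int i) \<inter> S (t + int j) = {}"
          using far[of i j] far[of j i] by (cases "i < j") auto
      qed
    qed (rule y_gen)
    then have "expectation (\<lambda>\<omega>. T r \<omega> ^ 4) \<le> 3 * (real (card (J r)))\<^sup>2 * L ^ 4"
      unfolding T_def using indep_fourth_moment[of "J r" "\<lambda>j. y (t + int j)" L] y_mean y_bound
      by (simp add: J_def)
    also have "\<dots> \<le> 3 * (real b)\<^sup>2 * L ^ 4"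
    proof -
      have "card (J r) \<le> card {..<b}" unfolding J_def by (rule card_mono) auto
      then show ?thesis by (intro mult_right_mono mult_left_mono power_mono) auto
    qed
    finally show ?thesis .
  qed
  have iT: "integrable M (\<lambda>\<omega>. T r \<omega> ^ 4)" for r
  proof (rule integrable_const_bound[where B = "(real (card (J r)) * L) ^ 4"])
    have "\<bar>T r \<omega>\<bar> \<le> real (card (J r)) * L" if "\<omega> \<in> space M" for \<omega>
      unfolding T_def by (rule order_trans[OF sum_abs sum_bounded_above]) (use y_bound that in auto)
    then show "AE \<omega> in M. norm (T r \<omega> ^ 4) \<le> (real (card (J r)) * L) ^ 4"
      by (intro AE_I2) (simp add: power_abs power_mono del: power_mult_distrib power_even_abs_numeral)
  qed measurable
  have "expectation (\<lambda>\<omega>. (bsum y t b \<omega>) ^ 4) \<le> expectation (\<lambda>\<omega>. real m ^ 3 * (\<Sum>r<m. T r \<omega> ^ 4))"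
    unfolding split
  proof (rule integral_mono')
    show "(\<Sum>r<m. T r \<omega>) ^ 4 \<le> real m ^ 3 * (\<Sum>r<m. T r \<omega> ^ 4)" for \<omega>
      using sum_power4_le[of "\<lambda>r. T r \<omega>" "{..<m}"] by simp
  qed (auto intro!: iT mult_nonneg_nonneg sum_nonneg)
  also have "\<dots> = real m ^ 3 * (\<Sum>r<m. expectation (\<lambda>\<omega>. T r \<omega> ^ 4))"
    using iT by simp
  also have "\<dots> \<le> real m ^ 3 * (\<Sum>r<m. 3 * (real b)\<^sup>2 * L ^ 4)"
    by (intro mult_left_mono sum_mono one) simp
  also have "\<dots> = 3 * real m ^ 4 * L ^ 4 * (real b)\<^sup>2" by (simp add: power_numeral_reduce)
  finally show ?thesis .
qed

section \<open>Block variances and the long-run variance\<close>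

definition bvar :: "nat \<Rightarrow> real" where
  "bvar b = expectation (\<lambda>\<omega>. (bsum y 0 b \<omega>)\<^sup>2)"

text \<open>The increments of \<open>bvar\<close> are constant from \<open>m\<close> on, so a single
  increment already is the long-run variance, the sum of all autocovariances over positive and
  negative lags.\<close>

definition lrvar :: real where
  "lrvar = bvar (Suc m) - bvar m"

lemma yy_integrable: "integrable M (\<lambda>\<omega>. y s \<omega> * y t \<omega>)"
  using sqint_inner_integrable[OF y_sqint y_sqint, of s t] by simp

lemma bsum_square_expand:
  "expectation (\<lambda>\<omega>. (bsum y t b \<omega>)\<^sup>2) = (\<Sum>i<b. \<Sum>j<b. expectation (\<lambda>\<omega>. y (t + int i) \<omega> * y (t + int j) \<omega>))"
  unfolding bsum_def power2_eq_square sum_product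
  by (subst Bochner_Integration.integral_sum;
      (intro sum.cong refl Bochner_Integration.integral_sum Bochner_Integration.integrable_sum yy_integrable)?)

lemma bsum_bvar: "expectation (\<lambda>\<omega>. (bsum y t b \<omega>)\<^sup>2) = bvar b"
  unfolding bvar_def bsum_square_expand
  using y_cov[of "0 + int i" t "0 + int j" for i j] by (simp add: add.commute)

lemma bvar_Suc: "bvar (Suc b) - bvar b = 2 * (\<Sum>i<b. expectation (\<lambda>\<omega>. y (int i) \<omega> * y (int b) \<omega>)) + expectation (\<lambda>\<omega>. (y 0 \<omega>)\<^sup>2)"
proof -
  have "bvar (Suc b) - bvar b = (\<Sum>i<b. expectation (\<lambda>\<omega>. y (int i) \<omega> * y (int b) \<omega>)) +
     (\<Sum>i<b. expectation (\<lambda>\<omega>. y (int b) \<omega> * y (int i) \<omega>)) + expectation (\<lambda>\<omega>. y (int b) \<omega> * y (int b) \<omega>)"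
    unfolding bvar_def bsum_square_expand by (simp add: sum.distrib)
  also have "expectation (\<lambda>\<omega>. y (int b) \<omega> * y (int b) \<omega>) = expectation (\<lambda>\<omega>. (y 0 \<omega>)\<^sup>2)"
    using y_cov[of 0 "int b" 0] by (simp add: power2_eq_square)
  finally show ?thesis by (simp add: mult.commute)
qed

text \<open>Two successive increments differ by twice the covariance at the new lag
  \<open>Suc b\<close>, which vanishes beyond the range of dependence.\<close>

lemma bvar_increment:
  assumes "m \<le> b"
  shows "bvar (Suc b) - bvar b = lrvar"
  using assms
proof (induction b rule: dec_induct)
  case base show ?case by (simp add: lrvar_def)
next
  case (step b)
  let ?c = "\<lambda>i j. expectation (\<lambda>\<omega>. y (int i) \<omega> * y (int j) \<omega>)"
  have "(\<Sum>i<Suc b. ?c i (Suc b)) = ?c 0 (Suc b) + (\<Sum>i<b. ?c (Suc i) (Suc b))"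
    by (rule sum.lessThan_Suc_shift)
  also have "?c 0 (Suc b) = 0" using step by (intro y_orth) auto
  also have "(\<Sum>i<b. ?c (Suc i) (Suc b)) = (\<Sum>i<b. ?c i b)"
    using y_cov[of "int i" 1 "int b" for i] by (intro sum.cong refl) (simp add: add.commute)
  finally have "(\<Sum>i<Suc b. ?c i (Suc b)) = (\<Sum>i<b. ?c i b)" by simp
  then show ?case using step.IH bvar_Suc[of b] bvar_Suc[of "Suc b"] by simp
qed

lemma bvar_eq: "m \<le> b \<Longrightarrow> bvar b = bvar m + (real b - real m) * lrvar"
proof (induction b rule: dec_induct)
  case (step b)
  then show ?case using bvar_increment[of b] by (simp add: algebra_simps)
qed simp

lemma bvar_tendsto: "(\<lambda>b. bvar b / real b) \<longlonglongrightarrow> lrvar"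
proof (rule Lim_transform_eventually)
  have "(\<lambda>b. (bvar m - real m * lrvar) * (1 / real b) + lrvar) \<longlonglongrightarrow> (bvar m - real m * lrvar) * 0 + lrvar"
    by (intro tendsto_intros lim_1_over_n)
  then show "(\<lambda>b. (bvar m - real m * lrvar) * (1 / real b) + lrvar) \<longlonglongrightarrow> lrvar" by simp
  show "\<forall>\<^sub>F b in sequentially. (bvar m - real m * lrvar) * (1 / real b) + lrvar = bvar b / real b"
    using eventually_ge_at_top[of m] eventually_gt_at_top[of 0]
  proof eventually_elim
    case (elim b)
    then show ?case by (simp add: bvar_eq[OF elim(1)] field_simps)
  qed
qed

lemma bvar_nonneg: "0 \<le> bvar b"
  by (simp add: bvar_def)

lemma lrvar_nonneg: "0 \<le> lrvar"
  by (rule LIMSEQ_le_const[OF bvar_tendsto]) (auto simp: bvar_nonneg)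

end

section \<open>Block statistics of real processes\<close>

definition avg :: "nat \<Rightarrow> (nat \<Rightarrow> 'b::real_vector) \<Rightarrow> 'b" where
  "avg N u = (1 / real N) *\<^sub>R (\<Sum>t<N. u t)"

lemma avg_real: "avg N u = (\<Sum>t<N. u t) / real N" for u :: "nat \<Rightarrow> real"
  by (simp add: avg_def)

lemma avg_add: "avg N (\<lambda>t. u t + v t) = avg N u + avg N v"
  by (simp add: avg_def sum.distrib scaleR_add_right)

lemma avg_diff: "avg N (\<lambda>t. u t - v t) = avg N u - avg N v"
  by (simp add: avg_def sum_subtractf scaleR_diff_right)

lemma avg_cmult: "avg N (\<lambda>t. c * u t) = c * avg N u" for u :: "nat \<Rightarrow> 'a::real_algebra"
  by (simp add: avg_def sum_distrib_left)

lemma avg_const [simp]: "N > 0 \<Longrightarrow> avg N (\<lambda>t. c) = c"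
  by (simp add: avg_def sum_constant_scaleR)

lemma avg_mono: "(\<And>t. t < N \<Longrightarrow> u t \<le> v t) \<Longrightarrow> avg N u \<le> avg N v" for u v :: "nat \<Rightarrow> real"
  unfolding avg_real by (intro divide_right_mono sum_mono) auto

lemma avg_le: "N > 0 \<Longrightarrow> (\<And>t. t < N \<Longrightarrow> u t \<le> c) \<Longrightarrow> avg N u \<le> c" for u :: "nat \<Rightarrow> real"
  using avg_mono[of N u "\<lambda>_. c"] by simp

lemma avg_nonneg: "(\<And>t. t < N \<Longrightarrow> 0 \<le> u t) \<Longrightarrow> 0 \<le> avg N u" for u :: "nat \<Rightarrow> real"
  unfolding avg_real by (intro divide_nonneg_nonneg sum_nonneg) auto

lemma norm_avg_le: "norm (avg N u) \<le> avg N (\<lambda>t. norm (u t))"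
  by (simp add: avg_def divide_right_mono norm_sum)

lemma avg_centered:
  fixes u :: "nat \<Rightarrow> real"
  assumes "N > 0"
  shows "avg N (\<lambda>t. (u t - avg N u)\<^sup>2) = avg N (\<lambda>t. (u t)\<^sup>2) - (avg N u)\<^sup>2"
proof -
  have "avg N (\<lambda>t. (u t - avg N u)\<^sup>2) = avg N (\<lambda>t. ((u t)\<^sup>2 + (avg N u)\<^sup>2) - (2 * avg N u) * u t)"
    by (simp add: power2_diff mult_ac)
  also have "\<dots> = avg N (\<lambda>t. (u t)\<^sup>2) - (avg N u)\<^sup>2"
    using assms unfolding avg_diff avg_add avg_cmult by (simp add: power2_eq_square)
  finally show ?thesis .
qed

lemma avg_centered_le: "N > 0 \<Longrightarrow> avg N (\<lambda>t. (u t - avg N u)\<^sup>2) \<le> avg N (\<lambda>t. (u t)\<^sup>2)" for u :: "nat \<Rightarrow> real"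
  by (simp add: avg_centered)

text \<open>Zero-based: block \<open>t\<close> covers the times \<open>t + 1, ..., t + b\<close>, so
  the \<open>N\<close> overlapping blocks are numbered \<open>0, ..., N - 1\<close>, while
  selections number them from 1.\<close>

definition blk :: "(int \<Rightarrow> 'w \<Rightarrow> 'b::real_normed_vector) \<Rightarrow> nat \<Rightarrow> nat \<Rightarrow> 'w \<Rightarrow> 'b" where
  "blk x b t \<omega> = (1 / sqrt (real b)) *\<^sub>R bsum x (1 + int t) b \<omega>"

text \<open>The centring is the mean over all overlapping blocks, that is the scaled conditional
  mean of the bootstrap and not the sample mean, which gives more weight to the ends of the
  sample.\<close>

definition cblk :: "(int \<Rightarrow> 'w \<Rightarrow> 'b::real_normed_vector) \<Rightarrow> nat \<Rightarrow> nat \<Rightarrow> nat \<Rightarrow> 'w \<Rightarrow> 'b" where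
  "cblk x b N t \<omega> = blk x b t \<omega> - avg N (\<lambda>s. blk x b s \<omega>)"

text \<open>The conditional variance of the scaled bootstrap mean, for a scalar process.\<close>

definition emp_var :: "(int \<Rightarrow> 'w \<Rightarrow> real) \<Rightarrow> nat \<Rightarrow> nat \<Rightarrow> 'w \<Rightarrow> real" where
  "emp_var x b N \<omega> = avg N (\<lambda>t. (cblk x b N t \<omega>)\<^sup>2)"

text \<open>The weighted arithmetic-geometric mean inequality on
  \<open>\<bar>u - v\<bar> * \<bar>u + v\<bar>\<close>. The weight is tuned to a mean square
  \<open>\<eta>\<^sup>2\<close> of \<open>u - v\<close>, which leaves a total error of order
  \<eta>.\<close>

lemma square_diff_le:
  fixes u v \<eta> :: real
  assumes "\<eta> > 0"
  shows "\<bar>u\<^sup>2 - v\<^sup>2\<bar> \<le> (1 / (2 * \<eta>) + \<eta>) * (u - v)\<^sup>2 + 4 * \<eta> * u\<^sup>2"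
proof -
  define p q where "p = \<bar>u - v\<bar>" and "q = \<bar>u + v\<bar>"
  have "0 \<le> (p - \<eta> * q)\<^sup>2" by simp
  then have "2 * \<eta> * (p * q) \<le> p\<^sup>2 + \<eta>\<^sup>2 * q\<^sup>2" by (simp add: power2_diff power_mult_distrib algebra_simps)
  then have A: "p * q \<le> p\<^sup>2 / (2 * \<eta>) + \<eta> / 2 * q\<^sup>2"
    using assms by (simp add: field_simps power2_eq_square)
  have "q\<^sup>2 = (2 * u - (u - v))\<^sup>2" by (simp add: q_def)
  also have "\<dots> \<le> 8 * u\<^sup>2 + 2 * (u - v)\<^sup>2"
    using zero_le_power2[of "2 * u + (u - v)"] by (simp add: power2_eq_square algebra_simps)
  finally have "\<eta> / 2 * q\<^sup>2 \<le> \<eta> / 2 * (8 * u\<^sup>2 + 2 * (u - v)\<^sup>2)"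
    using assms by (intro mult_left_mono) auto
  moreover have "\<bar>u\<^sup>2 - v\<^sup>2\<bar> = p * q"
    by (simp add: p_def q_def power2_eq_square square_diff_square_factored abs_mult mult.commute)
  moreover have "p\<^sup>2 = (u - v)\<^sup>2" by (simp add: p_def)
  ultimately show ?thesis using A by (simp add: algebra_simps)
qed

text \<open>If \<open>w\<close> is at least half as large as \<open>u\<close>, the cube is charged
  to \<open>w\<close>, which will have moments; otherwise the square is charged to
  \<open>u - w\<close>, which will be small. This stands in for a Lindeberg condition on untruncated
  blocks.\<close>

lemma min_square_cube_le:
  fixes u w s :: real
  assumes "0 \<le> s"
  shows "min (u\<^sup>2) (s * \<bar>u\<bar> ^ 3) \<le> 8 * s * \<bar>w\<bar> ^ 3 + 4 * (u - w)\<^sup>2"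
proof (cases "\<bar>u\<bar> \<le> 2 * \<bar>w\<bar>")
  case True
  then have "\<bar>u\<bar> ^ 3 \<le> (2 * \<bar>w\<bar>) ^ 3" by (intro power_mono) auto
  then have "s * \<bar>u\<bar> ^ 3 \<le> s * (2 * \<bar>w\<bar>) ^ 3" using assms by (rule mult_left_mono)
  then have "s * \<bar>u\<bar> ^ 3 \<le> 8 * s * \<bar>w\<bar> ^ 3" by (simp add: power_mult_distrib)
  then show ?thesis by (simp add: min.coboundedI2 add_increasing2)
next
  case False
  then have "\<bar>u\<bar> \<le> 2 * \<bar>u - w\<bar>" using abs_triangle_ineq2[of u w] by (smt (verit))
  then have "\<bar>u\<bar>\<^sup>2 \<le> (2 * \<bar>u - w\<bar>)\<^sup>2" by (rule power_mono) simp
  then have "u\<^sup>2 \<le> 4 * (u - w)\<^sup>2" by (simp add: power_mult_distrib)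
  moreover have "0 \<le> 8 * s * \<bar>w\<bar> ^ 3" using assms by simp
  ultimately show ?thesis by (simp add: min.coboundedI1)
qed

lemma abs_cube_le: "\<bar>w\<bar> ^ 3 \<le> 1 + w ^ 4" for w :: real
proof (cases "\<bar>w\<bar> \<le> 1")
  case True
  then show ?thesis using power_le_one[of "\<bar>w\<bar>" 3] by (simp add: add_increasing2)
next
  case False
  then have "\<bar>w\<bar> ^ 3 \<le> \<bar>w\<bar> ^ 4" by (intro power_increasing) auto
  then show ?thesis by simp
qed

text \<open>A deterministic inequality, applied to every outcome: centring kills the linear Taylor
  term and the quadratic one is the empirical variance. The remainder is kept as a minimum because
  general blocks have only an integrable square.\<close>

lemma avg_char_bound:
  assumes N: "N > 0" and k: "1 \<le> k" and s: "0 \<le> s"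
  shows "cmod (avg N (\<lambda>t. iexp ((u t - avg N u) / sqrt (real k))) ^ k - complex_of_real (exp (- s / 2)))
    \<le> avg N (\<lambda>t. min ((u t - avg N u)\<^sup>2) (1 / (6 * sqrt (real k)) * \<bar>u t - avg N u\<bar> ^ 3))
      + \<bar>avg N (\<lambda>t. (u t - avg N u)\<^sup>2) - s\<bar> / 2 + s\<^sup>2 / (8 * real k)"
proof -
  define c where "c t = u t - avg N u" for t
  define q where "q = avg N (\<lambda>t. (c t)\<^sup>2)"
  define z where "z = avg N (\<lambda>t. iexp (c t / sqrt (real k)))"
  define R where "R = (1 / real k) * avg N (\<lambda>t. min ((c t)\<^sup>2) (1 / (6 * sqrt (real k)) * \<bar>c t\<bar> ^ 3))"
  have c0: "avg N c = 0" unfolding c_def[abs_def] avg_diff using N by simp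
  have sk: "sqrt (real k) > 0" "(sqrt (real k))\<^sup>2 = real k" using k by auto
  have z1: "cmod z \<le> 1"
    unfolding z_def by (rule order_trans[OF norm_avg_le]) (use N in simp)
  have avg_of_real: "avg N (\<lambda>t. complex_of_real (f t)) = complex_of_real (avg N f)" for f
    by (simp add: avg_def scaleR_conv_of_real)
  have "avg N (\<lambda>t. 1 + \<i> * complex_of_real (c t / sqrt (real k)) - complex_of_real ((c t / sqrt (real k))\<^sup>2 / 2)) =
     1 + (\<i> * complex_of_real (1 / sqrt (real k))) * complex_of_real (avg N c) - complex_of_real (avg N (\<lambda>t. 1 / (2 * real k) * (c t)\<^sup>2))"
    unfolding avg_diff avg_add avg_of_real[symmetric] avg_cmult[symmetric] using N sk
    by (simp add: power_divide mult_ac)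
  also have "\<dots> = complex_of_real (1 - q / (2 * real k))"
    unfolding c0 q_def avg_cmult by simp
  finally have eq: "z - complex_of_real (1 - q / (2 * real k)) =
    avg N (\<lambda>t. iexp (c t / sqrt (real k)) - (1 + \<i> * complex_of_real (c t / sqrt (real k)) - complex_of_real ((c t / sqrt (real k))\<^sup>2 / 2)))"
    unfolding z_def avg_diff by simp
  have "cmod (z - complex_of_real (1 - q / (2 * real k))) \<le>
    avg N (\<lambda>t. min ((c t / sqrt (real k))\<^sup>2) (\<bar>c t / sqrt (real k)\<bar> ^ 3 / 6))"
    unfolding eq by (rule order_trans[OF norm_avg_le]) (rule avg_mono, rule iexp_taylor2)
  also have "\<dots> = R"
  proof -
    have "min ((v / sqrt (real k))\<^sup>2) (\<bar>v / sqrt (real k)\<bar> ^ 3 / 6) = (1 / real k) * min (v\<^sup>2) (1 / (6 * sqrt (real k)) * \<bar>v\<bar> ^ 3)" for v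
    proof -
      have "(v / sqrt (real k))\<^sup>2 = (1 / real k) * v\<^sup>2" using sk by (simp add: power_divide)
      moreover have "\<bar>v / sqrt (real k)\<bar> ^ 3 / 6 = (1 / real k) * (1 / (6 * sqrt (real k)) * \<bar>v\<bar> ^ 3)"
      proof -
        have "sqrt (real k) ^ 3 = real k * sqrt (real k)" using sk by (simp add: power3_eq_cube power2_eq_square)
        then show ?thesis by (simp add: power_divide abs_divide)
      qed
      ultimately show ?thesis by (simp only: mult_min_right[of "1 / real k"] zero_le_divide_1_iff of_nat_0_le_iff)
    qed
    then show ?thesis unfolding R_def avg_cmult[symmetric] by simp
  qed
  finally have "cmod (z - complex_of_real (1 - q / (2 * real k))) \<le> R" .
  from prod_char_bound[of k "\<lambda>_. z", OF z1 k s this]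
  have "cmod (z ^ k - complex_of_real (exp (- s / 2))) \<le> real k * R + \<bar>q - s\<bar> / 2 + s\<^sup>2 / (8 * real k)"
    by simp
  then show ?thesis using k unfolding R_def q_def z_def c_def by simp
qed

section \<open>Moments and characteristic functions of blocks\<close>

context mdep
begin

abbreviation C4 :: real where "C4 \<equiv> 3 * real m ^ 4 * L ^ 4"

lemma blk_measurable [measurable]: "blk y b t \<in> borel_measurable M"
  unfolding blk_def[abs_def] by measurable

lemma blk_sqint: "sqint M (blk y b t)"
  unfolding blk_def[abs_def] by (intro sqint_scaleR bsum_sqint)

lemma blk_gen: "blk y b t \<in> borel_measurable (gen (\<Union>j<b. S (1 + int t + int j)))"
  unfolding blk_def[abs_def] using bsum_gen by measurable

lemma blk_second: "expectation (\<lambda>\<omega>. (blk y b t \<omega>)\<^sup>2) = bvar b / real b"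
  by (simp add: blk_def power_divide bsum_bvar)

lemma blk_fourth_integrable: "integrable M (\<lambda>\<omega>. (blk y b t \<omega>) ^ 4)"
proof (rule integrable_const_bound[where B = "(1 / sqrt (real b) * (real b * L)) ^ 4"])
  have "\<bar>blk y b t \<omega>\<bar> \<le> 1 / sqrt (real b) * (real b * L)" if "\<omega> \<in> space M" for \<omega>
    using mult_left_mono[OF bsum_bound[OF that, of "1 + int t" b], of "1 / sqrt (real b)"] by (simp add: blk_def abs_mult)
  then show "AE \<omega> in M. norm (blk y b t \<omega> ^ 4) \<le> (1 / sqrt (real b) * (real b * L)) ^ 4"
    by (intro AE_I2) (simp add: power_abs power_mono del: power_mult_distrib power_even_abs_numeral power_divide)
qed measurable

lemma blk_fourth:
  assumes "1 \<le> b"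
  shows "expectation (\<lambda>\<omega>. (blk y b t \<omega>) ^ 4) \<le> C4"
proof -
  have "sqrt (real b) ^ 4 = (real b)\<^sup>2"
    using power_mult[of "sqrt (real b)" 2 2] by simp
  then have "expectation (\<lambda>\<omega>. (blk y b t \<omega>) ^ 4) = expectation (\<lambda>\<omega>. (bsum y (1 + int t) b \<omega>) ^ 4) / (real b)\<^sup>2"
    by (simp add: blk_def power_divide)
  also have "\<dots> \<le> (C4 * (real b)\<^sup>2) / (real b)\<^sup>2"
    by (intro divide_right_mono bsum_fourth_moment) simp
  finally show ?thesis using assms by simp
qed

lemma blk_indep:
  assumes "s + (b + m) \<le> t"
  shows "indep_var borel (blk y b s) borel (blk y b t)"
  by (rule gen_indep_var[OF blocks_disjoint blk_gen blk_gen]) (use assms in simp)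

lemma blk_mean: "expectation (blk y b t) = 0"
  unfolding blk_def[abs_def] using sqint_integrable[OF bsum_sqint] by (simp add: bsum_mean)

text \<open>Overlapping blocks are independent once their starting points differ by
  \<open>b + m\<close>, so their average has a variance of order \<open>(b + m) / N\<close>.\<close>

lemma avg_blk_second:
  assumes "N > 0"
  shows "expectation (\<lambda>\<omega>. (avg N (\<lambda>t. blk y b t \<omega>))\<^sup>2) \<le> 2 * real (b + m) / real N * (bvar b / real b)"
proof -
  have "expectation (\<lambda>\<omega>. (norm (\<Sum>t<N. blk y b t \<omega>))\<^sup>2) \<le> 2 * real (b + m) * real N * (bvar b / real b)"
  proof (rule second_moment_sum_le[OF blk_sqint])
    show "expectation (\<lambda>\<omega>. blk y b s \<omega> \<bullet> blk y b t \<omega>) = 0" if "s + (b + m) \<le> t" for s t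
      by (rule expectation_inner_indep[OF blk_sqint blk_sqint blk_indep[OF that] blk_mean])
  qed (simp add: blk_second)
  then have "expectation (\<lambda>\<omega>. (\<Sum>t<N. blk y b t \<omega>)\<^sup>2) / (real N)\<^sup>2 \<le> 2 * real (b + m) * real N * (bvar b / real b) / (real N)\<^sup>2"
    by (intro divide_right_mono) auto
  then show ?thesis using assms by (simp add: avg_real power_divide power2_eq_square mult_ac)
qed

text \<open>The same orthogonality for centred squares, whose variances are at most the fourth
  moment of a block. Here the boundedness of the process pays off: \<open>C4\<close> does not
  involve \<open>b\<close>.\<close>

lemma avg_blk_square:
  assumes "N > 0" "1 \<le> b"
  shows "expectation (\<lambda>\<omega>. \<bar>avg N (\<lambda>t. (blk y b t \<omega>)\<^sup>2) - bvar b / real b\<bar>) \<le> sqrt (2 * real (b + m) / real N * C4)"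
proof -
  define v where "v = bvar b / real b"
  define W where "W t \<omega> = (blk y b t \<omega>)\<^sup>2 - v" for t \<omega>
  have i2: "integrable M (\<lambda>\<omega>. (blk y b t \<omega>)\<^sup>2)" for t using blk_sqint[of b t] by (simp add: sqint_def)
  have iW: "integrable M (W t)" for t unfolding W_def[abs_def] using i2 by simp
  have W0: "expectation (W t) = 0" for t
    unfolding W_def[abs_def] using i2 by (simp add: blk_second prob_space v_def)
  have Wsq: "(W t \<omega>)\<^sup>2 = (blk y b t \<omega>) ^ 4 + v\<^sup>2 - 2 * v * (blk y b t \<omega>)\<^sup>2" for t \<omega>
    by (simp add: W_def power2_diff power_mult[symmetric])
  have sW: "sqint M (W t)" for t
    unfolding sqint_def
  proof
    show "integrable M (\<lambda>\<omega>. (norm (W t \<omega>))\<^sup>2)"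
      using i2 blk_fourth_integrable by (simp add: Wsq)
  qed (use iW in simp)
  have W2: "expectation (\<lambda>\<omega>. (norm (W t \<omega>))\<^sup>2) \<le> C4" for t
  proof -
    have "expectation (\<lambda>\<omega>. (norm (W t \<omega>))\<^sup>2) = expectation (\<lambda>\<omega>. (blk y b t \<omega>) ^ 4) + v\<^sup>2 - 2 * v * v"
      using i2 blk_fourth_integrable by (simp add: Wsq prob_space blk_second v_def[symmetric])
    also have "\<dots> = expectation (\<lambda>\<omega>. (blk y b t \<omega>) ^ 4) - v\<^sup>2" by (simp add: power2_eq_square)
    also have "\<dots> \<le> expectation (\<lambda>\<omega>. (blk y b t \<omega>) ^ 4)" by simp
    also have "\<dots> \<le> C4" using assms by (intro blk_fourth) auto
    finally show ?thesis .
  qed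
  have orth: "expectation (\<lambda>\<omega>. W s \<omega> \<bullet> W t \<omega>) = 0" if "s + (b + m) \<le> t" for s t
  proof (rule expectation_inner_indep[OF sW sW _ W0])
    have "indep_var borel ((\<lambda>z. z\<^sup>2 - v) \<circ> blk y b s) borel ((\<lambda>z. z\<^sup>2 - v) \<circ> blk y b t)"
      by (rule indep_var_compose[OF blk_indep[OF that]]) auto
    then show "indep_var borel (W s) borel (W t)" by (simp add: comp_def W_def[abs_def])
  qed
  have S: "expectation (\<lambda>\<omega>. (norm (\<Sum>t<N. W t \<omega>))\<^sup>2) \<le> 2 * real (b + m) * real N * C4"
    by (rule second_moment_sum_le[OF sW W2 orth])
  have A: "avg N (\<lambda>t. (blk y b t \<omega>)\<^sup>2) - v = avg N (\<lambda>t. W t \<omega>)" for \<omega>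
    unfolding W_def avg_diff using assms by simp
  have sA: "sqint M (\<lambda>\<omega>. avg N (\<lambda>t. W t \<omega>))"
    unfolding avg_def by (intro sqint_scaleR sqint_sum sW)
  have "expectation (\<lambda>\<omega>. \<bar>avg N (\<lambda>t. W t \<omega>)\<bar>) \<le> nrm2 M (\<lambda>\<omega>. avg N (\<lambda>t. W t \<omega>))"
    using expectation_norm_le_nrm2[OF sA] by simp
  also have "\<dots> \<le> sqrt (2 * real (b + m) / real N * C4)"
    unfolding nrm2_def
  proof (rule real_sqrt_le_mono)
    have "expectation (\<lambda>\<omega>. (norm (avg N (\<lambda>t. W t \<omega>)))\<^sup>2) = expectation (\<lambda>\<omega>. (norm (\<Sum>t<N. W t \<omega>))\<^sup>2) / (real N)\<^sup>2"
      by (simp add: avg_real power_divide)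
    also have "\<dots> \<le> 2 * real (b + m) * real N * C4 / (real N)\<^sup>2" by (intro divide_right_mono S) simp
    finally show "expectation (\<lambda>\<omega>. (norm (avg N (\<lambda>t. W t \<omega>)))\<^sup>2) \<le> 2 * real (b + m) / real N * C4"
      using assms by (simp add: power2_eq_square)
  qed
  finally show ?thesis unfolding A v_def[symmetric] .
qed

text \<open>The empirical variance is the average of squares minus the squared average; the law of
  large numbers handles the former, and the latter is small in mean.\<close>

lemma emp_var_bound:
  assumes "N > 0" "1 \<le> b"
  shows "expectation (\<lambda>\<omega>. \<bar>emp_var y b N \<omega> - bvar b / real b\<bar>)
    \<le> sqrt (2 * real (b + m) / real N * C4) + 2 * real (b + m) / real N * (bvar b / real b)"
proof -
  have i2: "integrable M (\<lambda>\<omega>. avg N (\<lambda>t. (blk y b t \<omega>)\<^sup>2))"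
    unfolding avg_real using blk_sqint by (auto simp: sqint_def intro!: integrable_divide Bochner_Integration.integrable_sum)
  have sA: "sqint M (\<lambda>\<omega>. avg N (\<lambda>t. blk y b t \<omega>))"
    unfolding avg_def by (intro sqint_scaleR sqint_sum blk_sqint)
  have ev: "emp_var y b N \<omega> = avg N (\<lambda>t. (blk y b t \<omega>)\<^sup>2) - (avg N (\<lambda>t. blk y b t \<omega>))\<^sup>2" for \<omega>
    unfolding emp_var_def cblk_def using assms by (simp add: avg_centered)
  have "expectation (\<lambda>\<omega>. \<bar>emp_var y b N \<omega> - bvar b / real b\<bar>) \<le>
    expectation (\<lambda>\<omega>. \<bar>avg N (\<lambda>t. (blk y b t \<omega>)\<^sup>2) - bvar b / real b\<bar> + (avg N (\<lambda>t. blk y b t \<omega>))\<^sup>2)"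
  proof (rule integral_mono')
    show "integrable M (\<lambda>\<omega>. \<bar>avg N (\<lambda>t. (blk y b t \<omega>)\<^sup>2) - bvar b / real b\<bar> + (avg N (\<lambda>t. blk y b t \<omega>))\<^sup>2)"
      using i2 sA by (simp add: sqint_def)
    show "\<bar>emp_var y b N \<omega> - bvar b / real b\<bar> \<le> \<bar>avg N (\<lambda>t. (blk y b t \<omega>)\<^sup>2) - bvar b / real b\<bar> + (avg N (\<lambda>t. blk y b t \<omega>))\<^sup>2" for \<omega>
      unfolding ev using zero_le_power2[of "avg N (\<lambda>t. blk y b t \<omega>)"] by linarith
  qed auto
  also have "\<dots> = expectation (\<lambda>\<omega>. \<bar>avg N (\<lambda>t. (blk y b t \<omega>)\<^sup>2) - bvar b / real b\<bar>) + expectation (\<lambda>\<omega>. (avg N (\<lambda>t. blk y b t \<omega>))\<^sup>2)"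
    using i2 sA by (simp add: sqint_def)
  also have "\<dots> \<le> sqrt (2 * real (b + m) / real N * C4) + 2 * real (b + m) / real N * (bvar b / real b)"
    using assms by (intro add_mono avg_blk_square avg_blk_second)
  finally show ?thesis .
qed

text \<open>Each block of length \<open>b\<close> is split into a long part and a gap of length \<open>m\<close>; the long parts are
  independent and the gaps are negligible.\<close>

lemma char_bsum_bound:
  assumes b: "2 * m \<le> b" and k: "1 \<le> k" and s: "0 \<le> s"
  shows "cmod ((CLINT \<omega>|M. iexp (bsum y t (k * b) \<omega> / sqrt (real (k * b)))) - complex_of_real (exp (- s / 2)))
    \<le> (1 + C4) / (6 * sqrt (real k)) + \<bar>bvar (b - m) / real b - s\<bar> / 2 + s\<^sup>2 / (8 * real k) + sqrt (4 * (real m)\<^sup>2 * L\<^sup>2 / real b)"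
proof -
  have b1: "1 \<le> b" and mb: "m \<le> b" using b m_pos by auto
  define n where "n = k * b"
  have n: "real n = real k * real b" "n > 0" using k b1 by (auto simp: n_def)
  define big where "big i = bsum y (t + int (i * b)) (b - m)" for i
  define small where "small i = bsum y (t + int (i * b) + int (b - m)) m" for i
  have dec: "bsum y t n \<omega> = (\<Sum>i<k. big i \<omega>) + (\<Sum>i<k. small i \<omega>)" for \<omega>
  proof -
    have "bsum y (t + int (i * b)) b \<omega> = big i \<omega> + small i \<omega>" for i
      unfolding big_def small_def bsum_add[symmetric] using mb by simp
    then show ?thesis unfolding n_def bsum_mult by (simp add: sum.distrib)
  qed
  have [measurable]: "big i \<in> borel_measurable M" "small i \<in> borel_measurable M" for i
    unfolding big_def small_def by measurable
  define R where "R = expectation (\<lambda>\<omega>. (\<Sum>i<k. small i \<omega>)\<^sup>2)"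
  \<comment> \<open>Distinct gaps are orthogonal, hence range 1 in the second-moment bound. One gap
    has variance at most \<open>2 * m * m * L\<^sup>2\<close>, which after summation and division by
    \<open>k * b\<close> leaves an error of order \<open>1 / b\<close>.\<close>
  have R: "R \<le> 2 * 1 * real k * (2 * real m * real m * L\<^sup>2)"
  proof -
    have "expectation (\<lambda>\<omega>. (norm (\<Sum>i<k. small i \<omega>))\<^sup>2) \<le> 2 * real 1 * real k * (2 * real m * real m * L\<^sup>2)"
    proof (rule second_moment_sum_le)
      show "expectation (\<lambda>\<omega>. small i \<omega> \<bullet> small j \<omega>) = 0" if "i + 1 \<le> j" for i j
      proof (rule expectation_inner_indep)
        have "(i + 1) * b \<le> j * b" using that by (rule mult_right_mono) simp
        then have "int ((i + 1) * b) \<le> int (j * b)" by (simp only: of_nat_le_iff)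
          then have "int (i * b) + int b \<le> int (j * b)" by (simp add: algebra_simps)
        \<comment> \<open>Between two gaps lies a long part of length \<open>b - m\<close>, which is
          at least \<open>m\<close> because \<open>2 * m \<le> b\<close>.\<close>
        then show "indep_var borel (small i) borel (small j)"
          unfolding small_def using b mb by (intro bsum_indep) (simp add: of_nat_diff)
      qed (auto simp: small_def bsum_sqint bsum_mean)
    qed (use bsum_second_moment in \<open>auto simp: small_def bsum_sqint\<close>)
    then show ?thesis by (simp add: R_def)
  qed
  have ssm: "sqint M (\<lambda>\<omega>. (\<Sum>i<k. small i \<omega>) / sqrt (real n))"
    by (intro sqint_divide sqint_sum) (simp add: small_def bsum_sqint)
  have diff: "cmod ((CLINT \<omega>|M. iexp (bsum y t n \<omega> / sqrt (real n))) - (CLINT \<omega>|M. iexp ((\<Sum>i<k. big i \<omega>) / sqrt (real n))))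
     \<le> sqrt (4 * (real m)\<^sup>2 * L\<^sup>2 / real b)"
  proof -
    have I1: "integrable M (\<lambda>\<omega>. iexp (bsum y t n \<omega> / sqrt (real n)))"
      by (rule integrable_iexp) auto
    have I2: "integrable M (\<lambda>\<omega>. iexp ((\<Sum>i<k. big i \<omega>) / sqrt (real n)))"
      by (rule integrable_iexp) auto
    have "cmod ((CLINT \<omega>|M. iexp (bsum y t n \<omega> / sqrt (real n))) - (CLINT \<omega>|M. iexp ((\<Sum>i<k. big i \<omega>) / sqrt (real n)))) =
      cmod (CLINT \<omega>|M. iexp (bsum y t n \<omega> / sqrt (real n)) - iexp ((\<Sum>i<k. big i \<omega>) / sqrt (real n)))"
      by (subst Bochner_Integration.integral_diff[OF I1 I2]) (rule refl)
    also have "\<dots> \<le> (\<integral>\<omega>. cmod (iexp (bsum y t n \<omega> / sqrt (real n)) - iexp ((\<Sum>i<k. big i \<omega>) / sqrt (real n))) \<partial>M)"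
      by (rule integral_norm_bound)
    also have "\<dots> \<le> (\<integral>\<omega>. norm ((\<Sum>i<k. small i \<omega>) / sqrt (real n)) \<partial>M)"
    proof (rule integral_mono')
      show "integrable M (\<lambda>\<omega>. norm ((\<Sum>i<k. small i \<omega>) / sqrt (real n)))"
        using sqint_integrable[OF ssm] by (rule integrable_norm)
      fix \<omega>
      have "cmod (iexp u - iexp v) \<le> \<bar>u - v\<bar>" for u v :: real
      proof -
        have "iexp u - iexp v = iexp v * (iexp (u - v) - 1)" by (simp add: exp_diff right_diff_distrib)
        then have "cmod (iexp u - iexp v) = cmod (iexp (u - v) - 1)" by (simp add: norm_mult)
        also have "\<dots> \<le> \<bar>u - v\<bar>" using iexp_approx1[of "u - v" 0] by simp
        finally show ?thesis .
      qed
      from this[of "bsum y t n \<omega> / sqrt (real n)" "(\<Sum>i<k. big i \<omega>) / sqrt (real n)"]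
      show "cmod (iexp (bsum y t n \<omega> / sqrt (real n)) - iexp ((\<Sum>i<k. big i \<omega>) / sqrt (real n))) \<le> norm ((\<Sum>i<k. small i \<omega>) / sqrt (real n))"
        unfolding dec by (simp add: add_divide_distrib del: of_real_divide)
    qed auto
    also have "\<dots> \<le> nrm2 M (\<lambda>\<omega>. (\<Sum>i<k. small i \<omega>) / sqrt (real n))"
      by (rule expectation_norm_le_nrm2[OF ssm])
    also have "\<dots> = sqrt (R / real n)" by (simp add: nrm2_def R_def power_divide)
    also have "\<dots> \<le> sqrt (4 * (real m)\<^sup>2 * L\<^sup>2 / real b)"
    proof (rule real_sqrt_le_mono)
      have "R / real n \<le> (2 * 1 * real k * (2 * real m * real m * L\<^sup>2)) / real n" using R by (rule divide_right_mono) simp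
      also have "\<dots> = 4 * (real m)\<^sup>2 * L\<^sup>2 / real b" using k b1 by (simp add: n power2_eq_square)
      finally show "R / real n \<le> 4 * (real m)\<^sup>2 * L\<^sup>2 / real b" .
    qed
    finally show ?thesis .
  qed
  define z where "z i = (CLINT \<omega>|M. iexp (big i \<omega> / sqrt (real n)))" for i
  have "(CLINT \<omega>|M. iexp ((\<Sum>i<k. big i \<omega>) / sqrt (real n))) = (CLINT \<omega>|M. (\<Prod>i<k. iexp (big i \<omega> / sqrt (real n))))"
    by (simp add: exp_sum[symmetric] sum_divide_distrib sum_distrib_left)
  also have "\<dots> = (\<Prod>i<k. z i)"
    unfolding z_def
  proof (rule indep_vars_lebesgue_integral)
    have "indep_vars (\<lambda>_. borel) big {..<k}"
    proof (rule gen_indep_vars[where K = "\<lambda>i. \<Union>j<b - m. S (t + int (i * b) + int j)"])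
      show "disjoint_family_on (\<lambda>i. \<Union>j<b - m. S (t + int (i * b) + int j)) {..<k}"
        unfolding disjoint_family_on_def
      proof (intro ballI impI)
        have far: "(\<Union>l<b - m. S (t + int (i * b) + int l)) \<inter> (\<Union>l<b - m. S (t + int (j * b) + int l)) = {}" if "i < j" for i j
        proof (rule blocks_disjoint)
          have "(i + 1) * b \<le> j * b" using that by (intro mult_right_mono) auto
          then have "int ((i + 1) * b) \<le> int (j * b)" by (simp only: of_nat_le_iff)
          then have "int (i * b) + int b \<le> int (j * b)" by (simp add: algebra_simps)
          then show "t + int (i * b) + int (b - m) + int m \<le> t + int (j * b) + 1" using mb by (simp add: of_nat_diff)
        qed
        fix i j :: nat assume "i \<noteq> j"
        then show "(\<Union>l<b - m. S (t + int (i * b) + int l)) \<inter> (\<Union>l<b - m. S (t + int (j * b) + int l)) = {}"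
          using far[of i j] far[of j i] by (cases "i < j") (simp_all add: Int_commute)
      qed
    qed (simp add: big_def bsum_gen)
    from indep_vars_compose2[OF this, of "\<lambda>_ v. iexp (v / sqrt (real n))"]
    show "indep_vars (\<lambda>_. borel) (\<lambda>i \<omega>. iexp (big i \<omega> / sqrt (real n))) {..<k}" by simp
    show "integrable M (\<lambda>\<omega>. iexp (big i \<omega> / sqrt (real n)))" for i
      by (rule integrable_iexp) auto
  qed simp
  finally have prod: "(CLINT \<omega>|M. iexp ((\<Sum>i<k. big i \<omega>) / sqrt (real n))) = (\<Prod>i<k. z i)" .
  \<comment> \<open>Normalised by \<open>b\<close> although the long part has length
    \<open>b - m\<close>; the discrepancy disappears as \<open>b\<close> grows.\<close>
  define q where "q = bvar (b - m) / real b"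
  have z1: "cmod (z i) \<le> 1" for i
    unfolding z_def by (rule order_trans[OF integral_norm_bound]) (simp add: prob_space)
  have zR: "cmod (z i - complex_of_real (1 - q / (2 * real k))) \<le> (1 + C4) / (6 * sqrt (real k) ^ 3)" for i
  proof -
    define v where "v \<omega> = big i \<omega> / sqrt (real b)" for \<omega>
    have [measurable]: "v \<in> borel_measurable M" unfolding v_def[abs_def] by measurable
    have vb: "\<bar>v \<omega>\<bar> \<le> real (b - m) * L / sqrt (real b)" if "\<omega> \<in> space M" for \<omega>
      unfolding v_def big_def using divide_right_mono[OF bsum_bound[OF that]] by (simp add: abs_divide)
    have iv: "integrable M (\<lambda>\<omega>. v \<omega> ^ p)" for p
      by (rule integrable_const_bound[where B = "(real (b - m) * L / sqrt (real b)) ^ p"])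
        (auto intro!: AE_I2 power_mono vb simp: power_abs simp del: power_divide power_mult_distrib)
    have iv3: "integrable M (\<lambda>\<omega>. \<bar>v \<omega>\<bar> ^ 3)" using integrable_abs[OF iv[of 3]] by (simp add: power_abs)
    have v0: "expectation v = 0" unfolding v_def[abs_def] big_def by (simp add: bsum_mean)
    have v2: "expectation (\<lambda>\<omega>. (v \<omega>)\<^sup>2) = q" using b1 by (simp add: v_def big_def power_divide bsum_bvar q_def)
    have v4: "expectation (\<lambda>\<omega>. v \<omega> ^ 4) \<le> C4"
    proof -
      have "sqrt (real b) ^ 4 = (real b)\<^sup>2" using power_mult[of "sqrt (real b)" 2 2] by simp
      then have "expectation (\<lambda>\<omega>. v \<omega> ^ 4) = expectation (\<lambda>\<omega>. (big i \<omega>) ^ 4) / (real b)\<^sup>2"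
        by (simp add: v_def power_divide)
      also have "\<dots> \<le> (C4 * (real (b - m))\<^sup>2) / (real b)\<^sup>2"
        unfolding big_def by (intro divide_right_mono bsum_fourth_moment) simp
      also have "\<dots> \<le> (C4 * (real b)\<^sup>2) / (real b)\<^sup>2"
        by (intro divide_right_mono mult_left_mono power_mono) auto
      finally show ?thesis using b1 by simp
    qed
    have "expectation (\<lambda>\<omega>. \<bar>v \<omega>\<bar> ^ 3) \<le> expectation (\<lambda>\<omega>. 1 + v \<omega> ^ 4)"
      by (rule integral_mono) (use iv3 iv[of 4] abs_cube_le in auto)
    also have "\<dots> \<le> 1 + C4" using v4 iv[of 4] by (simp add: prob_space)
    finally have v3: "expectation (\<lambda>\<omega>. \<bar>v \<omega>\<bar> ^ 3) \<le> 1 + C4" .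
    have vk: "big i \<omega> / sqrt (real n) = v \<omega> / sqrt (real k)" for \<omega>
      by (simp add: v_def n real_sqrt_mult mult.commute)
    let ?T = "\<lambda>\<omega>. 1 + \<i> * complex_of_real (v \<omega> / sqrt (real k)) - complex_of_real ((v \<omega> / sqrt (real k))\<^sup>2 / 2)"
    have i1: "integrable M (\<lambda>\<omega>. v \<omega> / sqrt (real k))" using iv[of 1] by simp
    have i2: "integrable M (\<lambda>\<omega>. (v \<omega> / sqrt (real k))\<^sup>2 / 2)" using iv[of 2] by (simp add: power_divide)
    have j1: "integrable M (\<lambda>\<omega>. \<i> * complex_of_real (v \<omega> / sqrt (real k)))"
      by (intro integrable_mult_right integrable_of_real i1)
    have j2: "integrable M (\<lambda>\<omega>. complex_of_real ((v \<omega> / sqrt (real k))\<^sup>2 / 2))"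
      by (intro integrable_of_real i2)
    have j3: "integrable M (\<lambda>\<omega>. 1 + \<i> * complex_of_real (v \<omega> / sqrt (real k)))"
      by (intro Bochner_Integration.integrable_add j1) simp
    have iT: "integrable M ?T" by (intro Bochner_Integration.integrable_diff j2 j3)
    have e1: "(CLINT \<omega>|M. \<i> * complex_of_real (v \<omega> / sqrt (real k))) = \<i> * complex_of_real (expectation v / sqrt (real k))"
      by (simp del: of_real_divide)
    have e2: "(CLINT \<omega>|M. complex_of_real ((v \<omega> / sqrt (real k))\<^sup>2 / 2)) = complex_of_real (expectation (\<lambda>\<omega>. (v \<omega>)\<^sup>2) / real k / 2)"
      unfolding integral_complex_of_real by (simp add: power_divide)
    have "(CLINT \<omega>|M. ?T \<omega>) = 1 + \<i> * complex_of_real (expectation v / sqrt (real k)) - complex_of_real (expectation (\<lambda>\<omega>. (v \<omega>)\<^sup>2) / real k / 2)"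
      unfolding Bochner_Integration.integral_diff[OF j3 j2] e2
      by (subst Bochner_Integration.integral_add[OF _ j1]) (simp_all add: e1 prob_space del: of_real_divide)
    also have "\<dots> = complex_of_real (1 - q / (2 * real k))" by (simp add: v0 v2 mult.commute)
    finally have T: "(CLINT \<omega>|M. ?T \<omega>) = complex_of_real (1 - q / (2 * real k))" .
    have "cmod (z i - complex_of_real (1 - q / (2 * real k))) = cmod (CLINT \<omega>|M. iexp (v \<omega> / sqrt (real k)) - ?T \<omega>)"
      unfolding z_def vk T[symmetric]
      by (subst Bochner_Integration.integral_diff[OF _ iT]) (rule integrable_iexp, auto)
    also have "\<dots> \<le> (\<integral>\<omega>. cmod (iexp (v \<omega> / sqrt (real k)) - ?T \<omega>) \<partial>M)" by (rule integral_norm_bound)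
    also have "\<dots> \<le> (\<integral>\<omega>. \<bar>v \<omega>\<bar> ^ 3 / (6 * sqrt (real k) ^ 3) \<partial>M)"
    proof (rule integral_mono')
      show "integrable M (\<lambda>\<omega>. \<bar>v \<omega>\<bar> ^ 3 / (6 * sqrt (real k) ^ 3))" using iv3 by simp
      fix \<omega>
      have "cmod (iexp (v \<omega> / sqrt (real k)) - ?T \<omega>) \<le> \<bar>v \<omega> / sqrt (real k)\<bar> ^ 3 / 6"
        using iexp_taylor2[of "v \<omega> / sqrt (real k)"] by simp
      then show "cmod (iexp (v \<omega> / sqrt (real k)) - ?T \<omega>) \<le> \<bar>v \<omega>\<bar> ^ 3 / (6 * sqrt (real k) ^ 3)"
        by (simp add: abs_divide power_divide mult.commute)
    qed auto
    also have "\<dots> = expectation (\<lambda>\<omega>. \<bar>v \<omega>\<bar> ^ 3) / (6 * sqrt (real k) ^ 3)" by simp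
    also have "\<dots> \<le> (1 + C4) / (6 * sqrt (real k) ^ 3)" using v3 by (intro divide_right_mono) auto
    finally show ?thesis .
  qed
  have "cmod ((\<Prod>i<k. z i) - complex_of_real (exp (- s / 2))) \<le> real k * ((1 + C4) / (6 * sqrt (real k) ^ 3)) + \<bar>q - s\<bar> / 2 + s\<^sup>2 / (8 * real k)"
    by (rule prod_char_bound[OF z1 k s zR])
  also have "real k * ((1 + C4) / (6 * sqrt (real k) ^ 3)) = (1 + C4) / (6 * sqrt (real k))"
  proof -
    have "sqrt (real k) ^ 3 = real k * sqrt (real k)" by (simp add: power3_eq_cube)
    then show ?thesis using k by simp
  qed
  finally show ?thesis
    using diff norm_triangle_ineq[of "(CLINT \<omega>|M. iexp (bsum y t n \<omega> / sqrt (real n))) - (\<Prod>i<k. z i)" "(\<Prod>i<k. z i) - complex_of_real (exp (- s / 2))"]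
    unfolding prod unfolding q_def n_def diff_add_cancel add_diff_eq by linarith
qed

end

section \<open>Processes approximable by finitely dependent ones\<close>

text \<open>The double limit in usable form: at level \<eta> the error is a null sequence plus
  \<open>\<eta> * D\<close>, with the same \<open>D\<close> at all levels. The restriction
  \<open>\<eta> \<le> 1\<close> absorbs higher powers of \<eta>.\<close>

lemma tendsto_zero_approx:
  fixes f :: "nat \<Rightarrow> real"
  assumes ap: "\<And>\<eta>. 0 < \<eta> \<Longrightarrow> \<eta> \<le> 1 \<Longrightarrow> \<exists>g. g \<longlonglongrightarrow> 0 \<and> (\<forall>\<^sub>F j in sequentially. f j \<le> g j + \<eta> * D)"
    and nonneg: "\<And>j. 0 \<le> f j"
  shows "f \<longlonglongrightarrow> 0"
proof (rule order_tendstoI)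
  fix r :: real assume r: "0 < r"
  define \<eta> where "\<eta> = min 1 (r / (2 * (\<bar>D\<bar> + 1)))"
  have \<eta>: "0 < \<eta>" "\<eta> \<le> 1" using r by (auto simp: \<eta>_def)
  have "\<eta> * D \<le> \<eta> * (\<bar>D\<bar> + 1)" using \<eta> by (intro mult_left_mono) auto
  also have "\<dots> \<le> r / (2 * (\<bar>D\<bar> + 1)) * (\<bar>D\<bar> + 1)" by (intro mult_right_mono) (auto simp: \<eta>_def)
  also have "\<dots> = r / 2" by (simp add: field_simps)
  finally have small: "\<eta> * D \<le> r / 2" .
  obtain g where g: "g \<longlonglongrightarrow> 0" "\<forall>\<^sub>F j in sequentially. f j \<le> g j + \<eta> * D" using ap[OF \<eta>] by blast
  have "\<forall>\<^sub>F j in sequentially. g j < r / 2" using g(1) r by (intro order_tendstoD) auto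
  with g(2) show "\<forall>\<^sub>F j in sequentially. f j < r"
    by eventually_elim (use small in linarith)
next
  fix r :: real assume "r < 0"
  then show "\<forall>\<^sub>F j in sequentially. r < f j" using nonneg by (intro always_eventually allI) (rule less_le_trans)
qed

text \<open>Since \<open>b \<ge> 1\<close>, the ratio is at most \<open>(1 + m) / (k - 1)\<close>:
  the number of blocks, not their length, drives the decay.\<close>

lemma block_ratio_tendsto:
  fixes b k :: "nat \<Rightarrow> nat"
  assumes b: "\<And>j. 1 \<le> b j" and k: "filterlim k at_top sequentially"
  shows "(\<lambda>j. real (b j + m) / real ((k j - 1) * b j + 1)) \<longlonglongrightarrow> 0"
proof -
  have "filterlim (\<lambda>j. - 1 + real (k j)) at_top sequentially"
    by (intro filterlim_tendsto_add_at_top[OF tendsto_const] filterlim_compose[OF filterlim_real_sequentially k])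
  then have "(\<lambda>j. (1 + real m) / (- 1 + real (k j))) \<longlonglongrightarrow> 0"
    by (intro tendsto_divide_0[OF tendsto_const] filterlim_at_top_imp_at_infinity)
  then show ?thesis
  proof (rule tendsto_sandwich[OF _ _ tendsto_const, rotated -1])
    have "\<forall>\<^sub>F j in sequentially. 2 \<le> k j" using k by (simp add: filterlim_at_top)
    then show "\<forall>\<^sub>F j in sequentially. real (b j + m) / real ((k j - 1) * b j + 1) \<le> (1 + real m) / (- 1 + real (k j))"
    proof eventually_elim
      case (elim j)
      have "real m \<le> real m * real (b j)" using b[of j] by (simp add: mult_le_cancel_left1)
      then have "real (b j + m) \<le> (1 + real m) * real (b j)" by (simp add: algebra_simps)
      moreover have "(real (k j) - 1) * real (b j) \<le> real ((k j - 1) * b j + 1)" using elim by (simp add: of_nat_diff)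
      moreover have "(real (k j) - 1) * real (b j) > 0" using elim b[of j] by simp
      ultimately have "real (b j + m) / real ((k j - 1) * b j + 1) \<le> ((1 + real m) * real (b j)) / ((real (k j) - 1) * real (b j))"
        by (intro frac_le) auto
      then show ?case using b[of j] by simp
    qed
  qed auto
qed

text \<open>The error is relative to the block length and uniform in its position, so it is at most
  \<epsilon> for normalised sums of every length. The range \<open>m\<close> and the bound
  \<open>L\<close> of the approximating process are free to deteriorate as \<epsilon>
  decreases.\<close>

locale approx_process = innovations M Z for M :: "'w measure" and Z :: "'i \<Rightarrow> 'w \<Rightarrow> 'b::{second_countable_topology, banach}" +
  fixes x :: "int \<Rightarrow> 'w \<Rightarrow> real"
  assumes x_sqint: "\<And>t. sqint M (x t)"
    and approx: "\<And>\<epsilon>. \<epsilon> > 0 \<Longrightarrow> \<exists>y S m L. mdep M Z y S m L \<and>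
      (\<forall>t b. expectation (\<lambda>\<omega>. (bsum x t b \<omega> - bsum y t b \<omega>)\<^sup>2) \<le> \<epsilon> * real b)"
begin

lemma x_bsum_sqint: "sqint M (bsum x t b)"
  unfolding bsum_def[abs_def] by (intro sqint_sum x_sqint)

lemma x_blk_sqint: "sqint M (blk x b t)"
  unfolding blk_def[abs_def] by (intro sqint_scaleR x_bsum_sqint)

lemma sq_integrable: "sqint M f \<Longrightarrow> integrable M (\<lambda>\<omega>. (f \<omega>)\<^sup>2)" for f :: "'w \<Rightarrow> real"
  by (simp add: sqint_def)

text \<open>A single approximation at level 1 is enough, as its own block variances grow linearly by
  finite dependence.\<close>

lemma x_second_bound: "\<exists>C\<ge>0. \<forall>t b. expectation (\<lambda>\<omega>. (bsum x t b \<omega>)\<^sup>2) \<le> C * real b"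
proof -
  obtain y S m L where "mdep M Z y S m L" and
    ap: "\<And>t b. expectation (\<lambda>\<omega>. (bsum x t b \<omega> - bsum y t b \<omega>)\<^sup>2) \<le> 1 * real b"
    using approx[of 1] by auto
  then interpret Y: mdep M Z y S m L by simp
  show ?thesis
  proof (intro exI[of _ "2 + 4 * real m * L\<^sup>2"] conjI allI)
    fix t b
    have s: "sqint M (\<lambda>\<omega>. bsum x t b \<omega> - bsum y t b \<omega>)" by (intro sqint_diff x_bsum_sqint Y.bsum_sqint)
    have "expectation (\<lambda>\<omega>. (bsum x t b \<omega>)\<^sup>2) \<le> expectation (\<lambda>\<omega>. 2 * (bsum x t b \<omega> - bsum y t b \<omega>)\<^sup>2 + 2 * (bsum y t b \<omega>)\<^sup>2)"
    proof (rule integral_mono)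
      fix \<omega>
      show "(bsum x t b \<omega>)\<^sup>2 \<le> 2 * (bsum x t b \<omega> - bsum y t b \<omega>)\<^sup>2 + 2 * (bsum y t b \<omega>)\<^sup>2"
        using zero_le_power2[of "(bsum x t b \<omega> - bsum y t b \<omega>) - bsum y t b \<omega>"]
        by (simp add: power2_eq_square algebra_simps)
    qed (use sq_integrable[OF s] sq_integrable[OF x_bsum_sqint] sq_integrable[OF Y.bsum_sqint] in auto)
    also have "\<dots> = 2 * expectation (\<lambda>\<omega>. (bsum x t b \<omega> - bsum y t b \<omega>)\<^sup>2) + 2 * expectation (\<lambda>\<omega>. (bsum y t b \<omega>)\<^sup>2)"
      using sq_integrable[OF s] sq_integrable[OF Y.bsum_sqint] by simp
    also have "\<dots> \<le> 2 * real b + 2 * (2 * real m * real b * L\<^sup>2)"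
      using ap[of t b] Y.bsum_second_moment[of t b] by simp
    finally show "expectation (\<lambda>\<omega>. (bsum x t b \<omega>)\<^sup>2) \<le> (2 + 4 * real m * L\<^sup>2) * real b"
      by (simp add: algebra_simps)
  qed simp
qed

text \<open>Gathers the comparisons used later under one constant. \<open>D\<close> depends on the
  process through the bound \<open>C\<close> on its block variances and not on the approximation; a
  mean square error \<open>\<eta>\<^sup>2\<close> becomes an error of order \<eta> for second
  moments.\<close>

lemma transfer:
  "\<exists>D\<ge>0. \<forall>\<eta>. 0 < \<eta> \<longrightarrow> \<eta> \<le> 1 \<longrightarrow> (\<exists>y S m L. mdep M Z y S m L \<and>
     (\<forall>t b. expectation (\<lambda>\<omega>. (bsum x t b \<omega> - bsum y t b \<omega>)\<^sup>2) \<le> \<eta>\<^sup>2 * real b) \<and>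
     (\<forall>t b. \<bar>expectation (\<lambda>\<omega>. (bsum x t b \<omega>)\<^sup>2) - expectation (\<lambda>\<omega>. (bsum y t b \<omega>)\<^sup>2)\<bar> \<le> \<eta> * D * real b) \<and>
     (\<forall>b N. 1 \<le> b \<longrightarrow> 0 < N \<longrightarrow> expectation (\<lambda>\<omega>. \<bar>emp_var x b N \<omega> - emp_var y b N \<omega>\<bar>) \<le> \<eta> * D))"
proof -
  obtain C where C: "0 \<le> C" "\<And>t b. expectation (\<lambda>\<omega>. (bsum x t b \<omega>)\<^sup>2) \<le> C * real b"
    using x_second_bound by blast
  \<comment> \<open>The 2 covers \<open>(1 / (2 * \<eta>) + \<eta>) * \<eta>\<^sup>2 \<le> 2 *
    \<eta>\<close>, valid for \<open>\<eta> \<le> 1\<close>; the rest comes from the term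
    \<open>4 * \<eta> * u\<^sup>2\<close> of the comparison of squares.\<close>
  define D where "D = 2 + 4 * C"
  show ?thesis
  proof (intro exI[of _ D] conjI allI impI)
    show "0 \<le> D" using C by (simp add: D_def)
    fix \<eta> :: real assume \<eta>: "0 < \<eta>" "\<eta> \<le> 1"
    obtain y S m L where Y: "mdep M Z y S m L" and
      ap: "\<And>t b. expectation (\<lambda>\<omega>. (bsum x t b \<omega> - bsum y t b \<omega>)\<^sup>2) \<le> \<eta>\<^sup>2 * real b"
      using approx[of "\<eta>\<^sup>2"] \<eta> by auto
    then interpret Y: mdep M Z y S m L by simp
    have calc: "(1 / (2 * \<eta>) + \<eta>) * (\<eta>\<^sup>2 * B) + 4 * \<eta> * (C * B) \<le> \<eta> * D * B" if "0 \<le> B" for B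
    proof -
      have "(1 / (2 * \<eta>) + \<eta>) * \<eta>\<^sup>2 = \<eta> / 2 + \<eta> * (\<eta> * \<eta>)" using \<eta> by (simp add: field_simps power2_eq_square)
      also have "\<dots> \<le> \<eta> * 2"
      proof -
        have "\<eta> * \<eta> \<le> 1 * 1" using \<eta> by (intro mult_mono) auto
        then have "\<eta> * (\<eta> * \<eta>) \<le> \<eta> * 1" using \<eta> by (intro mult_left_mono) auto
        then show ?thesis using \<eta> by linarith
      qed
      finally have "(1 / (2 * \<eta>) + \<eta>) * \<eta>\<^sup>2 + 4 * \<eta> * C \<le> \<eta> * D" by (simp add: D_def algebra_simps)
      from mult_right_mono[OF this that] show ?thesis by (simp add: algebra_simps)
    qed
    have sd: "sqint M (\<lambda>\<omega>. bsum x t b \<omega> - bsum y t b \<omega>)" for t b by (intro sqint_diff x_bsum_sqint Y.bsum_sqint)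
    have A: "\<bar>expectation (\<lambda>\<omega>. (bsum x t b \<omega>)\<^sup>2) - expectation (\<lambda>\<omega>. (bsum y t b \<omega>)\<^sup>2)\<bar> \<le> \<eta> * D * real b" for t b
    proof -
      have "\<bar>expectation (\<lambda>\<omega>. (bsum x t b \<omega>)\<^sup>2) - expectation (\<lambda>\<omega>. (bsum y t b \<omega>)\<^sup>2)\<bar> =
          \<bar>expectation (\<lambda>\<omega>. (bsum x t b \<omega>)\<^sup>2 - (bsum y t b \<omega>)\<^sup>2)\<bar>"
        using sq_integrable[OF x_bsum_sqint] sq_integrable[OF Y.bsum_sqint] by simp
      also have "\<dots> \<le> expectation (\<lambda>\<omega>. \<bar>(bsum x t b \<omega>)\<^sup>2 - (bsum y t b \<omega>)\<^sup>2\<bar>)" by (rule integral_abs_bound)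
      also have "\<dots> \<le> expectation (\<lambda>\<omega>. (1 / (2 * \<eta>) + \<eta>) * (bsum x t b \<omega> - bsum y t b \<omega>)\<^sup>2 + 4 * \<eta> * (bsum x t b \<omega>)\<^sup>2)"
        by (rule integral_mono) (use sq_integrable[OF sd] sq_integrable[OF x_bsum_sqint] sq_integrable[OF Y.bsum_sqint] square_diff_le[OF \<eta>(1)] in auto)
      also have "\<dots> = (1 / (2 * \<eta>) + \<eta>) * expectation (\<lambda>\<omega>. (bsum x t b \<omega> - bsum y t b \<omega>)\<^sup>2) + 4 * \<eta> * expectation (\<lambda>\<omega>. (bsum x t b \<omega>)\<^sup>2)"
        using sq_integrable[OF sd] sq_integrable[OF x_bsum_sqint] by simp
      also have "\<dots> \<le> (1 / (2 * \<eta>) + \<eta>) * (\<eta>\<^sup>2 * real b) + 4 * \<eta> * (C * real b)"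
        using \<eta> by (intro add_mono mult_left_mono ap C) auto
      also have "\<dots> \<le> \<eta> * D * real b" by (rule calc) simp
      finally show ?thesis .
    qed
    have B: "expectation (\<lambda>\<omega>. \<bar>emp_var x b N \<omega> - emp_var y b N \<omega>\<bar>) \<le> \<eta> * D" if b: "1 \<le> b" and N: "0 < N" for b N
    proof -
      define d where "d t \<omega> = blk x b t \<omega> - blk y b t \<omega>" for t \<omega>
      have sdt: "sqint M (d t)" for t unfolding d_def[abs_def] by (intro sqint_diff x_blk_sqint Y.blk_sqint)
      have ptw: "\<bar>emp_var x b N \<omega> - emp_var y b N \<omega>\<bar> \<le>
        (1 / (2 * \<eta>) + \<eta>) * avg N (\<lambda>t. (d t \<omega>)\<^sup>2) + 4 * \<eta> * avg N (\<lambda>t. (blk x b t \<omega>)\<^sup>2)" for \<omega>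
      proof -
        have cd: "cblk x b N t \<omega> - cblk y b N t \<omega> = d t \<omega> - avg N (\<lambda>s. d s \<omega>)" for t
          unfolding cblk_def d_def avg_diff by simp
        have "\<bar>emp_var x b N \<omega> - emp_var y b N \<omega>\<bar> = norm (avg N (\<lambda>t. (cblk x b N t \<omega>)\<^sup>2 - (cblk y b N t \<omega>)\<^sup>2))"
          unfolding emp_var_def avg_diff by simp
        also have "\<dots> \<le> avg N (\<lambda>t. \<bar>(cblk x b N t \<omega>)\<^sup>2 - (cblk y b N t \<omega>)\<^sup>2\<bar>)"
          by (rule order_trans[OF norm_avg_le]) simp
        also have "\<dots> \<le> avg N (\<lambda>t. (1 / (2 * \<eta>) + \<eta>) * (d t \<omega> - avg N (\<lambda>s. d s \<omega>))\<^sup>2 + 4 * \<eta> * (cblk x b N t \<omega>)\<^sup>2)"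
          by (rule avg_mono) (use square_diff_le[OF \<eta>(1)] cd in metis)
        also have "\<dots> = (1 / (2 * \<eta>) + \<eta>) * avg N (\<lambda>t. (d t \<omega> - avg N (\<lambda>s. d s \<omega>))\<^sup>2) + 4 * \<eta> * avg N (\<lambda>t. (cblk x b N t \<omega>)\<^sup>2)"
          unfolding avg_add avg_cmult ..
        also have "\<dots> \<le> (1 / (2 * \<eta>) + \<eta>) * avg N (\<lambda>t. (d t \<omega>)\<^sup>2) + 4 * \<eta> * avg N (\<lambda>t. (blk x b t \<omega>)\<^sup>2)"
          unfolding cblk_def using \<eta> N by (intro add_mono mult_left_mono avg_centered_le) auto
        finally show ?thesis .
      qed
      have i1: "integrable M (\<lambda>\<omega>. avg N (\<lambda>t. (d t \<omega>)\<^sup>2))" and i2: "integrable M (\<lambda>\<omega>. avg N (\<lambda>t. (blk x b t \<omega>)\<^sup>2))"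
        unfolding avg_real using sq_integrable[OF sdt] sq_integrable[OF x_blk_sqint] by auto
      have "expectation (\<lambda>\<omega>. \<bar>emp_var x b N \<omega> - emp_var y b N \<omega>\<bar>) \<le>
         expectation (\<lambda>\<omega>. (1 / (2 * \<eta>) + \<eta>) * avg N (\<lambda>t. (d t \<omega>)\<^sup>2) + 4 * \<eta> * avg N (\<lambda>t. (blk x b t \<omega>)\<^sup>2))"
        by (rule integral_mono') (use i1 i2 ptw \<eta> in \<open>auto intro!: add_nonneg_nonneg mult_nonneg_nonneg avg_nonneg\<close>)
      also have "\<dots> = (1 / (2 * \<eta>) + \<eta>) * avg N (\<lambda>t. expectation (\<lambda>\<omega>. (d t \<omega>)\<^sup>2)) + 4 * \<eta> * avg N (\<lambda>t. expectation (\<lambda>\<omega>. (blk x b t \<omega>)\<^sup>2))"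
        using i1 i2 sq_integrable[OF sdt] sq_integrable[OF x_blk_sqint] by (simp add: avg_real)
      also have "\<dots> \<le> (1 / (2 * \<eta>) + \<eta>) * (\<eta>\<^sup>2 * 1) + 4 * \<eta> * (C * 1)"
      proof (intro add_mono mult_left_mono avg_le N)
        have dsq: "(d t \<omega>)\<^sup>2 = (bsum x (1 + int t) b \<omega> - bsum y (1 + int t) b \<omega>)\<^sup>2 / real b" for t \<omega>
          unfolding d_def blk_def by (simp add: power_divide flip: diff_divide_distrib)
        have xsq: "(blk x b t \<omega>)\<^sup>2 = (bsum x (1 + int t) b \<omega>)\<^sup>2 / real b" for t \<omega>
          unfolding blk_def by (simp add: power_divide)
        show "expectation (\<lambda>\<omega>. (d t \<omega>)\<^sup>2) \<le> \<eta>\<^sup>2 * 1" for t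
          using ap[of "1 + int t" b] b by (simp add: dsq divide_le_eq)
        show "expectation (\<lambda>\<omega>. (blk x b t \<omega>)\<^sup>2) \<le> C * 1" for t
          using C(2)[of "1 + int t" b] b by (simp add: xsq divide_le_eq)
      qed (use \<eta> in auto)
      also have "\<dots> \<le> \<eta> * D * 1" by (rule calc) simp
      finally show ?thesis by simp
    qed
    show "\<exists>y S m L. mdep M Z y S m L \<and>
     (\<forall>t b. expectation (\<lambda>\<omega>. (bsum x t b \<omega> - bsum y t b \<omega>)\<^sup>2) \<le> \<eta>\<^sup>2 * real b) \<and>
     (\<forall>t b. \<bar>expectation (\<lambda>\<omega>. (bsum x t b \<omega>)\<^sup>2) - expectation (\<lambda>\<omega>. (bsum y t b \<omega>)\<^sup>2)\<bar> \<le> \<eta> * D * real b) \<and>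
     (\<forall>b N. 1 \<le> b \<longrightarrow> 0 < N \<longrightarrow> expectation (\<lambda>\<omega>. \<bar>emp_var x b N \<omega> - emp_var y b N \<omega>\<bar>) \<le> \<eta> * D)"
      by (intro exI[of _ y] exI[of _ S] exI[of _ m] exI[of _ L] conjI allI impI Y ap A B)
  qed
qed

definition lrv :: real where
  "lrv = lim (\<lambda>b. expectation (\<lambda>\<omega>. (bsum x 0 b \<omega>)\<^sup>2) / real b)"

text \<open>Normalised block variances eventually stay within any given distance of the long-run
  variance of some approximation. This gives the Cauchy property; and as that target does not depend
  on the start \<open>t\<close>, all starts share one limit.\<close>

lemma lrv_tendsto: "(\<lambda>b. expectation (\<lambda>\<omega>. (bsum x t b \<omega>)\<^sup>2) / real b) \<longlonglongrightarrow> lrv"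
proof -
  obtain D where D: "D \<ge> 0" and tr: "\<And>\<eta>. 0 < \<eta> \<Longrightarrow> \<eta> \<le> 1 \<Longrightarrow> (\<exists>y S m L. mdep M Z y S m L \<and>
     (\<forall>t b. \<bar>expectation (\<lambda>\<omega>. (bsum x t b \<omega>)\<^sup>2) - expectation (\<lambda>\<omega>. (bsum y t b \<omega>)\<^sup>2)\<bar> \<le> \<eta> * D * real b))"
    using transfer by meson
  define f where "f t b = expectation (\<lambda>\<omega>. (bsum x t b \<omega>)\<^sup>2) / real b" for t b
  have near: "\<exists>l. \<forall>t. \<forall>\<^sub>F b in sequentially. \<bar>f t b - l\<bar> < r" if r: "r > 0" for r
  proof -
    define \<eta> where "\<eta> = min 1 (r / (2 * (D + 1)))"
    have \<eta>: "0 < \<eta>" "\<eta> \<le> 1" using r D by (auto simp: \<eta>_def)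
    have "\<eta> * D \<le> \<eta> * (D + 1)" using \<eta> by (intro mult_left_mono) auto
    also have "\<dots> \<le> r / (2 * (D + 1)) * (D + 1)" using D by (intro mult_right_mono) (auto simp: \<eta>_def)
    also have "\<dots> = r / 2" using D by (simp add: field_simps)
    finally have small: "\<eta> * D \<le> r / 2" .
    obtain y S m L where "mdep M Z y S m L" and
      ap: "\<And>t b. \<bar>expectation (\<lambda>\<omega>. (bsum x t b \<omega>)\<^sup>2) - expectation (\<lambda>\<omega>. (bsum y t b \<omega>)\<^sup>2)\<bar> \<le> \<eta> * D * real b"
      using tr[OF \<eta>] by blast
    then interpret Y: mdep M Z y S m L by simp
    have ev: "\<forall>\<^sub>F b in sequentially. dist (Y.bvar b / real b) Y.lrvar < r / 2"
      using Y.bvar_tendsto r by (intro tendstoD) auto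
    have close: "\<bar>f t b - Y.bvar b / real b\<bar> \<le> \<eta> * D" if "b > 0" for t b
      using ap[of t b] that unfolding f_def Y.bsum_bvar diff_divide_distrib[symmetric] abs_divide by (simp add: divide_le_eq)
    have "\<forall>\<^sub>F b in sequentially. \<bar>f t b - Y.lrvar\<bar> < r" for t
      using ev eventually_gt_at_top[of 0]
    proof eventually_elim
      case (elim b)
      have "\<bar>f t b - Y.lrvar\<bar> \<le> \<bar>f t b - Y.bvar b / real b\<bar> + \<bar>Y.bvar b / real b - Y.lrvar\<bar>"
        using abs_triangle_ineq[of "f t b - Y.bvar b / real b" "Y.bvar b / real b - Y.lrvar"] by simp
      also have "\<dots> < \<eta> * D + r / 2"
        using close[OF elim(2), of t] elim(1) unfolding dist_real_def by (rule add_le_less_mono)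
      also have "\<dots> \<le> r" using small by simp
      finally show ?case .
    qed
    then show ?thesis by blast
  qed
  have "Cauchy (f 0)"
  proof (rule CauchyI)
    fix r :: real assume "r > 0"
    then obtain l where "\<forall>\<^sub>F b in sequentially. \<bar>f 0 b - l\<bar> < r / 2" using near[of "r / 2"] by auto
    then obtain B where B: "\<And>b. b \<ge> B \<Longrightarrow> \<bar>f 0 b - l\<bar> < r / 2" unfolding eventually_sequentially by auto
    have "norm (f 0 a - f 0 b) < r" if "a \<ge> B" "b \<ge> B" for a b
    proof -
      have "norm (f 0 a - f 0 b) \<le> \<bar>f 0 a - l\<bar> + \<bar>f 0 b - l\<bar>"
        using abs_triangle_ineq4[of "f 0 a - l" "f 0 b - l"] by simp
      also have "\<dots> < r / 2 + r / 2" by (intro add_strict_mono B that)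
      finally show ?thesis by simp
    qed
    then show "\<exists>B. \<forall>a\<ge>B. \<forall>b\<ge>B. norm (f 0 a - f 0 b) < r" by blast
  qed
  then have l0: "f 0 \<longlonglongrightarrow> lrv"
    unfolding lrv_def f_def[symmetric] using Cauchy_convergent convergent_LIMSEQ_iff by blast
  have "f t \<longlonglongrightarrow> lrv"
  proof (rule tendstoI)
    fix r :: real assume r: "r > 0"
    then obtain l where l: "\<And>t. \<forall>\<^sub>F b in sequentially. \<bar>f t b - l\<bar> < r / 3" using near[of "r / 3"] by auto
    have "\<forall>\<^sub>F b in sequentially. dist (f 0 b) lrv < r / 3" using l0 r by (intro tendstoD) auto
    with l[of 0] l[of t] show "\<forall>\<^sub>F b in sequentially. dist (f t b) lrv < r"
    proof eventually_elim
      case (elim b)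
      have "\<bar>f t b - lrv\<bar> \<le> \<bar>f t b - l\<bar> + \<bar>f 0 b - l\<bar> + \<bar>f 0 b - lrv\<bar>"
        using abs_triangle_ineq4[of "f t b - l" "f 0 b - l"] abs_triangle_ineq[of "f t b - f 0 b" "f 0 b - lrv"] by simp
      also have "\<dots> < r / 3 + r / 3 + r / 3"
        using elim unfolding dist_real_def by (intro add_strict_mono) auto
      finally show ?case by (simp add: dist_real_def)
    qed
  qed
  then show ?thesis unfolding f_def .
qed

lemma lrv_nonneg: "0 \<le> lrv"
  by (rule LIMSEQ_le_const[OF lrv_tendsto[of 0]]) auto

text \<open>The comparison of second moments, divided by \<open>b\<close>, passes to the limit and
  becomes a comparison of long-run variances.\<close>

lemma transfer_lrv:
  "\<exists>D\<ge>0. \<forall>\<eta>. 0 < \<eta> \<longrightarrow> \<eta> \<le> 1 \<longrightarrow> (\<exists>y S m L. mdep M Z y S m L \<and>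
     (\<forall>t b. expectation (\<lambda>\<omega>. (bsum x t b \<omega> - bsum y t b \<omega>)\<^sup>2) \<le> \<eta>\<^sup>2 * real b) \<and>
     \<bar>mdep.lrvar M y m - lrv\<bar> \<le> \<eta> * D \<and>
     (\<forall>b N. 1 \<le> b \<longrightarrow> 0 < N \<longrightarrow> expectation (\<lambda>\<omega>. \<bar>emp_var x b N \<omega> - emp_var y b N \<omega>\<bar>) \<le> \<eta> * D))"
proof -
  obtain D where D: "D \<ge> 0" and tr: "\<And>\<eta>. 0 < \<eta> \<Longrightarrow> \<eta> \<le> 1 \<Longrightarrow> (\<exists>y S m L. mdep M Z y S m L \<and>
     (\<forall>t b. expectation (\<lambda>\<omega>. (bsum x t b \<omega> - bsum y t b \<omega>)\<^sup>2) \<le> \<eta>\<^sup>2 * real b) \<and>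
     (\<forall>t b. \<bar>expectation (\<lambda>\<omega>. (bsum x t b \<omega>)\<^sup>2) - expectation (\<lambda>\<omega>. (bsum y t b \<omega>)\<^sup>2)\<bar> \<le> \<eta> * D * real b) \<and>
     (\<forall>b N. 1 \<le> b \<longrightarrow> 0 < N \<longrightarrow> expectation (\<lambda>\<omega>. \<bar>emp_var x b N \<omega> - emp_var y b N \<omega>\<bar>) \<le> \<eta> * D))"
    using transfer by meson
  show ?thesis
  proof (intro exI[of _ D] conjI allI impI D)
    fix \<eta> :: real assume \<eta>: "0 < \<eta>" "\<eta> \<le> 1"
    obtain y S m L where Y: "mdep M Z y S m L" and
      1: "\<And>t b. expectation (\<lambda>\<omega>. (bsum x t b \<omega> - bsum y t b \<omega>)\<^sup>2) \<le> \<eta>\<^sup>2 * real b" and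
      2: "\<And>t b. \<bar>expectation (\<lambda>\<omega>. (bsum x t b \<omega>)\<^sup>2) - expectation (\<lambda>\<omega>. (bsum y t b \<omega>)\<^sup>2)\<bar> \<le> \<eta> * D * real b" and
      3: "\<And>b N. 1 \<le> b \<Longrightarrow> 0 < N \<Longrightarrow> expectation (\<lambda>\<omega>. \<bar>emp_var x b N \<omega> - emp_var y b N \<omega>\<bar>) \<le> \<eta> * D"
      using tr[OF \<eta>] by blast
    interpret Y: mdep M Z y S m L by (rule Y)
    have "\<bar>Y.lrvar - lrv\<bar> \<le> \<eta> * D"
    proof (rule LIMSEQ_le_const2)
      show "(\<lambda>b. \<bar>Y.bvar b / real b - expectation (\<lambda>\<omega>. (bsum x 0 b \<omega>)\<^sup>2) / real b\<bar>) \<longlonglongrightarrow> \<bar>Y.lrvar - lrv\<bar>"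
        by (intro tendsto_intros Y.bvar_tendsto lrv_tendsto)
      show "\<exists>B. \<forall>b\<ge>B. \<bar>Y.bvar b / real b - expectation (\<lambda>\<omega>. (bsum x 0 b \<omega>)\<^sup>2) / real b\<bar> \<le> \<eta> * D"
      proof (intro exI[of _ 1] allI impI)
        fix b :: nat assume "1 \<le> b"
        then show "\<bar>Y.bvar b / real b - expectation (\<lambda>\<omega>. (bsum x 0 b \<omega>)\<^sup>2) / real b\<bar> \<le> \<eta> * D"
          using 2[of 0 b] unfolding Y.bsum_bvar diff_divide_distrib[symmetric] abs_divide by (simp add: divide_le_eq abs_minus_commute)
      qed
    qed
    then show "\<exists>y S m L. mdep M Z y S m L \<and>
     (\<forall>t b. expectation (\<lambda>\<omega>. (bsum x t b \<omega> - bsum y t b \<omega>)\<^sup>2) \<le> \<eta>\<^sup>2 * real b) \<and>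
     \<bar>mdep.lrvar M y m - lrv\<bar> \<le> \<eta> * D \<and>
     (\<forall>b N. 1 \<le> b \<longrightarrow> 0 < N \<longrightarrow> expectation (\<lambda>\<omega>. \<bar>emp_var x b N \<omega> - emp_var y b N \<omega>\<bar>) \<le> \<eta> * D)"
      by (intro exI[of _ y] exI[of _ S] exI[of _ m] exI[of _ L] conjI allI impI Y 1 3)
  qed
qed

section \<open>Limits along a sequence of block lengths and block numbers\<close>

context
  fixes b k N :: "nat \<Rightarrow> nat"
  assumes b1: "\<And>j. 1 \<le> b j" and k1: "\<And>j. 1 \<le> k j"
    and b_lim: "filterlim b at_top sequentially" and k_lim: "filterlim k at_top sequentially"
    and N_def: "\<And>j. N j = (k j - 1) * b j + 1"
begin

lemma N_pos: "0 < N j" by (simp add: N_def)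

lemma bvar_seq_tendsto:
  assumes "mdep M Z y S m L"
  shows "(\<lambda>j. mdep.bvar M y (b j) / real (b j)) \<longlonglongrightarrow> mdep.lrvar M y m"
  using filterlim_compose[OF mdep.bvar_tendsto[OF assms] b_lim] .

lemma ratio_tendsto: "(\<lambda>j. real (b j + m) / real (N j)) \<longlonglongrightarrow> 0"
  unfolding N_def by (rule block_ratio_tendsto[OF b1 k_lim])

lemma mean_square_tendsto:
  assumes "mdep M Z y S m L"
  shows "(\<lambda>j. 2 * real (b j + m) / real (N j) * (mdep.bvar M y (b j) / real (b j))) \<longlonglongrightarrow> 0"
  using tendsto_mult[OF tendsto_mult[OF tendsto_const[of 2] ratio_tendsto[of m]] bvar_seq_tendsto[OF assms]] by simp

lemma inv_sqrt_k_tendsto: "(\<lambda>j. 1 / sqrt (real (k j))) \<longlonglongrightarrow> 0"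
  by (intro tendsto_divide_0[OF tendsto_const] filterlim_at_top_imp_at_infinity
      filterlim_compose[OF sqrt_at_top] filterlim_compose[OF filterlim_real_sequentially k_lim])

lemma inv_k_tendsto: "(\<lambda>j. 1 / real (k j)) \<longlonglongrightarrow> 0"
  by (intro tendsto_divide_0[OF tendsto_const] filterlim_at_top_imp_at_infinity
      filterlim_compose[OF filterlim_real_sequentially k_lim])

text \<open>Compares in turn with the empirical variance, the block variance and the long-run
  variance of the approximation, then with the long-run variance of \<open>x\<close>. The first and
  the last step cost \<open>\<eta> * D\<close> each, hence \<open>2 * D\<close>.\<close>

lemma emp_var_tendsto: "(\<lambda>j. expectation (\<lambda>\<omega>. \<bar>emp_var x (b j) (N j) \<omega> - lrv\<bar>)) \<longlonglongrightarrow> 0"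
proof -
  obtain D where D: "D \<ge> 0" and tr: "\<And>\<eta>. 0 < \<eta> \<Longrightarrow> \<eta> \<le> 1 \<Longrightarrow> (\<exists>y S m L. mdep M Z y S m L \<and>
     (\<forall>t b. expectation (\<lambda>\<omega>. (bsum x t b \<omega> - bsum y t b \<omega>)\<^sup>2) \<le> \<eta>\<^sup>2 * real b) \<and>
     \<bar>mdep.lrvar M y m - lrv\<bar> \<le> \<eta> * D \<and>
     (\<forall>b N. 1 \<le> b \<longrightarrow> 0 < N \<longrightarrow> expectation (\<lambda>\<omega>. \<bar>emp_var x b N \<omega> - emp_var y b N \<omega>\<bar>) \<le> \<eta> * D))"
    using transfer_lrv by meson
  show ?thesis
  proof (rule tendsto_zero_approx[where D = "2 * D"])
    fix \<eta> :: real assume \<eta>: "0 < \<eta>" "\<eta> \<le> 1"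
    obtain y S m L where Y: "mdep M Z y S m L" and
      2: "\<bar>mdep.lrvar M y m - lrv\<bar> \<le> \<eta> * D" and
      3: "\<And>b N. 1 \<le> b \<Longrightarrow> 0 < N \<Longrightarrow> expectation (\<lambda>\<omega>. \<bar>emp_var x b N \<omega> - emp_var y b N \<omega>\<bar>) \<le> \<eta> * D"
      using tr[OF \<eta>] by blast
    interpret Y: mdep M Z y S m L by (rule Y)
    define g where "g j = sqrt (2 * real (b j + m) / real (N j) * Y.C4) + 2 * real (b j + m) / real (N j) * (Y.bvar (b j) / real (b j))
       + \<bar>Y.bvar (b j) / real (b j) - Y.lrvar\<bar>" for j
    have r2: "(\<lambda>j. 2 * real (b j + m) / real (N j)) \<longlonglongrightarrow> 0"
      using tendsto_mult[OF tendsto_const[of 2] ratio_tendsto[of m]] by simp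
    have "g \<longlonglongrightarrow> sqrt (0 * Y.C4) + 0 + \<bar>Y.lrvar - Y.lrvar\<bar>"
      unfolding g_def by (intro tendsto_intros mean_square_tendsto[OF Y] bvar_seq_tendsto[OF Y] r2)
    then have g0: "g \<longlonglongrightarrow> 0" by simp
    have "expectation (\<lambda>\<omega>. \<bar>emp_var x (b j) (N j) \<omega> - lrv\<bar>) \<le> g j + \<eta> * (2 * D)" for j
    proof -
      have iv: "integrable M (emp_var z (b j) (N j))" if "\<And>t. sqint M (blk z (b j) t)" for z
        unfolding emp_var_def[abs_def] cblk_def avg_real[where u = "\<lambda>t. _ t ^ 2"] avg_real
        by (intro integrable_divide Bochner_Integration.integrable_sum sq_integrable sqint_diff sqint_divide sqint_sum that)
      note ix = iv[of x, OF x_blk_sqint] and iy = iv[of y, OF Y.blk_sqint]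
      have "expectation (\<lambda>\<omega>. \<bar>emp_var x (b j) (N j) \<omega> - lrv\<bar>) \<le>
        expectation (\<lambda>\<omega>. \<bar>emp_var x (b j) (N j) \<omega> - emp_var y (b j) (N j) \<omega>\<bar> + \<bar>emp_var y (b j) (N j) \<omega> - Y.bvar (b j) / real (b j)\<bar>
          + (\<bar>Y.bvar (b j) / real (b j) - Y.lrvar\<bar> + \<bar>Y.lrvar - lrv\<bar>))"
        by (rule integral_mono) (use ix iy in auto)
      also have "\<dots> = expectation (\<lambda>\<omega>. \<bar>emp_var x (b j) (N j) \<omega> - emp_var y (b j) (N j) \<omega>\<bar>)
          + expectation (\<lambda>\<omega>. \<bar>emp_var y (b j) (N j) \<omega> - Y.bvar (b j) / real (b j)\<bar>)
          + (\<bar>Y.bvar (b j) / real (b j) - Y.lrvar\<bar> + \<bar>Y.lrvar - lrv\<bar>)"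
        using ix iy by (simp add: prob_space)
      also have "\<dots> \<le> g j + \<eta> * (2 * D)"
        using 2 3[OF b1[of j] N_pos[of j]] Y.emp_var_bound[OF N_pos[of j] b1[of j]] unfolding g_def by linarith
      finally show ?thesis .
    qed
    with g0 show "\<exists>g. g \<longlonglongrightarrow> 0 \<and> (\<forall>\<^sub>F j in sequentially. expectation (\<lambda>\<omega>. \<bar>emp_var x (b j) (N j) \<omega> - lrv\<bar>) \<le> g j + \<eta> * (2 * D))"
      by (intro exI[of _ g]) simp
  qed simp
qed

lemma exp_half_lipschitz: "0 \<le> s \<Longrightarrow> 0 \<le> s' \<Longrightarrow> \<bar>exp (- s / 2) - exp (- s' / 2)\<bar> \<le> \<bar>s - s'\<bar>" for s s' :: real
proof -
  have main: "exp (- s / 2) - exp (- s' / 2) \<le> s' - s" if "0 \<le> s" "s \<le> s'" for s s' :: real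
  proof -
    have "exp (- s / 2) - exp (- s' / 2) = exp (- s / 2) * (1 - exp (- (s' - s) / 2))"
      by (simp add: right_diff_distrib exp_add[symmetric] diff_divide_distrib)
    also have "\<dots> \<le> 1 * (1 - exp (- (s' - s) / 2))" using that by (intro mult_right_mono) auto
    also have "\<dots> \<le> s' - s" using exp_ge_add_one_self[of "- (s' - s) / 2"] that by (simp add: field_simps)
    finally show ?thesis .
  qed
  assume "0 \<le> s" "0 \<le> s'"
  then show ?thesis using main[of s s'] main[of s' s] by (cases "s \<le> s'") (auto simp: abs_if)
qed

text \<open>Characters are 1-Lipschitz, so replacing \<open>x\<close> by the approximation costs
  \<eta>; exchanging the long-run variances costs \<open>\<eta> * D\<close>. Hence the constant
  \<open>1 + D\<close>.\<close>

lemma char_tendsto: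
  "(\<lambda>j. CLINT \<omega>|M. iexp (bsum x t (k j * b j) \<omega> / sqrt (real (k j * b j)))) \<longlonglongrightarrow> complex_of_real (exp (- lrv / 2))"
proof -
  obtain D where D: "D \<ge> 0" and tr: "\<And>\<eta>. 0 < \<eta> \<Longrightarrow> \<eta> \<le> 1 \<Longrightarrow> (\<exists>y S m L. mdep M Z y S m L \<and>
     (\<forall>t b. expectation (\<lambda>\<omega>. (bsum x t b \<omega> - bsum y t b \<omega>)\<^sup>2) \<le> \<eta>\<^sup>2 * real b) \<and>
     \<bar>mdep.lrvar M y m - lrv\<bar> \<le> \<eta> * D)"
    using transfer_lrv by meson
  define f where "f j = cmod ((CLINT \<omega>|M. iexp (bsum x t (k j * b j) \<omega> / sqrt (real (k j * b j)))) - complex_of_real (exp (- lrv / 2)))" for j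
  have "f \<longlonglongrightarrow> 0"
  proof (rule tendsto_zero_approx[where D = "1 + D"])
    fix \<eta> :: real assume \<eta>: "0 < \<eta>" "\<eta> \<le> 1"
    obtain y S m L where Y: "mdep M Z y S m L" and
      1: "\<And>t b. expectation (\<lambda>\<omega>. (bsum x t b \<omega> - bsum y t b \<omega>)\<^sup>2) \<le> \<eta>\<^sup>2 * real b" and
      2: "\<bar>mdep.lrvar M y m - lrv\<bar> \<le> \<eta> * D"
      using tr[OF \<eta>] by blast
    interpret Y: mdep M Z y S m L by (rule Y)
    define g where "g j = (1 + Y.C4) / 6 * (1 / sqrt (real (k j))) + \<bar>Y.bvar (b j - m) / real (b j) - Y.lrvar\<bar> / 2
      + Y.lrvar\<^sup>2 / 8 * (1 / real (k j)) + sqrt (4 * (real m)\<^sup>2 * L\<^sup>2 * (1 / real (b j)))" for j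
    have ib: "(\<lambda>j. 1 / real (b j)) \<longlonglongrightarrow> 0"
      by (intro tendsto_divide_0[OF tendsto_const] filterlim_at_top_imp_at_infinity
          filterlim_compose[OF filterlim_real_sequentially b_lim])
    \<comment> \<open>An index shift by \<open>m\<close> removes the truncated subtraction.\<close>
    have "(\<lambda>n. Y.bvar (n - m) / real n) \<longlonglongrightarrow> Y.lrvar"
    proof (rule LIMSEQ_offset[where k = m])
      have "(\<lambda>n. Y.bvar n / real n * (real n / (real m + real n))) \<longlonglongrightarrow> Y.lrvar * 1"
      proof (intro tendsto_mult Y.bvar_tendsto)
        have "(\<lambda>n. 1 - real m / (real m + real n)) \<longlonglongrightarrow> 1 - 0"
          by (intro tendsto_intros tendsto_divide_0[OF tendsto_const] filterlim_at_top_imp_at_infinity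
              filterlim_tendsto_add_at_top[OF tendsto_const] filterlim_real_sequentially)
        then have "(\<lambda>n. 1 - real m / (real m + real n)) \<longlonglongrightarrow> 1" by simp
        then show "(\<lambda>n. real n / (real m + real n)) \<longlonglongrightarrow> 1"
          by (rule Lim_transform_eventually)
            (use eventually_gt_at_top[of 0] in \<open>eventually_elim, simp add: field_simps\<close>)
      qed
      then have "(\<lambda>n. Y.bvar n / real n * (real n / (real m + real n))) \<longlonglongrightarrow> Y.lrvar" by simp
      then show "(\<lambda>n. Y.bvar (n + m - m) / real (n + m)) \<longlonglongrightarrow> Y.lrvar"
        by (rule Lim_transform_eventually)
          (use eventually_gt_at_top[of 0] in \<open>eventually_elim, simp add: add.commute\<close>)
    qed
    from filterlim_compose[OF this b_lim]
    have bm: "(\<lambda>j. Y.bvar (b j - m) / real (b j)) \<longlonglongrightarrow> Y.lrvar" .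
    have "g \<longlonglongrightarrow> (1 + Y.C4) / 6 * 0 + \<bar>Y.lrvar - Y.lrvar\<bar> / 2 + Y.lrvar\<^sup>2 / 8 * 0 + sqrt (4 * (real m)\<^sup>2 * L\<^sup>2 * 0)"
      unfolding g_def by (intro tendsto_add tendsto_mult tendsto_divide tendsto_const tendsto_rabs tendsto_diff tendsto_real_sqrt
          bm ib inv_k_tendsto inv_sqrt_k_tendsto) simp
    then have g0: "g \<longlonglongrightarrow> 0" by simp
    have ev: "\<forall>\<^sub>F j in sequentially. 2 * m \<le> b j" using b_lim by (simp add: filterlim_at_top)
    have "\<forall>\<^sub>F j in sequentially. f j \<le> g j + \<eta> * (1 + D)"
      using ev
    proof eventually_elim
      case (elim j)
      define n where "n = k j * b j"
      have n: "n > 0" using b1[of j] k1[of j] by (simp add: n_def)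
      let ?X = "\<lambda>\<omega>. bsum x t n \<omega> / sqrt (real n)" and ?Y = "\<lambda>\<omega>. bsum y t n \<omega> / sqrt (real n)"
      have sd: "sqint M (\<lambda>\<omega>. ?X \<omega> - ?Y \<omega>)" by (intro sqint_diff sqint_divide x_bsum_sqint Y.bsum_sqint)
      have [measurable]: "bsum x t n \<in> borel_measurable M" using x_bsum_sqint by (rule sqint_measurable)
      have I: "integrable M (\<lambda>\<omega>. iexp (?X \<omega>))" "integrable M (\<lambda>\<omega>. iexp (?Y \<omega>))"
        by (rule integrable_iexp; auto)+
      have "cmod ((CLINT \<omega>|M. iexp (?X \<omega>)) - (CLINT \<omega>|M. iexp (?Y \<omega>))) = cmod (CLINT \<omega>|M. iexp (?X \<omega>) - iexp (?Y \<omega>))"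
        by (subst Bochner_Integration.integral_diff[OF I]) (rule refl)
      also have "\<dots> \<le> (\<integral>\<omega>. cmod (iexp (?X \<omega>) - iexp (?Y \<omega>)) \<partial>M)" by (rule integral_norm_bound)
      also have "\<dots> \<le> (\<integral>\<omega>. norm (?X \<omega> - ?Y \<omega>) \<partial>M)"
      proof (rule integral_mono')
        show "integrable M (\<lambda>\<omega>. norm (?X \<omega> - ?Y \<omega>))" using sqint_integrable[OF sd] by (rule integrable_norm)
        fix \<omega>
        have "cmod (iexp u - iexp v) \<le> \<bar>u - v\<bar>" for u v :: real
        proof -
          have "iexp u - iexp v = iexp v * (iexp (u - v) - 1)" by (simp add: exp_diff right_diff_distrib)
          then have "cmod (iexp u - iexp v) = cmod (iexp (u - v) - 1)" by (simp add: norm_mult)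
          also have "\<dots> \<le> \<bar>u - v\<bar>" using iexp_approx1[of "u - v" 0] by simp
          finally show ?thesis .
        qed
        then show "cmod (iexp (?X \<omega>) - iexp (?Y \<omega>)) \<le> norm (?X \<omega> - ?Y \<omega>)" by (simp only: real_norm_def)
      qed auto
      also have "\<dots> \<le> nrm2 M (\<lambda>\<omega>. ?X \<omega> - ?Y \<omega>)" by (rule expectation_norm_le_nrm2[OF sd])
      also have "\<dots> \<le> sqrt (\<eta>\<^sup>2)"
        unfolding nrm2_def
      proof (rule real_sqrt_le_mono)
        have "expectation (\<lambda>\<omega>. (norm (?X \<omega> - ?Y \<omega>))\<^sup>2) = expectation (\<lambda>\<omega>. (bsum x t n \<omega> - bsum y t n \<omega>)\<^sup>2) / real n"
          by (simp add: power_divide flip: diff_divide_distrib)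
        also have "\<dots> \<le> \<eta>\<^sup>2" using 1[of t n] n by (simp add: divide_le_eq)
        finally show "expectation (\<lambda>\<omega>. (norm (?X \<omega> - ?Y \<omega>))\<^sup>2) \<le> \<eta>\<^sup>2" .
      qed
      finally have A: "cmod ((CLINT \<omega>|M. iexp (?X \<omega>)) - (CLINT \<omega>|M. iexp (?Y \<omega>))) \<le> \<eta>" using \<eta> by simp
      have B: "cmod ((CLINT \<omega>|M. iexp (?Y \<omega>)) - complex_of_real (exp (- Y.lrvar / 2))) \<le> g j"
        using Y.char_bsum_bound[OF elim k1[of j] Y.lrvar_nonneg, of t] unfolding g_def n_def by simp
      have "cmod (complex_of_real (exp (- Y.lrvar / 2)) - complex_of_real (exp (- lrv / 2))) = \<bar>exp (- Y.lrvar / 2) - exp (- lrv / 2)\<bar>"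
        unfolding of_real_diff[symmetric] norm_of_real ..
      also have "\<dots> \<le> \<eta> * D" using exp_half_lipschitz[OF Y.lrvar_nonneg lrv_nonneg] 2 by simp
      finally have C: "cmod (complex_of_real (exp (- Y.lrvar / 2)) - complex_of_real (exp (- lrv / 2))) \<le> \<eta> * D" .
      have "f j \<le> \<eta> + g j + \<eta> * D"
        unfolding f_def n_def[symmetric] using norm_diff_triangle_le[OF norm_diff_triangle_le[OF A B] C] .
      then show ?case by (simp add: algebra_simps)
    qed
    with g0 show "\<exists>g. g \<longlonglongrightarrow> 0 \<and> (\<forall>\<^sub>F j in sequentially. f j \<le> g j + \<eta> * (1 + D))" by blast
  qed (simp add: f_def)
  then show ?thesis unfolding f_def by (rule LIM_zero_cancel[OF tendsto_norm_zero_cancel])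
qed

text \<open>Integrates the pathwise bound. The variance term is the law of large numbers for
  \<open>x\<close> itself; the remainder is charged to the approximating blocks, whose fourth
  moments are bounded, to the difference of blocks, whose mean square is at most
  \<open>\<eta>\<^sup>2\<close>, and to the squared mean of the approximating blocks.\<close>

lemma cond_char_tendsto:
  "(\<lambda>j. \<integral>\<omega>. cmod (avg (N j) (\<lambda>t. iexp (cblk x (b j) (N j) t \<omega> / sqrt (real (k j)))) ^ k j - complex_of_real (exp (- lrv / 2))) \<partial>M) \<longlonglongrightarrow> 0"
proof -
  obtain D where D: "D \<ge> 0" and tr: "\<And>\<eta>. 0 < \<eta> \<Longrightarrow> \<eta> \<le> 1 \<Longrightarrow> (\<exists>y S m L. mdep M Z y S m L \<and>
     (\<forall>t b. expectation (\<lambda>\<omega>. (bsum x t b \<omega> - bsum y t b \<omega>)\<^sup>2) \<le> \<eta>\<^sup>2 * real b) \<and>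
     \<bar>mdep.lrvar M y m - lrv\<bar> \<le> \<eta> * D)"
    using transfer_lrv by meson
  define V where "V j = expectation (\<lambda>\<omega>. \<bar>emp_var x (b j) (N j) \<omega> - lrv\<bar>)" for j
  show ?thesis
  \<comment> \<open>Eight is the factor 4 of the square-cube comparison times the 2 of
    \<open>(p - q)\<^sup>2 \<le> 2 * p\<^sup>2 + 2 * q\<^sup>2\<close>.\<close>
  proof (rule tendsto_zero_approx[where D = 8])
    fix \<eta> :: real assume \<eta>: "0 < \<eta>" "\<eta> \<le> 1"
    obtain y S m L where Y: "mdep M Z y S m L" and
      1: "\<And>t b. expectation (\<lambda>\<omega>. (bsum x t b \<omega> - bsum y t b \<omega>)\<^sup>2) \<le> \<eta>\<^sup>2 * real b"
      using tr[OF \<eta>] by blast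
    interpret Y: mdep M Z y S m L by (rule Y)
    define Q where "Q j = 2 * real (b j + m) / real (N j) * (Y.bvar (b j) / real (b j))" for j
    define g where "g j = 8 / 6 * (1 + Y.C4) * (1 / sqrt (real (k j))) + 8 * Q j + V j / 2 + lrv\<^sup>2 / 8 * (1 / real (k j))" for j
    have "g \<longlonglongrightarrow> 8 / 6 * (1 + Y.C4) * 0 + 8 * 0 + 0 / 2 + lrv\<^sup>2 / 8 * 0"
      unfolding g_def Q_def V_def by (intro tendsto_add tendsto_mult tendsto_divide tendsto_const mean_square_tendsto[OF Y] emp_var_tendsto
          inv_k_tendsto inv_sqrt_k_tendsto) simp
    then have g0: "g \<longlonglongrightarrow> 0" by simp
    have "(\<integral>\<omega>. cmod (avg (N j) (\<lambda>t. iexp (cblk x (b j) (N j) t \<omega> / sqrt (real (k j)))) ^ k j - complex_of_real (exp (- lrv / 2))) \<partial>M) \<le> g j + \<eta> * 8" for j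
    proof -
      define s where "s = 1 / (6 * sqrt (real (k j)))"
      have s: "0 \<le> s" by (simp add: s_def)
      define d where "d t \<omega> = blk x (b j) t \<omega> - blk y (b j) t \<omega>" for t \<omega>
      have sdt: "sqint M (d t)" for t unfolding d_def[abs_def] by (intro sqint_diff x_blk_sqint Y.blk_sqint)
      define W where "W \<omega> = (avg (N j) (\<lambda>t. blk y (b j) t \<omega>))\<^sup>2" for \<omega>
      define Cu where "Cu \<omega> = avg (N j) (\<lambda>t. \<bar>blk y (b j) t \<omega>\<bar> ^ 3)" for \<omega>
      define E2 where "E2 \<omega> = avg (N j) (\<lambda>t. (d t \<omega>)\<^sup>2)" for \<omega>
      have ptw: "cmod (avg (N j) (\<lambda>t. iexp (cblk x (b j) (N j) t \<omega> / sqrt (real (k j)))) ^ k j - complex_of_real (exp (- lrv / 2)))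
        \<le> 8 * s * Cu \<omega> + 8 * E2 \<omega> + 8 * W \<omega> + \<bar>emp_var x (b j) (N j) \<omega> - lrv\<bar> / 2 + lrv\<^sup>2 / (8 * real (k j))" for \<omega>
      proof -
        have "avg (N j) (\<lambda>t. min ((cblk x (b j) (N j) t \<omega>)\<^sup>2) (s * \<bar>cblk x (b j) (N j) t \<omega>\<bar> ^ 3)) \<le>
          avg (N j) (\<lambda>t. (8 * s) * \<bar>blk y (b j) t \<omega>\<bar> ^ 3 + (8 * (d t \<omega> - avg (N j) (\<lambda>t. d t \<omega>))\<^sup>2 + 8 * W \<omega>))"
        proof (rule avg_mono)
          fix t
          let ?c = "cblk x (b j) (N j) t \<omega>" and ?w = "blk y (b j) t \<omega>"
          have "?c - ?w = (d t \<omega> - avg (N j) (\<lambda>t. d t \<omega>)) - avg (N j) (\<lambda>t. blk y (b j) t \<omega>)"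
            unfolding cblk_def d_def avg_diff by simp
          moreover have "(p - q)\<^sup>2 \<le> 2 * p\<^sup>2 + 2 * q\<^sup>2" for p q :: real
            using zero_le_power2[of "p + q"] by (simp add: power2_eq_square algebra_simps)
          ultimately have "(?c - ?w)\<^sup>2 \<le> 2 * (d t \<omega> - avg (N j) (\<lambda>t. d t \<omega>))\<^sup>2 + 2 * W \<omega>" by (simp add: W_def)
          then show "min (?c\<^sup>2) (s * \<bar>?c\<bar> ^ 3) \<le> (8 * s) * \<bar>?w\<bar> ^ 3 + (8 * (d t \<omega> - avg (N j) (\<lambda>t. d t \<omega>))\<^sup>2 + 8 * W \<omega>)"
            using min_square_cube_le[OF s, of ?c ?w] by linarith
        qed
        also have "\<dots> = 8 * s * Cu \<omega> + (8 * avg (N j) (\<lambda>t. (d t \<omega> - avg (N j) (\<lambda>t. d t \<omega>))\<^sup>2) + 8 * W \<omega>)"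
          unfolding avg_add avg_cmult Cu_def using N_pos by simp
        also have "\<dots> \<le> 8 * s * Cu \<omega> + (8 * E2 \<omega> + 8 * W \<omega>)"
          unfolding E2_def by (intro add_left_mono add_right_mono mult_left_mono avg_centered_le N_pos) simp
        finally show ?thesis
          using avg_char_bound[OF N_pos[of j] k1[of j] lrv_nonneg, of "\<lambda>t. blk x (b j) t \<omega>"]
          unfolding cblk_def[symmetric] emp_var_def s_def by linarith
      qed
      have i3: "integrable M (\<lambda>\<omega>. \<bar>blk y (b j) t \<omega>\<bar> ^ 3)" for t
        by (rule Bochner_Integration.integrable_bound[of M "\<lambda>\<omega>. 1 + (blk y (b j) t \<omega>) ^ 4"])
          (use Y.blk_fourth_integrable abs_cube_le in \<open>auto intro: order_trans[OF _ abs_ge_self]\<close>)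
      have e3: "expectation (\<lambda>\<omega>. \<bar>blk y (b j) t \<omega>\<bar> ^ 3) \<le> 1 + Y.C4" for t
      proof -
        have "expectation (\<lambda>\<omega>. \<bar>blk y (b j) t \<omega>\<bar> ^ 3) \<le> expectation (\<lambda>\<omega>. 1 + (blk y (b j) t \<omega>) ^ 4)"
          by (rule integral_mono) (use i3 Y.blk_fourth_integrable abs_cube_le in auto)
        also have "\<dots> \<le> 1 + Y.C4"
          using Y.blk_fourth_integrable Y.blk_fourth[OF b1, of j t] by (simp add: prob_space)
        finally show ?thesis .
      qed
      have iCu: "integrable M Cu" unfolding Cu_def[abs_def] avg_real using i3 by auto
      have iE2: "integrable M E2" unfolding E2_def[abs_def] avg_real using sq_integrable[OF sdt] by auto
      have iW: "integrable M W" unfolding W_def[abs_def] avg_real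
        by (intro sq_integrable sqint_divide sqint_sum Y.blk_sqint)
      have iV: "integrable M (emp_var x (b j) (N j))"
        unfolding emp_var_def[abs_def] cblk_def avg_real
        by (intro integrable_divide Bochner_Integration.integrable_sum sq_integrable sqint_diff sqint_divide sqint_sum x_blk_sqint)
      have eCu: "expectation Cu \<le> 1 + Y.C4"
      proof -
        have "expectation Cu = avg (N j) (\<lambda>t. expectation (\<lambda>\<omega>. \<bar>blk y (b j) t \<omega>\<bar> ^ 3))"
          unfolding Cu_def[abs_def] avg_real using i3 by simp
        also have "\<dots> \<le> 1 + Y.C4" by (rule avg_le[OF N_pos e3])
        finally show ?thesis .
      qed
      have eE2: "expectation E2 \<le> \<eta>"
      proof -
        have "expectation E2 = avg (N j) (\<lambda>t. expectation (\<lambda>\<omega>. (d t \<omega>)\<^sup>2))"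
          unfolding E2_def[abs_def] avg_real using sq_integrable[OF sdt] by simp
        also have "\<dots> \<le> \<eta>\<^sup>2"
        proof (rule avg_le[OF N_pos])
          have dsq: "(d t \<omega>)\<^sup>2 = (bsum x (1 + int t) (b j) \<omega> - bsum y (1 + int t) (b j) \<omega>)\<^sup>2 / real (b j)" for t \<omega>
            unfolding d_def blk_def by (simp add: power_divide flip: diff_divide_distrib)
          show "expectation (\<lambda>\<omega>. (d t \<omega>)\<^sup>2) \<le> \<eta>\<^sup>2" for t
            using 1[of "1 + int t" "b j"] b1[of j] by (simp add: dsq divide_le_eq)
        qed
        also have "\<dots> \<le> \<eta>" using \<eta> by (simp add: power2_eq_square mult_le_one mult_left_le)
        finally show ?thesis .
      qed
      have eW: "expectation W \<le> Q j" unfolding W_def Q_def by (rule Y.avg_blk_second[OF N_pos])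
      have "(\<integral>\<omega>. cmod (avg (N j) (\<lambda>t. iexp (cblk x (b j) (N j) t \<omega> / sqrt (real (k j)))) ^ k j - complex_of_real (exp (- lrv / 2))) \<partial>M)
        \<le> expectation (\<lambda>\<omega>. 8 * s * Cu \<omega> + 8 * E2 \<omega> + 8 * W \<omega> + \<bar>emp_var x (b j) (N j) \<omega> - lrv\<bar> / 2 + lrv\<^sup>2 / (8 * real (k j)))"
      proof (rule integral_mono')
        show "integrable M (\<lambda>\<omega>. 8 * s * Cu \<omega> + 8 * E2 \<omega> + 8 * W \<omega> + \<bar>emp_var x (b j) (N j) \<omega> - lrv\<bar> / 2 + lrv\<^sup>2 / (8 * real (k j)))"
          using iCu iE2 iW iV by auto
        show "0 \<le> 8 * s * Cu \<omega> + 8 * E2 \<omega> + 8 * W \<omega> + \<bar>emp_var x (b j) (N j) \<omega> - lrv\<bar> / 2 + lrv\<^sup>2 / (8 * real (k j))" for \<omega>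
          by (rule order_trans[OF norm_ge_zero ptw])
      qed (rule ptw)
      also have "\<dots> = 8 * s * expectation Cu + 8 * expectation E2 + 8 * expectation W + V j / 2 + lrv\<^sup>2 / (8 * real (k j))"
        using iCu iE2 iW iV by (simp add: V_def prob_space)
      also have "\<dots> \<le> 8 * s * (1 + Y.C4) + 8 * \<eta> + 8 * Q j + V j / 2 + lrv\<^sup>2 / (8 * real (k j))"
        using mult_left_mono[OF eCu, of "8 * s"] s eE2 eW by linarith
      also have "\<dots> = g j + \<eta> * 8" by (simp add: g_def s_def field_simps)
      finally show ?thesis .
    qed
    with g0 show "\<exists>g. g \<longlonglongrightarrow> 0 \<and> (\<forall>\<^sub>F j in sequentially. (\<integral>\<omega>. cmod (avg (N j) (\<lambda>t. iexp (cblk x (b j) (N j) t \<omega> / sqrt (real (k j)))) ^ k j - complex_of_real (exp (- lrv / 2))) \<partial>M) \<le> g j + \<eta> * 8)"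
      by (intro exI[of _ g]) simp
  qed simp
qed

end

end

section \<open>Bernoulli shifts with coupled innovations\<close>

lemma sum_lag_le:
  fixes \<phi> :: "nat \<Rightarrow> real"
  assumes "\<And>h. 0 \<le> \<phi> h" "i < b"
  shows "(\<Sum>j<b. \<phi> (if i \<le> j then j - i else i - j)) \<le> \<phi> 0 + 2 * (\<Sum>h<b. \<phi> (Suc h))"
proof -
  have "(\<Sum>j<b. \<phi> (if i \<le> j then j - i else i - j)) =
     (\<Sum>j\<in>{..<i}. \<phi> (i - j)) + \<phi> 0 + (\<Sum>j\<in>{Suc i..<b}. \<phi> (j - i))"
  proof -
    have "{..<b} = {..<i} \<union> {i} \<union> {Suc i..<b}" using assms(2) by auto
    then have "(\<Sum>j<b. \<phi> (if i \<le> j then j - i else i - j)) =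
       (\<Sum>j\<in>{..<i} \<union> {i} \<union> {Suc i..<b}. \<phi> (if i \<le> j then j - i else i - j))" by simp
    also have "\<dots> = (\<Sum>j\<in>{..<i}. \<phi> (if i \<le> j then j - i else i - j)) + \<phi> 0 + (\<Sum>j\<in>{Suc i..<b}. \<phi> (if i \<le> j then j - i else i - j))"
      by (subst sum.union_disjoint; (subst sum.union_disjoint)?) auto
    finally show ?thesis by simp
  qed
  also have "(\<Sum>j\<in>{..<i}. \<phi> (i - j)) \<le> (\<Sum>h<b. \<phi> (Suc h))"
  proof -
    have "(\<Sum>j\<in>{..<i}. \<phi> (i - j)) = (\<Sum>h<i. \<phi> (Suc h))"
      by (rule sum.reindex_bij_witness[where i = "\<lambda>h. i - Suc h" and j = "\<lambda>j. i - Suc j"]) (auto simp: Suc_diff_Suc)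
    also have "\<dots> \<le> (\<Sum>h<b. \<phi> (Suc h))" using assms by (intro sum_mono2) auto
    finally show ?thesis .
  qed
  also have "(\<Sum>j\<in>{Suc i..<b}. \<phi> (j - i)) \<le> (\<Sum>h<b. \<phi> (Suc h))"
  proof -
    have "(\<Sum>j\<in>{Suc i..<b}. \<phi> (j - i)) = (\<Sum>h<b - Suc i. \<phi> (Suc h))"
      by (rule sum.reindex_bij_witness[where i = "\<lambda>h. h + Suc i" and j = "\<lambda>j. j - Suc i"]) (auto simp: Suc_diff_Suc Suc_le_eq)
    also have "\<dots> \<le> (\<Sum>h<b. \<phi> (Suc h))" using assms by (intro sum_mono2) auto
    finally show ?thesis .
  qed
  finally show ?thesis by simp
qed

text \<open>Row sums of the Gram matrix are dominated by a two-sided sum over lags, so a covariance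
  bound summable in the lag gives linear growth in \<open>b\<close>.\<close>

lemma (in prob_space) second_moment_sum_lag:
  fixes W :: "nat \<Rightarrow> 'a \<Rightarrow> 'b::{real_inner, banach, second_countable_topology}"
  assumes W: "\<And>t. sqint M (W t)" and \<phi>: "\<And>h. 0 \<le> \<phi> h"
    and cov: "\<And>s t. s \<le> t \<Longrightarrow> \<bar>\<integral>\<omega>. W s \<omega> \<bullet> W t \<omega> \<partial>M\<bar> \<le> \<phi> (t - s)"
    and R: "\<And>b. \<phi> 0 + 2 * (\<Sum>h<b. \<phi> (Suc h)) \<le> R"
  shows "(\<integral>\<omega>. (norm (\<Sum>t<b. W t \<omega>))\<^sup>2 \<partial>M) \<le> real b * R"
proof -
  have "(\<integral>\<omega>. (norm (\<Sum>t<b. W t \<omega>))\<^sup>2 \<partial>M) = (\<integral>\<omega>. (\<Sum>s<b. \<Sum>t<b. W s \<omega> \<bullet> W t \<omega>) \<partial>M)"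
    by (simp add: power2_norm_eq_inner inner_sum_left inner_sum_right) (subst sum.swap, rule refl)
  also have "\<dots> = (\<Sum>s<b. \<Sum>t<b. \<integral>\<omega>. W s \<omega> \<bullet> W t \<omega> \<partial>M)"
    by (subst Bochner_Integration.integral_sum;
        (intro sum.cong refl Bochner_Integration.integral_sum Bochner_Integration.integrable_sum sqint_inner_integrable W)?)
  also have "\<dots> \<le> (\<Sum>s<b. R)"
  proof (rule sum_mono)
    fix s assume s: "s \<in> {..<b}"
    have "(\<Sum>t<b. \<integral>\<omega>. W s \<omega> \<bullet> W t \<omega> \<partial>M) \<le> (\<Sum>t<b. \<phi> (if s \<le> t then t - s else s - t))"
    proof (rule sum_mono)
      fix t
      show "(\<integral>\<omega>. W s \<omega> \<bullet> W t \<omega> \<partial>M) \<le> \<phi> (if s \<le> t then t - s else s - t)"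
        using cov[of s t] cov[of t s] by (cases "s \<le> t") (auto simp: inner_commute abs_le_iff)
    qed
    also have "\<dots> \<le> \<phi> 0 + 2 * (\<Sum>h<b. \<phi> (Suc h))" using s by (intro sum_lag_le \<phi>) auto
    also have "\<dots> \<le> R" by (rule R)
    finally show "(\<Sum>t<b. \<integral>\<omega>. W s \<omega> \<bullet> W t \<omega> \<partial>M) \<le> R" .
  qed
  finally show ?thesis by simp
qed

locale m_approx = prob_space M for M :: "'w measure" +
  fixes X :: "int \<Rightarrow> 'w \<Rightarrow> L2" and f :: "(nat \<Rightarrow> L2) \<Rightarrow> L2" and \<delta> :: "int \<Rightarrow> 'w \<Rightarrow> L2"
    and \<delta>' :: "nat \<Rightarrow> int \<Rightarrow> int \<Rightarrow> 'w \<Rightarrow> L2"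
  assumes X_measurable [measurable]: "\<And>t. X t \<in> borel_measurable M"
    and X_mean: "\<And>t. (\<integral>\<omega>. X t \<omega> \<partial>M) = 0"
    and X_approx: "L2_m_approximable M X f \<delta> \<delta>'"
    and X_rate: "\<And>t. (\<lambda>m. real m * approx_error M X f \<delta> \<delta>' t m) \<longlonglongrightarrow> 0"
begin

text \<open>Innovations and copies form one independent family, so that each variable and each
  coupled variable is \<open>f\<close> applied to a reindexing of it.\<close>

definition Z :: "int + nat \<times> int \<times> int \<Rightarrow> 'w \<Rightarrow> L2" where
  "Z = case_sum \<delta> (\<lambda>(m, t, k). \<delta>' m t k)"

lemma f_measurable [measurable]: "f \<in> borel_measurable (PiM UNIV (\<lambda>_. borel))"
  using X_approx by (simp add: L2_m_approximable_def)

sublocale innovations M Z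
  by unfold_locales (use X_approx in \<open>simp add: L2_m_approximable_def Z_def\<close>)

lemma Z_law: "distr M borel (Z i) = distr M borel (\<delta> 0)"
  using X_approx by (auto simp: L2_m_approximable_def Z_def split: sum.split prod.split)

definition idx :: "int \<Rightarrow> nat \<Rightarrow> int + nat \<times> int \<times> int" where
  "idx t j = Inl (t - int j)"

definition cidx :: "nat \<Rightarrow> int \<Rightarrow> nat \<Rightarrow> int + nat \<times> int \<times> int" where
  "cidx m t j = (if j < m then Inl (t - int j) else Inr (m, t, t - int j))"

text \<open>A version of \<open>X t\<close> that is exactly a function of the innovations. The
  representation of \<open>X\<close> holds almost everywhere only, which would not give
  measurability with respect to \<open>gen\<close>.\<close>

definition Xf :: "int \<Rightarrow> 'w \<Rightarrow> L2" where "Xf t \<omega> = f (\<lambda>j. Z (idx t j) \<omega>)"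

definition Xm :: "nat \<Rightarrow> int \<Rightarrow> 'w \<Rightarrow> L2" where "Xm m t \<omega> = f (\<lambda>j. Z (cidx m t j) \<omega>)"

lemma Xm_coupled: "m_coupled f \<delta> \<delta>' t m = Xm m t"
  by (simp add: m_coupled_def Xm_def cidx_def Z_def fun_eq_iff if_distrib[of "\<lambda>i. Z i _"] cong: if_cong)
     (auto intro!: arg_cong[where f = f])

lemma AE_X: "AE \<omega> in M. \<forall>t. X t \<omega> = Xf t \<omega>"
  using X_approx by (subst AE_all_countable) (auto simp: L2_m_approximable_def Xf_def idx_def Z_def)

definition past :: "int \<Rightarrow> (int + nat \<times> int \<times> int) set" where
  "past t = range (idx t)"

definition window :: "nat \<Rightarrow> int \<Rightarrow> (int + nat \<times> int \<times> int) set" where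
  "window m t = range (cidx m t)"

lemma gen_sequence:
  assumes "\<And>j. \<pi> j \<in> K"
  shows "(\<lambda>\<omega>. f (\<lambda>j. Z (\<pi> j) \<omega>)) \<in> borel_measurable (gen K)"
proof (rule measurable_compose[OF _ f_measurable])
  have "(\<lambda>\<omega>. \<lambda>j\<in>UNIV. Z (\<pi> j) \<omega>) \<in> gen K \<rightarrow>\<^sub>M PiM UNIV (\<lambda>_. borel)"
    by (intro measurable_restrict Z_gen assms)
  then show "(\<lambda>\<omega> j. Z (\<pi> j) \<omega>) \<in> gen K \<rightarrow>\<^sub>M PiM UNIV (\<lambda>_. borel)" by (simp add: restrict_UNIV)
qed

lemma Xf_gen: "Xf t \<in> borel_measurable (gen (past t))"
  unfolding Xf_def[abs_def] past_def by (rule gen_sequence) auto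

lemma Xm_gen: "Xm m t \<in> borel_measurable (gen (window m t))"
  unfolding Xm_def[abs_def] window_def by (rule gen_sequence) auto

lemma Xf_measurable [measurable]: "Xf t \<in> borel_measurable M"
  by (rule gen_M[OF Xf_gen])

lemma Xm_measurable [measurable]: "Xm m t \<in> borel_measurable M"
  by (rule gen_M[OF Xm_gen])

text \<open>Each window keeps \<open>m\<close> consecutive innovations, and these do not meet; the
  replaced ones carry the time of the variable in their index.\<close>

lemma window_window_disjoint: "s + int m \<le> t \<Longrightarrow> 1 \<le> m \<Longrightarrow> window m s \<inter> window m t = {}"
  by (auto simp: window_def cidx_def split: if_splits)

text \<open>With a coupling depth at most the distance in time, \<open>Xm h t\<close> uses
  innovations later than \<open>s\<close> and copies tagged with \<open>t\<close>. It is thus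
  independent of \<open>Xf s\<close> and \<open>Xm m s\<close> jointly, whatever their depth
  \<open>m\<close>.\<close>

lemma window_window_disjoint': "s < t \<Longrightarrow> s + int h \<le> t \<Longrightarrow> (past s \<union> window m s) \<inter> window h t = {}"
  by (auto simp: window_def past_def cidx_def idx_def split: if_splits)

lemma expectation_reindex:
  fixes \<Psi> :: "('j \<Rightarrow> L2) \<Rightarrow> 'c::{banach, second_countable_topology}"
  assumes "inj \<pi>" "inj \<pi>'" and [measurable]: "\<Psi> \<in> borel_measurable (PiM UNIV (\<lambda>_. borel))"
  shows "(\<integral>\<omega>. \<Psi> (\<lambda>j. Z (\<pi> j) \<omega>) \<partial>M) = (\<integral>\<omega>. \<Psi> (\<lambda>j. Z (\<pi>' j) \<omega>) \<partial>M)"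
    and "integrable M (\<lambda>\<omega>. \<Psi> (\<lambda>j. Z (\<pi> j) \<omega>)) \<longleftrightarrow> integrable M (\<lambda>\<omega>. \<Psi> (\<lambda>j. Z (\<pi>' j) \<omega>))"
proof -
  have m: "(\<lambda>\<omega> j. Z (\<sigma> j) \<omega>) \<in> M \<rightarrow>\<^sub>M PiM UNIV (\<lambda>_. borel)" for \<sigma> :: "'j \<Rightarrow> _"
  proof -
    have "(\<lambda>\<omega>. \<lambda>j\<in>UNIV. Z (\<sigma> j) \<omega>) \<in> M \<rightarrow>\<^sub>M PiM UNIV (\<lambda>_. borel)" by (intro measurable_restrict) simp
    then show ?thesis by (simp add: restrict_UNIV)
  qed
  have D: "distr M (PiM UNIV (\<lambda>_. borel)) (\<lambda>\<omega> j. Z (\<pi> j) \<omega>) = distr M (PiM UNIV (\<lambda>_. borel)) (\<lambda>\<omega> j. Z (\<pi>' j) \<omega>)"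
    unfolding law_reindex[OF assms(1) Z_law] law_reindex[OF assms(2) Z_law] ..
  show "(\<integral>\<omega>. \<Psi> (\<lambda>j. Z (\<pi> j) \<omega>) \<partial>M) = (\<integral>\<omega>. \<Psi> (\<lambda>j. Z (\<pi>' j) \<omega>) \<partial>M)"
    using integral_distr[OF m[of \<pi>] assms(3)] integral_distr[OF m[of \<pi>'] assms(3)] unfolding D by simp
  show "integrable M (\<lambda>\<omega>. \<Psi> (\<lambda>j. Z (\<pi> j) \<omega>)) \<longleftrightarrow> integrable M (\<lambda>\<omega>. \<Psi> (\<lambda>j. Z (\<pi>' j) \<omega>))"
    using integrable_distr_eq[OF m[of \<pi>] assms(3)] integrable_distr_eq[OF m[of \<pi>'] assms(3)] unfolding D by simp
qed

lemma inj_idx: "inj (idx t)"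
  by (auto simp: inj_def idx_def)

lemma inj_cidx: "inj (cidx m t)"
  by (auto simp: inj_def cidx_def split: if_splits)

text \<open>Moves the time tags of the copies along with the innovations, so that a variable and its
  coupled version are shifted jointly.\<close>

definition shift :: "int \<Rightarrow> int + nat \<times> int \<times> int \<Rightarrow> int + nat \<times> int \<times> int" where
  "shift r = map_sum (\<lambda>s. s + r) (\<lambda>(m, t, k). (m, t + r, k + r))"

lemma inj_shift: "inj (shift r)"
  unfolding inj_def shift_def by (auto simp: map_sum_def split: sum.splits)

lemma shift_idx: "shift r (idx t j) = idx (t + r) j"
  by (simp add: shift_def idx_def)

lemma shift_cidx: "shift r (cidx m t j) = cidx m (t + r) j"
  by (simp add: shift_def cidx_def)

text \<open>The index sequences of a variable and of its coupled version are both injective, so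
  \<open>f\<close> sees the same product law through either.\<close>

lemma same_law:
  fixes g :: "L2 \<Rightarrow> 'c::{banach, second_countable_topology}"
  assumes [measurable]: "g \<in> borel_measurable borel"
  shows "(\<integral>\<omega>. g (Xf t \<omega>) \<partial>M) = (\<integral>\<omega>. g (Xf 0 \<omega>) \<partial>M)"
    and "(\<integral>\<omega>. g (Xm m t \<omega>) \<partial>M) = (\<integral>\<omega>. g (Xf 0 \<omega>) \<partial>M)"
    and "integrable M (\<lambda>\<omega>. g (Xf t \<omega>)) \<longleftrightarrow> integrable M (\<lambda>\<omega>. g (Xf 0 \<omega>))"
    and "integrable M (\<lambda>\<omega>. g (Xm m t \<omega>)) \<longleftrightarrow> integrable M (\<lambda>\<omega>. g (Xf 0 \<omega>))"
  unfolding Xf_def Xm_def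
  by (rule expectation_reindex[where \<Psi> = "\<lambda>z. g (f z)"]; (rule inj_idx inj_cidx | measurable))+

lemma Xf_sqint: "sqint M (Xf t)" and Xm_sqint: "sqint M (Xm m t)"
proof -
  have "integrable M (\<lambda>\<omega>. (norm (X 0 \<omega>))\<^sup>2)" using X_approx by (simp add: L2_m_approximable_def)
  moreover have "AE \<omega> in M. (norm (X 0 \<omega>))\<^sup>2 = (norm (Xf 0 \<omega>))\<^sup>2" using AE_X by eventually_elim simp
  ultimately have "integrable M (\<lambda>\<omega>. (norm (Xf 0 \<omega>))\<^sup>2)"
    by (subst integrable_cong_AE[symmetric]) auto
  then show "sqint M (Xf t)" "sqint M (Xm m t)"
    using same_law(3)[of "\<lambda>x. (norm x)\<^sup>2" t] same_law(4)[of "\<lambda>x. (norm x)\<^sup>2" m t] by (simp_all add: sqint_def)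
qed

lemma Xf_mean: "(\<integral>\<omega>. Xf t \<omega> \<partial>M) = 0" and Xm_mean: "(\<integral>\<omega>. Xm m t \<omega> \<partial>M) = 0"
proof -
  have "(\<integral>\<omega>. Xf 0 \<omega> \<partial>M) = (\<integral>\<omega>. X 0 \<omega> \<partial>M)"
    using AE_X by (intro integral_cong_AE) auto
  then have "(\<integral>\<omega>. Xf 0 \<omega> \<partial>M) = 0" by (simp add: X_mean)
  then show "(\<integral>\<omega>. Xf t \<omega> \<partial>M) = 0" "(\<integral>\<omega>. Xm m t \<omega> \<partial>M) = 0"
    using same_law(1)[of "\<lambda>x. x" t] same_law(2)[of "\<lambda>x. x" m t] by simp_all
qed

definition err :: "nat \<Rightarrow> real" where
  "err m = nrm2 M (\<lambda>\<omega>. Xf 0 \<omega> - Xm m 0 \<omega>)"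

lemma err_nonneg [simp]: "0 \<le> err m"
  by (simp add: err_def)

lemma shift_expectation:
  fixes \<Psi> :: "(int + nat \<times> int \<times> int \<Rightarrow> L2) \<Rightarrow> 'c::{banach, second_countable_topology}"
  assumes "\<Psi> \<in> borel_measurable (PiM UNIV (\<lambda>_. borel))"
  shows "(\<integral>\<omega>. \<Psi> (\<lambda>i. Z (shift r i) \<omega>) \<partial>M) = (\<integral>\<omega>. \<Psi> (\<lambda>i. Z i \<omega>) \<partial>M)"
  using expectation_reindex(1)[OF inj_shift inj_on_id2 assms] by simp

lemma f_reindex_measurable [measurable]:
  "(\<lambda>z. f (\<lambda>j. z (\<pi> j))) \<in> borel_measurable (PiM UNIV (\<lambda>_. borel))"
proof (rule measurable_compose[OF _ f_measurable])
  have "(\<lambda>z. \<lambda>j\<in>UNIV. z (\<pi> j)) \<in> PiM UNIV (\<lambda>_. borel) \<rightarrow>\<^sub>M PiM UNIV (\<lambda>_. borel :: L2 measure)"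
    by (intro measurable_restrict) simp
  then show "(\<lambda>z j. z (\<pi> j)) \<in> PiM UNIV (\<lambda>_. borel) \<rightarrow>\<^sub>M PiM UNIV (\<lambda>_. borel :: L2 measure)" by (simp add: restrict_UNIV)
qed

lemma err_eq: "nrm2 M (\<lambda>\<omega>. Xf t \<omega> - Xm m t \<omega>) = err m"
proof -
  have "(\<integral>\<omega>. (norm (Xf t \<omega> - Xm m t \<omega>))\<^sup>2 \<partial>M) = (\<integral>\<omega>. (norm (Xf 0 \<omega> - Xm m 0 \<omega>))\<^sup>2 \<partial>M)"
    using shift_expectation[of "\<lambda>z. (norm (f (\<lambda>j. z (idx 0 j)) - f (\<lambda>j. z (cidx m 0 j))))\<^sup>2" t]
    by (simp add: shift_idx shift_cidx Xf_def Xm_def)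
  then show ?thesis by (simp add: err_def nrm2_def)
qed

lemma err_approx_error: "approx_error M X f \<delta> \<delta>' t m = err m"
proof -
  have "(\<integral>\<omega>. (norm (X t \<omega> - m_coupled f \<delta> \<delta>' t m \<omega>))\<^sup>2 \<partial>M) = (\<integral>\<omega>. (norm (Xf t \<omega> - Xm m t \<omega>))\<^sup>2 \<partial>M)"
    unfolding Xm_coupled using AE_X by (intro integral_cong_AE) (auto elim: eventually_mono)
  then show ?thesis using err_eq[of t m] by (simp add: approx_error_def nrm2_def)
qed

lemma err_summable: "summable (\<lambda>m. err (Suc m))"
  using X_approx unfolding L2_m_approximable_def err_approx_error by blast

lemma err_rate: "(\<lambda>m. real m * err m) \<longlonglongrightarrow> 0"
  using X_rate[of 0] unfolding err_approx_error .

definition err_sum :: real where "err_sum = (\<Sum>m. err (Suc m))"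

lemma err_sum_le: "(\<Sum>h<b. err (Suc h)) \<le> err_sum"
  unfolding err_sum_def by (rule sum_le_suminf[OF err_summable]) auto

lemma err_sum_nonneg: "0 \<le> err_sum"
  using err_sum_le[of 0] by simp

lemma err_tendsto: "err \<longlonglongrightarrow> 0"
  using summable_LIMSEQ_zero[OF err_summable] by (rule LIMSEQ_imp_Suc)

section \<open>Covariance bounds for linear images of the process\<close>

context
  fixes T :: "L2 \<Rightarrow> 'c::{real_inner, banach, second_countable_topology}" and c :: real
  assumes T_linear: "bounded_linear T" and T_bound: "\<And>x. norm (T x) \<le> c * norm x"
begin

lemma T_measurable [measurable]: "T \<in> borel_measurable borel"
  by (intro borel_measurable_continuous_onI linear_continuous_on T_linear)

lemma T_diff: "T (x - y) = T x - T y"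
  by (rule linear_diff[OF bounded_linear.linear[OF T_linear]])

lemma T_sqint:
  assumes "sqint M Y"
  shows "sqint M (\<lambda>\<omega>. T (Y \<omega>))"
proof (rule sqint_mono[OF sqint_scaleR[OF assms, of c]])
  show "(\<lambda>\<omega>. T (Y \<omega>)) \<in> borel_measurable M" using assms by measurable
  show "norm (T (Y \<omega>)) \<le> norm (c *\<^sub>R Y \<omega>)" for \<omega>
    using T_bound[of "Y \<omega>"] by (simp add: order_trans[OF _ mult_right_mono[OF abs_ge_self]])
qed

lemma T_nrm2:
  assumes "sqint M Y" "0 \<le> c"
  shows "nrm2 M (\<lambda>\<omega>. T (Y \<omega>)) \<le> c * nrm2 M Y"
proof -
  have "nrm2 M (\<lambda>\<omega>. T (Y \<omega>)) \<le> nrm2 M (\<lambda>\<omega>. c *\<^sub>R Y \<omega>)"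
    using T_bound assms by (intro nrm2_mono sqint_scaleR) auto
  then show ?thesis using assms(2) by (simp add: nrm2_scaleR)
qed

lemma T_mean: "sqint M Y \<Longrightarrow> (\<integral>\<omega>. Y \<omega> \<partial>M) = 0 \<Longrightarrow> (\<integral>\<omega>. T (Y \<omega>) \<partial>M) = 0"
  using integral_bounded_linear[OF T_linear sqint_integrable, of Y]
  by (simp add: linear_0[OF bounded_linear.linear[OF T_linear]])

lemma T_gen: "Y \<in> borel_measurable (gen K) \<Longrightarrow> (\<lambda>\<omega>. T (Y \<omega>)) \<in> borel_measurable (gen K)"
  by measurable

text \<open>Coupling \<open>Xf t\<close> at a depth equal to the distance in time makes it
  independent of everything \<open>Y\<close> may use, so only the coupling error contributes to the
  covariance.\<close>

lemma T_cov_past: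
  assumes "s < t" "0 \<le> c" "sqint M Y" "Y \<in> borel_measurable (gen (past s \<union> window m s))"
  shows "\<bar>\<integral>\<omega>. Y \<omega> \<bullet> T (Xf t \<omega>) \<partial>M\<bar> \<le> nrm2 M Y * (c * err (nat (t - s)))"
proof -
  define h where "h = nat (t - s)"
  have h: "s + int h \<le> t" using assms(1) by (simp add: h_def)
  have "(\<integral>\<omega>. Y \<omega> \<bullet> T (Xm h t \<omega>) \<partial>M) = 0"
    by (rule expectation_inner_indep[OF assms(3) T_sqint[OF Xm_sqint]
        gen_indep_var[OF window_window_disjoint'[OF assms(1) h] assms(4) T_gen[OF Xm_gen]] T_mean[OF Xm_sqint Xm_mean]])
  moreover have "(\<integral>\<omega>. Y \<omega> \<bullet> T (Xf t \<omega> - Xm h t \<omega>) \<partial>M) = (\<integral>\<omega>. Y \<omega> \<bullet> T (Xf t \<omega>) \<partial>M) - (\<integral>\<omega>. Y \<omega> \<bullet> T (Xm h t \<omega>) \<partial>M)"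
    unfolding T_diff inner_diff_right
    by (intro Bochner_Integration.integral_diff sqint_inner_integrable assms(3) T_sqint Xf_sqint Xm_sqint)
  ultimately have "\<bar>\<integral>\<omega>. Y \<omega> \<bullet> T (Xf t \<omega>) \<partial>M\<bar> = \<bar>\<integral>\<omega>. Y \<omega> \<bullet> T (Xf t \<omega> - Xm h t \<omega>) \<partial>M\<bar>" by simp
  also have "\<dots> \<le> nrm2 M Y * nrm2 M (\<lambda>\<omega>. T (Xf t \<omega> - Xm h t \<omega>))"
    by (intro abs_expectation_inner_le assms(3) T_sqint sqint_diff Xf_sqint Xm_sqint)
  also have "\<dots> \<le> nrm2 M Y * (c * err h)"
    using T_nrm2[OF sqint_diff[OF Xf_sqint Xm_sqint] assms(2), of t h t] by (intro mult_left_mono) (auto simp: err_eq)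
  finally show ?thesis by (simp add: h_def)
qed

text \<open>The covariance at lag \<open>h\<close> is at most \<open>a * c * err h\<close>, with
  \<open>a\<close> the norm of \<open>T (Xf 0)\<close>. Keeping the factor \<open>a\<close> in front
  is essential: for the residual of a projection it tends to zero as the projection grows, while
  \<open>c = 1\<close> stays.\<close>

lemma T_bsum_bound:
  assumes c: "0 \<le> c"
  shows "(\<integral>\<omega>. (norm (bsum (\<lambda>t \<omega>. T (Xf t \<omega>)) t b \<omega>))\<^sup>2 \<partial>M)
    \<le> real b * (nrm2 M (\<lambda>\<omega>. T (Xf 0 \<omega>)) * (nrm2 M (\<lambda>\<omega>. T (Xf 0 \<omega>)) + 2 * c * err_sum))"
proof -
  define a where "a = nrm2 M (\<lambda>\<omega>. T (Xf 0 \<omega>))"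
  have a: "nrm2 M (\<lambda>\<omega>. T (Xf s \<omega>)) = a" for s
    using same_law(1)[of "\<lambda>x. (norm (T x))\<^sup>2" s] by (simp add: a_def nrm2_def)
  define \<phi> where "\<phi> h = (if h = 0 then a * a else a * (c * err h))" for h
  show ?thesis
    unfolding bsum_def a_def[symmetric]
  proof (rule second_moment_sum_lag[where \<phi> = \<phi>])
    show "0 \<le> \<phi> h" for h using c by (simp add: \<phi>_def a_def)
    show "sqint M (\<lambda>\<omega>. T (Xf s \<omega>))" for s by (intro T_sqint Xf_sqint)
    show "\<bar>\<integral>\<omega>. T (Xf (t + int i) \<omega>) \<bullet> T (Xf (t + int j) \<omega>) \<partial>M\<bar> \<le> \<phi> (j - i)" if "i \<le> j" for i j
    proof (cases "i = j")
      case True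
      then show ?thesis
        using abs_expectation_inner_le[OF T_sqint[OF Xf_sqint[of "t + int j"]] T_sqint[OF Xf_sqint[of "t + int j"]]]
        by (simp add: \<phi>_def a)
    next
      case False
      then have lt: "t + int i < t + int j" using that by simp
      \<comment> \<open>The window of depth zero only enlarges the index set to the form of the
        covariance bound.\<close>
      have "(\<lambda>\<omega>. T (Xf (t + int i) \<omega>)) \<in> borel_measurable (gen (past (t + int i) \<union> window 0 (t + int i)))"
        by (rule gen_mono[OF _ T_gen[OF Xf_gen]]) simp
      from T_cov_past[OF lt c T_sqint[OF Xf_sqint] this] show ?thesis
        using False that by (simp add: \<phi>_def a nat_diff_distrib')
    qed
    show "\<phi> 0 + 2 * (\<Sum>h<b. \<phi> (Suc h)) \<le> a * (a + 2 * c * err_sum)" for b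
    proof -
      have "(\<Sum>h<b. \<phi> (Suc h)) = a * c * (\<Sum>h<b. err (Suc h))" by (simp add: \<phi>_def sum_distrib_left mult_ac)
      also have "\<dots> \<le> a * c * err_sum" using c by (intro mult_left_mono err_sum_le) (simp add: a_def)
      finally show ?thesis by (simp add: \<phi>_def algebra_simps)
    qed
  qed
qed

text \<open>Below lag \<open>m\<close>, Cauchy-Schwarz bounds each covariance by the square of
  \<open>c * err m\<close>, which produces the product \<open>m * err m\<close>. From lag
  \<open>m\<close> on, the coupled part of the later difference is independent of the earlier one,
  and what remains is of order \<open>err m * err h\<close>, summable in the lag
  \<open>h\<close>.\<close>

lemma T_coupling_bound:
  assumes c: "0 \<le> c" and m: "1 \<le> m"
  shows "(\<integral>\<omega>. (norm (bsum (\<lambda>t \<omega>. T (Xf t \<omega>) - T (Xm m t \<omega>)) t b \<omega>))\<^sup>2 \<partial>M)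
    \<le> real b * (c\<^sup>2 * (2 * (real m * err m) * err m + 2 * err m * err_sum))"
proof -
  define D where "D s \<omega> = T (Xf s \<omega>) - T (Xm m s \<omega>)" for s \<omega>
  have D_alt: "D s = (\<lambda>\<omega>. T (Xf s \<omega> - Xm m s \<omega>))" for s by (simp add: D_def T_diff fun_eq_iff)
  have D_sq: "sqint M (D s)" for s unfolding D_def[abs_def] by (intro sqint_diff T_sqint Xf_sqint Xm_sqint)
  have D_nrm: "nrm2 M (D s) \<le> c * err m" for s
    unfolding D_alt using T_nrm2[OF sqint_diff[OF Xf_sqint Xm_sqint] c, of s m s] by (simp add: err_eq)
  have D_gen: "D s \<in> borel_measurable (gen (past s \<union> window m s))" for s
  proof -
    have "(\<lambda>\<omega>. T (Xf s \<omega>)) \<in> borel_measurable (gen (past s \<union> window m s))"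
      by (rule gen_mono[OF _ T_gen[OF Xf_gen]]) simp
    moreover have "(\<lambda>\<omega>. T (Xm m s \<omega>)) \<in> borel_measurable (gen (past s \<union> window m s))"
      by (rule gen_mono[OF _ T_gen[OF Xm_gen]]) simp
    ultimately show ?thesis unfolding D_def[abs_def] by measurable
  qed
  define \<phi> where "\<phi> h = (if h < m then (c * err m) * (c * err m) else (c * err m) * (c * err h))" for h
  show ?thesis
    unfolding bsum_def D_def[symmetric]
  proof (rule second_moment_sum_lag[OF D_sq, where \<phi> = \<phi>])
    show "0 \<le> \<phi> h" for h using c by (simp add: \<phi>_def)
    show "\<bar>\<integral>\<omega>. D (t + int i) \<omega> \<bullet> D (t + int j) \<omega> \<partial>M\<bar> \<le> \<phi> (j - i)" if ij: "i \<le> j" for i j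
    proof (cases "j - i < m")
      case True
      have "\<bar>\<integral>\<omega>. D (t + int i) \<omega> \<bullet> D (t + int j) \<omega> \<partial>M\<bar> \<le> nrm2 M (D (t + int i)) * nrm2 M (D (t + int j))"
        by (rule abs_expectation_inner_le[OF D_sq D_sq])
      also have "\<dots> \<le> (c * err m) * (c * err m)" using c by (intro mult_mono D_nrm) auto
      finally show ?thesis using True by (simp add: \<phi>_def)
    next
      case False
      then have lt: "t + int i < t + int j" and far: "t + int i + int m \<le> t + int j" using m by auto
      have "(\<integral>\<omega>. D (t + int i) \<omega> \<bullet> T (Xm m (t + int j) \<omega>) \<partial>M) = 0"
        by (rule expectation_inner_indep[OF D_sq T_sqint[OF Xm_sqint]
          gen_indep_var[OF window_window_disjoint'[OF lt far] D_gen T_gen[OF Xm_gen]] T_mean[OF Xm_sqint Xm_mean]])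
      moreover have "(\<integral>\<omega>. D (t + int i) \<omega> \<bullet> D (t + int j) \<omega> \<partial>M) =
        (\<integral>\<omega>. D (t + int i) \<omega> \<bullet> T (Xf (t + int j) \<omega>) \<partial>M) - (\<integral>\<omega>. D (t + int i) \<omega> \<bullet> T (Xm m (t + int j) \<omega>) \<partial>M)"
        unfolding D_def[of "t + int j"] inner_diff_right
        by (intro Bochner_Integration.integral_diff sqint_inner_integrable D_sq T_sqint Xf_sqint Xm_sqint)
      ultimately have "\<bar>\<integral>\<omega>. D (t + int i) \<omega> \<bullet> D (t + int j) \<omega> \<partial>M\<bar> \<le> nrm2 M (D (t + int i)) * (c * err (nat (t + int j - (t + int i))))"
        using T_cov_past[OF lt c D_sq D_gen] by simp
      also have "\<dots> \<le> (c * err m) * (c * err (nat (t + int j - (t + int i))))"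
        using c by (intro mult_right_mono D_nrm) auto
      finally show ?thesis using False ij by (simp add: \<phi>_def nat_diff_distrib')
    qed
    show "\<phi> 0 + 2 * (\<Sum>h<b. \<phi> (Suc h)) \<le> c\<^sup>2 * (2 * (real m * err m) * err m + 2 * err m * err_sum)" for b
    proof -
      have "\<phi> (Suc h) \<le> (if Suc h < m then c\<^sup>2 * (err m * err m) else 0) + c\<^sup>2 * err m * err (Suc h)" for h
        using c by (simp add: \<phi>_def power2_eq_square mult_ac)
      then have "(\<Sum>h<b. \<phi> (Suc h)) \<le> (\<Sum>h<b. (if Suc h < m then c\<^sup>2 * (err m * err m) else 0) + c\<^sup>2 * err m * err (Suc h))"
        by (intro sum_mono)
      also have "\<dots> = (\<Sum>h<b. if Suc h < m then c\<^sup>2 * (err m * err m) else 0) + c\<^sup>2 * err m * (\<Sum>h<b. err (Suc h))"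
        by (simp add: sum.distrib sum_distrib_left)
      also have "(\<Sum>h<b. if Suc h < m then c\<^sup>2 * (err m * err m) else 0) \<le> (real m - 1) * (c\<^sup>2 * (err m * err m))"
      proof -
        have "(\<Sum>h<b. if Suc h < m then c\<^sup>2 * (err m * err m) else 0) = (\<Sum>h\<in>{..<b} \<inter> {h. Suc h < m}. c\<^sup>2 * (err m * err m))"
          by (simp only: sum.inter_restrict finite_lessThan mem_Collect_eq)
        also have "\<dots> = real (card ({..<b} \<inter> {h. Suc h < m})) * (c\<^sup>2 * (err m * err m))" by simp
        also have "\<dots> \<le> (real m - 1) * (c\<^sup>2 * (err m * err m))"
        proof (rule mult_right_mono)
          have "{..<b} \<inter> {h. Suc h < m} \<subseteq> {..<m - 1}" by auto
          then have "card ({..<b} \<inter> {h. Suc h < m}) \<le> m - 1" using card_mono[of "{..<m - 1}"] by fastforce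
          then show "real (card ({..<b} \<inter> {h. Suc h < m})) \<le> real m - 1" using m by linarith
        qed simp
        finally show ?thesis .
      qed
      also have "c\<^sup>2 * err m * (\<Sum>h<b. err (Suc h)) \<le> c\<^sup>2 * err m * err_sum"
        by (intro mult_left_mono err_sum_le) auto
      finally have S: "(\<Sum>h<b. \<phi> (Suc h)) \<le> (real m - 1) * (c\<^sup>2 * (err m * err m)) + c\<^sup>2 * err m * err_sum" by simp
      have "\<phi> 0 = c\<^sup>2 * (err m * err m)" using m by (simp add: \<phi>_def power2_eq_square)
      also have "\<dots> \<le> 2 * (c\<^sup>2 * (err m * err m))" by simp
      finally have P: "\<phi> 0 \<le> 2 * (c\<^sup>2 * (err m * err m))" .
      have "\<phi> 0 + 2 * (\<Sum>h<b. \<phi> (Suc h)) \<le> 2 * (c\<^sup>2 * (err m * err m)) + 2 * ((real m - 1) * (c\<^sup>2 * (err m * err m)) + c\<^sup>2 * err m * err_sum)"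
        by (intro add_mono mult_left_mono S P) simp
      also have "\<dots> = c\<^sup>2 * (2 * (real m * err m) * err m + 2 * err m * err_sum)" by (simp add: algebra_simps)
      finally show ?thesis .
    qed
  qed
qed

end

lemma coupling_rate_tendsto: "(\<lambda>m. c\<^sup>2 * (2 * (real m * err m) * err m + 2 * err m * err_sum)) \<longlonglongrightarrow> 0"
proof -
  have "(\<lambda>m. c\<^sup>2 * (2 * (real m * err m) * err m + 2 * err m * err_sum)) \<longlonglongrightarrow> c\<^sup>2 * (2 * 0 * 0 + 2 * 0 * err_sum)"
    by (intro tendsto_intros err_rate err_tendsto)
  then show ?thesis by simp
qed

end

section \<open>Truncation of the coupled variables\<close>

definition clamp_real :: "real \<Rightarrow> real \<Rightarrow> real" where
  "clamp_real L v = max (- L) (min L v)"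

lemma clamp_real_measurable [measurable]: "clamp_real L \<in> borel_measurable borel"
  unfolding clamp_real_def[abs_def] by measurable

lemma clamp_real_bound: "0 \<le> L \<Longrightarrow> \<bar>clamp_real L v\<bar> \<le> L"
  by (auto simp: clamp_real_def)

lemma clamp_real_residual: "0 \<le> L \<Longrightarrow> \<bar>v - clamp_real L v\<bar> \<le> \<bar>v\<bar>"
  by (auto simp: clamp_real_def)

lemma clamp_real_eq: "\<bar>v\<bar> \<le> L \<Longrightarrow> clamp_real L v = v"
  by (auto simp: clamp_real_def)

context m_approx
begin

abbreviation xg :: "L2 \<Rightarrow> int \<Rightarrow> 'w \<Rightarrow> real" where "xg g t \<omega> \<equiv> Xf t \<omega> \<bullet> g"

definition trunc_mean :: "L2 \<Rightarrow> real \<Rightarrow> real" where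
  "trunc_mean g L = (\<integral>\<omega>. clamp_real L (Xf 0 \<omega> \<bullet> g) \<partial>M)"

text \<open>Clamping destroys the zero mean, hence the recentring. The mean is taken from
  \<open>Xf 0\<close>, which has the law of every coupled variable.\<close>

definition trunc :: "L2 \<Rightarrow> nat \<Rightarrow> real \<Rightarrow> int \<Rightarrow> 'w \<Rightarrow> real" where
  "trunc g m L t \<omega> = clamp_real L (Xm m t \<omega> \<bullet> g) - trunc_mean g L"

lemma trunc_gen: "trunc g m L t \<in> borel_measurable (gen (window m t))"
  unfolding trunc_def[abs_def] using Xm_gen[of m t] by measurable

lemma clamp_integrable: "0 \<le> L \<Longrightarrow> integrable M (\<lambda>\<omega>. clamp_real L (Xm m t \<omega> \<bullet> g))"
  by (rule integrable_const_bound[where B = L]) (auto simp: clamp_real_bound)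

lemma clamp_mean: "(\<integral>\<omega>. clamp_real L (Xm m t \<omega> \<bullet> g) \<partial>M) = trunc_mean g L"
  unfolding trunc_mean_def by (rule same_law(2)[where g = "\<lambda>x. clamp_real L (x \<bullet> g)"]) measurable

lemma trunc_mdep:
  assumes m: "1 \<le> m" and L: "0 \<le> L"
  shows "mdep M Z (trunc g m L) (window m) m (2 * L)"
proof
  show "trunc g m L t \<in> borel_measurable (gen (window m t))" for t by (rule trunc_gen)
  show "window m s \<inter> window m t = {}" if "s + int m \<le> t" for s t
    by (rule window_window_disjoint[OF that m])
  show "1 \<le> m" by fact
  show "\<bar>trunc g m L t \<omega>\<bar> \<le> 2 * L" for t \<omega>
  proof -
    have "\<bar>trunc_mean g L\<bar> \<le> (\<integral>\<omega>. \<bar>clamp_real L (Xf 0 \<omega> \<bullet> g)\<bar> \<partial>M)"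
      unfolding trunc_mean_def by (rule integral_abs_bound)
    also have "\<dots> \<le> (\<integral>\<omega>. L \<partial>M)" using L by (intro integral_mono') (auto simp: clamp_real_bound)
    finally have "\<bar>trunc_mean g L\<bar> \<le> L" by (simp add: prob_space)
    then show ?thesis
      using clamp_real_bound[OF L, of "Xm m t \<omega> \<bullet> g"] abs_triangle_ineq4[of "clamp_real L (Xm m t \<omega> \<bullet> g)" "trunc_mean g L"]
      by (simp add: trunc_def)
  qed
  show "(\<integral>\<omega>. trunc g m L t \<omega> \<partial>M) = 0" for t
    unfolding trunc_def using clamp_integrable[OF L] by (simp add: clamp_mean prob_space)
  show "(\<integral>\<omega>. trunc g m L (s + r) \<omega> * trunc g m L (t + r) \<omega> \<partial>M) = (\<integral>\<omega>. trunc g m L s \<omega> * trunc g m L t \<omega> \<partial>M)" for s t r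
    using shift_expectation[of "\<lambda>z. (clamp_real L (f (\<lambda>j. z (cidx m s j)) \<bullet> g) - trunc_mean g L) *
        (clamp_real L (f (\<lambda>j. z (cidx m t j)) \<bullet> g) - trunc_mean g L)" r]
    by (simp add: trunc_def Xm_def shift_cidx)
qed

definition trunc_err :: "L2 \<Rightarrow> real \<Rightarrow> real" where
  "trunc_err g L = (\<integral>\<omega>. (Xf 0 \<omega> \<bullet> g - clamp_real L (Xf 0 \<omega> \<bullet> g))\<^sup>2 \<partial>M)"

lemma inner_bounded: "norm (x \<bullet> g) \<le> norm g * norm x" for x g :: L2
  using Cauchy_Schwarz_ineq2[of x g] by (simp add: mult.commute)

lemma xg_sqint: "sqint M (xg g t)" and xm_sqint: "sqint M (\<lambda>\<omega>. Xm m t \<omega> \<bullet> g)"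
  by (rule T_sqint[OF bounded_linear_inner_left inner_bounded] Xf_sqint Xm_sqint)+

lemma trunc_err_tendsto: "(\<lambda>n. trunc_err g (real n)) \<longlonglongrightarrow> 0"
proof -
  have "(\<lambda>n. trunc_err g (real n)) \<longlonglongrightarrow> (\<integral>\<omega>. 0 \<partial>M)"
    unfolding trunc_err_def
  proof (rule integral_dominated_convergence)
    show "integrable M (\<lambda>\<omega>. (xg g 0 \<omega>)\<^sup>2)" using xg_sqint[where g = g and t = 0] by (simp add: sqint_def)
    show "AE \<omega> in M. (\<lambda>n. (Xf 0 \<omega> \<bullet> g - clamp_real (real n) (Xf 0 \<omega> \<bullet> g))\<^sup>2) \<longlonglongrightarrow> 0"
    proof (rule AE_I2, rule tendsto_eventually)
      fix \<omega>
      obtain n0 :: nat where "\<bar>Xf 0 \<omega> \<bullet> g\<bar> \<le> real n0" using real_arch_simple by blast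
      then have "\<bar>Xf 0 \<omega> \<bullet> g\<bar> \<le> real n" if "n0 \<le> n" for n
        using that by (meson of_nat_mono order_trans)
      then show "\<forall>\<^sub>F n in sequentially. (Xf 0 \<omega> \<bullet> g - clamp_real (real n) (Xf 0 \<omega> \<bullet> g))\<^sup>2 = 0"
        unfolding eventually_sequentially by (intro exI[of _ n0]) (simp add: clamp_real_eq)
    qed
    show "AE \<omega> in M. norm ((Xf 0 \<omega> \<bullet> g - clamp_real (real n) (Xf 0 \<omega> \<bullet> g))\<^sup>2) \<le> (xg g 0 \<omega>)\<^sup>2" for n
    proof (rule AE_I2)
      fix \<omega>
      show "norm ((Xf 0 \<omega> \<bullet> g - clamp_real (real n) (Xf 0 \<omega> \<bullet> g))\<^sup>2) \<le> (xg g 0 \<omega>)\<^sup>2"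
        using clamp_real_residual[of "real n" "Xf 0 \<omega> \<bullet> g"] by (simp add: abs_le_square_iff)
    qed
  qed simp_all
  then show ?thesis by simp
qed

text \<open>The truncation error is again finitely dependent and centred, and centring can only
  lower its second moment below \<open>trunc_err\<close>. The factor \<open>m\<close> is the price
  of dependence.\<close>

lemma trunc_bsum_bound:
  assumes m: "1 \<le> m" and L: "0 \<le> L"
  shows "(\<integral>\<omega>. (bsum (\<lambda>t \<omega>. Xm m t \<omega> \<bullet> g - trunc g m L t \<omega>) t b \<omega>)\<^sup>2 \<partial>M) \<le> 2 * real m * real b * trunc_err g L"
proof -
  interpret Y: mdep M Z "trunc g m L" "window m" m "2 * L" by (rule trunc_mdep[OF m L])
  define W where "W s \<omega> = Xm m s \<omega> \<bullet> g - trunc g m L s \<omega>" for s \<omega>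
  have W_sq: "sqint M (W s)" for s unfolding W_def[abs_def] by (intro sqint_diff xm_sqint Y.y_sqint)
  have W_gen: "W s \<in> borel_measurable (gen (window m s))" for s
    unfolding W_def[abs_def] using Xm_gen[of m s] trunc_gen[of g m L s] by measurable
  have W0: "(\<integral>\<omega>. W s \<omega> \<partial>M) = 0" for s
  proof -
    have "(\<integral>\<omega>. Xm m s \<omega> \<bullet> g \<partial>M) = 0" by (rule T_mean[OF bounded_linear_inner_left inner_bounded Xm_sqint Xm_mean])
    then show ?thesis unfolding W_def using sqint_integrable[OF xm_sqint] sqint_integrable[OF Y.y_sqint] Y.y_mean by simp
  qed
  have W2: "(\<integral>\<omega>. (W s \<omega>)\<^sup>2 \<partial>M) \<le> trunc_err g L" for s
  proof -
    define u where "u \<omega> = Xm m s \<omega> \<bullet> g - clamp_real L (Xm m s \<omega> \<bullet> g)" for \<omega>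
    have u_sq: "sqint M u"
      unfolding u_def[abs_def]
      by (intro sqint_diff xm_sqint sqint_bounded[where L = L]) (auto simp: clamp_real_bound L)
    have Wu: "W s \<omega> = u \<omega> + trunc_mean g L" for \<omega> by (simp add: W_def u_def trunc_def)
    have "(\<integral>\<omega>. u \<omega> + trunc_mean g L \<partial>M) = 0" using W0[of s] unfolding Wu .
    then have mu: "(\<integral>\<omega>. u \<omega> \<partial>M) = - trunc_mean g L" using sqint_integrable[OF u_sq] by (simp add: prob_space)
    have "(\<integral>\<omega>. (W s \<omega>)\<^sup>2 \<partial>M) = (\<integral>\<omega>. (u \<omega>)\<^sup>2 + 2 * trunc_mean g L * u \<omega> + (trunc_mean g L)\<^sup>2 \<partial>M)"
      unfolding Wu by (simp add: power2_sum algebra_simps)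
    also have "\<dots> = (\<integral>\<omega>. (u \<omega>)\<^sup>2 \<partial>M) + 2 * trunc_mean g L * (\<integral>\<omega>. u \<omega> \<partial>M) + (trunc_mean g L)\<^sup>2"
      using u_sq sqint_integrable[OF u_sq] by (simp add: sqint_def prob_space)
    also have "\<dots> \<le> (\<integral>\<omega>. (u \<omega>)\<^sup>2 \<partial>M)" by (simp add: mu power2_eq_square)
    also have "\<dots> = trunc_err g L"
      unfolding trunc_err_def u_def
      by (rule same_law(2)[where g = "\<lambda>x. (x \<bullet> g - clamp_real L (x \<bullet> g))\<^sup>2"]) measurable
    finally show ?thesis .
  qed
  have "(\<integral>\<omega>. (norm (\<Sum>j<b. W (t + int j) \<omega>))\<^sup>2 \<partial>M) \<le> 2 * real m * real b * trunc_err g L"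
  proof (rule second_moment_sum_le[OF W_sq])
    show "(\<integral>\<omega>. (norm (W (t + int j) \<omega>))\<^sup>2 \<partial>M) \<le> trunc_err g L" for j using W2 by simp
    show "(\<integral>\<omega>. W (t + int i) \<omega> \<bullet> W (t + int j) \<omega> \<partial>M) = 0" if "i + m \<le> j" for i j
      by (rule expectation_inner_indep[OF W_sq W_sq gen_indep_var[OF window_window_disjoint[OF _ m] W_gen W_gen] W0])
        (use that in simp)
  qed
  then show ?thesis by (simp add: bsum_def W_def)
qed

text \<open>The coupling error fixes \<open>m\<close> before \<open>L\<close> is chosen, because the
  truncation error is multiplied by \<open>m\<close>. Both are brought below a quarter of
  \<epsilon>, which the splitting of the square doubles.\<close>

lemma xg_approx_process: "approx_process M Z (xg g)"
proof
  show "sqint M (xg g t)" for t by (rule xg_sqint)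
  fix \<epsilon> :: real assume \<epsilon>: "\<epsilon> > 0"
  define R where "R m = (norm g)\<^sup>2 * (2 * (real m * err m) * err m + 2 * err m * err_sum)" for m
  have "\<forall>\<^sub>F m in sequentially. R m < \<epsilon> / 4"
    unfolding R_def using coupling_rate_tendsto \<epsilon> by (intro order_tendstoD) auto
  then have "\<forall>\<^sub>F m in sequentially. R m < \<epsilon> / 4 \<and> 1 \<le> m" using eventually_ge_at_top[of 1] by eventually_elim simp
  then obtain m where m: "R m < \<epsilon> / 4" "1 \<le> m" by (metis (no_types, lifting) eventually_happens' sequentially_bot)
  have "(\<lambda>n. 2 * real m * trunc_err g (real n)) \<longlonglongrightarrow> 2 * real m * 0"
    by (intro tendsto_intros trunc_err_tendsto)
  then have "\<forall>\<^sub>F n in sequentially. 2 * real m * trunc_err g (real n) < \<epsilon> / 4"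
    using \<epsilon> by (intro order_tendstoD) auto
  then obtain n where n: "2 * real m * trunc_err g (real n) < \<epsilon> / 4" by (metis (no_types, lifting) eventually_happens' sequentially_bot)
  define L where "L = real n"
  have L: "0 \<le> L" by (simp add: L_def)
  interpret Y: mdep M Z "trunc g m L" "window m" m "2 * L" by (rule trunc_mdep[OF m(2) L])
  have "(\<integral>\<omega>. (bsum (xg g) t b \<omega> - bsum (trunc g m L) t b \<omega>)\<^sup>2 \<partial>M) \<le> \<epsilon> * real b" for t b
  proof -
    define D where "D = bsum (\<lambda>t \<omega>. xg g t \<omega> - Xm m t \<omega> \<bullet> g) t b"
    define W where "W = bsum (\<lambda>t \<omega>. Xm m t \<omega> \<bullet> g - trunc g m L t \<omega>) t b"
    have dec: "bsum (xg g) t b \<omega> - bsum (trunc g m L) t b \<omega> = D \<omega> + W \<omega>" for \<omega>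
      unfolding D_def W_def bsum_diff by simp
    have D_sq: "sqint M D" unfolding D_def bsum_def[abs_def] by (intro sqint_sum sqint_diff xg_sqint xm_sqint)
    have W_sq: "sqint M W" unfolding W_def bsum_def[abs_def] by (intro sqint_sum sqint_diff Y.y_sqint xm_sqint)
    have "(\<integral>\<omega>. (D \<omega> + W \<omega>)\<^sup>2 \<partial>M) \<le> (\<integral>\<omega>. 2 * (D \<omega>)\<^sup>2 + 2 * (W \<omega>)\<^sup>2 \<partial>M)"
    proof (rule integral_mono')
      show "integrable M (\<lambda>\<omega>. 2 * (D \<omega>)\<^sup>2 + 2 * (W \<omega>)\<^sup>2)" using D_sq W_sq by (simp add: sqint_def)
      show "(D \<omega> + W \<omega>)\<^sup>2 \<le> 2 * (D \<omega>)\<^sup>2 + 2 * (W \<omega>)\<^sup>2" for \<omega>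
        using zero_le_power2[of "D \<omega> - W \<omega>"] by (simp add: power2_eq_square algebra_simps)
    qed simp
    also have "\<dots> = 2 * (\<integral>\<omega>. (D \<omega>)\<^sup>2 \<partial>M) + 2 * (\<integral>\<omega>. (W \<omega>)\<^sup>2 \<partial>M)"
      using D_sq W_sq by (simp add: sqint_def)
    also have "\<dots> \<le> 2 * (real b * R m) + 2 * (2 * real m * real b * trunc_err g L)"
      using T_coupling_bound[OF bounded_linear_inner_left inner_bounded norm_ge_zero m(2), of g t b]
        trunc_bsum_bound[OF m(2) L, of g t b] by (simp add: D_def W_def R_def)
    also have "\<dots> = 2 * real b * (R m + 2 * real m * trunc_err g L)" by (simp add: algebra_simps)
    also have "\<dots> \<le> 2 * real b * (\<epsilon> / 4 + \<epsilon> / 4)"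
      using m n unfolding L_def by (intro mult_left_mono add_mono) auto
    finally show ?thesis unfolding dec by (simp add: mult.commute)
  qed
  then show "\<exists>y S m L. mdep M Z y S m L \<and> (\<forall>t b. (\<integral>\<omega>. (bsum (xg g) t b \<omega> - bsum y t b \<omega>)\<^sup>2 \<partial>M) \<le> \<epsilon> * real b)"
    using trunc_mdep[OF m(2) L] by blast
qed

lemma bsum_xg: "bsum (xg g) t b \<omega> = bsum Xf t b \<omega> \<bullet> g"
  by (simp add: bsum_def inner_sum_left)

lemma bsum_Xf_sqint: "sqint M (bsum Xf t b)"
  unfolding bsum_def[abs_def] by (intro sqint_sum Xf_sqint)

section \<open>Long-run covariance form and its trace\<close>

definition lrvf :: "L2 \<Rightarrow> real" where
  "lrvf g = approx_process.lrv M (xg g)"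

lemma lrvf_tendsto: "(\<lambda>b. (\<integral>\<omega>. (bsum Xf t b \<omega> \<bullet> g)\<^sup>2 \<partial>M) / real b) \<longlonglongrightarrow> lrvf g"
  using approx_process.lrv_tendsto[OF xg_approx_process, of g t] unfolding lrvf_def bsum_xg .

lemma lrvf_nonneg: "0 \<le> lrvf g"
  unfolding lrvf_def by (rule approx_process.lrv_nonneg[OF xg_approx_process])

text \<open>Polarisation of the quadratic functional, which is what the scalar theory provides as a
  limit.\<close>

definition lrcov :: "L2 \<Rightarrow> L2 \<Rightarrow> real" where
  "lrcov g h = (lrvf (g + h) - lrvf (g - h)) / 4"

lemma bsum_inner_integrable: "integrable M (\<lambda>\<omega>. (bsum Xf t b \<omega> \<bullet> g) * (bsum Xf t b \<omega> \<bullet> h))"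
proof -
  have "sqint M (\<lambda>\<omega>. bsum Xf t b \<omega> \<bullet> g)" for g
    by (rule T_sqint[OF bounded_linear_inner_left inner_bounded bsum_Xf_sqint])
  from sqint_inner_integrable[OF this[of g] this[of h]] show ?thesis by simp
qed

lemma lrcov_tendsto:
  "(\<lambda>b. (\<integral>\<omega>. (bsum Xf t b \<omega> \<bullet> g) * (bsum Xf t b \<omega> \<bullet> h) \<partial>M) / real b) \<longlonglongrightarrow> lrcov g h"
proof -
  let ?e = "\<lambda>b g. \<integral>\<omega>. (bsum Xf t b \<omega> \<bullet> g)\<^sup>2 \<partial>M"
  have eq: "(\<integral>\<omega>. (bsum Xf t b \<omega> \<bullet> g) * (bsum Xf t b \<omega> \<bullet> h) \<partial>M) / real b = (?e b (g + h) / real b - ?e b (g - h) / real b) / 4" for b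
  proof -
    have "?e b (g + h) - ?e b (g - h) = (\<integral>\<omega>. (bsum Xf t b \<omega> \<bullet> (g + h))\<^sup>2 - (bsum Xf t b \<omega> \<bullet> (g - h))\<^sup>2 \<partial>M)"
      using bsum_inner_integrable[of t b "g + h" "g + h"] bsum_inner_integrable[of t b "g - h" "g - h"]
      by (simp add: power2_eq_square)
    also have "\<dots> = (\<integral>\<omega>. 4 * ((bsum Xf t b \<omega> \<bullet> g) * (bsum Xf t b \<omega> \<bullet> h)) \<partial>M)"
      by (simp add: inner_add_right inner_diff_right power2_eq_square algebra_simps)
    finally have "?e b (g + h) - ?e b (g - h) = 4 * (\<integral>\<omega>. (bsum Xf t b \<omega> \<bullet> g) * (bsum Xf t b \<omega> \<bullet> h) \<partial>M)" by simp
    then show ?thesis by (simp flip: diff_divide_distrib)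
  qed
  show ?thesis unfolding eq lrcov_def by (intro tendsto_intros lrvf_tendsto) simp
qed

text \<open>Bilinearity is exact for each finite block length and passes to the limit. Nonnegativity
  of the left side then makes the matrix of long-run covariances positive semidefinite.\<close>

lemma lrcov_quadratic:
  "lrvf (\<Sum>i<K. a i *\<^sub>R e i) = (\<Sum>i<K. \<Sum>j<K. a i * a j * lrcov (e i) (e j))"
proof (rule LIMSEQ_unique[OF lrvf_tendsto[of 0]])
  have eq: "(\<integral>\<omega>. (bsum Xf 0 b \<omega> \<bullet> (\<Sum>i<K. a i *\<^sub>R e i))\<^sup>2 \<partial>M) / real b =
     (\<Sum>i<K. \<Sum>j<K. a i * a j * ((\<integral>\<omega>. (bsum Xf 0 b \<omega> \<bullet> e i) * (bsum Xf 0 b \<omega> \<bullet> e j) \<partial>M) / real b))" for b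
  proof -
    have "(\<integral>\<omega>. (bsum Xf 0 b \<omega> \<bullet> (\<Sum>i<K. a i *\<^sub>R e i))\<^sup>2 \<partial>M) =
      (\<integral>\<omega>. (\<Sum>i<K. \<Sum>j<K. a i * a j * ((bsum Xf 0 b \<omega> \<bullet> e i) * (bsum Xf 0 b \<omega> \<bullet> e j))) \<partial>M)"
      by (simp add: inner_sum_right power2_eq_square sum_product mult_ac)
    also have "\<dots> = (\<Sum>i<K. \<Sum>j<K. a i * a j * (\<integral>\<omega>. (bsum Xf 0 b \<omega> \<bullet> e i) * (bsum Xf 0 b \<omega> \<bullet> e j) \<partial>M))"
      by (simp add: bsum_inner_integrable)
    finally show ?thesis by (simp add: sum_divide_distrib)
  qed
  show "(\<lambda>b. (\<integral>\<omega>. (bsum Xf 0 b \<omega> \<bullet> (\<Sum>i<K. a i *\<^sub>R e i))\<^sup>2 \<partial>M) / real b) \<longlonglongrightarrow> (\<Sum>i<K. \<Sum>j<K. a i * a j * lrcov (e i) (e j))"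
    unfolding eq by (intro tendsto_sum tendsto_mult tendsto_const lrcov_tendsto)
qed

lemma lrcov_sym: "lrcov g h = lrcov h g"
  by (rule LIMSEQ_unique[OF lrcov_tendsto[of 0]]) (use lrcov_tendsto[of 0 h g] in \<open>simp add: mult.commute\<close>)

end

locale m_approx_basis = m_approx + L2_basis
begin

definition lrc :: "nat \<Rightarrow> nat \<Rightarrow> real" where
  "lrc i j = lrcov (e i) (e j)"

lemma psd_lrc: "psd lrc"
  unfolding psd_def lrc_def lrcov_quadratic[symmetric] using lrcov_sym lrvf_nonneg by blast

lemma residual_linear: "bounded_linear (\<lambda>x. x - proj K x)"
  by (intro bounded_linear_sub bounded_linear_ident bounded_linear_proj)

text \<open>The bound for block sums with the projection residual as linear map and
  \<open>c = 1\<close>. As \<open>proj 0\<close> is zero, \<open>tail 0\<close> bounds the full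
  second moment of normalised sums.\<close>

definition tail :: "nat \<Rightarrow> real" where
  "tail K = nrm2 M (\<lambda>\<omega>. Xf 0 \<omega> - proj K (Xf 0 \<omega>)) * (nrm2 M (\<lambda>\<omega>. Xf 0 \<omega> - proj K (Xf 0 \<omega>)) + 2 * err_sum)"

lemma tail_nonneg: "0 \<le> tail K"
  unfolding tail_def by (intro mult_nonneg_nonneg add_nonneg_nonneg nrm2_nonneg err_sum_nonneg) auto

lemma bsum_residual: "bsum (\<lambda>t \<omega>. Xf t \<omega> - proj K (Xf t \<omega>)) t b \<omega> = bsum Xf t b \<omega> - proj K (bsum Xf t b \<omega>)"
  unfolding bsum_diff unfolding bsum_def
  by (simp add: linear_sum[OF bounded_linear.linear[OF bounded_linear_proj]])

lemma bsum_tail: "(\<integral>\<omega>. (norm (bsum Xf t b \<omega> - proj K (bsum Xf t b \<omega>)))\<^sup>2 \<partial>M) \<le> real b * tail K"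
  using T_bsum_bound[OF residual_linear, where c = 1 and t = t and b = b and K1 = K] norm_residual_le
  unfolding bsum_residual tail_def by simp

lemma tail_tendsto: "tail \<longlonglongrightarrow> 0"
proof -
  have "(\<lambda>K. \<integral>\<omega>. (norm (Xf 0 \<omega> - proj K (Xf 0 \<omega>)))\<^sup>2 \<partial>M) \<longlonglongrightarrow> (\<integral>\<omega>. 0 \<partial>M)"
  proof (rule integral_dominated_convergence)
    show "integrable M (\<lambda>\<omega>. (norm (Xf 0 \<omega>))\<^sup>2)" using Xf_sqint[of 0] by (simp add: sqint_def)
    show "AE \<omega> in M. (\<lambda>K. (norm (Xf 0 \<omega> - proj K (Xf 0 \<omega>)))\<^sup>2) \<longlonglongrightarrow> 0"
      using tendsto_power[OF residual_tendsto, of _ 2] by (intro AE_I2) simp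
    show "AE \<omega> in M. norm ((norm (Xf 0 \<omega> - proj K (Xf 0 \<omega>)))\<^sup>2) \<le> (norm (Xf 0 \<omega>))\<^sup>2" for K
      by (intro AE_I2) (simp add: power_mono norm_residual_le)
  qed simp_all
  then have "(\<lambda>K. nrm2 M (\<lambda>\<omega>. Xf 0 \<omega> - proj K (Xf 0 \<omega>))) \<longlonglongrightarrow> sqrt 0"
    unfolding nrm2_def by (intro tendsto_intros) simp
  then have "(\<lambda>K. nrm2 M (\<lambda>\<omega>. Xf 0 \<omega> - proj K (Xf 0 \<omega>)) * (nrm2 M (\<lambda>\<omega>. Xf 0 \<omega> - proj K (Xf 0 \<omega>)) + 2 * err_sum)) \<longlonglongrightarrow> 0 * (0 + 2 * err_sum)"
    by (intro tendsto_intros) simp_all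
  then show ?thesis by (simp add: tail_def[abs_def])
qed

text \<open>Partial traces are limits of second moments of projected normalised sums, all at most
  \<open>tail 0\<close>. This is what places the Gaussian limit on \<open>L2\<close>.\<close>

lemma summable_lrc: "summable (\<lambda>i. lrc i i)"
proof (rule bounded_imp_summable)
  show "0 \<le> lrc i i" for i by (rule psd_diag_nonneg[OF psd_lrc])
  fix K
  have "(\<lambda>b. \<Sum>i\<le>K. (\<integral>\<omega>. (bsum Xf 0 b \<omega> \<bullet> e i) * (bsum Xf 0 b \<omega> \<bullet> e i) \<partial>M) / real b) \<longlonglongrightarrow> (\<Sum>i\<le>K. lrc i i)"
    unfolding lrc_def by (intro tendsto_sum lrcov_tendsto)
  moreover have "(\<Sum>i\<le>K. (\<integral>\<omega>. (bsum Xf 0 b \<omega> \<bullet> e i) * (bsum Xf 0 b \<omega> \<bullet> e i) \<partial>M) / real b) \<le> tail 0" if "b \<ge> 1" for b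
  proof -
    have "(\<Sum>i\<le>K. \<integral>\<omega>. (bsum Xf 0 b \<omega> \<bullet> e i) * (bsum Xf 0 b \<omega> \<bullet> e i) \<partial>M) =
      (\<integral>\<omega>. (norm (proj (Suc K) (bsum Xf 0 b \<omega>)))\<^sup>2 \<partial>M)"
      unfolding norm_proj unfolding lessThan_Suc_atMost power2_eq_square by (simp add: bsum_inner_integrable)
    also have "\<dots> \<le> (\<integral>\<omega>. (norm (bsum Xf 0 b \<omega> - proj 0 (bsum Xf 0 b \<omega>)))\<^sup>2 \<partial>M)"
      using bsum_Xf_sqint[of 0 b] by (intro integral_mono') (auto simp: sqint_def proj_def[of 0] power_mono norm_proj_le)
    also have "\<dots> \<le> real b * tail 0" by (rule bsum_tail)
    finally show ?thesis using that by (simp add: sum_divide_distrib[symmetric] divide_le_eq mult.commute)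
  qed
  ultimately show "(\<Sum>i\<le>K. lrc i i) \<le> tail 0" by (intro LIMSEQ_le_const2) auto
qed

end

section \<open>Averages over block selections\<close>

text \<open>Extensional functions, matching the values of
  \<open>\<lambda>i\<in>{1..k}. I i \<omega>\<close>; block numbers start at 1, as the drawn indices
  do.\<close>

definition selections :: "nat \<Rightarrow> nat \<Rightarrow> (nat \<Rightarrow> nat) set" where
  "selections k N = PiE {1..k} (\<lambda>_. {1..N})"

definition sel_avg :: "nat \<Rightarrow> nat \<Rightarrow> ((nat \<Rightarrow> nat) \<Rightarrow> 'b::real_vector) \<Rightarrow> 'b" where
  "sel_avg k N g = (1 / real N ^ k) *\<^sub>R (\<Sum>v\<in>selections k N. g v)"

lemma finite_selections [simp]: "finite (selections k N)"
  by (simp add: selections_def finite_PiE)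

lemma card_selections: "card (selections k N) = N ^ k"
  by (simp add: selections_def card_PiE)

lemma selections_mem: "v \<in> selections k N \<Longrightarrow> i \<in> {1..k} \<Longrightarrow> v i \<in> {1..N}"
  by (auto simp: selections_def PiE_def Pi_def)

lemma sel_avg_const [simp]: "0 < N \<Longrightarrow> sel_avg k N (\<lambda>_. c) = c"
  by (simp add: sel_avg_def card_selections sum_constant_scaleR)

lemma sel_avg_add: "sel_avg k N (\<lambda>v. g v + h v) = sel_avg k N g + sel_avg k N h"
  by (simp add: sel_avg_def sum.distrib scaleR_add_right)

lemma sel_avg_diff: "sel_avg k N (\<lambda>v. g v - h v) = sel_avg k N g - sel_avg k N h"
  by (simp add: sel_avg_def sum_subtractf scaleR_diff_right)

lemma sel_avg_cmult: "sel_avg k N (\<lambda>v. c * g v) = c * sel_avg k N g" for g :: "_ \<Rightarrow> real"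
  by (simp add: sel_avg_def sum_distrib_left)

lemma sel_avg_sum: "sel_avg k N (\<lambda>v. \<Sum>i\<in>A. g i v) = (\<Sum>i\<in>A. sel_avg k N (g i))"
  unfolding sel_avg_def by (subst sum.swap) (simp add: scaleR_sum_right)

lemma sel_avg_mono: "(\<And>v. v \<in> selections k N \<Longrightarrow> g v \<le> h v) \<Longrightarrow> sel_avg k N g \<le> sel_avg k N h" for g h :: "_ \<Rightarrow> real"
  unfolding sel_avg_def by (auto intro!: mult_left_mono divide_right_mono sum_mono)

lemma sel_avg_cong: "(\<And>v. v \<in> selections k N \<Longrightarrow> g v = h v) \<Longrightarrow> sel_avg k N g = sel_avg k N h"
  unfolding sel_avg_def by (simp cong: sum.cong)

lemma sum_atLeast1_shift: "(\<Sum>x\<in>{1..N}. F x) = (\<Sum>t<N. F (Suc t))"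
  by (rule sum.reindex_bij_witness[where i = Suc and j = "\<lambda>x. x - 1"]) auto

text \<open>An average over a product set factorises, the combinatorial form of independence of the
  draws; \<open>Suc t\<close> translates from zero-based block numbers.\<close>

lemma sel_avg_prod:
  fixes F :: "nat \<Rightarrow> complex"
  shows "sel_avg k N (\<lambda>v. \<Prod>i\<in>{1..k}. F (v i)) = avg N (\<lambda>t. F (Suc t)) ^ k"
proof -
  have "(\<Sum>v\<in>selections k N. \<Prod>i\<in>{1..k}. F (v i)) = (\<Prod>i\<in>{1..k}. \<Sum>x\<in>{1..N}. F x)"
    unfolding selections_def by (rule prod_sum_PiE[symmetric]) auto
  also have "\<dots> = (\<Sum>t<N. F (Suc t)) ^ k" unfolding sum_atLeast1_shift by simp
  finally show ?thesis by (simp add: sel_avg_def avg_def scaleR_power[symmetric] power_one_over power_mult_distrib power_divide scaleR_conv_of_real)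
qed

text \<open>The joint law of two draws: uniform on pairs, or on the diagonal when
  \<open>a = c\<close>. Selections with prescribed values at both positions are counted by a sum of
  products of indicators, which factorises again.\<close>

lemma sel_avg_pair:
  fixes h :: "nat \<Rightarrow> nat \<Rightarrow> 'b::real_vector"
  assumes N: "0 < N" and ac: "a \<in> {1..k}" "c \<in> {1..k}"
  shows "sel_avg k N (\<lambda>v. h (v a) (v c)) =
    (if a = c then avg N (\<lambda>t. h (Suc t) (Suc t)) else avg N (\<lambda>s. avg N (\<lambda>t. h (Suc s) (Suc t))))"
proof -
  define wt where "wt x y = (\<Sum>v\<in>selections k N. (if v a = x then 1 else 0) * (if v c = y then 1 else 0) :: real)" for x y
  have wt: "wt x y = (if a = c then (if x = y then real N ^ (k - 1) else 0) else real N ^ (k - 2))"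
    if xy: "x \<in> {1..N}" "y \<in> {1..N}" for x y
  proof -
    define \<phi> :: "nat \<Rightarrow> nat \<Rightarrow> real" where
      "\<phi> i z = (if i = a then (if z = x then 1 else 0) else 1) * (if i = c then (if z = y then 1 else 0) else 1)" for i z
    have "(\<Prod>i\<in>{1..k}. \<phi> i (v i)) = (if v a = x then 1 else 0) * (if v c = y then 1 else 0)" for v
      using ac unfolding \<phi>_def prod.distrib by simp
    then have "wt x y = (\<Sum>v\<in>selections k N. \<Prod>i\<in>{1..k}. \<phi> i (v i))" by (simp add: wt_def)
    also have "\<dots> = (\<Prod>i\<in>{1..k}. \<Sum>z\<in>{1..N}. \<phi> i z)"
      unfolding selections_def by (rule prod_sum_PiE[symmetric]) auto
    also have "\<dots> = (if a = c then (if x = y then real N ^ (k - 1) else 0) else real N ^ (k - 2))"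
    proof (cases "a = c")
      case True
      have "(\<Sum>z\<in>{1..N}. \<phi> i z) = (if i = a then (if x = y then 1 else 0) else real N)" for i
        using xy True by (auto simp: \<phi>_def if_distrib[of "\<lambda>u. u * _"] cong: if_cong)
      then show ?thesis using True ac by (simp add: prod.If_cases Int_absorb1 card_Diff_singleton flip: Diff_eq)
    next
      case False
      have "(\<Sum>z\<in>{1..N}. \<phi> i z) = (if i \<in> {a, c} then 1 else real N)" for i
        using xy False by (auto simp: \<phi>_def)
      then have "(\<Prod>i\<in>{1..k}. \<Sum>z\<in>{1..N}. \<phi> i z) = (\<Prod>i\<in>{1..k}. if i \<in> {a, c} then 1 else real N)"
        by (simp only:)
      also have "\<dots> = (\<Prod>i\<in>{1..k} - {a, c}. real N)" by (rule prod.mono_neutral_cong_right) auto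
      also have "\<dots> = real N ^ card ({1..k} - {a, c})" by simp
      also have "card ({1..k} - {a, c}) = k - 2" using False ac by (subst card_Diff_subset) auto
      finally show ?thesis using False by simp
    qed
    finally show ?thesis .
  qed
  have "(\<Sum>v\<in>selections k N. h (v a) (v c)) =
    (\<Sum>v\<in>selections k N. \<Sum>x\<in>{1..N}. \<Sum>y\<in>{1..N}. ((if v a = x then 1 else 0) * (if v c = y then 1 else 0)) *\<^sub>R h x y)"
  proof (rule sum.cong[OF refl])
    fix v assume v: "v \<in> selections k N"
    have "(\<Sum>y\<in>{1..N}. ((if v a = x then 1 else 0) * (if v c = y then 1 else 0)) *\<^sub>R h x y) = (if x = v a then h x (v c) else 0)" for x
      using selections_mem[OF v ac(2)] by (simp add: if_distrib[of "\<lambda>u. u *\<^sub>R _"] cong: if_cong)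
    then show "h (v a) (v c) = (\<Sum>x\<in>{1..N}. \<Sum>y\<in>{1..N}. ((if v a = x then 1 else 0) * (if v c = y then 1 else 0)) *\<^sub>R h x y)"
      using selections_mem[OF v ac(1)] by simp
  qed
  also have "\<dots> = (\<Sum>x\<in>{1..N}. \<Sum>y\<in>{1..N}. wt x y *\<^sub>R h x y)"
    unfolding wt_def scaleR_sum_left
    by (subst sum.swap, rule sum.cong[OF refl], subst sum.swap) (rule refl)
  also have "\<dots> = (\<Sum>x\<in>{1..N}. \<Sum>y\<in>{1..N}. (if a = c then (if x = y then real N ^ (k - 1) else 0) else real N ^ (k - 2)) *\<^sub>R h x y)"
    by (intro sum.cong refl) (simp add: wt)
  finally have S: "(\<Sum>v\<in>selections k N. h (v a) (v c)) =
     (\<Sum>x\<in>{1..N}. \<Sum>y\<in>{1..N}. (if a = c then (if x = y then real N ^ (k - 1) else 0) else real N ^ (k - 2)) *\<^sub>R h x y)" .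
  show ?thesis
  proof (cases "a = c")
    case True
    have k1: "1 \<le> k" using ac by simp
    have "real N ^ k = real N * real N ^ (k - 1)" using k1 by (metis Suc_pred' power_Suc zero_less_one_class.zero_less_one less_le_trans One_nat_def less_eq_Suc_le)
    then show ?thesis
      using S True N sum_atLeast1_shift[of "\<lambda>x. h x x" N] unfolding sel_avg_def avg_def
      by (simp add: if_distrib[of "\<lambda>u. u *\<^sub>R _"] scaleR_sum_right[symmetric] cong: if_cong)
  next
    case False
    \<comment> \<open>Two distinct positions exist, so \<open>k - 2\<close> is not
      truncated.\<close>
    have "2 \<le> k" using ac False by simp
    then have "real N ^ k = real N * real N * real N ^ (k - 2)"
      by (metis le_add_diff_inverse power2_eq_square power_add)
    then show ?thesis
      using S False N sum_atLeast1_shift[of "\<lambda>x. \<Sum>y\<in>{1..N}. h x y" N]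
      unfolding sel_avg_def avg_def sum_atLeast1_shift[of "\<lambda>y. h x y" for x, symmetric]
      by (simp add: scaleR_sum_right[symmetric])
  qed
qed

lemma avg_inner_left: "avg N u \<bullet> x = avg N (\<lambda>t. u t \<bullet> x)" for u :: "nat \<Rightarrow> 'b::real_inner"
  by (simp add: avg_def inner_sum_left)

lemma avg_inner_right: "x \<bullet> avg N u = avg N (\<lambda>t. x \<bullet> u t)" for u :: "nat \<Rightarrow> 'b::real_inner"
  by (simp add: avg_def inner_sum_right)

text \<open>Different draws are independent and \<open>u\<close> averages to zero, so only the
  \<open>k\<close> diagonal pairs contribute.\<close>

lemma sel_avg_inner_sums:
  fixes u w :: "nat \<Rightarrow> 'b::real_inner"
  assumes N: "0 < N" and u: "avg N u = 0"
  shows "sel_avg k N (\<lambda>v. (\<Sum>i\<in>{1..k}. u (v i - 1)) \<bullet> (\<Sum>i\<in>{1..k}. w (v i - 1))) = real k * avg N (\<lambda>t. u t \<bullet> w t)"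
proof -
  have "sel_avg k N (\<lambda>v. (\<Sum>i\<in>{1..k}. u (v i - 1)) \<bullet> (\<Sum>i\<in>{1..k}. w (v i - 1))) =
    (\<Sum>a\<in>{1..k}. \<Sum>c\<in>{1..k}. sel_avg k N (\<lambda>v. u (v a - 1) \<bullet> w (v c - 1)))"
    unfolding inner_sum_left inner_sum_right sel_avg_sum by (subst sum.swap) (rule refl)
  also have "\<dots> = (\<Sum>a\<in>{1..k}. \<Sum>c\<in>{1..k}. if a = c then avg N (\<lambda>t. u t \<bullet> w t) else 0)"
  proof (intro sum.cong refl)
    fix a c assume ac: "a \<in> {1..k}" "c \<in> {1..k}"
    have "avg N u \<bullet> avg N w = avg N (\<lambda>s. u s \<bullet> avg N w)" by (rule avg_inner_left)
    then have "avg N (\<lambda>s. avg N (\<lambda>t. u s \<bullet> w t)) = avg N u \<bullet> avg N w" by (simp only: avg_inner_right)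
    then show "sel_avg k N (\<lambda>v. u (v a - 1) \<bullet> w (v c - 1)) = (if a = c then avg N (\<lambda>t. u t \<bullet> w t) else 0)"
      using sel_avg_pair[OF N ac, of "\<lambda>x y. u (x - 1) \<bullet> w (y - 1)"] u by simp
  qed
  also have "\<dots> = real k * avg N (\<lambda>t. u t \<bullet> w t)" by simp
  finally show ?thesis .
qed

lemma sel_avg_sum_single:
  fixes u :: "nat \<Rightarrow> 'b::real_vector"
  assumes N: "0 < N"
  shows "sel_avg k N (\<lambda>v. \<Sum>i\<in>{1..k}. u (v i - 1)) = real k *\<^sub>R avg N u"
proof -
  have "sel_avg k N (\<lambda>v. u (v a - 1)) = avg N u" if "a \<in> {1..k}" for a
    using sel_avg_pair[OF N that that, of "\<lambda>x y. u (x - 1)"] by simp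
  then show ?thesis unfolding sel_avg_sum by (simp add: sum_constant_scaleR)
qed

text \<open>With \<open>z\<close> the statistic at a fixed outcome of the data, this is the explicit
  form of the conditional law.\<close>

definition sel_measure :: "nat \<Rightarrow> nat \<Rightarrow> ((nat \<Rightarrow> nat) \<Rightarrow> 'b) \<Rightarrow> 'b::topological_space measure" where
  "sel_measure k N z = distr (measure_pmf (pmf_of_set (selections k N))) borel z"

lemma selections_nonempty: "0 < N \<Longrightarrow> selections k N \<noteq> {}"
  using card_selections[of k N] by auto

lemma sel_measure_prob: "sel_measure k N z \<in> space (prob_algebra borel)"
  unfolding sel_measure_def space_prob_algebra
  by (auto intro!: prob_space.prob_space_distr measure_pmf.prob_space_axioms)

lemma sel_measure_integral:
  fixes g :: "'b::topological_space \<Rightarrow> 'c::{banach, second_countable_topology}"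
  assumes "0 < N" "g \<in> borel_measurable borel"
  shows "(\<integral>x. g x \<partial>sel_measure k N z) = sel_avg k N (\<lambda>v. g (z v))"
proof -
  have "(\<integral>x. g x \<partial>sel_measure k N z) = (\<integral>v. g (z v) \<partial>measure_pmf (pmf_of_set (selections k N)))"
    unfolding sel_measure_def by (rule integral_distr) (use assms in auto)
  also have "\<dots> = (\<Sum>v\<in>selections k N. pmf (pmf_of_set (selections k N)) v *\<^sub>R g (z v))"
    using selections_nonempty[OF assms(1)] by (intro integral_measure_pmf) auto
  also have "\<dots> = sel_avg k N (\<lambda>v. g (z v))"
    using selections_nonempty[OF assms(1)] by (simp add: sel_avg_def scaleR_sum_right card_selections)
  finally show ?thesis .
qed

lemma sel_measure_measure:
  assumes "0 < N" "A \<in> sets borel"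
  shows "measure (sel_measure k N z) A = sel_avg k N (\<lambda>v. indicator A (z v))"
proof -
  interpret prob_space "sel_measure k N z" using sel_measure_prob[of k N z] by (simp add: space_prob_algebra_borel)
  have "measure (sel_measure k N z) A = (\<integral>x. indicator A x \<partial>sel_measure k N z)"
    using assms by (simp add: sel_measure_def)
  also have "\<dots> = sel_avg k N (\<lambda>v. indicator A (z v))"
    by (rule sel_measure_integral[OF assms(1)]) (use assms(2) in simp)
  finally show ?thesis .
qed

section \<open>Conditional expectations given the data\<close>

text \<open>The null set depends on \<open>A\<close>. Finite intersections of basis sets form a
  countable generating system stable under intersection; agreement on it determines a probability
  measure, and its null sets combine.\<close>

lemma AE_eq_kernels:
  fixes \<kappa> \<kappa>' :: "'w \<Rightarrow> 'b::second_countable_topology measure"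
  assumes P: "\<And>\<omega>. \<omega> \<in> space M \<Longrightarrow> \<kappa> \<omega> \<in> space (prob_algebra borel)" "\<And>\<omega>. \<omega> \<in> space M \<Longrightarrow> \<kappa>' \<omega> \<in> space (prob_algebra borel)"
    and eq: "\<And>A. A \<in> sets borel \<Longrightarrow> AE \<omega> in M. measure (\<kappa> \<omega>) A = measure (\<kappa>' \<omega>) A"
  shows "AE \<omega> in M. \<kappa> \<omega> = \<kappa>' \<omega>"
proof -
  obtain B :: "'b set set" where B: "countable B" "topological_basis B" using ex_countable_basis by blast
  define E where "E = (\<lambda>F. \<Inter>F) ` {F. F \<subseteq> B \<and> finite F}"
  have cE: "countable E" unfolding E_def using countable_Collect_finite_subset[OF B(1)] by (auto simp: conj_commute)
  have BE: "B \<subseteq> E" unfolding E_def by (auto intro!: image_eqI[where x = "{_}"])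
  have openE: "open A" if "A \<in> E" for A
    using that topological_basis_open[OF B(2)] unfolding E_def by (auto intro!: open_Inter)
  have univE: "UNIV \<in> E" unfolding E_def by (auto intro!: image_eqI[where x = "{}"])
  have stable: "Int_stable E"
    unfolding Int_stable_def
  proof (intro ballI)
    fix A A' assume "A \<in> E" "A' \<in> E"
    then obtain F F' where "F \<subseteq> B" "finite F" "A = \<Inter>F" "F' \<subseteq> B" "finite F'" "A' = \<Inter>F'" unfolding E_def by blast
    then show "A \<inter> A' \<in> E" unfolding E_def by (intro image_eqI[where x = "F \<union> F'"]) auto
  qed
  have sig: "sets (borel :: 'b measure) = sigma_sets UNIV E"
  proof
    have "sets (borel :: 'b measure) = sigma_sets UNIV B" by (subst borel_eq_countable_basis[OF B]) simp
    also have "\<dots> \<subseteq> sigma_sets UNIV E" by (rule sigma_sets_mono'[OF BE])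
    finally show "sets (borel :: 'b measure) \<subseteq> sigma_sets UNIV E" .
    have "E \<subseteq> sets (borel :: 'b measure)" using openE by auto
    from sets.sigma_sets_subset[OF this] show "sigma_sets UNIV E \<subseteq> sets (borel :: 'b measure)" by simp
  qed
  have "AE \<omega> in M. \<forall>A\<in>E. measure (\<kappa> \<omega>) A = measure (\<kappa>' \<omega>) A"
    using eq openE by (subst AE_ball_countable[OF cE]) auto
  with AE_space show ?thesis
  proof eventually_elim
    case (elim \<omega>)
    have p: "prob_space (\<kappa> \<omega>)" "sets (\<kappa> \<omega>) = sets borel" "prob_space (\<kappa>' \<omega>)" "sets (\<kappa>' \<omega>) = sets borel"
      using P elim by (auto simp: space_prob_algebra_borel)
    interpret k: prob_space "\<kappa> \<omega>" by fact
    interpret k': prob_space "\<kappa>' \<omega>" by fact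
    show "\<kappa> \<omega> = \<kappa>' \<omega>"
    proof (rule measure_eqI_generator_eq[where E = E and \<Omega> = UNIV and A = "\<lambda>_. UNIV"])
      show "emeasure (\<kappa> \<omega>) A = emeasure (\<kappa>' \<omega>) A" if "A \<in> E" for A
        using elim that by (simp add: k.emeasure_eq_measure k'.emeasure_eq_measure)
    qed (use stable sig p univE in auto)
  qed
qed

context prob_space
begin

text \<open>Links vector-valued versions to \<open>real_cond_exp\<close> coordinate by coordinate,
  since inner products pass through the defining integrals.\<close>

lemma cond_exp_inner:
  fixes Y E :: "'a \<Rightarrow> L2"
  assumes G: "subalgebra M G" and ce: "has_cond_exp M G Y E"
  shows "AE \<omega> in M. real_cond_exp M G (\<lambda>\<omega>. Y \<omega> \<bullet> g) \<omega> = E \<omega> \<bullet> g"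
proof -
  interpret finite_measure_subalgebra M G by unfold_locales (rule G)
  show ?thesis
  proof (rule real_cond_exp_charact)
    show "integrable M (\<lambda>\<omega>. Y \<omega> \<bullet> g)" "integrable M (\<lambda>\<omega>. E \<omega> \<bullet> g)" "(\<lambda>\<omega>. E \<omega> \<bullet> g) \<in> borel_measurable G"
      using ce unfolding has_cond_exp_def by auto
    fix A assume A: "A \<in> sets G"
    then have AM: "A \<in> sets M" using G by (auto simp: subalgebra_def)
    have pull: "(LINT \<omega>:A|M. W \<omega> \<bullet> g) = (LINT \<omega>:A|M. W \<omega>) \<bullet> g" if "integrable M W" for W :: "'a \<Rightarrow> L2"
      using that integrable_mult_indicator[OF AM that] by (simp add: set_lebesgue_integral_def flip: inner_scaleR_left)
    show "(LINT \<omega>:A|M. Y \<omega> \<bullet> g) = (LINT \<omega>:A|M. E \<omega> \<bullet> g)"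
      using ce A unfolding has_cond_exp_def by (simp add: pull)
  qed
qed

lemma integral_indep_indicator:
  fixes h :: "'a \<Rightarrow> real"
  assumes ind: "indep_set (sets H) (sets G)" and sp: "space G = space M" "space H = space M"
    and B: "B \<in> sets H" and h: "h \<in> borel_measurable G" "integrable M h"
  shows "(\<integral>\<omega>. indicator B \<omega> * h \<omega> \<partial>M) = prob B * (\<integral>\<omega>. h \<omega> \<partial>M)"
proof -
  have BM: "B \<in> sets M" using ind B unfolding indep_set_def indep_sets_def by (auto split: bool.splits)
  have "indep_var borel (indicator B :: 'a \<Rightarrow> real) borel h"
    unfolding indep_var_def indep_vars_def2
  proof
    show "\<forall>i\<in>UNIV. random_variable (case i of True \<Rightarrow> borel | False \<Rightarrow> borel) (case i of True \<Rightarrow> indicator B | False \<Rightarrow> h)"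
      using BM h by (auto split: bool.split)
    show "indep_sets (\<lambda>i. {(case i of True \<Rightarrow> indicator B | False \<Rightarrow> h) -` A \<inter> space M |A. A \<in> sets (case i of True \<Rightarrow> borel | False \<Rightarrow> borel)}) UNIV"
    proof (rule indep_sets_mono_sets[OF ind[unfolded indep_set_def]])
      fix i :: bool
      have "(indicator B :: 'a \<Rightarrow> real) \<in> borel_measurable H" using B by simp
      then show "{(case i of True \<Rightarrow> indicator B | False \<Rightarrow> h) -` A \<inter> space M |A. A \<in> sets (case i of True \<Rightarrow> borel | False \<Rightarrow> borel)}
        \<subseteq> (case i of True \<Rightarrow> sets H | False \<Rightarrow> sets G)"
        using measurable_sets[OF h(1)] measurable_sets[of "indicator B :: 'a \<Rightarrow> real" H borel] sp by (auto split: bool.splits)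
    qed
  qed
  moreover have "integrable M (indicator B :: 'a \<Rightarrow> real)"
    using BM by (intro integrable_real_indicator) (auto simp: emeasure_eq_measure)
  ultimately show ?thesis
    using indep_var_lebesgue_integral[OF _ _ h(2)] BM by simp
qed

text \<open>Freezing: the draws are uniform and independent of the data, so conditioning averages
  over their values. The events on which the draws equal a given selection partition the space up to
  a null set, and each splits off its probability \<open>1 / N ^ k\<close>.\<close>

lemma cond_exp_selection:
  fixes \<phi> :: "(nat \<Rightarrow> nat) \<Rightarrow> 'a \<Rightarrow> real" and I :: "nat \<Rightarrow> 'a \<Rightarrow> nat"
  assumes G: "subalgebra M G" and k: "1 \<le> k" and N: "0 < N"
    and I_indep: "indep_vars (\<lambda>_. count_space UNIV) I {1..k}"
    and I_law: "\<And>i. i \<in> {1..k} \<Longrightarrow> distr M (count_space UNIV) (I i) = measure_pmf (pmf_of_set {1..N})"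
    and I_G: "indep_set (sets (vimage_algebra (space M) (\<lambda>\<omega>. \<lambda>i\<in>{1..k}. I i \<omega>) (PiM {1..k} (\<lambda>_. count_space UNIV)))) (sets G)"
    and \<phi>: "\<And>v. v \<in> selections k N \<Longrightarrow> \<phi> v \<in> borel_measurable G" "\<And>v. v \<in> selections k N \<Longrightarrow> integrable M (\<phi> v)"
    and Y: "Y \<in> borel_measurable M" "AE \<omega> in M. Y \<omega> = \<phi> (\<lambda>i\<in>{1..k}. I i \<omega>) \<omega>"
  shows "AE \<omega> in M. real_cond_exp M G Y \<omega> = sel_avg k N (\<lambda>v. \<phi> v \<omega>)"
proof -
  interpret finite_measure_subalgebra M G by unfold_locales (rule G)
  define H where "H = vimage_algebra (space M) (\<lambda>\<omega>. \<lambda>i\<in>{1..k}. I i \<omega>) (PiM {1..k} (\<lambda>_. count_space (UNIV :: nat set)))"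
  define Ev where "Ev v = {\<omega>\<in>space M. \<forall>i\<in>{1..k}. I i \<omega> = v i}" for v
  have I_meas: "I i \<in> measurable M (count_space UNIV)" if "i \<in> {1..k}" for i
    using I_indep that by (simp add: indep_vars_def)
  have one: "prob (I i -` {x} \<inter> space M) = (if x \<in> {1..N} then 1 / real N else 0)" if "i \<in> {1..k}" for i x
  proof -
    have "prob (I i -` {x} \<inter> space M) = measure (distr M (count_space UNIV) (I i)) {x}"
      by (rule measure_distr[symmetric]) (use I_meas that in auto)
    also have "\<dots> = pmf (pmf_of_set {1..N}) x" unfolding I_law[OF that] by (simp add: measure_pmf_single)
    finally show ?thesis using N by (simp add: indicator_def)
  qed
  have Ev_eq: "Ev v = (\<Inter>i\<in>{1..k}. I i -` {v i} \<inter> space M)" for v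
    using k by (auto simp: Ev_def)
  have prob_Ev: "prob (Ev v) = 1 / real N ^ k" if v: "v \<in> selections k N" for v
  proof -
    have "prob (Ev v) = (\<Prod>i\<in>{1..k}. prob (I i -` {v i} \<inter> space M))"
      unfolding Ev_eq by (rule indep_varsD[OF I_indep]) (use k in auto)
    also have "\<dots> = (\<Prod>i\<in>{1..k}. 1 / real N)" using selections_mem[OF v] by (intro prod.cong refl) (simp add: one)
    finally show ?thesis by (simp add: power_one_over)
  qed
  have Ev_H: "Ev v \<in> sets H" if v: "v \<in> selections k N" for v
  proof -
    have v_ext: "v \<in> extensional {1..k}" using v by (simp add: selections_def PiE_def)
    have "{v} \<in> sets (PiM {1..k} (\<lambda>_. count_space (UNIV :: nat set)))"
    proof -
      have "{v} = PiE {1..k} (\<lambda>i. {v i})" using v_ext by (auto simp: PiE_def extensional_def fun_eq_iff Pi_def) metis+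
      also have "\<dots> \<in> sets (PiM {1..k} (\<lambda>_. count_space (UNIV :: nat set)))" by (rule sets_PiM_I_finite) auto
      finally show ?thesis .
    qed
    from in_vimage_algebra[OF this] have "(\<lambda>\<omega>. \<lambda>i\<in>{1..k}. I i \<omega>) -` {v} \<inter> space M \<in> sets H" unfolding H_def .
    also have "(\<lambda>\<omega>. \<lambda>i\<in>{1..k}. I i \<omega>) -` {v} \<inter> space M = Ev v"
      using v_ext by (auto simp: Ev_def fun_eq_iff extensional_def)
    finally show ?thesis .
  qed
  have Ev_M: "Ev v \<in> sets M" for v
    unfolding Ev_eq using I_meas k by (intro sets.finite_INT) (auto intro!: measurable_sets)
  \<comment> \<open>Only the law of each index is prescribed, so values outside
    \<open>{1..N}\<close> are excluded almost surely and not everywhere.\<close>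
  have AE_I: "AE \<omega> in M. \<forall>i\<in>{1..k}. I i \<omega> \<in> {1..N}"
  proof (subst AE_ball_countable, simp, intro ballI)
    fix i assume i: "i \<in> {1..k}"
    have "AE x in distr M (count_space UNIV) (I i). x \<in> {1..N}"
      unfolding I_law[OF i] using N by (simp add: AE_measure_pmf_iff)
    then show "AE \<omega> in M. I i \<omega> \<in> {1..N}" by (subst (asm) AE_distr_iff) (use I_meas[OF i] in auto)
  qed
  have Y_eq: "AE \<omega> in M. Y \<omega> = (\<Sum>v\<in>selections k N. indicator (Ev v) \<omega> * \<phi> v \<omega>)"
    using Y(2) AE_I AE_space
  proof eventually_elim
    case (elim \<omega>)
    define v0 where "v0 = (\<lambda>i\<in>{1..k}. I i \<omega>)"
    have v0: "v0 \<in> selections k N" using elim by (auto simp: v0_def selections_def)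
    have "indicator (Ev v) \<omega> = (if v = v0 then 1 else 0 :: real)" if "v \<in> selections k N" for v
    proof -
      have "v \<in> extensional {1..k}" using that by (simp add: selections_def PiE_def)
      then have "(\<forall>i\<in>{1..k}. I i \<omega> = v i) \<longleftrightarrow> v = v0"
        by (auto simp: v0_def fun_eq_iff extensional_def)
      then show ?thesis using elim by (simp add: Ev_def indicator_def)
    qed
    then have "(\<Sum>v\<in>selections k N. indicator (Ev v) \<omega> * \<phi> v \<omega>) = (\<Sum>v\<in>selections k N. if v = v0 then \<phi> v \<omega> else 0)"
      by (intro sum.cong refl) simp
    then show ?case using elim v0 by (simp add: v0_def)
  qed
  have \<phi>M: "\<phi> v \<in> borel_measurable M" if "v \<in> selections k N" for v using \<phi>(2)[OF that] by simp
  have int_term: "integrable M (\<lambda>\<omega>. indicator (Ev v) \<omega> * \<phi> v \<omega>)" if "v \<in> selections k N" for v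
    using integrable_mult_indicator[OF Ev_M \<phi>(2)[OF that]] by simp
  show ?thesis
  proof (rule real_cond_exp_charact)
    have "integrable M (\<lambda>\<omega>. \<Sum>v\<in>selections k N. indicator (Ev v) \<omega> * \<phi> v \<omega>)"
      by (intro Bochner_Integration.integrable_sum int_term)
    then show "integrable M Y"
      using integrable_cong_AE[OF Y(1) _ Y_eq] by (simp only: borel_measurable_integrable)
    show "integrable M (\<lambda>\<omega>. sel_avg k N (\<lambda>v. \<phi> v \<omega>))" unfolding sel_avg_def using \<phi>(2) by auto
    show "(\<lambda>\<omega>. sel_avg k N (\<lambda>v. \<phi> v \<omega>)) \<in> borel_measurable G" unfolding sel_avg_def
      by (intro borel_measurable_scaleR borel_measurable_const borel_measurable_sum \<phi>(1))
    fix A assume A: "A \<in> sets G"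
    then have AM: "A \<in> sets M" using G by (auto simp: subalgebra_def)
    have intA: "integrable M (\<lambda>\<omega>. indicator A \<omega> * \<phi> v \<omega>)" if "v \<in> selections k N" for v
      using integrable_mult_indicator[OF AM \<phi>(2)[OF that]] by simp
    have intAE: "integrable M (\<lambda>\<omega>. indicator (Ev v) \<omega> * (indicator A \<omega> * \<phi> v \<omega>))" if "v \<in> selections k N" for v
      using integrable_mult_indicator[OF Ev_M intA[OF that]] by simp
    have one_term: "(\<integral>\<omega>. indicator (Ev v) \<omega> * (indicator A \<omega> * \<phi> v \<omega>) \<partial>M) = 1 / real N ^ k * (\<integral>\<omega>. indicator A \<omega> * \<phi> v \<omega> \<partial>M)"
      if v: "v \<in> selections k N" for v
      unfolding prob_Ev[OF v, symmetric]
    proof (rule integral_indep_indicator)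
      show "indep_set (sets H) (sets G)" using I_G unfolding H_def .
      show "space G = space M" using G by (simp add: subalgebra_def)
      show "space H = space M" by (simp add: H_def)
      show "(\<lambda>\<omega>. indicator A \<omega> * \<phi> v \<omega>) \<in> borel_measurable G" using A \<phi>(1)[OF v] by measurable
    qed (use Ev_H v intA in auto)
    have "(LINT \<omega>:A|M. Y \<omega>) = (\<integral>\<omega>. (\<Sum>v\<in>selections k N. indicator (Ev v) \<omega> * (indicator A \<omega> * \<phi> v \<omega>)) \<partial>M)"
      unfolding set_lebesgue_integral_def
    proof (rule integral_cong_AE)
      show "AE \<omega> in M. indicat_real A \<omega> *\<^sub>R Y \<omega> = (\<Sum>v\<in>selections k N. indicator (Ev v) \<omega> * (indicator A \<omega> * \<phi> v \<omega>))"
        using Y_eq by eventually_elim (simp only: real_scaleR_def sum_distrib_left mult.left_commute)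
      show "(\<lambda>\<omega>. indicat_real A \<omega> *\<^sub>R Y \<omega>) \<in> borel_measurable M" using Y(1) AM by measurable
      show "(\<lambda>\<omega>. \<Sum>v\<in>selections k N. indicator (Ev v) \<omega> * (indicator A \<omega> * \<phi> v \<omega>)) \<in> borel_measurable M"
        by (rule borel_measurable_integrable) (intro Bochner_Integration.integrable_sum intAE)
    qed
    also have "\<dots> = (\<Sum>v\<in>selections k N. 1 / real N ^ k * (\<integral>\<omega>. indicator A \<omega> * \<phi> v \<omega> \<partial>M))"
      using intAE by (subst Bochner_Integration.integral_sum) (auto intro!: sum.cong simp only: one_term)
    also have "\<dots> = (LINT \<omega>:A|M. sel_avg k N (\<lambda>v. \<phi> v \<omega>))"
      unfolding set_lebesgue_integral_def sel_avg_def
      using intA by (simp add: sum_distrib_left mult.left_commute[of "indicator A _"])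
    finally show "(LINT \<omega>:A|M. Y \<omega>) = (LINT \<omega>:A|M. sel_avg k N (\<lambda>v. \<phi> v \<omega>))" .
  qed
qed

end

section \<open>The bootstrap distribution\<close>

lemma (in prob_space) sqint_AE_cong:
  assumes "sqint M f" "g \<in> borel_measurable M" "AE \<omega> in M. f \<omega> = g \<omega>"
  shows "sqint M g"
  unfolding sqint_def
proof
  have "AE \<omega> in M. (norm (f \<omega>))\<^sup>2 = (norm (g \<omega>))\<^sup>2" using assms(3) by eventually_elim simp
  then show "integrable M (\<lambda>\<omega>. (norm (g \<omega>))\<^sup>2)"
    using assms(1,2) by (subst integrable_cong_AE[symmetric, of "\<lambda>\<omega>. (norm (f \<omega>))\<^sup>2"]) (auto simp: sqint_def)
qed fact

lemma cblk_inner: "cblk x b N t \<omega> \<bullet> g = cblk (\<lambda>t \<omega>. x t \<omega> \<bullet> g) b N t \<omega>"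
  by (simp add: cblk_def blk_def bsum_def avg_inner_left inner_diff_left inner_sum_left)

lemma avg_cblk: "0 < N \<Longrightarrow> avg N (\<lambda>t. cblk x b N t \<omega>) = 0"
  by (simp add: cblk_def avg_diff)

lemma avg_centered_norm_le:
  fixes u :: "nat \<Rightarrow> 'b::real_inner"
  assumes "N > 0"
  shows "avg N (\<lambda>t. (norm (u t - avg N u))\<^sup>2) \<le> avg N (\<lambda>t. (norm (u t))\<^sup>2)"
proof -
  have "avg N (\<lambda>t. (norm (u t - avg N u))\<^sup>2) = avg N (\<lambda>t. ((norm (u t))\<^sup>2 + (norm (avg N u))\<^sup>2) - 2 * (u t \<bullet> avg N u))"
    by (simp add: power2_norm_eq_inner inner_diff_left inner_diff_right inner_commute algebra_simps)
  also have "\<dots> = avg N (\<lambda>t. (norm (u t))\<^sup>2) + (norm (avg N u))\<^sup>2 - 2 * (avg N u \<bullet> avg N u)"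
    using assms unfolding avg_diff avg_add avg_cmult avg_inner_left[symmetric] by simp
  also have "\<dots> = avg N (\<lambda>t. (norm (u t))\<^sup>2) - (norm (avg N u))\<^sup>2" by (simp add: power2_norm_eq_inner)
  finally show ?thesis by simp
qed

lemma bounded_linear_avg:
  assumes "bounded_linear T"
  shows "T (avg N u) = avg N (\<lambda>t. T (u t))"
  using bounded_linear.linear[OF assms] by (simp add: avg_def linear_scale linear_sum)

lemma (in prob_space) subalgebra_data_algebra:
  assumes "\<And>t. X t \<in> borel_measurable M"
  shows "subalgebra M (data_algebra M X n)"
proof -
  have "(\<lambda>\<omega>. \<omega>) \<in> M \<rightarrow>\<^sub>M data_algebra M X n"
    unfolding data_algebra_def
    by (rule measurable_vimage_algebra2) (use assms in \<open>auto intro!: measurable_restrict\<close>)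
  from measurable_sets[OF this] show ?thesis
    unfolding subalgebra_def by (auto simp: data_algebra_def)
      (metis (no_types, lifting) Int_absorb2 sets.sets_into_space space_vimage_algebra vimage_ident)
qed

lemma data_algebra_measurable: "t \<in> {1..n} \<Longrightarrow> X (int t) \<in> borel_measurable (data_algebra M X n)"
proof -
  assume t: "t \<in> {1..n}"
  have "(\<lambda>\<omega>. (\<lambda>t\<in>{1..n}. X (int t) \<omega>) t) \<in> borel_measurable (data_algebra M X n)"
    unfolding data_algebra_def
    by (rule measurable_compose[OF measurable_vimage_algebra1 measurable_component_singleton])
      (use t in \<open>auto simp: space_PiM\<close>)
  then show ?thesis using t by simp
qed

text \<open>Regroups the pseudo-observations block by block. The lower bound on the indices matters
  because \<open>I i \<omega> - 1\<close> is a truncated subtraction.\<close>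

lemma mbb_mean_blocks:
  assumes n: "n = k * b" "1 \<le> b" and I: "\<And>i. i \<in> {1..k} \<Longrightarrow> 1 \<le> I i \<omega>"
  shows "sqrt (real n) *\<^sub>R mbb_mean X n b I \<omega> = (1 / sqrt (real k)) *\<^sub>R (\<Sum>i\<in>{1..k}. blk X b (I i \<omega> - 1) \<omega>)"
proof -
  have "(\<Sum>s=1..n. mbb_obs X b I s \<omega>) = (\<Sum>s<k * b. mbb_obs X b I (Suc s) \<omega>)"
    unfolding n(1) by (rule sum_atLeast1_shift)
  also have "\<dots> = (\<Sum>i<k. \<Sum>s\<in>{i * b..<i * b + b}. mbb_obs X b I (Suc s) \<omega>)"
    by (rule sum.nat_group[symmetric])
  also have "\<dots> = (\<Sum>i<k. bsum X (1 + int (I (Suc i) \<omega> - 1)) b \<omega>)"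
  proof (rule sum.cong[OF refl])
    fix i assume i: "i \<in> {..<k}"
    have "(\<Sum>s\<in>{i * b..<i * b + b}. mbb_obs X b I (Suc s) \<omega>) = (\<Sum>j<b. mbb_obs X b I (Suc (i * b + j)) \<omega>)"
      by (rule sum.reindex_bij_witness[where i = "\<lambda>j. i * b + j" and j = "\<lambda>s. s - i * b"]) auto
    also have "\<dots> = bsum X (1 + int (I (Suc i) \<omega> - 1)) b \<omega>"
      unfolding bsum_def
    proof (rule sum.cong[OF refl])
      fix j assume j: "j \<in> {..<b}"
      have "1 \<le> I (Suc i) \<omega>" using I[of "Suc i"] i by simp
      then show "mbb_obs X b I (Suc (i * b + j)) \<omega> = X (1 + int (I (Suc i) \<omega> - 1) + int j) \<omega>"
        using j n by (simp add: mbb_obs_def of_nat_diff)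
    qed
    finally show "(\<Sum>s\<in>{i * b..<i * b + b}. mbb_obs X b I (Suc s) \<omega>) = bsum X (1 + int (I (Suc i) \<omega> - 1)) b \<omega>" .
  qed
  also have "\<dots> = (\<Sum>i\<in>{1..k}. bsum X (1 + int (I i \<omega> - 1)) b \<omega>)" by (rule sum_atLeast1_shift[symmetric])
  finally have S: "(\<Sum>s=1..n. mbb_obs X b I s \<omega>) = (\<Sum>i\<in>{1..k}. bsum X (1 + int (I i \<omega> - 1)) b \<omega>)" .
  have "sqrt (real n) * (1 / real n) = 1 / sqrt (real k) * (1 / sqrt (real b))"
  proof (cases "n = 0")
    case False
    have "sqrt (real n) * (1 / real n) = 1 / sqrt (real n)"
      using False real_div_sqrt[of "real n"] by (simp add: field_simps)
    then show ?thesis by (simp add: n(1) real_sqrt_mult)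
  qed (use n in auto)
  then show ?thesis by (simp only: mbb_mean_def S blk_def scaleR_sum_right[symmetric] scaleR_scaleR)
qed

text \<open>The sample size is fixed here, and the conditional objects are computed exactly up to
  null sets; limits enter only with \<open>mbb_seq\<close>.\<close>

locale mbb = m_approx_basis M X f \<delta> \<delta>' e
  for M :: "'w measure" and X f \<delta> \<delta>' and e :: "nat \<Rightarrow> L2" +
  fixes n b :: nat and I :: "nat \<Rightarrow> 'w \<Rightarrow> nat" and Estar :: "'w \<Rightarrow> L2" and Lstar :: "'w \<Rightarrow> L2 measure"
    and Cstar :: "'w \<Rightarrow> L2 \<Rightarrow> L2"
  assumes b_pos: "1 \<le> b" and b_less: "b < n" and b_dvd: "b dvd n"
    and indices: "mbb_indices M X n b I"
    and Estar: "has_cond_exp M (data_algebra M X n) (mbb_mean X n b I) Estar"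
    and Lstar: "has_cond_law M (data_algebra M X n) (\<lambda>\<omega>. sqrt (real n) *\<^sub>R (mbb_mean X n b I \<omega> - Estar \<omega>)) Lstar"
    and Cstar: "has_op_cond_exp M (data_algebra M X n)
      (\<lambda>\<omega>. tensor (mbb_mean X n b I \<omega> - Estar \<omega>) (mbb_mean X n b I \<omega> - Estar \<omega>)) Cstar"
begin

definition k :: nat where "k = n div b"
definition N :: nat where "N = n - b + 1"

abbreviation G where "G \<equiv> data_algebra M X n"

lemma n_eq: "n = k * b" using b_dvd by (simp add: k_def)

lemma k_ge2: "2 \<le> k"
proof (rule ccontr)
  assume "\<not> 2 \<le> k"
  then have "k = 0 \<or> k = 1" by auto
  then show False using n_eq b_less by auto
qed

lemma N_eq: "N = (k - 1) * b + 1"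
  using n_eq k_ge2 by (simp add: N_def diff_mult_distrib)

lemma N_pos: "0 < N" by (simp add: N_def)

lemma n_pos: "0 < n" using b_less by simp

lemma subalgebra_G: "subalgebra M G"
  by (rule subalgebra_data_algebra) simp

lemma bsum_X_measurable [measurable]: "bsum X t c \<in> borel_measurable M"
  unfolding bsum_def[abs_def] by measurable

lemma AE_bsum: "AE \<omega> in M. \<forall>t c. bsum X t c \<omega> = bsum Xf t c \<omega>"
  using AE_X by eventually_elim (simp add: bsum_def)

lemma AE_blk: "AE \<omega> in M. \<forall>t. blk X b t \<omega> = blk Xf b t \<omega>"
  using AE_bsum by eventually_elim (simp add: blk_def)

lemma blk_Xf_sqint: "sqint M (blk Xf b t)"
  unfolding blk_def[abs_def] by (intro sqint_scaleR bsum_Xf_sqint)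

lemma blk_X_sqint: "sqint M (blk X b t)"
proof (rule sqint_AE_cong[OF blk_Xf_sqint])
  show "blk X b t \<in> borel_measurable M" unfolding blk_def[abs_def] by measurable
  show "AE \<omega> in M. blk Xf b t \<omega> = blk X b t \<omega>" using AE_blk by eventually_elim simp
qed

lemma blk_X_G:
  assumes "t < N"
  shows "blk X b t \<in> borel_measurable G"
proof -
  have "X (1 + int t + int j) \<in> borel_measurable G" if "j < b" for j
  proof -
    have "1 + int t + int j = int (1 + t + j)" by simp
    moreover have "1 + t + j \<in> {1..n}" using assms that b_less by (auto simp: N_def)
    ultimately show ?thesis using data_algebra_measurable[of "1 + t + j" n X M] by (simp only:)
  qed
  then show ?thesis unfolding blk_def[abs_def] bsum_def[abs_def] by measurable
qed

definition mean_blk :: "'w \<Rightarrow> L2" where "mean_blk \<omega> = avg N (\<lambda>t. blk X b t \<omega>)"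

lemma mean_blk_G [measurable]: "mean_blk \<in> borel_measurable G"
  unfolding mean_blk_def[abs_def] avg_def using blk_X_G by measurable

lemma mean_blk_sqint: "sqint M mean_blk"
  unfolding mean_blk_def[abs_def] avg_def by (intro sqint_scaleR sqint_sum blk_X_sqint)

text \<open>The scaled bootstrap mean at a frozen selection \<open>v\<close>, a function of the data
  alone.\<close>

definition root :: "(nat \<Rightarrow> nat) \<Rightarrow> 'w \<Rightarrow> L2" where
  "root v \<omega> = (1 / sqrt (real k)) *\<^sub>R (\<Sum>i\<in>{1..k}. blk X b (v i - 1) \<omega>)"

definition croot :: "(nat \<Rightarrow> nat) \<Rightarrow> 'w \<Rightarrow> L2" where
  "croot v \<omega> = (1 / sqrt (real k)) *\<^sub>R (\<Sum>i\<in>{1..k}. cblk X b N (v i - 1) \<omega>)"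

lemma croot_eq: "croot v \<omega> = root v \<omega> - sqrt (real k) *\<^sub>R mean_blk \<omega>"
  by (simp add: croot_def root_def cblk_def mean_blk_def sum_subtractf scaleR_diff_right sum_constant_scaleR real_div_sqrt)

lemma root_G: "v \<in> selections k N \<Longrightarrow> root v \<in> borel_measurable G"
proof -
  assume v: "v \<in> selections k N"
  have "blk X b (v i - 1) \<in> borel_measurable G" if "i \<in> {1..k}" for i
    using selections_mem[OF v that] by (intro blk_X_G) auto
  then show ?thesis unfolding root_def[abs_def] by measurable
qed

lemma root_sqint: "sqint M (root v)"
  unfolding root_def[abs_def] by (intro sqint_scaleR sqint_sum blk_X_sqint)

lemma croot_G: "v \<in> selections k N \<Longrightarrow> croot v \<in> borel_measurable G"
  unfolding croot_eq[abs_def] using root_G by measurable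

lemma croot_sqint: "sqint M (croot v)"
  unfolding croot_eq[abs_def] by (intro sqint_diff sqint_scaleR root_sqint mean_blk_sqint)

lemma indices': "indep_vars (\<lambda>_. count_space UNIV) I {1..k}"
  "\<And>i. i \<in> {1..k} \<Longrightarrow> distr M (count_space UNIV) (I i) = measure_pmf (pmf_of_set {1..N})"
  "indep_set (sets (vimage_algebra (space M) (\<lambda>\<omega>. \<lambda>i\<in>{1..k}. I i \<omega>) (PiM {1..k} (\<lambda>_. count_space UNIV)))) (sets G)"
  using indices unfolding mbb_indices_def Let_def k_def N_def by auto

lemma AE_I: "AE \<omega> in M. \<forall>i\<in>{1..k}. 1 \<le> I i \<omega>"
proof (subst AE_ball_countable, simp, intro ballI)
  fix i assume i: "i \<in> {1..k}"
  have "AE x in distr M (count_space UNIV) (I i). x \<in> {1..N}"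
    unfolding indices'(2)[OF i] using N_pos by (simp add: AE_measure_pmf_iff)
  then have "AE \<omega> in M. I i \<omega> \<in> {1..N}"
    by (subst (asm) AE_distr_iff) (use indices'(1) i in \<open>auto simp: indep_vars_def\<close>)
  then show "AE \<omega> in M. 1 \<le> I i \<omega>" by eventually_elim simp
qed

abbreviation Ivec where "Ivec \<omega> \<equiv> (\<lambda>i\<in>{1..k}. I i \<omega>)"

lemma AE_root: "AE \<omega> in M. sqrt (real n) *\<^sub>R mbb_mean X n b I \<omega> = root (Ivec \<omega>) \<omega>"
  using AE_I
proof eventually_elim
  case (elim \<omega>)
  then show ?case
    using mbb_mean_blocks[where n = n and k = k and b = b and I = I and \<omega> = \<omega> and X = X, OF n_eq b_pos] by (simp add: root_def)
qed

lemma cond_exp_sel':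
  assumes "\<And>v. v \<in> selections k N \<Longrightarrow> \<phi> v \<in> borel_measurable G" "\<And>v. v \<in> selections k N \<Longrightarrow> integrable M (\<phi> v)"
    "Y \<in> borel_measurable M" "AE \<omega> in M. Y \<omega> = \<phi> (Ivec \<omega>) \<omega>"
  shows "AE \<omega> in M. real_cond_exp M G Y \<omega> = sel_avg k N (\<lambda>v. \<phi> v \<omega>)"
  by (rule cond_exp_selection[OF subalgebra_G _ N_pos indices' assms]) (use k_ge2 in simp)

lemma mbb_mean_integrable: "integrable M (mbb_mean X n b I)"
  using Estar by (simp add: has_cond_exp_def)

lemma Estar_measurable [measurable]: "Estar \<in> borel_measurable M"
  using Estar by (auto simp: has_cond_exp_def)

text \<open>Versions are compared on the countably many coordinates \<open>e l\<close>, whose null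
  sets combine. One draw has conditional mean \<open>mean_blk\<close>, and \<open>k\<close> draws
  divided by \<open>sqrt k\<close> leave the factor \<open>sqrt k\<close>.\<close>

lemma AE_Estar: "AE \<omega> in M. sqrt (real n) *\<^sub>R Estar \<omega> = sqrt (real k) *\<^sub>R mean_blk \<omega>"
proof -
  have "AE \<omega> in M. Estar \<omega> \<bullet> e l = sqrt (real k) / sqrt (real n) * (mean_blk \<omega> \<bullet> e l)" for l
  proof -
    define \<phi> where "\<phi> v \<omega> = (1 / sqrt (real n)) * (root v \<omega> \<bullet> e l)" for v \<omega>
    have "AE \<omega> in M. real_cond_exp M G (\<lambda>\<omega>. mbb_mean X n b I \<omega> \<bullet> e l) \<omega> = sel_avg k N (\<lambda>v. \<phi> v \<omega>)"
    proof (rule cond_exp_sel')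
      show "\<phi> v \<in> borel_measurable G" if "v \<in> selections k N" for v
        unfolding \<phi>_def[abs_def] using root_G[OF that] by measurable
      show "integrable M (\<phi> v)" for v
        unfolding \<phi>_def[abs_def] using sqint_integrable[OF root_sqint, of v] by simp
      show "(\<lambda>\<omega>. mbb_mean X n b I \<omega> \<bullet> e l) \<in> borel_measurable M" using mbb_mean_integrable by measurable
      show "AE \<omega> in M. mbb_mean X n b I \<omega> \<bullet> e l = \<phi> (Ivec \<omega>) \<omega>"
        using AE_root
      proof eventually_elim
        case (elim \<omega>)
        show ?case unfolding \<phi>_def elim[symmetric] using n_pos by simp
      qed
    qed
    with cond_exp_inner[OF subalgebra_G Estar, of "e l"] show ?thesis
    proof eventually_elim
      case (elim \<omega>)
      have "sel_avg k N (\<lambda>v. root v \<omega>) = (1 / sqrt (real k)) *\<^sub>R (real k *\<^sub>R mean_blk \<omega>)"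
        unfolding root_def mean_blk_def sel_avg_sum_single[OF N_pos, symmetric]
        by (simp add: sel_avg_def scaleR_sum_right mult.commute)
      moreover have "sel_avg k N (\<lambda>v. \<phi> v \<omega>) = (1 / sqrt (real n)) * (sel_avg k N (\<lambda>v. root v \<omega>) \<bullet> e l)"
        unfolding \<phi>_def sel_avg_cmult by (simp add: sel_avg_def inner_sum_left)
      ultimately show ?case using elim by (simp add: real_div_sqrt)
    qed
  qed
  then have "AE \<omega> in M. \<forall>l. Estar \<omega> \<bullet> e l = sqrt (real k) / sqrt (real n) * (mean_blk \<omega> \<bullet> e l)"
    by (subst AE_all_countable) blast
  then show ?thesis
  proof eventually_elim
    case (elim \<omega>)
    show ?case by (rule inner_e_ext) (use elim n_pos in simp)
  qed
qed

lemma AE_croot: "AE \<omega> in M. sqrt (real n) *\<^sub>R (mbb_mean X n b I \<omega> - Estar \<omega>) = croot (Ivec \<omega>) \<omega>"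
  using AE_root AE_Estar by eventually_elim (simp add: croot_eq scaleR_diff_right)

lemma Lstar_kernel: "Lstar \<in> M \<rightarrow>\<^sub>M prob_algebra borel"
  using Lstar measurable_from_subalg[OF subalgebra_G] unfolding has_cond_law_def by blast

text \<open>Freezing, applied to the indicator of each Borel set, yields the probabilities; the
  comparison of kernels removes the dependence of the null set on that set. Centring by
  \<open>Estar\<close> has become centring of the blocks in \<open>croot\<close>.\<close>

lemma AE_Lstar: "AE \<omega> in M. Lstar \<omega> = sel_measure k N (\<lambda>v. croot v \<omega>)"
proof (rule AE_eq_kernels)
  show "Lstar \<omega> \<in> space (prob_algebra borel)" if "\<omega> \<in> space M" for \<omega>
    using measurable_space[OF Lstar_kernel that] .
  show "sel_measure k N (\<lambda>v. croot v \<omega>) \<in> space (prob_algebra borel)" for \<omega> by (rule sel_measure_prob)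
  fix A :: "L2 set" assume A: "A \<in> sets borel"
  let ?Z = "\<lambda>\<omega>. sqrt (real n) *\<^sub>R (mbb_mean X n b I \<omega> - Estar \<omega>)"
  have "AE \<omega> in M. real_cond_exp M G (\<lambda>\<omega>'. indicator A (?Z \<omega>')) \<omega> = sel_avg k N (\<lambda>v. indicator A (croot v \<omega>))"
  proof (rule cond_exp_sel')
    fix v assume v: "v \<in> selections k N"
    show "(\<lambda>\<omega>. indicator A (croot v \<omega>) :: real) \<in> borel_measurable G" using croot_G[OF v] A by measurable
    then have "(\<lambda>\<omega>. indicator A (croot v \<omega>) :: real) \<in> borel_measurable M"
      by (rule measurable_from_subalg[OF subalgebra_G])
    then show "integrable M (\<lambda>\<omega>. indicator A (croot v \<omega>) :: real)"
      by (intro integrable_const_bound[where B = 1]) auto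
  next
    show "(\<lambda>\<omega>. indicator A (?Z \<omega>) :: real) \<in> borel_measurable M" using A mbb_mean_integrable by measurable
    show "AE \<omega> in M. indicator A (?Z \<omega>) = (indicator A (croot (Ivec \<omega>) \<omega>) :: real)"
      using AE_croot by eventually_elim simp
  qed
  moreover have "AE \<omega> in M. measure (Lstar \<omega>) A = real_cond_exp M G (\<lambda>\<omega>'. indicator A (?Z \<omega>')) \<omega>"
    using Lstar A unfolding has_cond_law_def by blast
  ultimately show "AE \<omega> in M. measure (Lstar \<omega>) A = measure (sel_measure k N (\<lambda>v. croot v \<omega>)) A"
    by eventually_elim (simp add: sel_measure_measure[OF N_pos A])
qed

text \<open>Independent centred draws have no cross terms, and the \<open>k\<close> equal
  contributions cancel the normalisation \<open>1 / k\<close>.\<close>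

lemma sel_avg_croot:
  "sel_avg k N (\<lambda>v. (croot v \<omega> \<bullet> g) * (croot v \<omega> \<bullet> h)) = avg N (\<lambda>t. (cblk X b N t \<omega> \<bullet> g) * (cblk X b N t \<omega> \<bullet> h))"
proof -
  have a0: "avg N (\<lambda>t. cblk X b N t \<omega> \<bullet> g) = 0"
    unfolding avg_inner_left[symmetric] avg_cblk[OF N_pos] by simp
  have "(croot v \<omega> \<bullet> g) * (croot v \<omega> \<bullet> h) =
    (1 / real k) * ((\<Sum>i\<in>{1..k}. cblk X b N (v i - 1) \<omega> \<bullet> g) \<bullet> (\<Sum>i\<in>{1..k}. cblk X b N (v i - 1) \<omega> \<bullet> h))" for v
    by (simp add: croot_def inner_sum_left)
  then have "sel_avg k N (\<lambda>v. (croot v \<omega> \<bullet> g) * (croot v \<omega> \<bullet> h)) =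
    (1 / real k) * (real k * avg N (\<lambda>t. (cblk X b N t \<omega> \<bullet> g) \<bullet> (cblk X b N t \<omega> \<bullet> h)))"
    by (simp only: sel_avg_cmult sel_avg_inner_sums[OF N_pos a0, of k "\<lambda>t. cblk X b N t \<omega> \<bullet> h"])
  then show ?thesis using k_ge2 by simp
qed

text \<open>The null set depends on the vector to which the operator is applied, so only the matrix
  entries in the basis are identified; they are countably many and determine the Hilbert-Schmidt
  norm.\<close>

lemma AE_Cstar: "AE \<omega> in M. \<forall>i l. real n * (Cstar \<omega> (e i) \<bullet> e l) = avg N (\<lambda>t. (cblk X b N t \<omega> \<bullet> e i) * (cblk X b N t \<omega> \<bullet> e l))"
proof -
  have "AE \<omega> in M. real n * (Cstar \<omega> (e i) \<bullet> e l) = avg N (\<lambda>t. (cblk X b N t \<omega> \<bullet> e i) * (cblk X b N t \<omega> \<bullet> e l))" for i l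
  proof -
    let ?D = "\<lambda>\<omega>. mbb_mean X n b I \<omega> - Estar \<omega>"
    have ce: "has_cond_exp M G (\<lambda>\<omega>. tensor (?D \<omega>) (?D \<omega>) (e i)) (\<lambda>\<omega>. Cstar \<omega> (e i))"
      using Cstar unfolding has_op_cond_exp_def by blast
    define \<phi> where "\<phi> v \<omega> = (1 / real n) * ((croot v \<omega> \<bullet> e i) * (croot v \<omega> \<bullet> e l))" for v \<omega>
    have "AE \<omega> in M. real_cond_exp M G (\<lambda>\<omega>. tensor (?D \<omega>) (?D \<omega>) (e i) \<bullet> e l) \<omega> = sel_avg k N (\<lambda>v. \<phi> v \<omega>)"
    proof (rule cond_exp_sel')
      show "\<phi> v \<in> borel_measurable G" if "v \<in> selections k N" for v
        unfolding \<phi>_def[abs_def] using croot_G[OF that] by measurable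
      have "sqint M (\<lambda>\<omega>. croot v \<omega> \<bullet> g)" for v g
        by (rule T_sqint[OF bounded_linear_inner_left inner_bounded croot_sqint])
      from sqint_inner_integrable[OF this this]
      show "integrable M (\<phi> v)" for v unfolding \<phi>_def[abs_def] by simp
      show "(\<lambda>\<omega>. tensor (?D \<omega>) (?D \<omega>) (e i) \<bullet> e l) \<in> borel_measurable M"
        unfolding tensor_def using mbb_mean_integrable by measurable
      show "AE \<omega> in M. tensor (?D \<omega>) (?D \<omega>) (e i) \<bullet> e l = \<phi> (Ivec \<omega>) \<omega>"
        using AE_croot
      proof eventually_elim
        case (elim \<omega>)
        define D where "D = ?D \<omega>"
        have "1 / real n * (sqrt (real n) * (D \<bullet> e i) * (sqrt (real n) * (D \<bullet> e l))) = (D \<bullet> e i) * (D \<bullet> e l)"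
          using n_pos by (simp add: field_simps)
        then show ?case unfolding \<phi>_def elim[symmetric] tensor_def inner_scaleR_left D_def by simp
      qed
    qed
    with cond_exp_inner[OF subalgebra_G ce, of "e l"] show ?thesis
    proof eventually_elim
      case (elim \<omega>)
      then have "Cstar \<omega> (e i) \<bullet> e l = (1 / real n) * avg N (\<lambda>t. (cblk X b N t \<omega> \<bullet> e i) * (cblk X b N t \<omega> \<bullet> e l))"
        unfolding \<phi>_def sel_avg_cmult sel_avg_croot by simp
      then show ?case using n_pos by simp
    qed
  qed
  then show ?thesis by (simp add: AE_all_countable)
qed

lemma charf_sel_measure:
  assumes g: "g = (\<Sum>i<K. a i *\<^sub>R e i)"
  shows "charf K a (sel_measure k N (\<lambda>v. croot v \<omega>)) = avg N (\<lambda>t. iexp (cblk (\<lambda>t \<omega>. X t \<omega> \<bullet> g) b N t \<omega> / sqrt (real k))) ^ k"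
proof -
  have lin: "lin K a x = x \<bullet> g" for x
    by (simp add: g inner_sum_right)
  have "charf K a (sel_measure k N (\<lambda>v. croot v \<omega>)) = sel_avg k N (\<lambda>v. iexp (croot v \<omega> \<bullet> g))"
    unfolding charf_def lin by (rule sel_measure_integral[OF N_pos]) measurable
  also have "\<dots> = sel_avg k N (\<lambda>v. \<Prod>i\<in>{1..k}. (\<lambda>x. iexp ((cblk X b N (x - 1) \<omega> \<bullet> g) / sqrt (real k))) (v i))"
    by (intro sel_avg_cong) (simp add: croot_def inner_sum_left exp_sum[symmetric] sum_divide_distrib sum_distrib_left)
  also have "\<dots> = avg N (\<lambda>t. iexp ((cblk X b N t \<omega> \<bullet> g) / sqrt (real k))) ^ k"
    by (rule trans[OF sel_avg_prod]) simp
  finally show ?thesis unfolding cblk_inner .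
qed

lemma AE_emp_cov:
  "AE \<omega> in M. \<forall>t. cblk X b N t \<omega> = cblk Xf b N t \<omega>"
  using AE_blk by eventually_elim (simp add: cblk_def)

lemma blk_tail: "(\<integral>\<omega>. (norm (blk Xf b t \<omega> - proj K (blk Xf b t \<omega>)))\<^sup>2 \<partial>M) \<le> tail K"
proof -
  have "blk Xf b t \<omega> - proj K (blk Xf b t \<omega>) = (1 / sqrt (real b)) *\<^sub>R (bsum Xf (1 + int t) b \<omega> - proj K (bsum Xf (1 + int t) b \<omega>))" for \<omega>
    by (simp add: blk_def proj_scaleR scaleR_diff_right)
  then have "(\<integral>\<omega>. (norm (blk Xf b t \<omega> - proj K (blk Xf b t \<omega>)))\<^sup>2 \<partial>M) =
    (\<integral>\<omega>. (norm (bsum Xf (1 + int t) b \<omega> - proj K (bsum Xf (1 + int t) b \<omega>)))\<^sup>2 \<partial>M) / real b"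
    by (simp add: power_divide)
  then show ?thesis using bsum_tail[of "1 + int t" b K] b_pos by (simp add: divide_le_eq mult.commute)
qed

text \<open>The conditional second moment of the part of the bootstrap statistic outside the first
  \<open>K\<close> coordinates.\<close>

definition emp_tail :: "nat \<Rightarrow> 'w \<Rightarrow> real" where
  "emp_tail K \<omega> = avg N (\<lambda>t. (norm (cblk Xf b N t \<omega> - proj K (cblk Xf b N t \<omega>)))\<^sup>2)"

lemma residual_sqint: "sqint M Y \<Longrightarrow> sqint M (\<lambda>\<omega>. Y \<omega> - proj K (Y \<omega>))"
  by (rule T_sqint[OF residual_linear, where c = 1]) (simp_all add: norm_residual_le)

lemma cblk_Xf_sqint: "sqint M (cblk Xf b N t)"
  unfolding cblk_def[abs_def] avg_def by (intro sqint_diff sqint_scaleR sqint_sum blk_Xf_sqint)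

lemma emp_tail_integrable: "integrable M (emp_tail K)"
  unfolding emp_tail_def[abs_def] avg_real using residual_sqint[OF cblk_Xf_sqint] by (auto simp: sqint_def)

lemma emp_tail_nonneg: "0 \<le> emp_tail K \<omega>"
  unfolding emp_tail_def by (rule avg_nonneg) simp

text \<open>Centring at the empirical mean lowers the average of squared norms, and each uncentred
  block obeys the tail bound for sums of length \<open>b\<close>.\<close>

lemma emp_tail_le: "(\<integral>\<omega>. emp_tail K \<omega> \<partial>M) \<le> tail K"
proof -
  have int: "integrable M (\<lambda>\<omega>. (norm (blk Xf b t \<omega> - proj K (blk Xf b t \<omega>)))\<^sup>2)" for t
    using residual_sqint[OF blk_Xf_sqint] by (simp add: sqint_def)
  have "(\<integral>\<omega>. emp_tail K \<omega> \<partial>M) \<le> (\<integral>\<omega>. avg N (\<lambda>t. (norm (blk Xf b t \<omega> - proj K (blk Xf b t \<omega>)))\<^sup>2) \<partial>M)"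
  proof (rule integral_mono)
    show "integrable M (\<lambda>\<omega>. avg N (\<lambda>t. (norm (blk Xf b t \<omega> - proj K (blk Xf b t \<omega>)))\<^sup>2))"
      unfolding avg_real using int by auto
    fix \<omega>
    have "cblk Xf b N t \<omega> - proj K (cblk Xf b N t \<omega>) = (blk Xf b t \<omega> - proj K (blk Xf b t \<omega>)) -
        avg N (\<lambda>t. blk Xf b t \<omega> - proj K (blk Xf b t \<omega>))" for t
      unfolding cblk_def proj_diff avg_diff bounded_linear_avg[OF bounded_linear_proj] by simp
    then show "emp_tail K \<omega> \<le> avg N (\<lambda>t. (norm (blk Xf b t \<omega> - proj K (blk Xf b t \<omega>)))\<^sup>2)"
      unfolding emp_tail_def using avg_centered_norm_le[OF N_pos, of "\<lambda>t. blk Xf b t \<omega> - proj K (blk Xf b t \<omega>)"] by simp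
  qed (rule emp_tail_integrable)
  also have "\<dots> = avg N (\<lambda>t. \<integral>\<omega>. (norm (blk Xf b t \<omega> - proj K (blk Xf b t \<omega>)))\<^sup>2 \<partial>M)"
    unfolding avg_real using int by simp
  also have "\<dots> \<le> tail K" by (rule avg_le[OF N_pos blk_tail])
  finally show ?thesis .
qed

text \<open>Jensen is used twice, under the conditional law and over the data. In between, the
  conditional mean square of the residual is exactly \<open>emp_tail K\<close>, because the residual
  blocks average to zero.\<close>

lemma Lstar_tail: "(\<integral>\<omega>. (\<integral>x. min 1 (norm (x - proj K x)) \<partial>Lstar \<omega>) \<partial>M) \<le> sqrt (tail K)"
proof -
  have ae: "AE \<omega> in M. (\<integral>x. min 1 (norm (x - proj K x)) \<partial>Lstar \<omega>) \<le> sqrt (emp_tail K \<omega>)"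
    using AE_Lstar AE_emp_cov
  proof eventually_elim
    case (elim \<omega>)
    define u where "u t = cblk X b N t \<omega> - proj K (cblk X b N t \<omega>)" for t
    have u0: "avg N u = 0"
      unfolding u_def avg_diff bounded_linear_avg[OF bounded_linear_proj, symmetric] avg_cblk[OF N_pos] by (simp add: proj_def)
    have cu: "croot v \<omega> - proj K (croot v \<omega>) = (1 / sqrt (real k)) *\<^sub>R (\<Sum>i\<in>{1..k}. u (v i - 1))" for v
      by (simp add: croot_def u_def proj_scaleR linear_sum[OF bounded_linear.linear[OF bounded_linear_proj]] sum_subtractf scaleR_diff_right)
    define s where "s v = norm (croot v \<omega> - proj K (croot v \<omega>))" for v
    have "sel_avg k N (\<lambda>v. (s v)\<^sup>2) = sel_avg k N (\<lambda>v. (1 / real k) * ((\<Sum>i\<in>{1..k}. u (v i - 1)) \<bullet> (\<Sum>i\<in>{1..k}. u (v i - 1))))"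
      unfolding s_def cu by (simp add: power2_norm_eq_inner[symmetric] power_divide)
    also have "\<dots> = emp_tail K \<omega>"
      unfolding sel_avg_cmult sel_avg_inner_sums[OF N_pos u0] using k_ge2 elim(2)
      by (simp add: emp_tail_def u_def power2_norm_eq_inner)
    finally have s2: "sel_avg k N (\<lambda>v. (s v)\<^sup>2) = emp_tail K \<omega>" .
    have "(\<integral>x. min 1 (norm (x - proj K x)) \<partial>Lstar \<omega>) = sel_avg k N (\<lambda>v. min 1 (s v))"
      unfolding elim(1) s_def by (rule sel_measure_integral[OF N_pos]) measurable
    also have "\<dots> \<le> sel_avg k N s" by (rule sel_avg_mono) simp
    also have "\<dots> \<le> sqrt (emp_tail K \<omega>)"
    proof (rule real_le_rsqrt)
      \<comment> \<open>Jensen for a finite average, in the form that a variance is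
        nonnegative.\<close>
      define m where "m = sel_avg k N s"
      have "0 \<le> sel_avg k N (\<lambda>v. (s v - m)\<^sup>2)"
        using sel_avg_mono[of k N "\<lambda>_. 0" "\<lambda>v. (s v - m)\<^sup>2"] N_pos by simp
      also have "\<dots> = sel_avg k N (\<lambda>v. ((s v)\<^sup>2 + m\<^sup>2) - (2 * m) * s v)" by (simp add: power2_diff mult_ac)
      also have "\<dots> = emp_tail K \<omega> + m\<^sup>2 - 2 * m * m"
        unfolding sel_avg_diff sel_avg_add sel_avg_cmult s2 m_def[symmetric] using N_pos by simp
      finally show "(sel_avg k N s)\<^sup>2 \<le> emp_tail K \<omega>" by (simp add: m_def power2_eq_square)
    qed
    finally show ?case .
  qed
  have sq: "sqint M (\<lambda>\<omega>. sqrt (emp_tail K \<omega>))"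
    unfolding sqint_def using emp_tail_integrable[of K] emp_tail_nonneg by auto
  have "(\<integral>\<omega>. (\<integral>x. min 1 (norm (x - proj K x)) \<partial>Lstar \<omega>) \<partial>M) \<le> (\<integral>\<omega>. sqrt (emp_tail K \<omega>) \<partial>M)"
  proof (rule integral_mono_AE')
    show "integrable M (\<lambda>\<omega>. sqrt (emp_tail K \<omega>))" by (rule sqint_integrable[OF sq])
    show "AE \<omega> in M. 0 \<le> sqrt (emp_tail K \<omega>)" using emp_tail_nonneg by simp
  qed (rule ae)
  also have "\<dots> \<le> nrm2 M (\<lambda>\<omega>. sqrt (emp_tail K \<omega>))" using expectation_norm_le_nrm2[OF sq] emp_tail_nonneg by simp
  also have "\<dots> = sqrt (\<integral>\<omega>. emp_tail K \<omega> \<partial>M)" by (simp add: nrm2_def emp_tail_nonneg)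
  also have "\<dots> \<le> sqrt (tail K)" by (rule real_sqrt_le_mono[OF emp_tail_le])
  finally show ?thesis .
qed

lemma Lstar_charf:
  assumes g: "g = (\<Sum>i<K. a i *\<^sub>R e i)"
  shows "(\<integral>\<omega>. cmod (charf K a (Lstar \<omega>) - c) \<partial>M) =
    (\<integral>\<omega>. cmod (avg N (\<lambda>t. iexp (cblk (xg g) b N t \<omega> / sqrt (real k))) ^ k - c) \<partial>M)"
proof (rule integral_cong_AE)
  show "(\<lambda>\<omega>. cmod (charf K a (Lstar \<omega>) - c)) \<in> borel_measurable M"
    using charf_kernel_measurable[OF Lstar_kernel] by measurable
  have [measurable]: "cblk (xg g) b N t \<in> borel_measurable M" for t
    unfolding cblk_def[abs_def] blk_def avg_def bsum_def by measurable
  show "(\<lambda>\<omega>. cmod (avg N (\<lambda>t. iexp (cblk (xg g) b N t \<omega> / sqrt (real k))) ^ k - c)) \<in> borel_measurable M"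
    unfolding avg_def by measurable
  show "AE \<omega> in M. cmod (charf K a (Lstar \<omega>) - c) = cmod (avg N (\<lambda>t. iexp (cblk (xg g) b N t \<omega> / sqrt (real k))) ^ k - c)"
    using AE_Lstar AE_emp_cov by eventually_elim (simp add: charf_sel_measure[OF g] flip: cblk_inner)
qed

end

section \<open>Asymptotics along the sample sizes\<close>

text \<open>Outside the corner of size \<open>K\<close> remain two strips. There the squared
  difference is at most twice the sum of the squares, the squares are dominated by products of
  diagonal entries, and each strip factorises into a trace and a tail of a trace. Two strips with a
  factor 2 give the 4.\<close>

lemma entrywise_tail_bound:
  fixes a c :: "nat \<Rightarrow> nat \<Rightarrow> real"
  assumes a: "\<And>i l. (a i l)\<^sup>2 \<le> a i i * a l l" "\<And>i. 0 \<le> a i i" "\<And>m. (\<Sum>i<m. a i i) \<le> ta" "\<And>m. (\<Sum>i\<in>{K..<m}. a i i) \<le> qa"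
    and c: "\<And>i l. (c i l)\<^sup>2 \<le> c i i * c l l" "\<And>i. 0 \<le> c i i" "\<And>m. (\<Sum>i<m. c i i) \<le> tc" "\<And>m. (\<Sum>i\<in>{K..<m}. c i i) \<le> qc"
    and m: "K \<le> m"
  shows "(\<Sum>i<m. \<Sum>l<m. (a i l - c i l)\<^sup>2) \<le> (\<Sum>i<K. \<Sum>l<K. (a i l - c i l)\<^sup>2) + 4 * (ta * qa + tc * qc)"
proof -
  have split: "(\<Sum>i<m. F i) = (\<Sum>i<K. F i) + (\<Sum>i\<in>{K..<m}. F i)" for F :: "nat \<Rightarrow> real"
    using sum.atLeastLessThan_concat[of 0 K m F] m by (simp add: lessThan_atLeast0)
  define g where "g i l = 2 * (a i i * a l l) + 2 * (c i i * c l l)" for i l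
  have g: "(a i l - c i l)\<^sup>2 \<le> g i l" for i l
    using a(1)[of i l] c(1)[of i l] zero_le_power2[of "a i l + c i l"]
    by (simp add: g_def power2_eq_square algebra_simps)
  have corner: "(\<Sum>i\<in>A. \<Sum>l\<in>B. g i l) = 2 * ((\<Sum>i\<in>A. a i i) * (\<Sum>l\<in>B. a l l)) + 2 * ((\<Sum>i\<in>A. c i i) * (\<Sum>l\<in>B. c l l))" for A B
    by (simp only: g_def sum.distrib sum_distrib_left[symmetric] sum_distrib_right[symmetric])
  have nonneg: "0 \<le> (\<Sum>i\<in>A. a i i)" "0 \<le> (\<Sum>i\<in>A. c i i)" for A by (auto intro: sum_nonneg a c)
  have ta: "0 \<le> ta" "0 \<le> tc" using a(3)[of 0] c(3)[of 0] by auto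
  have 1: "(\<Sum>i<K. \<Sum>l\<in>{K..<m}. (a i l - c i l)\<^sup>2) \<le> 2 * (ta * qa) + 2 * (tc * qc)"
  proof -
    have "(\<Sum>i<K. \<Sum>l\<in>{K..<m}. (a i l - c i l)\<^sup>2) \<le> (\<Sum>i<K. \<Sum>l\<in>{K..<m}. g i l)" by (intro sum_mono g)
    also have "\<dots> \<le> 2 * (ta * qa) + 2 * (tc * qc)"
      unfolding corner by (intro add_mono mult_left_mono mult_mono a c nonneg ta) auto
    finally show ?thesis .
  qed
  have 2: "(\<Sum>i\<in>{K..<m}. \<Sum>l<m. (a i l - c i l)\<^sup>2) \<le> 2 * (ta * qa) + 2 * (tc * qc)"
  proof -
    have "(\<Sum>i\<in>{K..<m}. \<Sum>l<m. (a i l - c i l)\<^sup>2) \<le> (\<Sum>i\<in>{K..<m}. \<Sum>l<m. g i l)" by (intro sum_mono g)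
    also have "\<dots> \<le> 2 * (ta * qa) + 2 * (tc * qc)"
      unfolding corner mult.commute[of "sum _ {K..<m}"] by (intro add_mono mult_left_mono mult_mono a c nonneg ta) auto
    finally show ?thesis .
  qed
  have "(\<Sum>i<m. \<Sum>l<m. (a i l - c i l)\<^sup>2) = (\<Sum>i<K. \<Sum>l<K. (a i l - c i l)\<^sup>2) +
     (\<Sum>i<K. \<Sum>l\<in>{K..<m}. (a i l - c i l)\<^sup>2) + (\<Sum>i\<in>{K..<m}. \<Sum>l<m. (a i l - c i l)\<^sup>2)"
    unfolding split[of "\<lambda>i. \<Sum>l<m. (a i l - c i l)\<^sup>2"] by (simp add: split[of "\<lambda>l. (a i l - c i l)\<^sup>2" for i] sum.distrib)
  then show ?thesis using 1 2 by simp
qed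

section \<open>Hilbert-Schmidt norms through matrix entries\<close>

context L2_basis
begin

text \<open>By Parseval the squared norm is approached by sums over square sections; a bound from
  size \<open>K\<close> on is enough, as smaller sections sit inside larger ones.\<close>

lemma hs_norm_le:
  assumes bound: "\<And>m. K \<le> m \<Longrightarrow> (\<Sum>i<m. \<Sum>l<m. (\<Psi> (e i) \<bullet> e l)\<^sup>2) \<le> B"
  shows "hs_norm e \<Psi> \<le> ennreal (sqrt B)"
proof -
  have part: "(\<Sum>i<m. (norm (\<Psi> (e i)))\<^sup>2) \<le> B" for m
  proof (rule LIMSEQ_le_const2)
    show "(\<lambda>m'. \<Sum>i<m. \<Sum>l<m'. (\<Psi> (e i) \<bullet> e l)\<^sup>2) \<longlonglongrightarrow> (\<Sum>i<m. (norm (\<Psi> (e i)))\<^sup>2)"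
      using parseval by (intro tendsto_sum) (simp add: sums_def)
    have "(\<Sum>i<m. \<Sum>l<m'. (\<Psi> (e i) \<bullet> e l)\<^sup>2) \<le> B" if m': "max K m \<le> m'" for m'
    proof -
      have "(\<Sum>i<m. \<Sum>l<m'. (\<Psi> (e i) \<bullet> e l)\<^sup>2) \<le> (\<Sum>i<m'. \<Sum>l<m'. (\<Psi> (e i) \<bullet> e l)\<^sup>2)"
        using m' by (intro sum_mono2) (auto intro: sum_nonneg)
      also have "\<dots> \<le> B" using m' by (intro bound) simp
      finally show ?thesis .
    qed
    then show "\<exists>N. \<forall>m'\<ge>N. (\<Sum>i<m. \<Sum>l<m'. (\<Psi> (e i) \<bullet> e l)\<^sup>2) \<le> B" by blast
  qed
  have "summable (\<lambda>i. (norm (\<Psi> (e i)))\<^sup>2)"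
    using part[of "Suc _"] by (intro bounded_imp_summable[where B = B]) (auto simp: lessThan_Suc_atMost)
  moreover from this have "(\<Sum>i. (norm (\<Psi> (e i)))\<^sup>2) \<le> B" by (intro suminf_le_const part)
  ultimately show ?thesis by (simp add: hs_norm_def ennreal_leI)
qed

end

text \<open>The case distinction on summability is rewritten with the extended nonnegative sum,
  which is infinite exactly when the real series diverges.\<close>

lemma hs_norm_measurable:
  assumes [measurable]: "\<And>i. (\<lambda>\<omega>. \<Psi> \<omega> (e i)) \<in> borel_measurable M"
  shows "(\<lambda>\<omega>. hs_norm e (\<Psi> \<omega>)) \<in> borel_measurable M"
proof -
  have "hs_norm e T = (let s = \<Sum>i. ennreal ((norm (T (e i)))\<^sup>2) in if s = top then top else ennreal (sqrt (enn2real s)))" for T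
  proof (cases "summable (\<lambda>i. (norm (T (e i)))\<^sup>2)")
    case True
    then have "(\<Sum>i. ennreal ((norm (T (e i)))\<^sup>2)) = ennreal (\<Sum>i. (norm (T (e i)))\<^sup>2)" by (intro suminf_ennreal2) auto
    then show ?thesis using True by (simp add: hs_norm_def suminf_nonneg)
  next
    case False
    then have "(\<Sum>i. ennreal ((norm (T (e i)))\<^sup>2)) = top"
      using summable_suminf_not_top[of "\<lambda>i. (norm (T (e i)))\<^sup>2", OF zero_le_power2] by blast
    then show ?thesis using False by (simp add: hs_norm_def)
  qed
  then have "(\<lambda>\<omega>. hs_norm e (\<Psi> \<omega>)) = (\<lambda>\<omega>. let s = \<Sum>i. ennreal ((norm (\<Psi> \<omega> (e i)))\<^sup>2) in
      if s = top then top else ennreal (sqrt (enn2real s)))" by (rule ext)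
  then show ?thesis by (simp only: Let_def) measurable
qed

text \<open>The norm is extended-valued and its bound holds almost everywhere only, so Markov's
  inequality is applied to the real majorant.\<close>

lemma (in prob_space) prob_gt_le_expectation:
  assumes Y: "Y \<in> borel_measurable M" and R: "integrable M R" "\<And>\<omega>. 0 \<le> R \<omega>" and le: "AE \<omega> in M. Y \<omega> \<le> ennreal (R \<omega>)" and \<epsilon>: "0 < \<epsilon>"
  shows "prob {\<omega>\<in>space M. Y \<omega> > ennreal \<epsilon>} \<le> expectation R / \<epsilon>"
proof -
  have "prob {\<omega>\<in>space M. Y \<omega> > ennreal \<epsilon>} \<le> prob {\<omega>\<in>space M. \<epsilon> \<le> R \<omega>}"
  proof (rule finite_measure_mono_AE)
    show "AE \<omega> in M. \<omega> \<in> {\<omega>\<in>space M. Y \<omega> > ennreal \<epsilon>} \<longrightarrow> \<omega> \<in> {\<omega>\<in>space M. \<epsilon> \<le> R \<omega>}"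
      using le
    proof eventually_elim
      case (elim \<omega>)
      have "\<epsilon> \<le> R \<omega>" if "ennreal \<epsilon> < Y \<omega>"
        using less_le_trans[OF that elim] by (simp add: ennreal_less_iff[OF less_imp_le[OF \<epsilon>]])
      then show ?case by simp
    qed
  qed (use R in measurable)
  also have "\<dots> \<le> expectation R / \<epsilon>"
    by (rule integral_Markov_inequality_measure[where A = "{}"]) (use R \<epsilon> in auto)
  finally show ?thesis .
qed

lemma (in prob_space) covariance_square_le:
  fixes Y Y' :: "'a \<Rightarrow> real"
  assumes "sqint M Y" "sqint M Y'"
  shows "(expectation (\<lambda>\<omega>. Y \<omega> * Y' \<omega>))\<^sup>2 \<le> expectation (\<lambda>\<omega>. Y \<omega> * Y \<omega>) * expectation (\<lambda>\<omega>. Y' \<omega> * Y' \<omega>)"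
proof -
  have "\<bar>expectation (\<lambda>\<omega>. Y \<omega> * Y' \<omega>)\<bar> \<le> nrm2 M Y * nrm2 M Y'"
    using abs_expectation_inner_le[OF assms] by simp
  from power_mono[OF this, of 2] show ?thesis
    by (simp add: power_mult_distrib nrm2_square) (simp add: power2_eq_square)
qed

lemma avg_cauchy_schwarz:
  fixes u v :: "nat \<Rightarrow> real"
  shows "(avg N (\<lambda>t. u t * v t))\<^sup>2 \<le> avg N (\<lambda>t. u t * u t) * avg N (\<lambda>t. v t * v t)"
  using Cauchy_Schwarz_ineq_sum[of u v "{..<N}"]
  unfolding avg_real by (simp add: power_divide divide_right_mono power2_eq_square)

text \<open>Sample sizes are indexed by \<open>j\<close>, to be instantiated with the increasing
  enumeration of the admissible set, so that ordinary sequences can be used.\<close>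

locale mbb_seq = m_approx_basis M X f \<delta> \<delta>' e
  for M :: "'w measure" and X f \<delta> \<delta>' and e :: "nat \<Rightarrow> L2" +
  fixes n b :: "nat \<Rightarrow> nat" and I :: "nat \<Rightarrow> nat \<Rightarrow> 'w \<Rightarrow> nat" and Estar :: "nat \<Rightarrow> 'w \<Rightarrow> L2"
    and Lstar :: "nat \<Rightarrow> 'w \<Rightarrow> L2 measure" and Cstar :: "nat \<Rightarrow> 'w \<Rightarrow> L2 \<Rightarrow> L2"
  assumes mbb: "\<And>j. mbb M X f \<delta> \<delta>' e (n j) (b j) (I j) (Estar j) (Lstar j) (Cstar j)"
    and b_lim: "filterlim b at_top sequentially" and k_lim: "filterlim (\<lambda>j. n j div b j) at_top sequentially"
begin

definition k :: "nat \<Rightarrow> nat" where "k j = n j div b j"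
definition N :: "nat \<Rightarrow> nat" where "N j = n j - b j + 1"

lemma mbb_k: "mbb.k (n j) (b j) = k j" and mbb_N: "mbb.N (n j) (b j) = N j"
  using mbb.k_def[OF mbb] mbb.N_def[OF mbb] by (simp_all add: k_def N_def)

lemma n_eq: "n j = k j * b j"
  using mbb.n_eq[OF mbb] unfolding mbb_k .

lemma n_pos: "0 < n j"
  by (rule mbb.n_pos[OF mbb])

lemma seq_params: "1 \<le> b j" "1 \<le> k j" "filterlim b at_top sequentially" "filterlim k at_top sequentially" "N j = (k j - 1) * b j + 1"
  using mbb.b_pos[OF mbb] mbb.k_ge2[OF mbb, of j] mbb.N_eq[OF mbb, of j] b_lim k_lim
  unfolding mbb_k mbb_N k_def[abs_def] by auto

lemma n_lim: "filterlim n at_top sequentially"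
  by (rule filterlim_at_top_mono[OF b_lim]) (use seq_params n_eq in \<open>auto intro!: always_eventually\<close>)

abbreviation \<gamma> where "\<gamma> \<equiv> gauss_measure lrc"

lemma charf_gauss: "charf K a \<gamma> = complex_of_real (exp (- lrvf (\<Sum>i<K. a i *\<^sub>R e i) / 2))"
  unfolding charf_def char_gauss_measure[OF psd_lrc summable_lrc] lrcov_quadratic lrc_def ..

lemma sqrt_tail_tendsto: "(\<lambda>K. sqrt (tail K)) \<longlonglongrightarrow> 0"
  using tendsto_real_sqrt[OF tail_tendsto] by simp

text \<open>A frequency vector \<open>a\<close> amounts to one direction \<open>g\<close>, which is
  a scalar problem; the tail bound does not involve \<open>j\<close>.\<close>

lemma Lstar_bump: "(\<lambda>j. \<integral>\<omega>. \<bar>(\<integral>x. bump l x \<partial>Lstar j \<omega>) - (\<integral>x. bump l x \<partial>\<gamma>)\<bar> \<partial>M) \<longlonglongrightarrow> 0"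
proof (rule random_measures_bump_tendsto[where \<kappa> = Lstar, OF prob_space_axioms mbb.Lstar_kernel[OF mbb] gauss_measure_in _ _ sqrt_tail_tendsto])
  fix K a
  define g where "g = (\<Sum>i<K. a i *\<^sub>R e i)"
  show "(\<lambda>j. \<integral>\<omega>. cmod (charf K a (Lstar j \<omega>) - charf K a \<gamma>) \<partial>M) \<longlonglongrightarrow> 0"
    unfolding charf_gauss mbb.Lstar_charf[OF mbb refl] mbb_k mbb_N lrvf_def
    by (rule approx_process.cond_char_tendsto[OF xg_approx_process seq_params])
qed (rule mbb.Lstar_tail[OF mbb])

definition root_n :: "nat \<Rightarrow> 'w \<Rightarrow> L2" where
  "root_n j \<omega> = (1 / sqrt (real (n j))) *\<^sub>R bsum Xf 1 (n j) \<omega>"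

lemma root_n_sqint: "sqint M (root_n j)"
  unfolding root_n_def[abs_def] by (intro sqint_scaleR bsum_Xf_sqint)

lemma sample_mean_measurable [measurable]: "sample_mean X m \<in> borel_measurable M"
  unfolding sample_mean_def[abs_def] by measurable

lemma AE_root_n: "AE \<omega> in M. sqrt (real (n j)) *\<^sub>R sample_mean X (n j) \<omega> = root_n j \<omega>"
proof -
  have s: "sqrt (real (n j)) * (1 / real (n j)) = 1 / sqrt (real (n j))"
    using n_pos[of j] real_div_sqrt[of "real (n j)"] by (simp add: field_simps)
  have "AE \<omega> in M. \<forall>t. X t \<omega> = Xf t \<omega>" by (rule AE_X)
  then show ?thesis
    by eventually_elim (simp only: sample_mean_def root_n_def scaleR_scaleR s sum_atLeast1_shift bsum_def of_nat_Suc)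
qed

definition law :: "nat \<Rightarrow> L2 measure" where
  "law j = distr M borel (\<lambda>\<omega>. sqrt (real (n j)) *\<^sub>R sample_mean X (n j) \<omega>)"

lemma law_in: "law j \<in> space (prob_algebra borel)"
  unfolding law_def space_prob_algebra by (auto intro!: prob_space_distr)

lemma law_integral:
  fixes g :: "L2 \<Rightarrow> 'c::{banach, second_countable_topology}"
  assumes [measurable]: "g \<in> borel_measurable borel"
  shows "(\<integral>x. g x \<partial>law j) = (\<integral>\<omega>. g (root_n j \<omega>) \<partial>M)"
proof -
  note [measurable] = sqint_measurable[OF root_n_sqint]
  have "(\<integral>x. g x \<partial>law j) = (\<integral>\<omega>. g (sqrt (real (n j)) *\<^sub>R sample_mean X (n j) \<omega>) \<partial>M)"
    unfolding law_def by (rule integral_distr) measurable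
  also have "\<dots> = (\<integral>\<omega>. g (root_n j \<omega>) \<partial>M)"
    by (rule integral_cong_AE) (use AE_root_n[of j] in \<open>auto elim: eventually_mono\<close>)
  finally show ?thesis .
qed

lemma root_n_tail: "(\<integral>\<omega>. (norm (root_n j \<omega> - proj K (root_n j \<omega>)))\<^sup>2 \<partial>M) \<le> tail K"
proof -
  have "root_n j \<omega> - proj K (root_n j \<omega>) = (1 / sqrt (real (n j))) *\<^sub>R (bsum Xf 1 (n j) \<omega> - proj K (bsum Xf 1 (n j) \<omega>))" for \<omega>
    by (simp add: root_n_def proj_scaleR scaleR_diff_right)
  then have "(\<integral>\<omega>. (norm (root_n j \<omega> - proj K (root_n j \<omega>)))\<^sup>2 \<partial>M) =
    (\<integral>\<omega>. (norm (bsum Xf 1 (n j) \<omega> - proj K (bsum Xf 1 (n j) \<omega>)))\<^sup>2 \<partial>M) / real (n j)"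
    by (simp add: power_divide)
  then show ?thesis using bsum_tail[of 1 "n j" K] n_pos[of j] by (simp add: divide_le_eq mult.commute)
qed

lemma root_n_residual_sqint: "sqint M (\<lambda>\<omega>. root_n j \<omega> - proj K (root_n j \<omega>))"
  by (rule T_sqint[OF residual_linear, where c = 1]) (simp_all add: norm_residual_le root_n_sqint)

text \<open>The unconditional laws are viewed as constant random measures, so the criterion used for
  the bootstrap laws applies to them too.\<close>

lemma law_bump: "(\<lambda>j. \<integral>x. bump l x \<partial>law j) \<longlonglongrightarrow> (\<integral>x. bump l x \<partial>\<gamma>)"
proof -
  have "(\<lambda>j. \<integral>\<omega>. \<bar>(\<integral>x. bump l x \<partial>law j) - (\<integral>x. bump l x \<partial>\<gamma>)\<bar> \<partial>M) \<longlonglongrightarrow> 0"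
  proof (rule random_measures_bump_tendsto[where \<kappa> = "\<lambda>j \<omega>. law j", OF prob_space_axioms _ gauss_measure_in _ _ sqrt_tail_tendsto])
    show "(\<lambda>\<omega>. law j) \<in> M \<rightarrow>\<^sub>M prob_algebra borel" for j using law_in by simp
    fix K a
    define g where "g = (\<Sum>i<K. a i *\<^sub>R e i)"
    have lin: "lin K a x = x \<bullet> g" for x by (simp add: g_def inner_sum_right)
    have "charf K a (law j) = (CLINT \<omega>|M. iexp (bsum (xg g) 1 (k j * b j) \<omega> / sqrt (real (k j * b j))))" for j
      unfolding charf_def lin by (subst law_integral) (simp_all add: root_n_def bsum_xg n_eq)
    then have "(\<lambda>j. charf K a (law j)) \<longlonglongrightarrow> charf K a \<gamma>"
      unfolding charf_gauss lrvf_def g_def[symmetric] using approx_process.char_tendsto[OF xg_approx_process seq_params] by simp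
    then have "(\<lambda>j. cmod (charf K a (law j) - charf K a \<gamma>)) \<longlonglongrightarrow> 0"
      by (simp add: LIM_zero tendsto_norm_zero)
    then show "(\<lambda>j. \<integral>\<omega>. cmod (charf K a (law j) - charf K a \<gamma>) \<partial>M) \<longlonglongrightarrow> 0" by (simp add: prob_space)
  next
    fix K j
    have "(\<integral>x. min 1 (norm (x - proj K x)) \<partial>law j) = (\<integral>\<omega>. min 1 (norm (root_n j \<omega> - proj K (root_n j \<omega>))) \<partial>M)"
      by (rule law_integral) measurable
    also have "\<dots> \<le> (\<integral>\<omega>. norm (root_n j \<omega> - proj K (root_n j \<omega>)) \<partial>M)"
      by (rule integral_mono') (use sqint_integrable[OF root_n_residual_sqint] in auto)
    also have "\<dots> \<le> nrm2 M (\<lambda>\<omega>. root_n j \<omega> - proj K (root_n j \<omega>))"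
      by (rule expectation_norm_le_nrm2[OF root_n_residual_sqint])
    also have "\<dots> \<le> sqrt (tail K)" unfolding nrm2_def by (rule real_sqrt_le_mono[OF root_n_tail])
    finally show "(\<integral>\<omega>. (\<integral>x. min 1 (norm (x - proj K x)) \<partial>law j) \<partial>M) \<le> sqrt (tail K)" by (simp add: prob_space)
  qed
  then have "(\<lambda>j. \<bar>(\<integral>x. bump l x \<partial>law j) - (\<integral>x. bump l x \<partial>\<gamma>)\<bar>) \<longlonglongrightarrow> 0"
    by (simp add: prob_space)
  then have "(\<lambda>j. (\<integral>x. bump l x \<partial>law j) - (\<integral>x. bump l x \<partial>\<gamma>)) \<longlonglongrightarrow> 0"
    by (rule tendsto_rabs_zero_cancel)
  then show ?thesis by (rule LIM_zero_cancel)
qed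

text \<open>Both laws are compared with \<gamma>: the deterministic one is eventually within half of
  \<epsilon>, and so is the random one unless one of finitely many bump integrals is off by \<eta>,
  an event controlled by Markov's inequality.\<close>

lemma bootstrap_law_consistent:
  assumes d: "metrizes_weak_convergence d"
  shows "tendsto_zero_in_prob M (\<lambda>j \<omega>. ennreal (d (Lstar j \<omega>) (law j))) sequentially"
  unfolding tendsto_zero_in_prob_def
proof (intro conjI allI impI)
  have kern: "Lstar j \<in> M \<rightarrow>\<^sub>M prob_algebra borel" for j by (rule mbb.Lstar_kernel[OF mbb])
  have dm: "(\<lambda>\<omega>. d (Lstar j \<omega>) (law j)) \<in> borel_measurable M" for j
    by (rule measurable_compose[OF kern metrizes_measurable[OF d law_in]])
  then show "\<forall>\<^sub>F j in sequentially. (\<lambda>\<omega>. ennreal (d (Lstar j \<omega>) (law j))) \<in> borel_measurable M" by simp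
  interpret d: Metric_space "space (prob_algebra borel)" d using d by (simp add: metrizes_weak_convergence_def)
  define D where "D = range rat_step_L2"
  have D: "countable D" "closure D = UNIV" by (simp_all add: D_def closure_rat_step_L2)
  have "weakly_converges law \<gamma>"
    by (rule weakly_converges_bump[OF D law_in gauss_measure_in law_bump])
  then have d_law: "(\<lambda>j. d (law j) \<gamma>) \<longlonglongrightarrow> 0"
    using d law_in gauss_measure_in unfolding metrizes_weak_convergence_def by blast
  fix \<epsilon> :: real assume \<epsilon>: "0 < \<epsilon>"
  obtain L \<eta> where L: "finite L" "0 < \<eta>" and nb': "\<forall>\<mu>\<in>space (prob_algebra borel).
    (\<forall>l\<in>L. \<bar>(\<integral>x. bump l x \<partial>\<mu>) - (\<integral>x. bump l x \<partial>\<gamma>)\<bar> < \<eta>) \<longrightarrow> d \<mu> \<gamma> < \<epsilon> / 2"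
    using metrizes_bump_neighbourhood[OF D d gauss_measure_in[of lrc] half_gt_zero[OF \<epsilon>]] by (elim exE conjE) (rule that)
  have nb: "d \<mu> \<gamma> < \<epsilon> / 2" if "\<mu> \<in> space (prob_algebra borel)"
    "\<And>l. l \<in> L \<Longrightarrow> \<bar>(\<integral>x. bump l x \<partial>\<mu>) - (\<integral>x. bump l x \<partial>\<gamma>)\<bar> < \<eta>" for \<mu>
    using bspec[OF nb' that(1)] that(2) by simp
  define R where "R j \<omega> = (\<Sum>l\<in>L. \<bar>(\<integral>x. bump l x \<partial>Lstar j \<omega>) - (\<integral>x. bump l x \<partial>\<gamma>)\<bar>)" for j \<omega>
  have R_int1: "integrable M (\<lambda>\<omega>. \<bar>(\<integral>x. bump l x \<partial>Lstar j \<omega>) - (\<integral>x. bump l x \<partial>\<gamma>)\<bar>)" for l j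
  proof (rule integrable_const_bound[where B = 2])
    have le1: "\<bar>\<integral>x. bump l x \<partial>\<mu>\<bar> \<le> 1" if \<mu>: "\<mu> \<in> space (prob_algebra borel)" for \<mu> :: "L2 measure"
    proof -
      interpret \<mu>: prob_space \<mu> using \<mu> by (simp add: space_prob_algebra_borel)
      have "\<bar>\<integral>x. bump l x \<partial>\<mu>\<bar> \<le> (\<integral>x. \<bar>bump l x\<bar> \<partial>\<mu>)" by (rule integral_abs_bound)
      also have "\<dots> \<le> (\<integral>x. 1 \<partial>\<mu>)"
        using integrable_bump[OF \<mu>] by (intro integral_mono) (auto simp: abs_bump_le_1)
      finally show ?thesis by (simp add: \<mu>.prob_space)
    qed
    show "AE \<omega> in M. norm \<bar>(\<integral>x. bump l x \<partial>Lstar j \<omega>) - (\<integral>x. bump l x \<partial>\<gamma>)\<bar> \<le> 2"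
    proof (rule AE_I2)
      fix \<omega> assume \<omega>: "\<omega> \<in> space M"
      show "norm \<bar>(\<integral>x. bump l x \<partial>Lstar j \<omega>) - (\<integral>x. bump l x \<partial>\<gamma>)\<bar> \<le> 2"
        using abs_triangle_ineq4[of "\<integral>x. bump l x \<partial>Lstar j \<omega>" "\<integral>x. bump l x \<partial>\<gamma>"]
          le1[OF measurable_space[OF kern \<omega>], of j] le1[OF gauss_measure_in[of lrc]] by simp
    qed
    show "(\<lambda>\<omega>. \<bar>(\<integral>x. bump l x \<partial>Lstar j \<omega>) - (\<integral>x. bump l x \<partial>\<gamma>)\<bar>) \<in> borel_measurable M"
      using kernel_integral_measurable[OF kern, of "bump l" j] by measurable
  qed
  have R_int: "integrable M (R j)" for j unfolding R_def[abs_def] by (intro Bochner_Integration.integrable_sum R_int1)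
  have R_nonneg: "0 \<le> R j \<omega>" for j \<omega> by (simp add: R_def sum_nonneg)
  have R_lim: "(\<lambda>j. expectation (R j)) \<longlonglongrightarrow> 0"
  proof -
    have "(\<lambda>j. \<Sum>l\<in>L. \<integral>\<omega>. \<bar>(\<integral>x. bump l x \<partial>Lstar j \<omega>) - (\<integral>x. bump l x \<partial>\<gamma>)\<bar> \<partial>M) \<longlonglongrightarrow> (\<Sum>l\<in>L. 0)"
      by (intro tendsto_sum Lstar_bump)
    then show ?thesis unfolding R_def using R_int1 by simp
  qed
  show "(\<lambda>j. prob {\<omega>\<in>space M. ennreal \<epsilon> < ennreal (d (Lstar j \<omega>) (law j))}) \<longlonglongrightarrow> 0"
  proof (rule tendsto_sandwich[OF _ _ tendsto_const])
    show "(\<lambda>j. expectation (R j) / \<eta>) \<longlonglongrightarrow> 0" using tendsto_divide[OF R_lim tendsto_const[of \<eta>]] L(2) by simp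
    have "\<forall>\<^sub>F j in sequentially. d (law j) \<gamma> < \<epsilon> / 2" using d_law \<epsilon> by (intro order_tendstoD) auto
    then show "\<forall>\<^sub>F j in sequentially. prob {\<omega>\<in>space M. ennreal \<epsilon> < ennreal (d (Lstar j \<omega>) (law j))} \<le> expectation (R j) / \<eta>"
    proof eventually_elim
      case (elim j)
      have "prob {\<omega>\<in>space M. ennreal \<epsilon> < ennreal (d (Lstar j \<omega>) (law j))} \<le> prob {\<omega>\<in>space M. \<eta> \<le> R j \<omega>}"
      proof (rule finite_measure_mono)
        show "{\<omega>\<in>space M. \<eta> \<le> R j \<omega>} \<in> sets M" using R_int[of j] by measurable
        show "{\<omega>\<in>space M. ennreal \<epsilon> < ennreal (d (Lstar j \<omega>) (law j))} \<subseteq> {\<omega>\<in>space M. \<eta> \<le> R j \<omega>}"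
        proof safe
          fix \<omega> assume \<omega>: "\<omega> \<in> space M" and gt: "ennreal \<epsilon> < ennreal (d (Lstar j \<omega>) (law j))"
          show "\<eta> \<le> R j \<omega>"
          proof (rule ccontr)
            assume "\<not> \<eta> \<le> R j \<omega>"
            then have lt: "\<bar>(\<integral>x. bump l x \<partial>Lstar j \<omega>) - (\<integral>x. bump l x \<partial>\<gamma>)\<bar> < \<eta>" if "l \<in> L" for l
              using member_le_sum[OF that, of "\<lambda>l. \<bar>(\<integral>x. bump l x \<partial>Lstar j \<omega>) - (\<integral>x. bump l x \<partial>\<gamma>)\<bar>"] L(1)
              by (simp add: R_def)
            have P: "Lstar j \<omega> \<in> space (prob_algebra borel)" by (rule measurable_space[OF kern \<omega>])
            have "d (Lstar j \<omega>) (law j) \<le> d (Lstar j \<omega>) \<gamma> + d \<gamma> (law j)"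
              by (rule d.triangle[OF P gauss_measure_in law_in])
            also have "\<dots> < \<epsilon> / 2 + \<epsilon> / 2"
              using nb[OF P lt] elim by (simp add: d.commute)
            finally show False using gt \<epsilon> by (simp add: ennreal_less_iff)
          qed
        qed
      qed
      also have "\<dots> \<le> expectation (R j) / \<eta>"
        by (rule integral_Markov_inequality_measure[where A = "{}"])
          (use R_int L(2) R_nonneg in auto)
      finally show ?case .
    qed
  qed simp
qed

definition emp_cov :: "nat \<Rightarrow> 'w \<Rightarrow> L2 \<Rightarrow> L2 \<Rightarrow> real" where
  "emp_cov j \<omega> g h = avg (N j) (\<lambda>t. (cblk Xf (b j) (N j) t \<omega> \<bullet> g) * (cblk Xf (b j) (N j) t \<omega> \<bullet> h))"

definition mean_cov :: "nat \<Rightarrow> L2 \<Rightarrow> L2 \<Rightarrow> real" where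
  "mean_cov j g h = (\<integral>\<omega>. (root_n j \<omega> \<bullet> g) * (root_n j \<omega> \<bullet> h) \<partial>M)"

lemma root_n_inner_sqint: "sqint M (\<lambda>\<omega>. root_n j \<omega> \<bullet> g)"
  by (rule T_sqint[OF bounded_linear_inner_left inner_bounded root_n_sqint])

lemma mean_cov_tendsto: "(\<lambda>j. mean_cov j g h) \<longlonglongrightarrow> lrcov g h"
proof -
  have "mean_cov j g h = (\<integral>\<omega>. (bsum Xf 1 (n j) \<omega> \<bullet> g) * (bsum Xf 1 (n j) \<omega> \<bullet> h) \<partial>M) / real (n j)" for j
  proof -
    have "(root_n j \<omega> \<bullet> g) * (root_n j \<omega> \<bullet> h) = (bsum Xf 1 (n j) \<omega> \<bullet> g) * (bsum Xf 1 (n j) \<omega> \<bullet> h) / real (n j)" for \<omega>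
      by (simp add: root_n_def)
    then show ?thesis by (simp add: mean_cov_def)
  qed
  then show ?thesis using filterlim_compose[OF lrcov_tendsto[of 1 g h] n_lim] by simp
qed

text \<open>Reduces the entries to empirical variances of the scalar processes in the directions
  \<open>g + h\<close> and \<open>g - h\<close>, for which convergence in mean is known.\<close>

lemma emp_cov_polar:
  "emp_cov j \<omega> g h = (emp_var (xg (g + h)) (b j) (N j) \<omega> - emp_var (xg (g - h)) (b j) (N j) \<omega>) / 4"
proof -
  have "emp_var (xg (g + h)) (b j) (N j) \<omega> - emp_var (xg (g - h)) (b j) (N j) \<omega> =
    avg (N j) (\<lambda>t. 4 * ((cblk Xf (b j) (N j) t \<omega> \<bullet> g) * (cblk Xf (b j) (N j) t \<omega> \<bullet> h)))"
    unfolding emp_var_def cblk_inner[symmetric] avg_diff[symmetric]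
    by (simp add: inner_add_right inner_diff_right power2_eq_square algebra_simps)
  then show ?thesis unfolding avg_cmult emp_cov_def by simp
qed

lemma cblk_Xf_sqint: "sqint M (cblk Xf (b j) (N j) t)"
  using mbb.cblk_Xf_sqint[OF mbb] unfolding mbb_N .

lemma emp_var_integrable: "integrable M (emp_var (xg g) (b j) (N j))"
proof -
  have "sqint M (\<lambda>\<omega>. cblk Xf (b j) (N j) t \<omega> \<bullet> g)" for t
    by (rule T_sqint[OF bounded_linear_inner_left inner_bounded cblk_Xf_sqint])
  then show ?thesis unfolding emp_var_def[abs_def] cblk_inner[symmetric] avg_real by (auto simp: sqint_def)
qed

lemma emp_cov_integrable: "integrable M (\<lambda>\<omega>. emp_cov j \<omega> g h)"
  unfolding emp_cov_polar using emp_var_integrable by auto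

lemma emp_cov_tendsto: "(\<lambda>j. \<integral>\<omega>. \<bar>emp_cov j \<omega> g h - mean_cov j g h\<bar> \<partial>M) \<longlonglongrightarrow> 0"
proof (rule tendsto_sandwich[OF _ _ tendsto_const])
  let ?v = "\<lambda>j g. \<integral>\<omega>. \<bar>emp_var (xg g) (b j) (N j) \<omega> - lrvf g\<bar> \<partial>M"
  have v0: "(\<lambda>j. ?v j g) \<longlonglongrightarrow> 0" for g
    unfolding lrvf_def by (rule approx_process.emp_var_tendsto[OF xg_approx_process seq_params])
  have "(\<lambda>j. ?v j (g + h) / 4 + ?v j (g - h) / 4 + \<bar>lrcov g h - mean_cov j g h\<bar>) \<longlonglongrightarrow> 0 / 4 + 0 / 4 + \<bar>lrcov g h - lrcov g h\<bar>"
    by (intro tendsto_intros v0 mean_cov_tendsto) simp_all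
  then show "(\<lambda>j. ?v j (g + h) / 4 + ?v j (g - h) / 4 + \<bar>lrcov g h - mean_cov j g h\<bar>) \<longlonglongrightarrow> 0" by simp
  show "\<forall>\<^sub>F j in sequentially. (\<integral>\<omega>. \<bar>emp_cov j \<omega> g h - mean_cov j g h\<bar> \<partial>M) \<le> ?v j (g + h) / 4 + ?v j (g - h) / 4 + \<bar>lrcov g h - mean_cov j g h\<bar>"
  proof (intro always_eventually allI)
    fix j
    let ?w = "\<lambda>g \<omega>. \<bar>emp_var (xg g) (b j) (N j) \<omega> - lrvf g\<bar>"
    have int: "integrable M (?w g)" for g using emp_var_integrable by auto
    have "(\<integral>\<omega>. \<bar>emp_cov j \<omega> g h - mean_cov j g h\<bar> \<partial>M) \<le> (\<integral>\<omega>. ?w (g + h) \<omega> / 4 + ?w (g - h) \<omega> / 4 + \<bar>lrcov g h - mean_cov j g h\<bar> \<partial>M)"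
    proof (rule integral_mono)
      fix \<omega>
      define p q where "p = emp_var (xg (g + h)) (b j) (N j) \<omega> - lrvf (g + h)" and "q = emp_var (xg (g - h)) (b j) (N j) \<omega> - lrvf (g - h)"
      have "emp_cov j \<omega> g h - mean_cov j g h = (p / 4 - q / 4) + (lrcov g h - mean_cov j g h)"
        unfolding emp_cov_polar lrcov_def p_def q_def by (simp add: field_simps)
      also have "\<bar>\<dots>\<bar> \<le> (\<bar>p / 4\<bar> + \<bar>q / 4\<bar>) + \<bar>lrcov g h - mean_cov j g h\<bar>"
        by (rule order_trans[OF abs_triangle_ineq add_right_mono[OF abs_triangle_ineq4]])
      finally show "\<bar>emp_cov j \<omega> g h - mean_cov j g h\<bar> \<le> ?w (g + h) \<omega> / 4 + ?w (g - h) \<omega> / 4 + \<bar>lrcov g h - mean_cov j g h\<bar>"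
        by (simp add: p_def q_def)
    qed (use int emp_cov_integrable in auto)
    also have "\<dots> = ?v j (g + h) / 4 + ?v j (g - h) / 4 + \<bar>lrcov g h - mean_cov j g h\<bar>"
      using int by (simp add: prob_space)
    finally show "(\<integral>\<omega>. \<bar>emp_cov j \<omega> g h - mean_cov j g h\<bar> \<partial>M) \<le> ?v j (g + h) / 4 + ?v j (g - h) / 4 + \<bar>lrcov g h - mean_cov j g h\<bar>" .
  qed
qed simp

definition emp_tail :: "nat \<Rightarrow> nat \<Rightarrow> 'w \<Rightarrow> real" where
  "emp_tail j K \<omega> = avg (N j) (\<lambda>t. (norm (cblk Xf (b j) (N j) t \<omega> - proj K (cblk Xf (b j) (N j) t \<omega>)))\<^sup>2)"

lemma emp_tail_eq: "mbb.emp_tail f \<delta> \<delta>' e (n j) (b j) = emp_tail j"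
  using mbb.emp_tail_def[OF mbb, of j] unfolding mbb_N by (simp add: fun_eq_iff emp_tail_def)

lemmas emp_tail_le = mbb.emp_tail_le[OF mbb, unfolded emp_tail_eq]
  and emp_tail_integrable = mbb.emp_tail_integrable[OF mbb, unfolded emp_tail_eq]
  and emp_tail_nonneg = mbb.emp_tail_nonneg[OF mbb, unfolded emp_tail_eq]

text \<open>Bessel's inequality for the residual.\<close>

lemma sum_coefficients_le: "(\<Sum>i\<in>{K..<m}. (x \<bullet> e i) * (x \<bullet> e i)) \<le> (norm (x - proj K x))\<^sup>2"
proof (cases "K \<le> m")
  case True
  have "(\<Sum>i<m. (x \<bullet> e i)\<^sup>2) = (\<Sum>i<K. (x \<bullet> e i)\<^sup>2) + (\<Sum>i\<in>{K..<m}. (x \<bullet> e i)\<^sup>2)"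
    using sum.atLeastLessThan_concat[of 0 K m "\<lambda>i. (x \<bullet> e i)\<^sup>2"] True by (simp add: lessThan_atLeast0)
  moreover have "(norm (proj m x))\<^sup>2 \<le> (norm x)\<^sup>2" by (intro power_mono norm_proj_le) simp
  ultimately show ?thesis
    using pythagoras_proj[of x K] unfolding norm_proj[symmetric] by (simp add: power2_eq_square)
qed simp

lemma emp_cov_sum_le: "(\<Sum>i\<in>{K..<m}. emp_cov j \<omega> (e i) (e i)) \<le> emp_tail j K \<omega>"
proof -
  have "(\<Sum>i\<in>{K..<m}. emp_cov j \<omega> (e i) (e i)) = avg (N j) (\<lambda>t. \<Sum>i\<in>{K..<m}. (cblk Xf (b j) (N j) t \<omega> \<bullet> e i) * (cblk Xf (b j) (N j) t \<omega> \<bullet> e i))"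
    unfolding emp_cov_def avg_real by (subst sum.swap) (simp add: sum_divide_distrib)
  also have "\<dots> \<le> emp_tail j K \<omega>"
    unfolding emp_tail_def avg_real by (intro divide_right_mono sum_mono sum_coefficients_le) simp
  finally show ?thesis .
qed

lemma mean_cov_sum_le: "(\<Sum>i\<in>{K..<m}. mean_cov j (e i) (e i)) \<le> tail K"
proof -
  have int: "integrable M (\<lambda>\<omega>. (root_n j \<omega> \<bullet> e i) * (root_n j \<omega> \<bullet> e i))" for i
    using sqint_inner_integrable[OF root_n_inner_sqint root_n_inner_sqint] by simp
  have "(\<Sum>i\<in>{K..<m}. mean_cov j (e i) (e i)) = (\<integral>\<omega>. (\<Sum>i\<in>{K..<m}. (root_n j \<omega> \<bullet> e i) * (root_n j \<omega> \<bullet> e i)) \<partial>M)"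
    unfolding mean_cov_def using int by simp
  also have "\<dots> \<le> (\<integral>\<omega>. (norm (root_n j \<omega> - proj K (root_n j \<omega>)))\<^sup>2 \<partial>M)"
    by (rule integral_mono) (use int root_n_residual_sqint[of j K] sum_coefficients_le in \<open>auto simp: sqint_def\<close>)
  also have "\<dots> \<le> tail K" by (rule root_n_tail)
  finally show ?thesis .
qed

text \<open>Majorises the square root of the entrywise bound: the corner by its sum of absolute
  values, the random tail term as a product of square roots, so that Cauchy-Schwarz bounds its
  expectation by first moments of \<open>emp_tail\<close>.\<close>

definition hs_bound :: "nat \<Rightarrow> nat \<Rightarrow> 'w \<Rightarrow> real" where
  "hs_bound j K \<omega> = (\<Sum>i<K. \<Sum>l<K. \<bar>emp_cov j \<omega> (e i) (e l) - mean_cov j (e i) (e l)\<bar>)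
     + 2 * (sqrt (emp_tail j 0 \<omega>) * sqrt (emp_tail j K \<omega>)) + 2 * sqrt (tail 0 * tail K)"

definition cov_error :: "nat \<Rightarrow> 'w \<Rightarrow> L2 \<Rightarrow> L2" where
  "cov_error j \<omega> h = real (n j) *\<^sub>R Cstar j \<omega> h -
     real (n j) *\<^sub>R op_expectation M (\<lambda>\<omega>'. tensor (sample_mean X (n j) \<omega>') (sample_mean X (n j) \<omega>')) h"

text \<open>The pointwise operator expectation is a Bochner integral, through which the inner
  product passes; the factor \<open>n\<close> turns sample means into \<open>root_n\<close>.\<close>

lemma op_expectation_inner:
  "real (n j) * (op_expectation M (\<lambda>\<omega>'. tensor (sample_mean X (n j) \<omega>') (sample_mean X (n j) \<omega>')) g \<bullet> h) = mean_cov j g h"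
proof -
  let ?s = "sample_mean X (n j)"
  have sq: "sqint M (\<lambda>\<omega>. (1 / sqrt (real (n j))) *\<^sub>R root_n j \<omega>)" by (rule sqint_scaleR[OF root_n_sqint])
  have s_eq: "AE \<omega> in M. (1 / sqrt (real (n j))) *\<^sub>R root_n j \<omega> = ?s \<omega>"
    using AE_root_n[of j]
  proof eventually_elim
    case (elim \<omega>)
    show ?case unfolding elim[symmetric] using n_pos[of j] by simp
  qed
  have s_sq: "sqint M ?s" by (rule sqint_AE_cong[OF sq _ s_eq]) measurable
  have "integrable M (\<lambda>\<omega>. (?s \<omega> \<bullet> g) *\<^sub>R ?s \<omega>)"
  proof (rule Bochner_Integration.integrable_bound)
    show "integrable M (\<lambda>\<omega>. norm (?s \<omega> \<bullet> g) * norm (?s \<omega>))"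
      by (rule sqint_mult[OF T_sqint[OF bounded_linear_inner_left inner_bounded s_sq] s_sq])
  qed (use s_sq in \<open>auto simp: sqint_def\<close>)
  then have "op_expectation M (\<lambda>\<omega>'. tensor (?s \<omega>') (?s \<omega>')) g \<bullet> h = (\<integral>\<omega>. (?s \<omega> \<bullet> g) * (?s \<omega> \<bullet> h) \<partial>M)"
    unfolding op_expectation_def tensor_def by (simp flip: integral_inner_left)
  also have "real (n j) * \<dots> = (\<integral>\<omega>. real (n j) * ((?s \<omega> \<bullet> g) * (?s \<omega> \<bullet> h)) \<partial>M)" by simp
  also have "\<dots> = mean_cov j g h"
    unfolding mean_cov_def
  proof (rule integral_cong_AE)
    show "AE \<omega> in M. real (n j) * ((?s \<omega> \<bullet> g) * (?s \<omega> \<bullet> h)) = (root_n j \<omega> \<bullet> g) * (root_n j \<omega> \<bullet> h)"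
      using AE_root_n[of j]
    proof eventually_elim
      case (elim \<omega>)
      show ?case unfolding elim[symmetric] inner_scaleR_left by simp
    qed
  qed (use sqint_measurable[OF root_n_sqint] in measurable)
  finally show ?thesis .
qed

lemma cov_error_measurable: "(\<lambda>\<omega>. hs_norm e (cov_error j \<omega>)) \<in> borel_measurable M"
proof (rule hs_norm_measurable)
  have "has_cond_exp M (data_algebra M X (n j)) (\<lambda>\<omega>. tensor (mbb_mean X (n j) (b j) (I j) \<omega> - Estar j \<omega>)
      (mbb_mean X (n j) (b j) (I j) \<omega> - Estar j \<omega>) h) (\<lambda>\<omega>. Cstar j \<omega> h)" for h
    using mbb.Cstar[OF mbb] unfolding has_op_cond_exp_def by blast
  then have [measurable]: "(\<lambda>\<omega>. Cstar j \<omega> h) \<in> borel_measurable M" for h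
    unfolding has_cond_exp_def by (meson borel_measurable_integrable)
  show "(\<lambda>\<omega>. cov_error j \<omega> (e i)) \<in> borel_measurable M" for i unfolding cov_error_def by measurable
qed

lemma hs_norm_cov_error: "AE \<omega> in M. hs_norm e (cov_error j \<omega>) \<le> ennreal (hs_bound j K \<omega>)"
  using mbb.AE_Cstar[OF mbb, of j] mbb.AE_emp_cov[OF mbb, of j] unfolding mbb_N
proof eventually_elim
  case (elim \<omega>)
  define a where "a i l = emp_cov j \<omega> (e i) (e l)" for i l
  define c where "c i l = mean_cov j (e i) (e l)" for i l
  define T where "T = {..<K} \<times> {..<K}"
  have entry: "cov_error j \<omega> (e i) \<bullet> e l = a i l - c i l" for i l
    using elim op_expectation_inner[of j "e i" "e l"]
    by (simp add: cov_error_def inner_diff_left a_def c_def emp_cov_def)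
  let ?B = "(\<Sum>i<K. \<Sum>l<K. (a i l - c i l)\<^sup>2) + 4 * (emp_tail j 0 \<omega> * emp_tail j K \<omega> + tail 0 * tail K)"
  have "hs_norm e (cov_error j \<omega>) \<le> ennreal (sqrt ?B)"
  proof (rule hs_norm_le)
    fix m assume m: "K \<le> m"
    show "(\<Sum>i<m. \<Sum>l<m. (cov_error j \<omega> (e i) \<bullet> e l)\<^sup>2) \<le> ?B"
      unfolding entry
    proof (rule entrywise_tail_bound[OF _ _ _ _ _ _ _ _ m])
      show "(a i l)\<^sup>2 \<le> a i i * a l l" for i l unfolding a_def emp_cov_def by (rule avg_cauchy_schwarz)
      show "(c i l)\<^sup>2 \<le> c i i * c l l" for i l
        unfolding c_def mean_cov_def by (rule covariance_square_le[OF root_n_inner_sqint root_n_inner_sqint])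
      show "0 \<le> a i i" for i unfolding a_def emp_cov_def by (rule avg_nonneg) simp
      show "0 \<le> c i i" for i unfolding c_def mean_cov_def by (rule Bochner_Integration.integral_nonneg) simp
    qed (use emp_cov_sum_le[of 0] emp_cov_sum_le mean_cov_sum_le[of 0] mean_cov_sum_le in \<open>auto simp: a_def c_def lessThan_atLeast0\<close>)
  qed
  also have "sqrt ?B \<le> hs_bound j K \<omega>"
  proof -
    have s: "(\<Sum>i<K. \<Sum>l<K. F i l) = (\<Sum>(i, l)\<in>T. F i l)" for F :: "nat \<Rightarrow> nat \<Rightarrow> real"
      unfolding T_def by (rule sum.cartesian_product)
    have "sqrt (\<Sum>i<K. \<Sum>l<K. (a i l - c i l)\<^sup>2) \<le> (\<Sum>i<K. \<Sum>l<K. \<bar>a i l - c i l\<bar>)"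
      unfolding s using L2_set_le_sum_abs[of "\<lambda>(i, l). a i l - c i l" T] by (simp add: L2_set_def case_prod_beta')
    moreover have "sqrt (4 * (emp_tail j 0 \<omega> * emp_tail j K \<omega> + tail 0 * tail K)) \<le>
        2 * (sqrt (emp_tail j 0 \<omega>) * sqrt (emp_tail j K \<omega>)) + 2 * sqrt (tail 0 * tail K)"
    proof -
      have "sqrt (4 * (emp_tail j 0 \<omega> * emp_tail j K \<omega> + tail 0 * tail K)) = 2 * sqrt (emp_tail j 0 \<omega> * emp_tail j K \<omega> + tail 0 * tail K)"
        by (simp only: real_sqrt_mult real_sqrt_four)
      also have "\<dots> \<le> 2 * (sqrt (emp_tail j 0 \<omega> * emp_tail j K \<omega>) + sqrt (tail 0 * tail K))"
        by (intro mult_left_mono sqrt_add_le_add_sqrt mult_nonneg_nonneg emp_tail_nonneg tail_nonneg) simp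
      finally show ?thesis by (simp add: real_sqrt_mult)
    qed
    moreover have "sqrt ?B \<le> sqrt (\<Sum>i<K. \<Sum>l<K. (a i l - c i l)\<^sup>2) + sqrt (4 * (emp_tail j 0 \<omega> * emp_tail j K \<omega> + tail 0 * tail K))"
      by (rule sqrt_add_le_add_sqrt) (auto intro!: sum_nonneg add_nonneg_nonneg mult_nonneg_nonneg emp_tail_nonneg tail_nonneg)
    ultimately show ?thesis unfolding hs_bound_def a_def c_def by simp
  qed
  finally show ?case by (simp add: ennreal_leI)
qed

lemma sqrt_emp_tail_sqint: "sqint M (\<lambda>\<omega>. sqrt (emp_tail j K \<omega>))"
  unfolding sqint_def using emp_tail_integrable[of j K] emp_tail_nonneg by auto

lemma sqrt_emp_tail_nrm2: "nrm2 M (\<lambda>\<omega>. sqrt (emp_tail j K \<omega>)) \<le> sqrt (tail K)"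
  unfolding nrm2_def using emp_tail_le[of j K] emp_tail_nonneg by simp

lemma hs_bound_integrable: "integrable M (hs_bound j K)"
  unfolding hs_bound_def[abs_def]
  using sqint_inner_integrable[OF sqrt_emp_tail_sqint sqrt_emp_tail_sqint] emp_cov_integrable by auto

lemma hs_bound_expectation:
  "expectation (hs_bound j K) \<le> (\<Sum>i<K. \<Sum>l<K. \<integral>\<omega>. \<bar>emp_cov j \<omega> (e i) (e l) - mean_cov j (e i) (e l)\<bar> \<partial>M) + 4 * sqrt (tail 0 * tail K)"
proof -
  have "(\<integral>\<omega>. sqrt (emp_tail j 0 \<omega>) * sqrt (emp_tail j K \<omega>) \<partial>M) \<le> nrm2 M (\<lambda>\<omega>. sqrt (emp_tail j 0 \<omega>)) * nrm2 M (\<lambda>\<omega>. sqrt (emp_tail j K \<omega>))"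
    using nrm2_cauchy_schwarz[OF sqrt_emp_tail_sqint sqrt_emp_tail_sqint] emp_tail_nonneg by simp
  also have "\<dots> \<le> sqrt (tail 0) * sqrt (tail K)" by (intro mult_mono sqrt_emp_tail_nrm2) (auto simp: tail_nonneg)
  finally have 1: "(\<integral>\<omega>. sqrt (emp_tail j 0 \<omega>) * sqrt (emp_tail j K \<omega>) \<partial>M) \<le> sqrt (tail 0 * tail K)"
    by (simp add: real_sqrt_mult)
  have "expectation (hs_bound j K) = (\<Sum>i<K. \<Sum>l<K. \<integral>\<omega>. \<bar>emp_cov j \<omega> (e i) (e l) - mean_cov j (e i) (e l)\<bar> \<partial>M)
    + 2 * (\<integral>\<omega>. sqrt (emp_tail j 0 \<omega>) * sqrt (emp_tail j K \<omega>) \<partial>M) + 2 * sqrt (tail 0 * tail K)"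
    unfolding hs_bound_def
    using sqint_inner_integrable[OF sqrt_emp_tail_sqint sqrt_emp_tail_sqint, of j 0 j K] emp_cov_integrable
    by (simp add: prob_space)
  then show ?thesis using 1 by simp
qed

text \<open>\<open>K\<close> is chosen from the tail before \<open>j\<close> grows, after which the
  corner is a finite sum of null sequences. Markov's inequality divides by \<epsilon>, hence the
  constant \<open>1 / \<epsilon>\<close>.\<close>

lemma bootstrap_covariance_consistent:
  "tendsto_zero_in_prob M (\<lambda>j \<omega>. hs_norm e (cov_error j \<omega>)) sequentially"
  unfolding tendsto_zero_in_prob_def
proof (intro conjI allI impI)
  show "\<forall>\<^sub>F j in sequentially. (\<lambda>\<omega>. hs_norm e (cov_error j \<omega>)) \<in> borel_measurable M"
    by (simp add: cov_error_measurable)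
  fix \<epsilon> :: real assume \<epsilon>: "0 < \<epsilon>"
  show "(\<lambda>j. prob {\<omega>\<in>space M. ennreal \<epsilon> < hs_norm e (cov_error j \<omega>)}) \<longlonglongrightarrow> 0"
  proof (rule tendsto_zero_approx[where D = "1 / \<epsilon>"])
    fix \<eta> :: real assume \<eta>: "0 < \<eta>"
    have "(\<lambda>K. 4 * sqrt (tail 0 * tail K)) \<longlonglongrightarrow> 4 * sqrt (tail 0 * 0)" by (intro tendsto_intros tail_tendsto)
    then have "\<forall>\<^sub>F K in sequentially. 4 * sqrt (tail 0 * tail K) < \<eta>" using \<eta> by (intro order_tendstoD) auto
    then obtain K where K: "4 * sqrt (tail 0 * tail K) < \<eta>" by (metis (no_types, lifting) eventually_happens' sequentially_bot)
    define g where "g j = (\<Sum>i<K. \<Sum>l<K. \<integral>\<omega>. \<bar>emp_cov j \<omega> (e i) (e l) - mean_cov j (e i) (e l)\<bar> \<partial>M)" for j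
    have "g \<longlonglongrightarrow> (\<Sum>i<K. \<Sum>l<K. 0)" unfolding g_def by (intro tendsto_sum emp_cov_tendsto)
    then have "(\<lambda>j. g j / \<epsilon>) \<longlonglongrightarrow> 0" using tendsto_divide[of g 0 sequentially "\<lambda>_. \<epsilon>" \<epsilon>] \<epsilon> by simp
    moreover have "prob {\<omega>\<in>space M. ennreal \<epsilon> < hs_norm e (cov_error j \<omega>)} \<le> g j / \<epsilon> + \<eta> * (1 / \<epsilon>)" for j
    proof -
      have "0 \<le> hs_bound j K \<omega>" for \<omega>
        unfolding hs_bound_def by (intro add_nonneg_nonneg mult_nonneg_nonneg sum_nonneg) (auto simp: emp_tail_nonneg tail_nonneg)
      then have "prob {\<omega>\<in>space M. ennreal \<epsilon> < hs_norm e (cov_error j \<omega>)} \<le> expectation (hs_bound j K) / \<epsilon>"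
        by (rule prob_gt_le_expectation[OF cov_error_measurable hs_bound_integrable _ hs_norm_cov_error \<epsilon>])
      also have "\<dots> \<le> (g j + \<eta>) / \<epsilon>"
        using hs_bound_expectation[of j K] K \<epsilon> by (intro divide_right_mono) (auto simp: g_def)
      finally show ?thesis by (simp add: add_divide_distrib)
    qed
    ultimately show "\<exists>g. g \<longlonglongrightarrow> 0 \<and> (\<forall>\<^sub>F j in sequentially. prob {\<omega>\<in>space M. ennreal \<epsilon> < hs_norm e (cov_error j \<omega>)} \<le> g j + \<eta> * (1 / \<epsilon>))"
      by (intro exI[of _ "\<lambda>j. g j / \<epsilon>"]) simp
  qed simp
qed

end

section \<open>Limits along an infinite set of sample sizes\<close>

lemma filterlim_enumerate:
  assumes "infinite S"
  shows "filterlim (enumerate S) (inf sequentially (principal S)) sequentially"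
  unfolding filterlim_inf filterlim_principal
  using filterlim_subseq[OF strict_mono_enumerate[OF assms]] enumerate_in_set[OF assms] by simp

text \<open>The increasing enumeration meets every element of \<open>S\<close>, so convergence along
  it is convergence along the whole filter and not just along a subsequence.\<close>

lemma tendsto_along_infinite_set:
  fixes S :: "nat set" and g :: "nat \<Rightarrow> 'b::topological_space"
  assumes S: "infinite S" and lim: "(\<lambda>j. g (enumerate S j)) \<longlonglongrightarrow> l"
  shows "(g \<longlongrightarrow> l) (inf sequentially (principal S))"
proof (rule topological_tendstoI)
  fix U :: "'b set" assume "open U" "l \<in> U"
  then obtain J where J: "\<And>j. J \<le> j \<Longrightarrow> g (enumerate S j) \<in> U"
    using topological_tendstoD[OF lim] unfolding eventually_sequentially by blast
  have "g n \<in> U" if n: "enumerate S J \<le> n" "n \<in> S" for n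
  proof -
    obtain j where j: "enumerate S j = n" using enumerate_Ex[OF S n(2)] by blast
    then have "J \<le> j" using n(1) strict_mono_less_eq[OF strict_mono_enumerate[OF S]] by blast
    then show ?thesis using J j by blast
  qed
  then show "\<forall>\<^sub>F n in inf sequentially (principal S). g n \<in> U"
    unfolding eventually_inf_principal eventually_sequentially by blast
qed

lemma tendsto_zero_in_prob_along:
  assumes S: "infinite S" and meas: "\<And>n. n \<in> S \<Longrightarrow> Y n \<in> borel_measurable M"
    and lim: "tendsto_zero_in_prob M (\<lambda>j. Y (enumerate S j)) sequentially"
  shows "tendsto_zero_in_prob M Y (inf sequentially (principal S))"
  unfolding tendsto_zero_in_prob_def
proof (intro conjI allI impI)
  show "\<forall>\<^sub>F n in inf sequentially (principal S). Y n \<in> borel_measurable M"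
    using meas by (simp add: eventually_inf_principal)
  fix \<epsilon> :: real assume "0 < \<epsilon>"
  then show "((\<lambda>n. measure M {\<omega>\<in>space M. ennreal \<epsilon> < Y n \<omega>}) \<longlongrightarrow> 0) (inf sequentially (principal S))"
    by (intro tendsto_along_infinite_set[OF S]) (use lim in \<open>auto simp: tendsto_zero_in_prob_def\<close>)
qed

text \<open>Both summands are nonnegative, so each tends to zero. The second gives
  \<open>b * (Z + 1) < sqrt n \<le> n = b * (n div b)\<close> eventually, and cancelling
  \<open>b\<close> bounds the number of blocks from below.\<close>

lemma block_lengths_at_top:
  fixes n b :: "nat \<Rightarrow> nat"
  assumes nb: "\<And>j. 1 \<le> b j" "\<And>j. b j dvd n j" "\<And>j. 0 < n j"
    and lim: "(\<lambda>j. 1 / real (b j) + real (b j) / sqrt (real (n j))) \<longlonglongrightarrow> 0"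
  shows "filterlim b at_top sequentially" "filterlim (\<lambda>j. n j div b j) at_top sequentially"
proof -
  have ev: "\<forall>\<^sub>F j in sequentially. 1 / real (b j) < 1 / real (Suc Z) \<and> real (b j) / sqrt (real (n j)) < 1 / real (Suc Z)" for Z
  proof -
    have "\<forall>\<^sub>F j in sequentially. 1 / real (b j) + real (b j) / sqrt (real (n j)) < 1 / real (Suc Z)"
      using lim by (rule order_tendstoD) simp
    then show ?thesis
    proof eventually_elim
      case (elim j)
      have "0 \<le> 1 / real (b j)" "0 \<le> real (b j) / sqrt (real (n j))" by simp_all
      then show ?case using elim by linarith
    qed
  qed
  show "filterlim b at_top sequentially"
    unfolding filterlim_at_top
  proof
    fix Z
    show "\<forall>\<^sub>F j in sequentially. Z \<le> b j"
      using ev[of Z]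
    proof eventually_elim
      case (elim j)
      have "real (Suc Z) < real (b j)" using elim nb(1)[of j] by (simp add: divide_less_eq less_divide_eq)
      then show ?case by simp
    qed
  qed
  show "filterlim (\<lambda>j. n j div b j) at_top sequentially"
    unfolding filterlim_at_top
  proof
    fix Z
    show "\<forall>\<^sub>F j in sequentially. Z \<le> n j div b j"
      using ev[of Z]
    proof eventually_elim
      case (elim j)
      define s where "s = sqrt (real (n j))"
      have s: "1 \<le> s" "s * s = real (n j)" using nb(3)[of j] by (auto simp: s_def)
      have lt: "real (b j) * real (Suc Z) < s"
        using elim s(1) unfolding s_def[symmetric] by (simp add: divide_less_eq less_divide_eq mult.commute)
      also have "\<dots> \<le> real (n j)" unfolding s(2)[symmetric] using s(1) by simp
      also have "\<dots> = real (b j) * real (n j div b j)"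
        using nb(2)[of j] by (simp flip: of_nat_mult)
      finally have "real (Suc Z) < real (n j div b j)" using nb(1)[of j] by simp
      then show ?case by simp
    qed
  qed
qed

theorem theorem2p1:
  fixes M :: "'w measure"
    and X :: "int \<Rightarrow> 'w \<Rightarrow> L2"
    and f :: "(nat \<Rightarrow> L2) \<Rightarrow> L2"
    and \<delta> :: "int \<Rightarrow> 'w \<Rightarrow> L2"
    and \<delta>' :: "nat \<Rightarrow> int \<Rightarrow> int \<Rightarrow> 'w \<Rightarrow> L2"
    and S :: "nat set"
    and b :: "nat \<Rightarrow> nat"
    and I :: "nat \<Rightarrow> nat \<Rightarrow> 'w \<Rightarrow> nat"
    and Estar :: "nat \<Rightarrow> 'w \<Rightarrow> L2"
    and Lstar :: "nat \<Rightarrow> 'w \<Rightarrow> L2 measure"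
    and Cstar :: "nat \<Rightarrow> 'w \<Rightarrow> L2 \<Rightarrow> L2"
    and d :: "L2 measure \<Rightarrow> L2 measure \<Rightarrow> real"
    and e :: "nat \<Rightarrow> L2"
  defines "F \<equiv> inf sequentially (principal S)"
  assumes "prob_space M"
    and "strictly_stationary M X"
    and "\<And>t. (\<integral>\<omega>. X t \<omega> \<partial>M) = 0"
    and "L2_m_approximable M X f \<delta> \<delta>'"
    and "\<And>t. (\<lambda>m. real m * approx_error M X f \<delta> \<delta>' t m) \<longlonglongrightarrow> 0"
    and "infinite S"
    and "\<And>n. n \<in> S \<Longrightarrow> 1 \<le> b n \<and> b n < n \<and> b n dvd n"
    and "((\<lambda>n. 1 / real (b n) + real (b n) / sqrt (real n)) \<longlongrightarrow> 0) F"
    and "\<And>n. n \<in> S \<Longrightarrow> mbb_indices M X n (b n) (I n)"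
    and "\<And>n. n \<in> S \<Longrightarrow>
           has_cond_exp M (data_algebra M X n) (mbb_mean X n (b n) (I n)) (Estar n)"
    and "\<And>n. n \<in> S \<Longrightarrow>
           has_cond_law M (data_algebra M X n)
             (\<lambda>\<omega>. sqrt (real n) *\<^sub>R (mbb_mean X n (b n) (I n) \<omega> - Estar n \<omega>)) (Lstar n)"
    and "\<And>n. n \<in> S \<Longrightarrow>
           has_op_cond_exp M (data_algebra M X n)
             (\<lambda>\<omega>. tensor (mbb_mean X n (b n) (I n) \<omega> - Estar n \<omega>)
                          (mbb_mean X n (b n) (I n) \<omega> - Estar n \<omega>)) (Cstar n)"
    and "metrizes_weak_convergence d"
    and "orthonormal_basis e"
  shows
    "tendsto_zero_in_prob M
       (\<lambda>n \<omega>. ennreal (d (Lstar n \<omega>)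
                          (distr M borel (\<lambda>\<omega>'. sqrt (real n) *\<^sub>R sample_mean X n \<omega>')))) F
     \<and>
     tendsto_zero_in_prob M
       (\<lambda>n \<omega>. hs_norm e (\<lambda>h. real n *\<^sub>R Cstar n \<omega> h -
          real n *\<^sub>R op_expectation M (\<lambda>\<omega>'. tensor (sample_mean X n \<omega>') (sample_mean X n \<omega>')) h)) F"
proof -
  interpret prob_space M by fact
  have meas: "X t \<in> borel_measurable M" for t using assms(3) by (simp add: strictly_stationary_def)
  define r where "r = enumerate S"
  have rS: "r j \<in> S" for j unfolding r_def by (rule enumerate_in_set[OF \<open>infinite S\<close>])
  interpret m_approx_basis M X f \<delta> \<delta>' e
    by unfold_locales (use meas assms in auto)
  have mbb_n: "mbb M X f \<delta> \<delta>' e n (b n) (I n) (Estar n) (Lstar n) (Cstar n)" if "n \<in> S" for n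
    by unfold_locales (use that assms in auto)
  have "(\<lambda>j. 1 / real (b (r j)) + real (b (r j)) / sqrt (real (r j))) \<longlonglongrightarrow> 0"
    using filterlim_compose[OF assms(9)[unfolded F_def] filterlim_enumerate[OF \<open>infinite S\<close>]] by (simp add: r_def)
  note lengths = block_lengths_at_top[OF _ _ _ this]
  interpret mbb_seq M X f \<delta> \<delta>' e r "\<lambda>j. b (r j)" "\<lambda>j. I (r j)" "\<lambda>j. Estar (r j)" "\<lambda>j. Lstar (r j)" "\<lambda>j. Cstar (r j)"
  proof (rule mbb_seq.intro[OF m_approx_basis_axioms mbb_seq_axioms.intro])
    show "mbb M X f \<delta> \<delta>' e (r j) (b (r j)) (I (r j)) (Estar (r j)) (Lstar (r j)) (Cstar (r j))" for j
      by (rule mbb_n[OF rS])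
    have "1 \<le> b (r j)" "b (r j) dvd r j" "0 < r j" for j using assms(8)[OF rS, of j] by auto
    from lengths[OF this] show "filterlim (\<lambda>j. b (r j)) at_top sequentially" "filterlim (\<lambda>j. r j div b (r j)) at_top sequentially" .
  qed
  show ?thesis
    unfolding F_def
  proof (intro conjI tendsto_zero_in_prob_along[OF \<open>infinite S\<close>])
    show "tendsto_zero_in_prob M (\<lambda>j \<omega>. ennreal (d (Lstar (enumerate S j) \<omega>)
        (distr M borel (\<lambda>\<omega>'. sqrt (real (enumerate S j)) *\<^sub>R sample_mean X (enumerate S j) \<omega>')))) sequentially"
      using bootstrap_law_consistent[OF assms(14)] unfolding law_def unfolding r_def .
    show "tendsto_zero_in_prob M (\<lambda>j \<omega>. hs_norm e (\<lambda>h. real (enumerate S j) *\<^sub>R Cstar (enumerate S j) \<omega> h -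
        real (enumerate S j) *\<^sub>R op_expectation M (\<lambda>\<omega>'. tensor (sample_mean X (enumerate S j) \<omega>') (sample_mean X (enumerate S j) \<omega>')) h)) sequentially"
      using bootstrap_covariance_consistent unfolding cov_error_def[abs_def] unfolding r_def .
    fix n assume n: "n \<in> S"
    \<comment> \<open>Facts of the locale are indexed by \<open>j\<close>; every admissible
      \<open>n\<close> is some \<open>r j\<close>, which transfers measurability to all of
      them.\<close>
    obtain j where j: "r j = n" using enumerate_Ex[OF \<open>infinite S\<close> n] unfolding r_def by blast
    show "(\<lambda>\<omega>. hs_norm e (\<lambda>h. real n *\<^sub>R Cstar n \<omega> h -
        real n *\<^sub>R op_expectation M (\<lambda>\<omega>'. tensor (sample_mean X n \<omega>') (sample_mean X n \<omega>')) h)) \<in> borel_measurable M"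
      using cov_error_measurable[of j] unfolding cov_error_def[abs_def] unfolding j .
    have "(\<lambda>\<omega>. d (Lstar n \<omega>) (law j)) \<in> borel_measurable M"
      by (rule measurable_compose[OF mbb.Lstar_kernel[OF mbb_n[OF n]] metrizes_measurable[OF assms(14) law_in]])
    then show "(\<lambda>\<omega>. ennreal (d (Lstar n \<omega>) (distr M borel (\<lambda>\<omega>'. sqrt (real n) *\<^sub>R sample_mean X n \<omega>')))) \<in> borel_measurable M"
      unfolding law_def unfolding j by measurable
  qed
qed

end
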